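(* There is a natural isomorphism of flows $||K|| \cong |K|_{nat}$ for all precubical sets $K$.
   Context: Spaces. $\mathbf{Top}$ is the category of $\Delta$-generated spaces (topology final with respect to all continuous maps from $[0,1]$), or of $\Delta$-Hausdorff $\Delta$-generated spaces (those in which the image of every continuous map from $[0,1]$ is closed); either choice is allowed. Products and colimits are taken in $\mathbf{Top}$. Flows. A flow $X$ is a small semicategory (no identities required) enriched over $(\mathbf{Top},\times)$: a set $X^0$ of states, for each $(\alpha,\beta)\in X^0\times X^0$ a space $\mathbb{P}_{\alpha,\beta}X$ of execution paths, and continuous strictly associative compositions $*:\mathbb{P}_{\alpha,\beta}X\times\mathbb{P}_{\beta,\gamma}X\to\mathbb{P}_{\alpha,\gamma}X$. Maps of flows are enriched semifunctors; the category is $\mathbf{Flow}$. Precubical sets. $[n]=\{0,1\}^n$ (with $[0]=\{()\}$) with the product order; $0_n=(0,\dots,0)$, $1_n=(1,\dots,1)$. $\square$ is the subcategory of sets with objects $[n]$, $n\geq 0$, generated by the maps $\delta_i^\epsilon:[n-1]\to[n]$ inserting $\epsilon\in\{0,1\}$ in position $i$. A precubical set is a presheaf $K$ on $\square$, $K_n=K([n])$, with face maps $\partial_i^\epsilon:K_n\to K_{n-1}$; $K_0$ is the set of vertices; $\square[n]=\square(-,[n])$. For $A=\{a_1<\dots<a_k\}\subset\{1,\dots,n\}$, $\partial^\epsilon_A=\partial^\epsilon_{a_1}\cdots\partial^\epsilon_{a_k}$. Natural realization. For $n\geq1$, $N_n$ is the set of tame natural $d$-paths of $[0,1]^n$, i.e.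 of continuous maps $\gamma=(\gamma_1,\dots,\gamma_n):[0,n]\to[0,1]^n$, nondecreasing in each coordinate, with $\gamma(0),\gamma(n)\in\{0,1\}^n$ and $t=\gamma_1(t)+\dots+\gamma_n(t)$ for all $t\in[0,n]$, with the compact-open topology. The flow $|\square[n]|_{nat}$ has set of states $\{0,1\}^n$; if $\alpha<\beta$ and $m$ is the number of coordinates where $\alpha,\beta$ differ, $\mathbb{P}_{\alpha,\beta}|\square[n]|_{nat}=N_m$, viewed as the space of tame natural $d$-paths in the $m$-dimensional subcube of $[0,1]^n$ from $\alpha$ to $\beta$; otherwise it is empty. Composition is Moore composition (concatenation, lengths add). A map $\phi$ of $\square$ acts on states by $\phi$ and on path spaces by the identity of $N_m$. The natural realization is the colimit-preserving functor $|K|_{nat}=\varinjlim_{\square[n]\to K}|\square[n]|_{nat}$. Cube chains. For a sequence of positive integers $\underline{n}=(n_1,\dots,n_p)$ put $|\underline n|=n_1+\dots+n_p$ and let $\square[\underline n]=\square[n_1]*\dots*\square[n_p]$, where $*$ means that the vertex $1_{n_i}$ of $\square[n_i]$ is identified with the vertex $0_{n_{i+1}}$ of $\square[n_{i+1}]$. For a partition $A\sqcup B=\{1,\dots,m_1+m_2\}$ with $|A|=m_1>0$, $|B|=m_2>0$, let $\phi_{A,B}:\square[m_1]*\square[m_2]\to\square[m_1+m_2]$ be the unique map of precubical sets with $\phi_{A,B}(\mathrm{Id}_{[m_1]})=\partial^0_B(\mathrm{Id}_{[m_1+m_2]})$ and $\phi_{A,B}(\mathrm{Id}_{[m_2]})=\partial^1_A(\mathrm{Id}_{[m_1+m_2]})$.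 For a partition $A\sqcup B=\{1,\dots,n_i\}$, $\delta_{i,A,B}$ is the map to $\square[\underline n]$ obtained by applying $\phi_{A,B}$ on the $i$-th block and identities on the other blocks. For $\alpha,\beta\in K_0$ and $n\geq1$, the category $\mathrm{Ch}_{\alpha,\beta}(K,n)$ has as objects the maps $\square[\underline n]\to K$ with $|\underline n|=n$ sending the initial vertex of $\square[n_1]$ to $\alpha$ and the final vertex of $\square[n_p]$ to $\beta$; morphisms from $a:\square[\underline n_a]\to K$ to $b:\square[\underline n_b]\to K$ are maps $\square[\underline n_a]\to\square[\underline n_b]$ over $K$ that are composites of maps of the form $\delta_{i,A,B}$ (identities included). The flow $||K||$. The diagram $\mathcal{D}_{\alpha,\beta}(K,n):\mathrm{Ch}_{\alpha,\beta}(K,n)\to\mathbf{Top}$ sends $\square[\underline n]\to K$ to $N_{n_1}\times\dots\times N_{n_p}$, and on morphisms uses the maps $N_{m_1}\times N_{m_2}\to N_{m_1+m_2}$ induced by $\phi_{A,B}$, i.e. Moore composition of the two paths viewed in the corresponding faces of $[0,1]^{m_1+m_2}$. The flow $||K||$ has set of states $K_0$, $\mathbb{P}_{\alpha,\beta}||K||=\coprod_{n\geq1}\varinjlim\mathcal{D}_{\alpha,\beta}(K,n)$, and composition induced by concatenation of tuples. It is functorial in $K$. *)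

theory Defs
  imports "HOL-Analysis.Analysis"
begin

section \<open>The category of spaces\<close>

abbreviation unit_interval_top :: "real topology"
  where "unit_interval_top \<equiv> top_of_set {0..1}"

definition delta_gen :: "'a topology \<Rightarrow> 'a topology"
  where "delta_gen X = topology (\<lambda>U. U \<subseteq> topspace X \<and>
    (\<forall>f. continuous_map unit_interval_top X f \<longrightarrow> openin unit_interval_top {t \<in> {0..1}. f t \<in> U}))"

lemma istopology_delta_gen:
  "istopology (\<lambda>U. U \<subseteq> topspace X \<and>
    (\<forall>f. continuous_map unit_interval_top X f \<longrightarrow> openin unit_interval_top {t \<in> {0..1}. f t \<in> U}))"
  unfolding istopology_def
proof (rule conjI)
  let ?P = "\<lambda>U f. openin unit_interval_top {t \<in> {0..1}. f t \<in> U}"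
  show "\<forall>S T. S \<subseteq> topspace X \<and> (\<forall>f. continuous_map unit_interval_top X f \<longrightarrow> ?P S f) \<longrightarrow>
      T \<subseteq> topspace X \<and> (\<forall>f. continuous_map unit_interval_top X f \<longrightarrow> ?P T f) \<longrightarrow>
      S \<inter> T \<subseteq> topspace X \<and> (\<forall>f. continuous_map unit_interval_top X f \<longrightarrow> ?P (S \<inter> T) f)"
  proof -
    have "?P (S \<inter> T) f" if "?P S f" "?P T f" for S T and f :: "real \<Rightarrow> 'a"
    proof -
      have "{t \<in> {0..1}. f t \<in> S \<inter> T} = {t \<in> {0..1}. f t \<in> S} \<inter> {t \<in> {0..1}. f t \<in> T}"
        by auto
      then show ?thesis using openin_Int[OF that] by simp
    qed
    then show ?thesis by blast
  qed
  show "\<forall>\<K>. (\<forall>K\<in>\<K>. K \<subseteq> topspace X \<and> (\<forall>f. continuous_map unit_interval_top X f \<longrightarrow> ?P K f)) \<longrightarrow>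
      \<Union>\<K> \<subseteq> topspace X \<and> (\<forall>f. continuous_map unit_interval_top X f \<longrightarrow> ?P (\<Union>\<K>) f)"
  proof -
    have "?P (\<Union>\<K>) f" if "\<forall>K\<in>\<K>. ?P K f" for \<K> and f :: "real \<Rightarrow> 'a"
    proof -
      have "{t \<in> {0..1}. f t \<in> \<Union>\<K>} = \<Union>((\<lambda>K. {t \<in> {0..1}. f t \<in> K}) ` \<K>)"
        by auto
      moreover have "openin unit_interval_top (\<Union>((\<lambda>K. {t \<in> {0..1}. f t \<in> K}) ` \<K>))"
        using that by (intro openin_Union) blast
      ultimately show ?thesis by simp
    qed
    then show ?thesis by blast
  qed
qed

lemma openin_delta_gen:
  "openin (delta_gen X) U \<longleftrightarrow> U \<subseteq> topspace X \<and>
    (\<forall>f. continuous_map unit_interval_top X f \<longrightarrow> openin unit_interval_top {t \<in> {0..1}. f t \<in> U})"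
  unfolding delta_gen_def topology_inverse'[OF istopology_delta_gen] ..

definition delta_generated :: "'a topology \<Rightarrow> bool"
  where "delta_generated X \<longleftrightarrow> delta_gen X = X"

definition delta_Hausdorff :: "'a topology \<Rightarrow> bool"
  where "delta_Hausdorff X \<longleftrightarrow> (\<forall>f. continuous_map unit_interval_top X f \<longrightarrow> closedin X (f ` {0..1}))"

datatype top_choice = Delta_Generated | Delta_Hausdorff

fun in_Top :: "top_choice \<Rightarrow> 'a topology \<Rightarrow> bool" where
  "in_Top Delta_Generated X \<longleftrightarrow> delta_generated X"
| "in_Top Delta_Hausdorff X \<longleftrightarrow> delta_generated X \<and> delta_Hausdorff X"

text \<open>The binary product is the same for both choices: the Hausdorff objects are reflective,
  so limits are computed among the $\Delta$-generated spaces.\<close>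

definition dprod :: "'a topology \<Rightarrow> 'b topology \<Rightarrow> ('a \<times> 'b) topology"
  where "dprod X Y = delta_gen (prod_topology X Y)"

definition quot_top :: "'a topology \<Rightarrow> ('a \<times> 'a) set \<Rightarrow> 'a set topology"
  where "quot_top X E = topology (\<lambda>U. U \<subseteq> topspace X // E \<and> openin X (\<Union>U))"

lemma istopology_quot_top:
  assumes "equiv (topspace X) E"
  shows "istopology (\<lambda>U. U \<subseteq> topspace X // E \<and> openin X (\<Union>U))"
  unfolding istopology_def
proof (rule conjI)
  let ?P = "\<lambda>U. U \<subseteq> topspace X // E \<and> openin X (\<Union>U)"
  have "?P (S \<inter> T)" if "?P S" "?P T" for S T
  proof -
    have "\<Union>(S \<inter> T) = \<Union>S \<inter> \<Union>T"
      using that quotient_disj[OF assms] by blast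
    then show ?thesis using that by auto
  qed
  then show "\<forall>S T. ?P S \<longrightarrow> ?P T \<longrightarrow> ?P (S \<inter> T)" by blast
  have "?P (\<Union>\<K>)" if "\<forall>K\<in>\<K>. ?P K" for \<K>
  proof -
    have "\<Union>(\<Union>\<K>) = \<Union>(Union ` \<K>)" by auto
    moreover have "openin X (\<Union>(Union ` \<K>))"
      using that by (intro openin_Union) blast
    ultimately show ?thesis using that by auto
  qed
  then show "\<forall>\<K>. (\<forall>K\<in>\<K>. ?P K) \<longrightarrow> ?P (\<Union>\<K>)" by blast
qed

lemma openin_quot_top:
  assumes "equiv (topspace X) E"
  shows "openin (quot_top X E) U \<longleftrightarrow> U \<subseteq> topspace X // E \<and> openin X (\<Union>U)"
  unfolding quot_top_def topology_inverse'[OF istopology_quot_top[OF assms]] ..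

text \<open>Coequalizers in the chosen category: identify the pairs in \<open>R\<close> and as little else as
  possible subject to staying in the category. For \<open>Delta_Generated\<close> the last condition is automatic,
  so this is the equivalence relation generated by \<open>R\<close>; for \<open>Delta_Hausdorff\<close> one gets the
  $\Delta$-Hausdorff reflection of the corresponding quotient.\<close>

definition coeq_rel :: "top_choice \<Rightarrow> 'a topology \<Rightarrow> ('a \<times> 'a) set \<Rightarrow> ('a \<times> 'a) set"
  where "coeq_rel T X R =
    \<Inter>{E. equiv (topspace X) E \<and> R \<subseteq> E \<and> in_Top T (quot_top X E)}"

definition coeq_top :: "top_choice \<Rightarrow> 'a topology \<Rightarrow> ('a \<times> 'a) set \<Rightarrow> 'a set topology"
  where "coeq_top T X R = quot_top X (coeq_rel T X R)"

section \<open>Flows\<close>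

record ('s, 'p) flow =
  states :: "'s set"
  paths :: "'s \<Rightarrow> 's \<Rightarrow> 'p topology"
  pcomp :: "'s \<Rightarrow> 's \<Rightarrow> 's \<Rightarrow> 'p \<Rightarrow> 'p \<Rightarrow> 'p"

definition is_flow :: "top_choice \<Rightarrow> ('s, 'p) flow \<Rightarrow> bool" where
  "is_flow T X \<longleftrightarrow>
    (\<forall>\<alpha>\<in>states X. \<forall>\<beta>\<in>states X. in_Top T (paths X \<alpha> \<beta>)) \<and>
    (\<forall>\<alpha>\<in>states X. \<forall>\<beta>\<in>states X. \<forall>\<gamma>\<in>states X.
      continuous_map (dprod (paths X \<alpha> \<beta>) (paths X \<beta> \<gamma>)) (paths X \<alpha> \<gamma>)
        (\<lambda>(x, y). pcomp X \<alpha> \<beta> \<gamma> x y)) \<and>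
    (\<forall>\<alpha>\<in>states X. \<forall>\<beta>\<in>states X. \<forall>\<gamma>\<in>states X. \<forall>\<delta>\<in>states X.
      \<forall>x\<in>topspace (paths X \<alpha> \<beta>). \<forall>y\<in>topspace (paths X \<beta> \<gamma>). \<forall>z\<in>topspace (paths X \<gamma> \<delta>).
        pcomp X \<alpha> \<gamma> \<delta> (pcomp X \<alpha> \<beta> \<gamma> x y) z = pcomp X \<alpha> \<beta> \<delta> x (pcomp X \<beta> \<gamma> \<delta> y z))"

text \<open>A map of flows is given by its action on states and on each path space; only the values on
  the carriers are meaningful, so equality of maps is \<open>fmap_eq\<close>.\<close>

type_synonym ('s, 'p, 't, 'q) fmap = "('s \<Rightarrow> 't) \<times> ('s \<Rightarrow> 's \<Rightarrow> 'p \<Rightarrow> 'q)"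

definition flow_map :: "('s, 'p) flow \<Rightarrow> ('t, 'q) flow \<Rightarrow> ('s, 'p, 't, 'q) fmap \<Rightarrow> bool" where
  "flow_map X Y f \<longleftrightarrow>
    (\<forall>\<alpha>\<in>states X. fst f \<alpha> \<in> states Y) \<and>
    (\<forall>\<alpha>\<in>states X. \<forall>\<beta>\<in>states X.
      continuous_map (paths X \<alpha> \<beta>) (paths Y (fst f \<alpha>) (fst f \<beta>)) (snd f \<alpha> \<beta>)) \<and>
    (\<forall>\<alpha>\<in>states X. \<forall>\<beta>\<in>states X. \<forall>\<gamma>\<in>states X.
      \<forall>x\<in>topspace (paths X \<alpha> \<beta>). \<forall>y\<in>topspace (paths X \<beta> \<gamma>).
        snd f \<alpha> \<gamma> (pcomp X \<alpha> \<beta> \<gamma> x y) =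
        pcomp Y (fst f \<alpha>) (fst f \<beta>) (fst f \<gamma>) (snd f \<alpha> \<beta> x) (snd f \<beta> \<gamma> y))"

definition fmap_eq :: "('s, 'p) flow \<Rightarrow> ('s, 'p, 't, 'q) fmap \<Rightarrow> ('s, 'p, 't, 'q) fmap \<Rightarrow> bool" where
  "fmap_eq X f g \<longleftrightarrow>
    (\<forall>\<alpha>\<in>states X. fst f \<alpha> = fst g \<alpha>) \<and>
    (\<forall>\<alpha>\<in>states X. \<forall>\<beta>\<in>states X. \<forall>x\<in>topspace (paths X \<alpha> \<beta>). snd f \<alpha> \<beta> x = snd g \<alpha> \<beta> x)"

definition fmap_id :: "('s, 'p, 's, 'p) fmap"
  where "fmap_id = (id, \<lambda>\<alpha> \<beta>. id)"

definition fmap_comp :: "('t, 'q, 'u, 'r) fmap \<Rightarrow> ('s, 'p, 't, 'q) fmap \<Rightarrow> ('s, 'p, 'u, 'r) fmap"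
  where "fmap_comp g f = (fst g \<circ> fst f, \<lambda>\<alpha> \<beta>. snd g (fst f \<alpha>) (fst f \<beta>) \<circ> snd f \<alpha> \<beta>)"

definition flow_iso ::
  "top_choice \<Rightarrow> ('s, 'p) flow \<Rightarrow> ('t, 'q) flow \<Rightarrow> ('s, 'p, 't, 'q) fmap \<Rightarrow> bool" where
  "flow_iso T X Y f \<longleftrightarrow> is_flow T X \<and> is_flow T Y \<and> flow_map X Y f \<and>
    (\<exists>g. flow_map Y X g \<and> fmap_eq X (fmap_comp g f) fmap_id \<and> fmap_eq Y (fmap_comp f g) fmap_id)"

text \<open>Diagrams of flows are given by a set \<open>I\<close> of objects, the flow \<open>D a\<close> at \<open>a\<close>, and the set
  \<open>M a b\<close> of maps \<open>D a \<rightarrow> D b\<close> belonging to the diagram. HOL cannot quantify over types inside a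
  formula, so the universal property takes the type of the flows it is tested against as a parameter.\<close>

definition flow_cocone ::
  "top_choice \<Rightarrow> 'i set \<Rightarrow> ('i \<Rightarrow> ('s, 'p) flow) \<Rightarrow> ('i \<Rightarrow> 'i \<Rightarrow> ('s, 'p, 's, 'p) fmap set)
    \<Rightarrow> ('t, 'q) flow \<Rightarrow> ('i \<Rightarrow> ('s, 'p, 't, 'q) fmap) \<Rightarrow> bool" where
  "flow_cocone T I D M X j \<longleftrightarrow> is_flow T X \<and>
    (\<forall>a\<in>I. flow_map (D a) X (j a)) \<and>
    (\<forall>a\<in>I. \<forall>b\<in>I. \<forall>m\<in>M a b. fmap_eq (D a) (fmap_comp (j b) m) (j a))"

definition is_flow_colimit ::
  "('u, 'r) flow itself \<Rightarrow> top_choice \<Rightarrow> 'i set \<Rightarrow> ('i \<Rightarrow> ('s, 'p) flow)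
    \<Rightarrow> ('i \<Rightarrow> 'i \<Rightarrow> ('s, 'p, 's, 'p) fmap set)
    \<Rightarrow> ('t, 'q) flow \<Rightarrow> ('i \<Rightarrow> ('s, 'p, 't, 'q) fmap) \<Rightarrow> bool" where
  "is_flow_colimit _ T I D M X j \<longleftrightarrow> flow_cocone T I D M X j \<and>
    (\<forall>(Y :: ('u, 'r) flow) k. flow_cocone T I D M Y k \<longrightarrow>
      (\<exists>h. flow_map X Y h \<and> (\<forall>a\<in>I. fmap_eq (D a) (fmap_comp h (j a)) (k a)) \<and>
        (\<forall>h'. flow_map X Y h' \<and> (\<forall>a\<in>I. fmap_eq (D a) (fmap_comp h' (j a)) (k a)) \<longrightarrow>
          fmap_eq X h' h)))"

section \<open>Precubical sets\<close>

definition verts :: "nat \<Rightarrow> bool list set"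
  where "verts n = {v. length v = n}"

text \<open>\<open>coface n i e\<close> is the map from \<open>[n]\<close> to \<open>[n + 1]\<close> inserting \<open>e\<close> in position \<open>i\<close>. Positions and
  coordinates are numbered from \<open>0\<close>.\<close>

definition coface :: "nat \<Rightarrow> nat \<Rightarrow> bool \<Rightarrow> bool list \<Rightarrow> bool list"
  where "coface n i e = (\<lambda>v\<in>verts n. take i v @ [e] @ drop i v)"

text \<open>\<open>box m n \<phi>\<close>: \<open>\<phi>\<close> is a morphism from \<open>[m]\<close> to \<open>[n]\<close> of the box category.\<close>

inductive box :: "nat \<Rightarrow> nat \<Rightarrow> (bool list \<Rightarrow> bool list) \<Rightarrow> bool" where
  box_id: "box n n (\<lambda>v\<in>verts n. v)"
| box_coface: "i \<le> n \<Longrightarrow> box n (Suc n) (coface n i e)"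
| box_comp: "box l m \<psi> \<Longrightarrow> box m n \<phi> \<Longrightarrow> box l n (compose (verts l) \<phi> \<psi>)"

text \<open>Presheaves on the box category: \<open>act K m n \<phi>\<close> is the map from \<open>cells K n\<close> to \<open>cells K m\<close>
  induced by \<open>\<phi>\<close>.\<close>

record 'k precub =
  cells :: "nat \<Rightarrow> 'k set"
  act :: "nat \<Rightarrow> nat \<Rightarrow> (bool list \<Rightarrow> bool list) \<Rightarrow> 'k \<Rightarrow> 'k"

definition precubical_set :: "'k precub \<Rightarrow> bool" where
  "precubical_set K \<longleftrightarrow>
    (\<forall>m n \<phi>. box m n \<phi> \<longrightarrow> (\<forall>x\<in>cells K n. act K m n \<phi> x \<in> cells K m)) \<and>
    (\<forall>n. \<forall>x\<in>cells K n. act K n n (\<lambda>v\<in>verts n. v) x = x) \<and>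
    (\<forall>l m n \<psi> \<phi>. box l m \<psi> \<and> box m n \<phi> \<longrightarrow>
      (\<forall>x\<in>cells K n. act K l n (compose (verts l) \<phi> \<psi>) x = act K l m \<psi> (act K m n \<phi> x)))"

type_synonym ('k, 'l) pmap = "nat \<Rightarrow> 'k \<Rightarrow> 'l"

definition pmaps :: "'k precub \<Rightarrow> 'l precub \<Rightarrow> ('k, 'l) pmap set" where
  "pmaps K L = {f. (\<forall>n. f n \<in> cells K n \<rightarrow>\<^sub>E cells L n) \<and>
    (\<forall>m n \<phi>. box m n \<phi> \<longrightarrow> (\<forall>x\<in>cells K n. f m (act K m n \<phi> x) = act L m n \<phi> (f n x)))}"

definition pmap_id :: "'k precub \<Rightarrow> ('k, 'k) pmap"
  where "pmap_id K = (\<lambda>n. \<lambda>x\<in>cells K n. x)"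

definition pmap_comp :: "'k precub \<Rightarrow> ('l, 'm) pmap \<Rightarrow> ('k, 'l) pmap \<Rightarrow> ('k, 'm) pmap"
  where "pmap_comp K g f = (\<lambda>n. compose (cells K n) (g n) (f n))"

definition face :: "'k precub \<Rightarrow> nat \<Rightarrow> bool \<Rightarrow> nat \<Rightarrow> 'k \<Rightarrow> 'k"
  where "face K n e i x = act K (n - 1) n (coface (n - 1) i e) x"

fun iterated_face :: "'k precub \<Rightarrow> nat \<Rightarrow> bool \<Rightarrow> nat list \<Rightarrow> 'k \<Rightarrow> 'k" where
  "iterated_face K n e [] x = x"
| "iterated_face K n e (a # as) x = iterated_face K (n - 1) e as (face K n e a x)"

text \<open>For \<open>A = {a\<^sub>1 < \<dots> < a\<^sub>k}\<close>, the face operator of \<open>a\<^sub>k\<close> is applied first.\<close>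

definition face_set :: "'k precub \<Rightarrow> nat \<Rightarrow> bool \<Rightarrow> nat set \<Rightarrow> 'k \<Rightarrow> 'k"
  where "face_set K n e A x = iterated_face K n e (rev (sorted_list_of_set A)) x"

definition std_cube :: "nat \<Rightarrow> (bool list \<Rightarrow> bool list) precub" where
  "std_cube n = \<lparr>cells = (\<lambda>d. {\<phi>. box d n \<phi>}), act = (\<lambda>m d \<psi> \<phi>. compose (verts m) \<phi> \<psi>)\<rparr>"

definition std_cube_map ::
  "nat \<Rightarrow> (bool list \<Rightarrow> bool list) \<Rightarrow> (bool list \<Rightarrow> bool list, bool list \<Rightarrow> bool list) pmap" where
  "std_cube_map m \<phi> = (\<lambda>d. \<lambda>\<psi>\<in>cells (std_cube m) d. compose (verts d) \<phi> \<psi>)"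

definition vertex_cell :: "bool list \<Rightarrow> bool list \<Rightarrow> bool list"
  where "vertex_cell v = (\<lambda>_\<in>verts 0. v)"

abbreviation zeros :: "nat \<Rightarrow> bool list" where "zeros n \<equiv> replicate n False"
abbreviation ones :: "nat \<Rightarrow> bool list" where "ones n \<equiv> replicate n True"

section \<open>The natural realization\<close>

definition compact_open_top :: "'a topology \<Rightarrow> 'b topology \<Rightarrow> ('a \<Rightarrow> 'b) topology" where
  "compact_open_top X Y = topology_generated_by
    {{f \<in> extensional (topspace X). continuous_map X Y f \<and> f ` C \<subseteq> U} | C U. compactin X C \<and> openin Y U}"

type_synonym dpath = "real \<Rightarrow> nat \<Rightarrow> real"

definition natural_dpaths :: "nat \<Rightarrow> dpath topology" where
  "natural_dpaths n = subtopology
    (compact_open_top (top_of_set {0..real n}) (product_topology (\<lambda>_. unit_interval_top) {..<n}))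
    {\<gamma>. (\<forall>i<n. mono_on {0..real n} (\<lambda>t. \<gamma> t i)) \<and>
        (\<forall>i<n. \<gamma> 0 i \<in> {0, 1} \<and> \<gamma> (real n) i \<in> {0, 1}) \<and>
        (\<forall>t\<in>{0..real n}. t = (\<Sum>i<n. \<gamma> t i))}"

definition diff_coords :: "bool list \<Rightarrow> bool list \<Rightarrow> nat set"
  where "diff_coords \<alpha> \<beta> = {c. c < length \<alpha> \<and> \<alpha> ! c \<noteq> \<beta> ! c}"

definition vert_less :: "bool list \<Rightarrow> bool list \<Rightarrow> bool"
  where "vert_less \<alpha> \<beta> \<longleftrightarrow> list_all2 (\<le>) \<alpha> \<beta> \<and> \<alpha> \<noteq> \<beta>"

text \<open>A path in the cube of dimension \<open>card (diff_coords \<alpha> \<beta>)\<close>, viewed in the subcube from \<open>\<alpha>\<close> to \<open>\<beta>\<close>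
  of the ambient cube, and back. The coordinates of the subcube are enumerated increasingly.\<close>

definition to_subcube :: "bool list \<Rightarrow> bool list \<Rightarrow> dpath \<Rightarrow> dpath" where
  "to_subcube \<alpha> \<beta> x = (\<lambda>t\<in>{0..real (card (diff_coords \<alpha> \<beta>))}. \<lambda>c\<in>{..<length \<alpha>}.
    if c \<in> diff_coords \<alpha> \<beta> then x t (card {j \<in> diff_coords \<alpha> \<beta>. j < c}) else of_bool (\<alpha> ! c))"

definition from_subcube :: "bool list \<Rightarrow> bool list \<Rightarrow> dpath \<Rightarrow> dpath" where
  "from_subcube \<alpha> \<beta> z = (\<lambda>t\<in>{0..real (card (diff_coords \<alpha> \<beta>))}. \<lambda>k\<in>{..<card (diff_coords \<alpha> \<beta>)}.
    z t (sorted_list_of_set (diff_coords \<alpha> \<beta>) ! k))"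

definition moore :: "nat \<Rightarrow> nat \<Rightarrow> dpath \<Rightarrow> dpath \<Rightarrow> dpath" where
  "moore l m p q = (\<lambda>t\<in>{0..real (l + m)}. if t \<le> real l then p t else q (t - real l))"

definition cube_comp :: "bool list \<Rightarrow> bool list \<Rightarrow> bool list \<Rightarrow> dpath \<Rightarrow> dpath \<Rightarrow> dpath" where
  "cube_comp \<alpha> \<beta> \<gamma> x y = from_subcube \<alpha> \<gamma>
    (moore (card (diff_coords \<alpha> \<beta>)) (card (diff_coords \<beta> \<gamma>)) (to_subcube \<alpha> \<beta> x) (to_subcube \<beta> \<gamma> y))"

definition cube_flow :: "nat \<Rightarrow> (bool list, dpath) flow" where
  "cube_flow n = \<lparr>states = verts n,
    paths = (\<lambda>\<alpha> \<beta>. if vert_less \<alpha> \<beta> then natural_dpaths (card (diff_coords \<alpha> \<beta>))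
      else discrete_topology {}),
    pcomp = cube_comp\<rparr>"

text \<open>The diagram of cubes of \<open>K\<close>: objects are maps from a standard cube to \<open>K\<close>.\<close>

type_synonym 'k cube_over = "nat \<times> (bool list \<Rightarrow> bool list, 'k) pmap"

definition cubes_over :: "'k precub \<Rightarrow> 'k cube_over set"
  where "cubes_over K = {(n, c). c \<in> pmaps (std_cube n) K}"

definition cube_over_homs ::
  "'k cube_over \<Rightarrow> 'k cube_over \<Rightarrow> (bool list, dpath, bool list, dpath) fmap set" where
  "cube_over_homs a b = {(\<phi>, \<lambda>_ _. id) | \<phi>. box (fst a) (fst b) \<phi> \<and>
    pmap_comp (std_cube (fst a)) (snd b) (std_cube_map (fst a) \<phi>) = snd a}"

text \<open>A natural realization functor: \<open>R K\<close> is a colimit, with legs \<open>j K\<close>, of the flows of the cubes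
  of \<open>K\<close>, and \<open>Rmap K L f\<close> is the induced map. Colimits being defined only up to isomorphism, the
  functor is not a constant but a choice of colimits; a statement about it is a statement about all
  such choices. Its existence is not implied by the definition and has to be stated separately.\<close>

definition natural_realization ::
  "('u, 'r) flow itself \<Rightarrow> top_choice \<Rightarrow> ('k precub \<Rightarrow> ('s, 'p) flow)
    \<Rightarrow> ('k precub \<Rightarrow> 'k cube_over \<Rightarrow> (bool list, dpath, 's, 'p) fmap)
    \<Rightarrow> ('k precub \<Rightarrow> 'k precub \<Rightarrow> ('k, 'k) pmap \<Rightarrow> ('s, 'p, 's, 'p) fmap) \<Rightarrow> bool" where
  "natural_realization U T R j Rmap \<longleftrightarrow>
    (\<forall>K. precubical_set K \<longrightarrow>
      is_flow_colimit U T (cubes_over K) (\<lambda>a. cube_flow (fst a)) cube_over_homs (R K) (j K)) \<and>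
    (\<forall>K L f. precubical_set K \<and> precubical_set L \<and> f \<in> pmaps K L \<longrightarrow>
      flow_map (R K) (R L) (Rmap K L f) \<and>
      (\<forall>(n, c)\<in>cubes_over K. fmap_eq (cube_flow n)
        (fmap_comp (Rmap K L f) (j K (n, c))) (j L (n, pmap_comp (std_cube n) f c))))"

section \<open>Cube chains\<close>

text \<open>The wedge of cubes of dimensions \<open>ns\<close>. A cell is an equivalence class of pairs consisting of
  the index of a block and a cell of that block.\<close>

type_synonym wcell = "(nat \<times> (bool list \<Rightarrow> bool list)) set"

definition wedge_cells :: "nat list \<Rightarrow> nat \<Rightarrow> (nat \<times> (bool list \<Rightarrow> bool list)) set"
  where "wedge_cells ns d = {(i, \<phi>). i < length ns \<and> box d (ns ! i) \<phi>}"

definition equiv_gen :: "'a set \<Rightarrow> ('a \<times> 'a) set \<Rightarrow> ('a \<times> 'a) set"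
  where "equiv_gen A R = \<Inter>{E. equiv A E \<and> R \<subseteq> E}"

definition wedge_rel ::
  "nat list \<Rightarrow> nat \<Rightarrow> ((nat \<times> (bool list \<Rightarrow> bool list)) \<times> (nat \<times> (bool list \<Rightarrow> bool list))) set" where
  "wedge_rel ns d = equiv_gen (wedge_cells ns d)
    {((i, vertex_cell (ones (ns ! i))), (Suc i, vertex_cell (zeros (ns ! Suc i)))) | i.
      d = 0 \<and> Suc i < length ns}"

definition wclass :: "nat list \<Rightarrow> nat \<Rightarrow> nat \<Rightarrow> (bool list \<Rightarrow> bool list) \<Rightarrow> wcell"
  where "wclass ns d i \<phi> = wedge_rel ns d `` {(i, \<phi>)}"

definition wedge :: "nat list \<Rightarrow> wcell precub" where
  "wedge ns = \<lparr>cells = (\<lambda>d. wedge_cells ns d // wedge_rel ns d),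
    act = (\<lambda>m d \<psi> C. \<Union>(i, \<phi>)\<in>C. wclass ns m i (compose (verts m) \<phi> \<psi>))\<rparr>"

definition wedge_initial :: "nat list \<Rightarrow> wcell"
  where "wedge_initial ns = wclass ns 0 0 (vertex_cell (zeros (ns ! 0)))"

definition wedge_final :: "nat list \<Rightarrow> wcell"
  where "wedge_final ns = wclass ns 0 (length ns - 1) (vertex_cell (ones (last ns)))"

definition block_id :: "nat list \<Rightarrow> nat \<Rightarrow> wcell"
  where "block_id ns i = wclass ns (ns ! i) i (\<lambda>v\<in>verts (ns ! i). v)"

definition split_at :: "nat list \<Rightarrow> nat \<Rightarrow> nat set \<Rightarrow> nat set \<Rightarrow> nat list"
  where "split_at ns i A B = take i ns @ [card A, card B] @ drop (Suc i) ns"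

text \<open>\<open>f\<close> is the map from \<open>wedge (split_at ns i A B)\<close> to \<open>wedge ns\<close> given by the partition \<open>A \<squnion> B\<close> on
  the \<open>i\<close>-th block; such a map is determined by the images of the top cells of the blocks.\<close>

definition is_delta :: "nat list \<Rightarrow> nat \<Rightarrow> nat set \<Rightarrow> nat set \<Rightarrow> (wcell, wcell) pmap \<Rightarrow> bool" where
  "is_delta ns i A B f \<longleftrightarrow>
    i < length ns \<and> A \<union> B = {..<ns ! i} \<and> A \<inter> B = {} \<and> A \<noteq> {} \<and> B \<noteq> {} \<and>
    f \<in> pmaps (wedge (split_at ns i A B)) (wedge ns) \<and>
    (\<forall>j<i. f (ns ! j) (block_id (split_at ns i A B) j) = block_id ns j) \<and>
    f (card A) (block_id (split_at ns i A B) i) = face_set (wedge ns) (ns ! i) False B (block_id ns i) \<and>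
    f (card B) (block_id (split_at ns i A B) (Suc i)) = face_set (wedge ns) (ns ! i) True A (block_id ns i) \<and>
    (\<forall>j. i < j \<and> j < length ns \<longrightarrow>
      f (ns ! j) (block_id (split_at ns i A B) (Suc j)) = block_id ns j)"

text \<open>The induced map on tuples of paths composes the entries \<open>i\<close> and \<open>i + 1\<close>, viewed in the face with
  the coordinates in \<open>B\<close> equal to \<open>0\<close>, i.e. the subcube from \<open>0\<close> to the indicator of \<open>A\<close>, and in the
  face with the coordinates in \<open>A\<close> equal to \<open>1\<close>.\<close>

definition delta_paths :: "nat \<Rightarrow> nat \<Rightarrow> nat set \<Rightarrow> dpath list \<Rightarrow> dpath list" where
  "delta_paths n i A xs = take i xs @
    [cube_comp (zeros n) (map (\<lambda>c. c \<in> A) [0..<n]) (ones n) (xs ! i) (xs ! Suc i)] @ drop (i + 2) xs"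

text \<open>\<open>chain_mor ns ms f F\<close>: \<open>f\<close> from \<open>wedge ns\<close> to \<open>wedge ms\<close> is a composite of maps as above, and
  \<open>F\<close> is the map on tuples of paths which the diagram assigns to it.\<close>

inductive chain_mor ::
  "nat list \<Rightarrow> nat list \<Rightarrow> (wcell, wcell) pmap \<Rightarrow> (dpath list \<Rightarrow> dpath list) \<Rightarrow> bool" where
  chain_mor_id: "0 \<notin> set ns \<Longrightarrow> chain_mor ns ns (pmap_id (wedge ns)) id"
| chain_mor_delta: "0 \<notin> set ns \<Longrightarrow> is_delta ns i A B f \<Longrightarrow>
    chain_mor (split_at ns i A B) ns f (delta_paths (ns ! i) i A)"
| chain_mor_comp: "chain_mor ls ms f F \<Longrightarrow> chain_mor ms ns g G \<Longrightarrow>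
    chain_mor ls ns (pmap_comp (wedge ls) g f) (G \<circ> F)"

type_synonym 'k chain = "nat list \<times> (wcell, 'k) pmap"

definition chains :: "'k precub \<Rightarrow> 'k \<Rightarrow> 'k \<Rightarrow> nat \<Rightarrow> 'k chain set" where
  "chains K \<alpha> \<beta> n = {(ns, a). ns \<noteq> [] \<and> 0 \<notin> set ns \<and> sum_list ns = n \<and> a \<in> pmaps (wedge ns) K \<and>
    a 0 (wedge_initial ns) = \<alpha> \<and> a 0 (wedge_final ns) = \<beta>}"

text \<open>The product, in the category of spaces, of the spaces of natural d-paths for the entries of
  \<open>ns\<close>, as a topology on lists.\<close>

definition path_tuples :: "nat list \<Rightarrow> dpath list topology" where
  "path_tuples ns = delta_gen (pullback_topology {xs. length xs = length ns}
    (\<lambda>xs. \<lambda>i\<in>{..<length ns}. xs ! i)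
    (product_topology (\<lambda>i. natural_dpaths (ns ! i)) {..<length ns}))"

type_synonym 'k tagged_tuple = "'k chain \<times> dpath list"

definition chain_sum :: "'k precub \<Rightarrow> 'k \<Rightarrow> 'k \<Rightarrow> nat \<Rightarrow> 'k tagged_tuple topology"
  where "chain_sum K \<alpha> \<beta> n = sum_topology (\<lambda>a. path_tuples (fst a)) (chains K \<alpha> \<beta> n)"

definition chain_glue :: "'k precub \<Rightarrow> 'k \<Rightarrow> 'k \<Rightarrow> nat \<Rightarrow> ('k tagged_tuple \<times> 'k tagged_tuple) set" where
  "chain_glue K \<alpha> \<beta> n = {((a, xs), (b, F xs)) | a b f F xs.
    a \<in> chains K \<alpha> \<beta> n \<and> b \<in> chains K \<alpha> \<beta> n \<and>
    chain_mor (fst a) (fst b) f F \<and> pmap_comp (wedge (fst a)) (snd b) f = snd a \<and>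
    xs \<in> topspace (path_tuples (fst a))}"

definition chain_rel ::
  "top_choice \<Rightarrow> 'k precub \<Rightarrow> 'k \<Rightarrow> 'k \<Rightarrow> nat \<Rightarrow> ('k tagged_tuple \<times> 'k tagged_tuple) set"
  where "chain_rel T K \<alpha> \<beta> n = coeq_rel T (chain_sum K \<alpha> \<beta> n) (chain_glue K \<alpha> \<beta> n)"

definition chain_colim ::
  "top_choice \<Rightarrow> 'k precub \<Rightarrow> 'k \<Rightarrow> 'k \<Rightarrow> nat \<Rightarrow> 'k tagged_tuple set topology"
  where "chain_colim T K \<alpha> \<beta> n = coeq_top T (chain_sum K \<alpha> \<beta> n) (chain_glue K \<alpha> \<beta> n)"

definition chain_concat :: "'k chain \<Rightarrow> 'k chain \<Rightarrow> 'k chain" where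
  "chain_concat a b = (fst a @ fst b, \<lambda>d. \<lambda>C\<in>cells (wedge (fst a @ fst b)) d.
    the_elem ((\<lambda>(i, \<phi>). if i < length (fst a) then snd a d (wclass (fst a) d i \<phi>)
      else snd b d (wclass (fst b) d (i - length (fst a)) \<phi>)) ` C))"

section \<open>The flow of cube chains\<close>

type_synonym 'k cpath = "nat \<times> 'k tagged_tuple set"

definition chain_flow :: "top_choice \<Rightarrow> 'k precub \<Rightarrow> ('k, 'k cpath) flow" where
  "chain_flow T K = \<lparr>states = cells K 0,
    paths = (\<lambda>\<alpha> \<beta>. sum_topology (\<lambda>n. chain_colim T K \<alpha> \<beta> n) {1..}),
    pcomp = (\<lambda>\<alpha> \<beta> \<gamma> (m, C) (n, D). (m + n, \<Union>(a, xs)\<in>C. \<Union>(b, ys)\<in>D.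
      chain_rel T K \<alpha> \<gamma> (m + n) `` {(chain_concat a b, xs @ ys)}))\<rparr>"

definition chain_flow_map ::
  "top_choice \<Rightarrow> 'k precub \<Rightarrow> 'l precub \<Rightarrow> ('k, 'l) pmap \<Rightarrow> ('k, 'k cpath, 'l, 'l cpath) fmap" where
  "chain_flow_map T K L f = (f 0, \<lambda>\<alpha> \<beta> (n, C). (n, \<Union>((ns, a), xs)\<in>C.
    chain_rel T L (f 0 \<alpha>) (f 0 \<beta>) n `` {((ns, pmap_comp (wedge ns) f a), xs)}))"

definition natural_flow_iso ::
  "top_choice \<Rightarrow> ('k precub \<Rightarrow> ('s, 'p) flow)
    \<Rightarrow> ('k precub \<Rightarrow> 'k precub \<Rightarrow> ('k, 'k) pmap \<Rightarrow> ('s, 'p, 's, 'p) fmap)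
    \<Rightarrow> ('k precub \<Rightarrow> ('t, 'q) flow)
    \<Rightarrow> ('k precub \<Rightarrow> 'k precub \<Rightarrow> ('k, 'k) pmap \<Rightarrow> ('t, 'q, 't, 'q) fmap)
    \<Rightarrow> ('k precub \<Rightarrow> ('s, 'p, 't, 'q) fmap) \<Rightarrow> bool" where
  "natural_flow_iso T F Fmap G Gmap \<eta> \<longleftrightarrow>
    (\<forall>K. precubical_set K \<longrightarrow> flow_iso T (F K) (G K) (\<eta> K)) \<and>
    (\<forall>K L f. precubical_set K \<and> precubical_set L \<and> f \<in> pmaps K L \<longrightarrow>
      flow_map (F K) (F L) (Fmap K L f) \<and> flow_map (G K) (G L) (Gmap K L f) \<and>
      fmap_eq (F K) (fmap_comp (\<eta> L) (Fmap K L f)) (fmap_comp (Gmap K L f) (\<eta> K)))"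

end

theory Submission
  imports Defs
begin

text \<open>
  The flow of cube chains \<open>chain_flow T K\<close> is shown to be itself a colimit of the flows of the cubes
  of \<open>K\<close> (\<open>chain_flow_colimit\<close>). This gives the existence of a natural realization, and
  uniqueness of colimits then identifies every natural realization with the flow of cube chains.

  The leg at a cube sends a natural d-path in the subcube from \<open>\<alpha>\<close> to \<open>\<beta>\<close> to the class of that path on
  the chain whose only cube is the face spanned by \<open>\<alpha>\<close> and \<open>\<beta>\<close>. It respects composition because the
  two-cube chain through \<open>\<beta>\<close> maps to the one-cube chain from \<open>\<alpha>\<close> to \<open>\<gamma>\<close> by one of the elementary maps of
  cube chains, and this map composes the two paths (\<open>subcube_maps_merge\<close>). Conversely a point of a
  path space is represented by a cube chain with a path in each of its cubes, so it is the composite of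
  the images of these paths under the legs. Hence a cocone with vertex \<open>Y\<close> extends in at most one
  way (\<open>legs_determine\<close>), namely by composing in \<open>Y\<close> the values of the cocone on the successive cubes;
  the result is compatible with the gluing because the components of the cocone are maps of flows
  (\<open>eval_merge\<close>).

  The combinatorics is carried out on lists of blocks. A block is a dimension, a cell of that dimension
  and a natural d-path, and a chain with a tuple of paths is the same thing as a list of blocks in which
  each one starts where its predecessor ends (\<open>tuple_of_props\<close>, \<open>tuple_of_blocks\<close>). Concatenation of
  chains becomes concatenation of lists, and the gluing relation is generated by merging two adjacent
  faces of one cube into that cube (\<open>merge_glue\<close>, \<open>chain_mor_blocks\<close>).

  Three topological facts enter. Continuity out of a $\Delta$-generated space may be tested along paths;
  to use this for the legs one needs that the space of natural d-paths is $\Delta$-generated, and it is so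
  because it is homeomorphic to a convex subset of a normed space (\<open>delta_generated_natural_dpaths\<close>).
  Composition in the flow of cube chains is continuous because products with $\Delta$-generated spaces
  preserve quotients (\<open>quot_times_top_path\<close>). Finally, a coequalizer is the quotient by the
  intersection of the admissible equivalence relations, those that contain the pairs to be identified
  and whose quotient lies in the category. The $\Delta$-Hausdorff property passes to this
  quotient (\<open>delta_Hausdorff_quot_INT\<close>), and kernels of maps into spaces of the category are admissible
  (\<open>coeq_rel_kernel\<close>), so that for both choices of the category a map out of a coequalizer only has to
  be checked on the generating pairs.
\<close>

section \<open>Testing continuity along paths\<close>

abbreviation top_path :: "'a topology \<Rightarrow> (real \<Rightarrow> 'a) \<Rightarrow> bool"
  where "top_path \<equiv> continuous_map unit_interval_top"

lemma topspace_delta_gen [simp]: "topspace (delta_gen X) = topspace X"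
proof -
  have "openin (delta_gen X) (topspace X)"
  proof (unfold openin_delta_gen, intro conjI allI impI)
    fix f assume "top_path X f"
    then have "{t \<in> {0..1}. f t \<in> topspace X} = {0..1}"
      by (auto simp: continuous_map_def)
    then show "openin unit_interval_top {t \<in> {0..1}. f t \<in> topspace X}" by simp
  qed simp
  then have "topspace X \<subseteq> topspace (delta_gen X)" by (rule openin_subset)
  moreover have "topspace (delta_gen X) \<subseteq> topspace X"
    using openin_topspace[of "delta_gen X"] unfolding openin_delta_gen by blast
  ultimately show ?thesis by blast
qed

lemma top_path_delta_gen [simp]: "top_path (delta_gen X) f \<longleftrightarrow> top_path X f"
proof
  assume *: "top_path (delta_gen X) f"
  show "top_path X f"
    unfolding continuous_map_def
  proof (intro conjI allI impI)
    show "f \<in> topspace unit_interval_top \<rightarrow> topspace X"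
      using * by (simp add: continuous_map_def)
    fix U assume U: "openin X U"
    have "openin (delta_gen X) U"
      unfolding openin_delta_gen using U openin_subset[OF U] by (auto simp: continuous_map_def)
    then show "openin unit_interval_top {x \<in> topspace unit_interval_top. f x \<in> U}"
      using * by (simp add: continuous_map_def)
  qed
next
  assume "top_path X f"
  then show "top_path (delta_gen X) f"
    by (auto simp: continuous_map_def openin_delta_gen)
qed

lemma delta_generated_delta_gen [simp]: "delta_generated (delta_gen X)"
  unfolding delta_generated_def topology_eq
  by (auto simp: openin_delta_gen)

lemma top_path_const: "top_path X (\<lambda>_. x) \<longleftrightarrow> x \<in> topspace X"
proof
  assume "top_path X (\<lambda>_. x)"
  then have "(\<lambda>_. x) \<in> topspace unit_interval_top \<rightarrow> topspace X" by (rule continuous_map_funspace)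
  from funcset_mem[OF this, of 0] show "x \<in> topspace X" by simp
qed simp

lemma unit_interval_nontrivial [simp]: "unit_interval_top \<noteq> trivial_topology"
  by (metis empty_iff atLeastAtMost_iff order_refl topspace_euclidean_subtopology
      topspace_discrete_topology zero_le_one)

lemma top_path_in: "top_path X p \<Longrightarrow> t \<in> {0..1} \<Longrightarrow> p t \<in> topspace X"
  by (auto simp: continuous_map_def)

lemma delta_generatedI:
  assumes "\<And>U. U \<subseteq> topspace X \<Longrightarrow>
    (\<And>p. top_path X p \<Longrightarrow> openin unit_interval_top {t \<in> {0..1}. p t \<in> U}) \<Longrightarrow> openin X U"
  shows "delta_generated X"
  unfolding delta_generated_def topology_eq openin_delta_gen
proof (intro allI iffI)
  fix U assume "U \<subseteq> topspace X \<and> (\<forall>f. top_path X f \<longrightarrow> openin unit_interval_top {t \<in> {0..1}. f t \<in> U})"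
  then show "openin X U" using assms by blast
next
  fix U assume U: "openin X U"
  then show "U \<subseteq> topspace X \<and> (\<forall>f. top_path X f \<longrightarrow> openin unit_interval_top {t \<in> {0..1}. f t \<in> U})"
    using openin_subset[OF U] by (auto simp: continuous_map_def)
qed

lemma delta_generatedD:
  assumes "delta_generated X" "U \<subseteq> topspace X"
    "\<And>p. top_path X p \<Longrightarrow> openin unit_interval_top {t \<in> {0..1}. p t \<in> U}"
  shows "openin X U"
  using assms openin_delta_gen[of X U] unfolding delta_generated_def by simp

lemma delta_generated_closedin:
  assumes "delta_generated X" "C \<subseteq> topspace X"
    "\<And>p. top_path X p \<Longrightarrow> closedin unit_interval_top {t \<in> {0..1}. p t \<in> C}"
  shows "closedin X C"
  unfolding closedin_def
proof
  show "openin X (topspace X - C)"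
  proof (rule delta_generatedD[OF assms(1)])
    fix p assume p: "top_path X p"
    then have "{t \<in> {0..1}. p t \<in> topspace X - C} = topspace unit_interval_top - {t \<in> {0..1}. p t \<in> C}"
      by (auto simp: continuous_map_def)
    then show "openin unit_interval_top {t \<in> {0..1}. p t \<in> topspace X - C}"
      using assms(3)[OF p] by (simp add: closedin_def)
  qed auto
qed (rule assms)

text \<open>The main tool for continuity: the open sets of a $\Delta$-generated space are exactly those that paths
  detect, so a map out of it is continuous as soon as it carries paths to paths.\<close>

lemma continuous_map_from_delta_generated:
  assumes "delta_generated X" "\<And>p. top_path X p \<Longrightarrow> top_path Y (f \<circ> p)"
  shows "continuous_map X Y f"
  unfolding continuous_map_def
proof (intro conjI allI impI)
  show "f \<in> topspace X \<rightarrow> topspace Y"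
  proof
    fix x assume "x \<in> topspace X"
    then have "top_path Y (f \<circ> (\<lambda>_. x))" by (intro assms) simp
    then have "top_path Y (\<lambda>_. f x)" by (simp only: o_def)
    then show "f x \<in> topspace Y" by (simp only: top_path_const)
  qed
  fix U assume U: "openin Y U"
  show "openin X {x \<in> topspace X. f x \<in> U}"
  proof (rule delta_generatedD[OF assms(1)])
    fix p assume p: "top_path X p"
    have "{t \<in> {0..1}. p t \<in> {x \<in> topspace X. f x \<in> U}} = {t \<in> {0..1}. (f \<circ> p) t \<in> U}"
      using p by (auto simp: continuous_map_def)
    then show "openin unit_interval_top {t \<in> {0..1}. p t \<in> {x \<in> topspace X. f x \<in> U}}"
      using assms(2)[OF p] U by (auto simp: continuous_map_def)
  qed auto
qed

lemma delta_generated_homeomorphic: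
  assumes "homeomorphic_map X Y f" "delta_generated X"
  shows "delta_generated Y"
proof (rule delta_generatedI)
  fix U assume U: "U \<subseteq> topspace Y"
    "\<And>p. top_path Y p \<Longrightarrow> openin unit_interval_top {t \<in> {0..1}. p t \<in> U}"
  have f: "continuous_map X Y f" using assms(1) by (rule homeomorphic_imp_continuous_map)
  have "openin X {x \<in> topspace X. f x \<in> U}"
  proof (rule delta_generatedD[OF assms(2)])
    fix p assume p: "top_path X p"
    then have "top_path Y (f \<circ> p)" using f by (rule continuous_map_compose)
    from U(2)[OF this] have "openin unit_interval_top {t \<in> {0..1}. f (p t) \<in> U}" by simp
    moreover have "{t \<in> {0..1}. f (p t) \<in> U} = {t \<in> {0..1}. p t \<in> {x \<in> topspace X. f x \<in> U}}"
      using p by (auto simp: continuous_map_def)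
    ultimately show "openin unit_interval_top {t \<in> {0..1}. p t \<in> {x \<in> topspace X. f x \<in> U}}" by simp
  qed auto
  then show "openin Y U"
    using U(1) assms(1) unfolding homeomorphic_map_def quotient_map_def by blast
qed

section \<open>Quotients\<close>

lemma topspace_quot_top:
  assumes "equiv (topspace X) E"
  shows "topspace (quot_top X E) = topspace X // E"
proof -
  have "openin (quot_top X E) (topspace X // E)"
    by (simp add: openin_quot_top[OF assms] Union_quotient[OF assms])
  then have "topspace X // E \<subseteq> topspace (quot_top X E)" by (rule openin_subset)
  moreover have "topspace (quot_top X E) \<subseteq> topspace X // E"
    using openin_topspace[of "quot_top X E"] unfolding openin_quot_top[OF assms] by blast
  ultimately show ?thesis by blast
qed

lemma Union_quotient_subset:
  assumes "equiv A E" "U \<subseteq> A // E"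
  shows "\<Union>U = {x \<in> A. E `` {x} \<in> U}"
proof (intro equalityI subsetI)
  fix x assume "x \<in> \<Union>U"
  then obtain C where C: "C \<in> U" "x \<in> C" by blast
  then obtain y where y: "y \<in> A" "C = E `` {y}" using assms(2) by (blast elim: quotientE)
  then have "E `` {x} = C" "x \<in> A"
    using C assms(1) equiv_class_eq[OF assms(1), of y x] equiv_type[OF assms(1)] by auto
  then show "x \<in> {x \<in> A. E `` {x} \<in> U}" using C by simp
next
  fix x assume "x \<in> {x \<in> A. E `` {x} \<in> U}"
  then show "x \<in> \<Union>U" using equiv_class_self[OF assms(1)] by blast
qed

lemma continuous_map_quot_proj:
  assumes "equiv (topspace X) E"
  shows "continuous_map X (quot_top X E) (\<lambda>x. E `` {x})"
  unfolding continuous_map_def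
proof (intro conjI allI impI)
  show "(\<lambda>x. E `` {x}) \<in> topspace X \<rightarrow> topspace (quot_top X E)"
    by (auto simp: topspace_quot_top[OF assms] intro: quotientI)
  fix U assume "openin (quot_top X E) U"
  then show "openin X {x \<in> topspace X. E `` {x} \<in> U}"
    using Union_quotient_subset[OF assms] by (auto simp: openin_quot_top[OF assms])
qed

lemma continuous_map_from_quot:
  assumes E: "equiv (topspace X) E" and f: "continuous_map X Y (\<lambda>x. f (E `` {x}))"
  shows "continuous_map (quot_top X E) Y f"
  unfolding continuous_map_def
proof (intro conjI allI impI)
  show "f \<in> topspace (quot_top X E) \<rightarrow> topspace Y"
    using f by (auto simp: topspace_quot_top[OF E] continuous_map_def elim!: quotientE)
  fix U assume U: "openin Y U"
  let ?V = "{x \<in> topspace (quot_top X E). f x \<in> U}"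
  have V: "?V \<subseteq> topspace X // E" by (auto simp: topspace_quot_top[OF E])
  have "\<Union>?V = {x \<in> topspace X. f (E `` {x}) \<in> U}"
    unfolding Union_quotient_subset[OF E V] by (auto simp: topspace_quot_top[OF E] intro: quotientI)
  then show "openin (quot_top X E) ?V"
    using f U V by (simp add: openin_quot_top[OF E] continuous_map_def)
qed

text \<open>Paths of the space project to paths of the quotient, so a subset of the quotient that paths recognize
  as open has an open preimage.\<close>

lemma delta_generated_quot:
  assumes E: "equiv (topspace X) E" and X: "delta_generated X"
  shows "delta_generated (quot_top X E)"
proof (rule delta_generatedI)
  fix U assume U: "U \<subseteq> topspace (quot_top X E)"
    "\<And>p. top_path (quot_top X E) p \<Longrightarrow> openin unit_interval_top {t \<in> {0..1}. p t \<in> U}"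
  have UE: "U \<subseteq> topspace X // E" using U(1) by (simp add: topspace_quot_top[OF E])
  have "openin X (\<Union>U)"
    unfolding Union_quotient_subset[OF E UE]
  proof (rule delta_generatedD[OF X])
    fix p assume p: "top_path X p"
    then have "top_path (quot_top X E) ((\<lambda>x. E `` {x}) \<circ> p)"
      by (rule continuous_map_compose) (rule continuous_map_quot_proj[OF E])
    from U(2)[OF this] have "openin unit_interval_top {t \<in> {0..1}. E `` {p t} \<in> U}" by simp
    moreover have "{t \<in> {0..1}. E `` {p t} \<in> U} = {t \<in> {0..1}. p t \<in> {x \<in> topspace X. E `` {x} \<in> U}}"
      using p by (auto simp: continuous_map_def)
    ultimately show "openin unit_interval_top {t \<in> {0..1}. p t \<in> {x \<in> topspace X. E `` {x} \<in> U}}" by simp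
  qed auto
  then show "openin (quot_top X E) U" using UE by (simp add: openin_quot_top[OF E])
qed

section \<open>$\Delta$-Hausdorff spaces\<close>

lemma top_path_affine:
  assumes "top_path X p" "0 \<le> u" "u \<le> v" "v \<le> 1"
  shows "top_path X (\<lambda>t. p (u + t * (v - u)))"
proof -
  have "continuous_map unit_interval_top unit_interval_top (\<lambda>t. u + t * (v - u))"
    unfolding continuous_map_in_subtopology
  proof
    show "continuous_map unit_interval_top euclidean (\<lambda>t. u + t * (v - u))"
      by (auto intro!: continuous_intros)
    have "u + t * (v - u) \<le> 1" if "0 \<le> t" "t \<le> 1" for t
    proof -
      have "t * (v - u) \<le> 1 * (v - u)" using that assms by (intro mult_right_mono) auto
      then show ?thesis using assms by simp
    qed
    then show "(\<lambda>t. u + t * (v - u)) \<in> topspace unit_interval_top \<rightarrow> {0..1}" using assms by auto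
  qed
  from continuous_map_compose[OF this assms(1)] show ?thesis by (simp add: o_def)
qed

lemma delta_Hausdorff_subpath_closed:
  assumes X: "delta_Hausdorff X" and p: "top_path X p" and uv: "0 \<le> u" "u \<le> v" "v \<le> 1"
  shows "closedin X (p ` {u..v})"
proof -
  have "closedin X ((\<lambda>t. p (u + t * (v - u))) ` {0..1})"
    using X top_path_affine[OF p uv] unfolding delta_Hausdorff_def by blast
  moreover have "(\<lambda>t. u + t * (v - u)) ` {0..1} = {u..v}"
  proof (cases "u = v")
    case False
    then have "u < v" using uv by simp
    then show ?thesis using image_affinity_atLeastAtMost[of "v - u" u 0 1]
      by (simp add: mult.commute add.commute)
  next
    case True
    have "(\<lambda>_::real. v) ` {0..1} = {v}" by (rule image_constant[of 0]) simp
    then show ?thesis using True by simp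
  qed
  ultimately show ?thesis by (metis image_image)
qed

lemma delta_Hausdorff_closed_point:
  assumes "delta_Hausdorff X" "x \<in> topspace X"
  shows "closedin X {x}"
proof -
  have "(\<lambda>_::real. x) ` {0..1} = {x}" by (rule image_constant[of 0]) simp
  then show ?thesis using assms unfolding delta_Hausdorff_def by (metis top_path_const)
qed

lemma openin_unit_interval_ball:
  assumes "openin unit_interval_top U" "s \<in> U"
  obtains d where "d > 0" "\<And>r. r \<in> {0..1} \<Longrightarrow> dist r s < d \<Longrightarrow> r \<in> U"
  using assms unfolding openin_euclidean_subtopology_iff by blast

text \<open>This replaces the closed diagonal of a Hausdorff space. If \<open>p t\<close> and \<open>q s\<close> differ, then \<open>q\<close> avoids
  the closed point \<open>p t\<close> on a whole interval around \<open>s\<close>; the image of that interval is closed, so its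
  preimage under \<open>p\<close> misses a neighbourhood of \<open>t\<close>.\<close>

lemma delta_Hausdorff_coincidence_closed:
  assumes X: "delta_Hausdorff X" and p: "top_path X p" and q: "top_path X q"
  shows "closed {z \<in> {0..1} \<times> {0..1}. p (fst z) = q (snd z)}"
proof -
  let ?S = "{0..1::real} \<times> {0..1::real}"
  have "openin (top_of_set ?S) {z \<in> ?S. p (fst z) \<noteq> q (snd z)}"
  proof (subst openin_subopen, intro ballI)
    fix z assume z: "z \<in> {z \<in> ?S. p (fst z) \<noteq> q (snd z)}"
    obtain t s where ts: "z = (t, s)" by fastforce
    have t: "t \<in> {0..1}" and s: "s \<in> {0..1}" and ne: "p t \<noteq> q s" using z ts by auto
    have pt: "p t \<in> topspace X" using p t by (auto simp: continuous_map_def)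
    have "closedin unit_interval_top {r \<in> topspace unit_interval_top. q r \<in> {p t}}"
      using closedin_continuous_map_preimage[OF q delta_Hausdorff_closed_point[OF X pt]] .
    then have "openin unit_interval_top ({0..1} - {r \<in> {0..1}. q r = p t})"
      by (simp add: closedin_def)
    moreover have "s \<in> {0..1} - {r \<in> {0..1}. q r = p t}" using s ne by auto
    ultimately obtain d where d: "d > 0" "\<And>r. r \<in> {0..1} \<Longrightarrow> dist r s < d \<Longrightarrow> q r \<noteq> p t"
      by (rule openin_unit_interval_ball) blast
    define u where "u = max 0 (s - d / 2)"
    define v where "v = min 1 (s + d / 2)"
    have uv: "0 \<le> u" "u \<le> v" "v \<le> 1" using s d(1) by (auto simp: u_def v_def)
    have nin: "p t \<notin> q ` {u..v}"
    proof
      assume "p t \<in> q ` {u..v}"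
      then obtain r where r: "r \<in> {u..v}" "q r = p t" by auto
      then have "r \<in> {0..1}" "dist r s < d"
        using s d(1) by (auto simp: u_def v_def dist_real_def)
      then show False using d(2) r by blast
    qed
    have "closedin unit_interval_top {r \<in> topspace unit_interval_top. p r \<in> q ` {u..v}}"
      using closedin_continuous_map_preimage[OF p delta_Hausdorff_subpath_closed[OF X q uv]] .
    then have V: "openin unit_interval_top ({0..1} - {r \<in> {0..1}. p r \<in> q ` {u..v}})" (is "openin _ ?V")
      by (simp add: closedin_def)
    have J: "openin unit_interval_top ({0..1} \<inter> {s - d/2 <..< s + d/2})" (is "openin _ ?J")
      by (rule openin_open_Int) simp
    have "openin (top_of_set ?S) (?V \<times> ?J)"
      using V J by (rule openin_Times)
    moreover have "z \<in> ?V \<times> ?J" using ts t s d(1) nin by auto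
    moreover have "?V \<times> ?J \<subseteq> {z \<in> ?S. p (fst z) \<noteq> q (snd z)}"
    proof
      fix w assume w: "w \<in> ?V \<times> ?J"
      obtain r r' where rr: "w = (r, r')" by fastforce
      have "r' \<in> {u..v}" using w rr by (auto simp: u_def v_def)
      moreover have "p r \<notin> q ` {u..v}" "r \<in> {0..1}" "r' \<in> {0..1}" using w rr by auto
      ultimately show "w \<in> {z \<in> ?S. p (fst z) \<noteq> q (snd z)}" using rr by auto
    qed
    ultimately show "\<exists>T. openin (top_of_set ?S) T \<and> z \<in> T \<and> T \<subseteq> {z \<in> ?S. p (fst z) \<noteq> q (snd z)}"
      by blast
  qed
  then have "closedin (top_of_set ?S) (?S - {z \<in> ?S. p (fst z) \<noteq> q (snd z)})"
    by (intro closedin_diff) auto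
  moreover have "?S - {z \<in> ?S. p (fst z) \<noteq> q (snd z)} = {z \<in> ?S. p (fst z) = q (snd z)}" by auto
  ultimately have "closedin (top_of_set ?S) {z \<in> ?S. p (fst z) = q (snd z)}" by simp
  moreover have "closed ?S" by (intro closed_Times) auto
  ultimately show ?thesis by (rule closedin_closed_trans)
qed

section \<open>Coequalizers\<close>

lemma in_Top_dgen: "in_Top T X \<Longrightarrow> delta_generated X"
  by (cases T) auto

lemma equiv_INT:
  assumes "\<E> \<noteq> {}" "\<And>E. E \<in> \<E> \<Longrightarrow> equiv A E"
  shows "equiv A (\<Inter>\<E>)"
proof (rule equivI)
  show "\<Inter>\<E> \<subseteq> A \<times> A" using assms equiv_type by blast
  show "refl_on A (\<Inter>\<E>)"
    using assms by (auto simp: refl_on_def equiv_def)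
  show "sym (\<Inter>\<E>)"
    using assms(2) unfolding equiv_def sym_def by blast
  show "trans (\<Inter>\<E>)"
    using assms(2) unfolding equiv_def trans_def by blast
qed

text \<open>The point of a $\Delta$-Hausdorff quotient is that coincidence of two paths is a closed condition on the
  square. A path \<open>c\<close> of the space meets the image of a path \<open>p\<close> of the quotient by the intersection at
  those times that occur in pairs of times at which the two paths agree in all the given quotients. This
  is a projection of an intersection of closed, hence compact, subsets of the square.\<close>

lemma delta_Hausdorff_quot_INT:
  assumes ne: "\<E> \<noteq> {}" and eq: "\<And>E. E \<in> \<E> \<Longrightarrow> equiv (topspace X) E"
    and H: "\<And>E. E \<in> \<E> \<Longrightarrow> delta_Hausdorff (quot_top X E)" and X: "delta_generated X"
  shows "delta_Hausdorff (quot_top X (\<Inter>\<E>))"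
  unfolding delta_Hausdorff_def
proof (intro allI impI)
  let ?E = "\<Inter>\<E>"
  let ?Q = "quot_top X ?E"
  fix p assume p: "top_path ?Q p"
  have E: "equiv (topspace X) ?E" using equiv_INT[OF ne eq] .
  define r where "r = (\<lambda>t. SOME x. x \<in> p t)"
  have r: "r t \<in> topspace X \<and> p t = ?E `` {r t}" if "t \<in> {0..1}" for t
  proof -
    have "p t \<in> topspace X // ?E"
      using p that by (auto simp: continuous_map_def topspace_quot_top[OF E])
    then obtain x where x: "x \<in> topspace X" "p t = ?E `` {x}" by (rule quotientE)
    then have "x \<in> p t" using equiv_class_self[OF E] by blast
    then have "r t \<in> p t" unfolding r_def by (rule someI)
    then have "(x, r t) \<in> ?E" using x by simp
    then show ?thesis using equiv_class_eq[OF E] x equiv_type[OF E] by blast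
  qed
  show "closedin ?Q (p ` {0..1})"
  proof -
    have subcube_map: "p ` {0..1} \<subseteq> topspace X // ?E"
      using p by (auto simp: continuous_map_def topspace_quot_top[OF E])
    have cl: "closedin X {x \<in> topspace X. ?E `` {x} \<in> p ` {0..1}}"
    proof (rule delta_generated_closedin[OF X])
      fix c assume c: "top_path X c"
      have cX: "c t \<in> topspace X" if "t \<in> {0..1}" for t
        using c that by (auto simp: continuous_map_def)
      have proj: "top_path (quot_top X F) (\<lambda>t. F `` {r t})" if F: "F \<in> \<E>" for F
      proof -
        have "continuous_map ?Q (quot_top X F) (\<lambda>C. F `` {SOME x. x \<in> C})"
        proof (rule continuous_map_from_quot[OF E], rule continuous_map_eq[OF continuous_map_quot_proj[OF eq[OF F]]])
          fix x assume x: "x \<in> topspace X"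
          then have "x \<in> ?E `` {x}" using equiv_class_self[OF E] by blast
          then have "(SOME y. y \<in> ?E `` {x}) \<in> ?E `` {x}" by (rule someI)
          then have "(x, SOME y. y \<in> ?E `` {x}) \<in> F" using F by blast
          then show "F `` {x} = F `` {SOME y. y \<in> ?E `` {x}}" by (rule equiv_class_eq[OF eq[OF F]])
        qed
        from continuous_map_compose[OF p this] show ?thesis by (simp add: o_def r_def)
      qed
      have cproj: "top_path (quot_top X F) (\<lambda>t. F `` {c t})" if F: "F \<in> \<E>" for F
        using continuous_map_compose[OF c continuous_map_quot_proj[OF eq[OF F]]] by (simp add: o_def)
      let ?A = "\<lambda>F. {z \<in> {0..1} \<times> {0..1}. F `` {c (fst z)} = F `` {r (snd z)}}"
      have "closed (?A F)" if "F \<in> \<E>" for F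
        using delta_Hausdorff_coincidence_closed[OF H[OF that] cproj[OF that] proj[OF that]] .
      then have cl_A: "closed (\<Inter>(?A ` \<E>))" by blast
      moreover have "\<Inter>(?A ` \<E>) \<subseteq> {0..1} \<times> {0..1}" using ne by auto
      ultimately have "compact (\<Inter>(?A ` \<E>))"
        using closed_Int_compact[OF cl_A compact_Times[OF compact_Icc[of 0 1] compact_Icc[of 0 1]]]
        by (simp only: Int_absorb2)
      then have "compact (fst ` (\<Inter>(?A ` \<E>)))"
        by (intro compact_continuous_image continuous_intros)
      then have "closed (fst ` (\<Inter>(?A ` \<E>)))" by (rule compact_imp_closed)
      moreover have "{t \<in> {0..1}. c t \<in> {x \<in> topspace X. ?E `` {x} \<in> p ` {0..1}}} = fst ` (\<Inter>(?A ` \<E>))"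
      proof (intro equalityI subsetI)
        fix t assume "t \<in> {t \<in> {0..1}. c t \<in> {x \<in> topspace X. ?E `` {x} \<in> p ` {0..1}}}"
        then obtain s where s: "t \<in> {0..1}" "s \<in> {0..1}" "?E `` {c t} = p s" by blast
        then have "(c t, r s) \<in> ?E" using r[OF s(2)] by (intro eq_equiv_class[OF _ E]) simp_all
        then have "F `` {c t} = F `` {r s}" if "F \<in> \<E>" for F
          using that by (intro equiv_class_eq[OF eq]) auto
        then have "(t, s) \<in> \<Inter>(?A ` \<E>)" using s by auto
        then show "t \<in> fst ` (\<Inter>(?A ` \<E>))" by (rule image_eqI[rotated]) simp
      next
        fix t assume "t \<in> fst ` (\<Inter>(?A ` \<E>))"
        then obtain z where z: "t = fst z" "z \<in> \<Inter>(?A ` \<E>)" by (rule imageE)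
        define s where "s = snd z"
        have s: "(t, s) \<in> \<Inter>(?A ` \<E>)" using z by (simp add: s_def)
        then have ts: "t \<in> {0..1}" "s \<in> {0..1}" using ne by auto
        have "(c t, r s) \<in> F" if F: "F \<in> \<E>" for F
          using s F r[OF ts(2)] by (intro eq_equiv_class[OF _ eq[OF F]]) auto
        then have "?E `` {c t} = ?E `` {r s}" by (intro equiv_class_eq[OF E]) auto
        then show "t \<in> {t \<in> {0..1}. c t \<in> {x \<in> topspace X. ?E `` {x} \<in> p ` {0..1}}}"
          using ts cX r[OF ts(2)] by auto
      qed
      moreover have "fst ` (\<Inter>(?A ` \<E>)) \<subseteq> {0..1}" using ne by auto
      ultimately show "closedin unit_interval_top {t \<in> {0..1}. c t \<in> {x \<in> topspace X. ?E `` {x} \<in> p ` {0..1}}}"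
        by (simp only: closed_subset)
    qed auto
    show ?thesis
      unfolding closedin_def openin_quot_top[OF E] topspace_quot_top[OF E]
    proof (intro conjI)
      have "\<Union>(topspace X // ?E - p ` {0..1}) = topspace X - {x \<in> topspace X. ?E `` {x} \<in> p ` {0..1}}"
        by (subst Union_quotient_subset[OF E]) (auto intro: quotientI)
      then show "openin X (\<Union>(topspace X // ?E - p ` {0..1}))"
        using cl by (simp add: closedin_def)
    qed (use subcube_map in auto)
  qed
qed

text \<open>Used for the quotient by the total relation, which makes the family of equivalence relations
  defining \<open>coeq_rel\<close> nonempty.\<close>

lemma in_Top_one_point:
  assumes "topspace X \<subseteq> {a}"
  shows "in_Top T X"
proof -
  have "delta_generated X"
  proof (rule delta_generatedI)
    fix U assume "U \<subseteq> topspace X"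
    then have "U = {} \<or> U = topspace X" using assms by auto
    then show "openin X U" by auto
  qed
  moreover have "delta_Hausdorff X"
    unfolding delta_Hausdorff_def
  proof (intro allI impI)
    fix f assume "top_path X f"
    then have "f ` {0..1} \<subseteq> topspace X" by (auto simp: continuous_map_def)
    moreover have "f ` {0..1} \<noteq> {}" by simp
    ultimately have "f ` {0..1} = topspace X" using assms by blast
    then show "closedin X (f ` {0..1})" by simp
  qed
  ultimately show ?thesis by (cases T) auto
qed

lemma coeq_rel_family_nonempty:
  assumes "R \<subseteq> topspace X \<times> topspace X"
  shows "{E. equiv (topspace X) E \<and> R \<subseteq> E \<and> in_Top T (quot_top X E)} \<noteq> {}"
proof -
  let ?E = "topspace X \<times> topspace X"
  have E: "equiv (topspace X) ?E" by (auto simp: equiv_def refl_on_def sym_def trans_def)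
  have "topspace (quot_top X ?E) \<subseteq> {topspace X}"
    by (auto simp: topspace_quot_top[OF E] quotient_def)
  then have "in_Top T (quot_top X ?E)" by (rule in_Top_one_point)
  then show ?thesis using E assms by blast
qed

lemma equiv_coeq_rel:
  assumes "R \<subseteq> topspace X \<times> topspace X"
  shows "equiv (topspace X) (coeq_rel T X R)"
  unfolding coeq_rel_def by (rule equiv_INT[OF coeq_rel_family_nonempty[OF assms]]) blast

lemma coeq_rel_contains: "R \<subseteq> coeq_rel T X R"
  unfolding coeq_rel_def by blast

lemma in_Top_coeq_top:
  assumes R: "R \<subseteq> topspace X \<times> topspace X" and X: "delta_generated X"
  shows "in_Top T (coeq_top T X R)"
proof -
  have dg: "delta_generated (coeq_top T X R)"
    unfolding coeq_top_def by (rule delta_generated_quot[OF equiv_coeq_rel[OF R] X])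
  moreover have "delta_Hausdorff (coeq_top T X R)" if "T = Delta_Hausdorff"
    unfolding coeq_top_def coeq_rel_def
    by (rule delta_Hausdorff_quot_INT[OF coeq_rel_family_nonempty[OF R] _ _ X])
      (use that in auto)
  ultimately show ?thesis by (cases T) auto
qed

text \<open>The quotient by the kernel of \<open>f\<close> injects continuously into \<open>Y\<close>, so the image of a path in it is
  the preimage of the image of a path in \<open>Y\<close>, which is closed. Hence the kernel of \<open>f\<close> takes part in the intersection
  that defines \<open>coeq_rel\<close>.\<close>

lemma coeq_rel_kernel:
  assumes f: "continuous_map X Y f" and Y: "in_Top T Y" and X: "delta_generated X"
    and R: "R \<subseteq> topspace X \<times> topspace X" "\<And>x y. (x, y) \<in> R \<Longrightarrow> f x = f y"
    and xy: "(x, y) \<in> coeq_rel T X R"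
  shows "f x = f y"
proof -
  let ?E = "{(x, y). x \<in> topspace X \<and> y \<in> topspace X \<and> f x = f y}"
  have E: "equiv (topspace X) ?E"
    by (auto simp: equiv_def refl_on_def sym_def trans_def)
  have fE: "f (SOME z. z \<in> ?E `` {x}) = f x" if "x \<in> topspace X" for x
  proof -
    have "x \<in> ?E `` {x}" using that by simp
    then have "(SOME z. z \<in> ?E `` {x}) \<in> ?E `` {x}" by (rule someI)
    then have "(x, SOME z. z \<in> ?E `` {x}) \<in> ?E" by (rule Image_singleton_iff[THEN iffD1])
    then show ?thesis by (metis (mono_tags, lifting) case_prodD mem_Collect_eq)
  qed
  define g where "g = (\<lambda>C. f (SOME z. z \<in> C))"
  have g: "continuous_map (quot_top X ?E) Y g"
    unfolding g_def
    by (rule continuous_map_from_quot[OF E], rule continuous_map_eq[OF f]) (rule fE[symmetric])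
  have g_inj: "C = D" if "C \<in> topspace X // ?E" "D \<in> topspace X // ?E" "g C = g D" for C D
    using that fE unfolding g_def by (auto elim!: quotientE)
  have "delta_Hausdorff (quot_top X ?E)" if T: "T = Delta_Hausdorff"
    unfolding delta_Hausdorff_def
  proof (intro allI impI)
    fix p assume p: "top_path (quot_top X ?E) p"
    have "top_path Y (g \<circ> p)" using p g by (rule continuous_map_compose)
    then have "closedin Y ((g \<circ> p) ` {0..1})"
      using Y T by (auto simp: delta_Hausdorff_def)
    from closedin_continuous_map_preimage[OF g this]
    have "closedin (quot_top X ?E) {C \<in> topspace X // ?E. g C \<in> (g \<circ> p) ` {0..1}}"
      by (simp add: topspace_quot_top[OF E])
    moreover have "{C \<in> topspace X // ?E. g C \<in> (g \<circ> p) ` {0..1}} = p ` {0..1}"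
    proof (intro equalityI subsetI)
      fix C assume C: "C \<in> {C \<in> topspace X // ?E. g C \<in> (g \<circ> p) ` {0..1}}"
      then obtain t where t: "t \<in> {0..1}" "g C = g (p t)" by auto
      have "p t \<in> topspace X // ?E" using top_path_in[OF p t(1)] by (simp only: topspace_quot_top[OF E])
      then have "C = p t" using C t(2) by (intro g_inj) blast+
      then show "C \<in> p ` {0..1}" using t(1) by (rule image_eqI)
    next
      fix C assume "C \<in> p ` {0..1}"
      then obtain t where t: "C = p t" "t \<in> {0..1}" by (rule imageE)
      have "p t \<in> topspace X // ?E" using top_path_in[OF p t(2)] by (simp only: topspace_quot_top[OF E])
      then show "C \<in> {C \<in> topspace X // ?E. g C \<in> (g \<circ> p) ` {0..1}}" using t by auto
    qed
    ultimately show "closedin (quot_top X ?E) (p ` {0..1})" by simp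
  qed
  then have "in_Top T (quot_top X ?E)"
    using delta_generated_quot[OF E X] by (cases T) auto
  moreover have "R \<subseteq> ?E" using R by blast
  ultimately have "coeq_rel T X R \<subseteq> ?E" unfolding coeq_rel_def using E by blast
  then show ?thesis using xy by blast
qed

section \<open>Convex sets\<close>

text \<open>The formula interpolates linearly between the values \<open>y m\<close> at the natural numbers \<open>m\<close>.\<close>

lemma piecewise_linear_continuous:
  fixes y :: "nat \<Rightarrow> 'a::real_normed_vector"
  defines "g \<equiv> \<lambda>u::real. (1 - frac u) *\<^sub>R y (nat \<lfloor>u\<rfloor>) + frac u *\<^sub>R y (Suc (nat \<lfloor>u\<rfloor>))"
  shows "continuous_on {0..real N} g"
proof (induction N)
  case 0
  then show ?case by simp
next
  case (Suc N)
  have "g u = (1 - (u - N)) *\<^sub>R y N + (u - N) *\<^sub>R y (Suc N)" if u: "u \<in> {real N..real (Suc N)}" for u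
  proof (cases "u = real (Suc N)")
    case True
    have fl: "\<lfloor>u\<rfloor> = int (Suc N)" unfolding True by (rule floor_of_nat)
    have fr: "frac u = 0" unfolding frac_def fl True by simp
    have "nat (int (Suc N)) = Suc N" by (rule nat_int)
    then show ?thesis unfolding g_def fl fr using True by simp
  next
    case False
    then have "\<lfloor>u\<rfloor> = int N" using u by (simp add: floor_eq_iff)
    then show ?thesis by (simp add: g_def frac_def)
  qed
  moreover have "continuous_on {real N..real (Suc N)} (\<lambda>u. (1 - (u - N)) *\<^sub>R y N + (u - N) *\<^sub>R y (Suc N))"
    by (intro continuous_intros)
  ultimately have "continuous_on {real N..real (Suc N)} g"
    by (subst continuous_on_cong[OF refl]) auto
  then have "continuous_on ({0..real N} \<union> {real N..real (Suc N)}) g"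
    using Suc.IH by (intro continuous_on_closed_Un) auto
  moreover have "{0..real N} \<union> {real N..real (Suc N)} = {0..real (Suc N)}" by auto
  ultimately show ?case by simp
qed

text \<open>The path interpolates between consecutive terms as a function of \<open>u = 1 / s\<close>. Beyond \<open>M\<close> the interpolation
  stays in the convex set \<open>S \<inter> ball x (1 / Suc M)\<close>, which gives continuity at \<open>s = 0\<close>.\<close>

lemma path_through_sequence:
  fixes y :: "nat \<Rightarrow> 'a::real_normed_vector"
  assumes S: "convex S" "x \<in> S" "\<And>k. y k \<in> S" and lim: "\<And>k. dist x (y k) < 1 / real (Suc k)"
  obtains p where "top_path (top_of_set S) p" "p 0 = x" "\<And>k. k > 0 \<Longrightarrow> p (1 / real k) = y k"
proof
  define g where "g = (\<lambda>u::real. (1 - frac u) *\<^sub>R y (nat \<lfloor>u\<rfloor>) + frac u *\<^sub>R y (Suc (nat \<lfloor>u\<rfloor>)))"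
  define p where "p = (\<lambda>s::real. if s = 0 then x else g (1 / s))"
  have gS: "g u \<in> S \<inter> ball x (1 / real (Suc M))" if "u \<ge> real M" for u M
  proof -
    have M: "M \<le> nat \<lfloor>u\<rfloor>" using that by (simp add: le_nat_floor)
    have yb: "y k \<in> S \<inter> ball x (1 / real (Suc M))" if "M \<le> k" for k
    proof -
      have "1 / real (Suc k) \<le> 1 / real (Suc M)" using that by (simp add: frac_le)
      then show ?thesis using lim[of k] S(3) by simp
    qed
    have "convex (S \<inter> ball x (1 / real (Suc M)))" using S(1) by (intro convex_Int) auto
    then show ?thesis
      unfolding g_def using frac_ge_0[of u] frac_lt_1[of u] yb M
      by (intro convexD_alt[of _ _ _ "frac u"]) auto
  qed
  have "continuous_on {0..1} p"
    unfolding continuous_on_eq_continuous_within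
  proof
    fix s :: real assume s: "s \<in> {0..1}"
    show "continuous (at s within {0..1}) p"
    proof (cases "s = 0")
      case True
      show ?thesis
        unfolding continuous_within_eps_delta True
      proof (intro allI impI)
        fix e :: real assume "e > 0"
        then obtain M0 where M0: "1 / real (Suc M0) < e" by (rule nat_approx_posE)
        define M where "M = Suc M0"
        have "1 / real (Suc M) \<le> 1 / real (Suc M0)" by (simp add: M_def frac_le)
        then have M: "M > 0" "1 / real (Suc M) < e" using M0 by (auto simp: M_def)
        have "dist (p r) (p 0) < e" if r: "r \<in> {0..1}" "dist r 0 < 1 / real M" for r
        proof (cases "r = 0")
          case False
          then have "real M \<le> 1 / r" using r M(1) by (simp add: field_simps dist_real_def)
          from gS[OF this] show ?thesis using False M by (simp add: p_def dist_commute)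
        qed (use \<open>e > 0\<close> in simp)
        then show "\<exists>d>0. \<forall>x'\<in>{0..1}. dist x' 0 < d \<longrightarrow> dist (p x') (p 0) < e"
          using M(1) by (intro exI[of _ "1 / real M"]) simp
      qed
    next
      case False
      then have s0: "s > 0" using s by simp
      obtain N where N: "1 / s < real N" using reals_Archimedean2 by blast
      then have N0: "N > 0" using s0 by (intro gr0I) (simp add: field_simps)
      have sN: "s > 1 / real N" using N N0 s0 by (simp add: field_simps)
      have "continuous_on {1 / real N<..} (\<lambda>r. g (1 / r))"
      proof (rule continuous_on_compose2[of "{0..real N}" g])
        show "continuous_on {0..real N} g" unfolding g_def by (rule piecewise_linear_continuous)
        have pos: "r > 0" if "r \<in> {1 / real N<..}" for r
          using that N0 by (auto intro: less_trans[of 0 "1 / real N"])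
        show "continuous_on {1 / real N<..} (\<lambda>r. 1 / r)"
          using pos by (intro continuous_intros) force
        show "(\<lambda>r. 1 / r) ` {1 / real N<..} \<subseteq> {0..real N}"
        proof safe
          fix r assume r: "r > 1 / real N"
          then have "r > 0" using pos by simp
          then show "1 / r \<in> {0..real N}" using r N0 by (simp add: field_simps)
        qed
      qed
      then have "continuous (at s) (\<lambda>r. g (1 / r))"
        using sN by (simp add: continuous_on_eq_continuous_at)
      moreover have "eventually (\<lambda>r. g (1 / r) = p r) (nhds s)"
        unfolding eventually_nhds using s0 by (intro exI[of _ "{0<..}"]) (auto simp: p_def)
      ultimately have "continuous (at s) p"
        by (simp add: isCont_cong)
      then show ?thesis by (rule continuous_at_imp_continuous_at_within)
    qed
  qed
  moreover have "p s \<in> S" if "s \<in> {0..1}" for s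
    using gS[of 0 "1 / s"] that S(2) by (auto simp: p_def)
  ultimately show "top_path (top_of_set S) p"
    by (simp add: continuous_map_in_subtopology image_subset_iff)
  show "p 0 = x" by (simp add: p_def)
  show "p (1 / real k) = y k" if "k > 0" for k
    using that by (simp add: p_def g_def frac_def)
qed

text \<open>If \<open>U\<close> were not a neighbourhood of one of its points, a sequence outside \<open>U\<close> would converge to that
  point, and the path through the sequence would contradict the assumption on \<open>U\<close>.\<close>

lemma delta_generated_convex:
  fixes S :: "'a::real_normed_vector set"
  assumes "convex S"
  shows "delta_generated (top_of_set S)"
proof (rule delta_generatedI)
  fix U assume U: "U \<subseteq> topspace (top_of_set S)"
    "\<And>p. top_path (top_of_set S) p \<Longrightarrow> openin unit_interval_top {t \<in> {0..1}. p t \<in> U}"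
  show "openin (top_of_set S) U"
  proof (rule ccontr)
    assume "\<not> openin (top_of_set S) U"
    then obtain x where x: "x \<in> U" "\<And>e. e > 0 \<Longrightarrow> \<not> ball x e \<inter> S \<subseteq> U"
      using U(1) by (auto simp: openin_contains_ball)
    have "\<exists>y. y \<in> S \<and> y \<notin> U \<and> dist x y < 1 / real (Suc k)" for k
      using x(2)[of "1 / real (Suc k)"] by auto
    then obtain y where y: "\<And>k. y k \<in> S" "\<And>k. y k \<notin> U" "\<And>k. dist x (y k) < 1 / real (Suc k)"
      by metis
    obtain p where p: "top_path (top_of_set S) p" "p 0 = x" "\<And>k. k > 0 \<Longrightarrow> p (1 / real k) = y k"
      using path_through_sequence[OF assms _ y(1) y(3)] x(1) U(1) by auto
    have "0 \<in> {t \<in> {0..1}. p t \<in> U}" using p(2) x(1) by simp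
    with U(2)[OF p(1)] obtain e where e: "e > 0" "\<And>t. t \<in> {0..1} \<Longrightarrow> dist t 0 < e \<Longrightarrow> p t \<in> U"
      by (rule openin_unit_interval_ball) blast
    obtain k where k: "1 / real (Suc k) < e" using e(1) nat_approx_posE by blast
    have "p (1 / real (Suc k)) \<in> U" using k by (intro e(2)) (auto simp: dist_real_def)
    then show False using p(3)[of "Suc k"] y(2) by simp
  qed
qed

section \<open>Products of quotients\<close>

lemma top_path_prod:
  "top_path (prod_topology X Y) p \<longleftrightarrow> top_path X (\<lambda>t. fst (p t)) \<and> top_path Y (\<lambda>t. snd (p t))"
  by (simp add: continuous_map_pairwise o_def)

lemma top_path_dprod:
  "top_path (dprod X Y) p \<longleftrightarrow> top_path X (\<lambda>t. fst (p t)) \<and> top_path Y (\<lambda>t. snd (p t))"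
  by (simp add: dprod_def top_path_prod)

text \<open>Multiplication by an interval preserves quotients. Near \<open>t0\<close>, the class \<open>p t0\<close> together with the whole
  image of a small interval \<open>J\<close> around \<open>t0\<close> lies in \<open>V\<close>. The classes for which this holds form an open
  set: along a path of \<open>X\<close> this follows from the tube lemma, because subsets of the square are open as
  soon as paths of the square recognize them as open.\<close>

lemma quot_times_path_open:
  assumes E: "equiv (topspace X) E" and X: "delta_generated X"
    and V: "\<And>c r. top_path X c \<Longrightarrow> top_path Y r \<Longrightarrow>
      openin unit_interval_top {t \<in> {0..1}. (E `` {c t}, r t) \<in> V}"
    and p: "top_path (quot_top X E) p" and r: "top_path Y r"
  shows "openin unit_interval_top {t \<in> {0..1}. (p t, r t) \<in> V}"
proof (subst openin_subopen, intro ballI)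
  fix t0 assume "t0 \<in> {t \<in> {0..1}. (p t, r t) \<in> V}"
  then have t0: "t0 \<in> {0..1}" and t0V: "(p t0, r t0) \<in> V" by auto
  have "p t0 \<in> topspace X // E"
    using p t0 by (auto simp: continuous_map_def topspace_quot_top[OF E])
  then obtain x where x: "x \<in> topspace X" "p t0 = E `` {x}" by (rule quotientE)
  have "openin unit_interval_top {t \<in> {0..1}. (E `` {x}, r t) \<in> V}"
    by (rule V[OF _ r]) (simp add: top_path_const x)
  moreover have "t0 \<in> {t \<in> {0..1}. (E `` {x}, r t) \<in> V}" using t0 t0V x(2) by simp
  ultimately obtain d where d: "d > 0" "\<And>t. t \<in> {0..1} \<Longrightarrow> dist t t0 < d \<Longrightarrow> (E `` {x}, r t) \<in> V"
    by (rule openin_unit_interval_ball) blast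
  define J where "J = {max 0 (t0 - d/2)..min 1 (t0 + d/2)}"
  have J: "J \<noteq> {}" "J \<subseteq> {0..1}" "compact J" using t0 d(1) by (auto simp: J_def)
  have xJ: "(E `` {x}, r t) \<in> V" if "t \<in> J" for t
    using that J(2) d(1) t0 by (intro d(2)) (auto simp: J_def dist_real_def)
  \<comment> \<open>the classes that lie in \<open>V\<close> together with the image of all of \<open>J\<close>\<close>
  define O' where "O' = {C \<in> topspace X // E. \<forall>t\<in>J. (C, r t) \<in> V}"
  have O'sub: "O' \<subseteq> topspace X // E" by (auto simp: O'_def)
  have "openin X {z \<in> topspace X. E `` {z} \<in> O'}"
  proof (rule delta_generatedD[OF X])
    fix c assume c: "top_path X c"
    let ?S = "{0..1::real} \<times> {0..1::real}"
    let ?W = "{z \<in> ?S. (E `` {c (snd z)}, r (fst z)) \<in> V}"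
    have W: "openin (top_of_set ?S) ?W"
    proof (rule delta_generatedD)
      show "delta_generated (top_of_set ?S)" by (intro delta_generated_convex convex_Times) auto
      fix q assume q: "top_path (top_of_set ?S) q"
      then have q': "continuous_on {0..1} q" "q \<in> {0..1} \<rightarrow> ?S"
        by (auto simp: continuous_map_in_subtopology)
      have "top_path unit_interval_top (\<lambda>t. snd (q t))" "top_path unit_interval_top (\<lambda>t. fst (q t))"
        using q'(1) funcset_mem[OF q'(2)]
        by (auto simp: continuous_map_in_subtopology mem_Times_iff intro!: continuous_intros)
      from continuous_map_compose[OF this(1) c] continuous_map_compose[OF this(2) r]
      have "top_path X (\<lambda>t. c (snd (q t)))" "top_path Y (\<lambda>t. r (fst (q t)))"
        by (simp_all only: o_def)
      from V[OF this]
      have "openin unit_interval_top {t \<in> {0..1}. (E `` {c (snd (q t))}, r (fst (q t))) \<in> V}" .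
      moreover have "{t \<in> {0..1}. q t \<in> ?W} = {t \<in> {0..1}. (E `` {c (snd (q t))}, r (fst (q t))) \<in> V}"
        using funcset_mem[OF q'(2)] by auto
      ultimately show "openin unit_interval_top {t \<in> {0..1}. q t \<in> ?W}" by simp
    qed auto
    show "openin unit_interval_top {t \<in> {0..1}. c t \<in> {z \<in> topspace X. E `` {z} \<in> O'}}"
    proof (subst openin_subopen, intro ballI)
      fix s assume s: "s \<in> {t \<in> {0..1}. c t \<in> {z \<in> topspace X. E `` {z} \<in> O'}}"
      have JI: "openin (top_of_set (J \<times> {0..1})) (?W \<inter> (J \<times> {0..1}))"
      proof -
        obtain G where G: "open G" "?W = ?S \<inter> G" using W unfolding openin_open by (elim exE conjE)
        have "J \<times> {0..1} \<subseteq> ?S" using J(2) by (rule Sigma_mono) (rule order_refl)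
        then have "?W \<inter> (J \<times> {0..1}) = (J \<times> {0..1}) \<inter> G" unfolding G(2) by (rule_tac set_eqI) (simp, meson subsetD)
        then show ?thesis using openin_open_Int[OF G(1)] by simp
      qed
      have "(\<lambda>t. (t, s)) ` J \<subseteq> ?W \<inter> (J \<times> {0..1})"
        using s J(2) by (auto simp: O'_def)
      from tube_lemma[OF J(3,1) this JI] obtain N where
        N: "openin unit_interval_top N" "s \<in> N" "J \<times> N \<subseteq> ?W \<inter> (J \<times> {0..1})" by blast
      have "N \<subseteq> {t \<in> {0..1}. c t \<in> {z \<in> topspace X. E `` {z} \<in> O'}}"
      proof
        fix t assume t: "t \<in> N"
        have t1: "t \<in> {0..1}" using subsetD[OF openin_subset[OF N(1)] t] by simp
        then have ct: "c t \<in> topspace X" using c by (auto simp: continuous_map_def)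
        have "\<forall>t'\<in>J. (E `` {c t}, r t') \<in> V" using N(3) t by auto
        then show "t \<in> {t \<in> {0..1}. c t \<in> {z \<in> topspace X. E `` {z} \<in> O'}}"
          using t1 ct by (auto simp: O'_def intro: quotientI)
      qed
      then show "\<exists>Ta. openin unit_interval_top Ta \<and> s \<in> Ta \<and>
          Ta \<subseteq> {t \<in> {0..1}. c t \<in> {z \<in> topspace X. E `` {z} \<in> O'}}" using N by blast
    qed
  qed auto
  then have "openin (quot_top X E) O'"
    using O'sub by (simp add: openin_quot_top[OF E] Union_quotient_subset[OF E O'sub])
  then have "openin unit_interval_top {t \<in> {0..1}. p t \<in> O'}"
    using p by (auto simp: continuous_map_def)
  moreover have "openin unit_interval_top ({0..1} \<inter> {t0 - d/2 <..< t0 + d/2})"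
    by (rule openin_open_Int) simp
  ultimately have "openin unit_interval_top ({t \<in> {0..1}. p t \<in> O'} \<inter> ({0..1} \<inter> {t0 - d/2 <..< t0 + d/2}))"
    (is "openin _ ?N") by (rule openin_Int)
  moreover have "t0 \<in> ?N" using t0 d(1) x xJ by (auto simp: O'_def intro: quotientI)
  moreover have "?N \<subseteq> {t \<in> {0..1}. (p t, r t) \<in> V}" by (auto simp: O'_def J_def)
  ultimately show "\<exists>Ta. openin unit_interval_top Ta \<and> t0 \<in> Ta \<and> Ta \<subseteq> {t \<in> {0..1}. (p t, r t) \<in> V}"
    by blast
qed

lemma quot_times_top_path:
  assumes E: "equiv (topspace X) E" and X: "delta_generated X"
    and f: "\<And>c r. top_path X c \<Longrightarrow> top_path Y r \<Longrightarrow> top_path Z (\<lambda>t. f (E `` {c t}) (r t))"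
    and p: "top_path (quot_top X E) p" and r: "top_path Y r"
  shows "top_path Z (\<lambda>t. f (p t) (r t))"
  unfolding continuous_map_def
proof (intro conjI allI impI)
  show "(\<lambda>t. f (p t) (r t)) \<in> topspace unit_interval_top \<rightarrow> topspace Z"
  proof
    fix t :: real assume t: "t \<in> topspace unit_interval_top"
    then have "p t \<in> topspace X // E"
      using p by (auto simp: continuous_map_def topspace_quot_top[OF E])
    then obtain x where x: "x \<in> topspace X" "p t = E `` {x}" by (rule quotientE)
    have "r t \<in> topspace Y" using r t by (auto simp: continuous_map_def)
    then have "top_path Z (\<lambda>_. f (E `` {x}) (r t))" using x(1) by (intro f) (simp_all add: top_path_const)
    then show "f (p t) (r t) \<in> topspace Z" by (simp add: x top_path_const)
  qed
  fix U assume U: "openin Z U"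
  have "openin unit_interval_top {t \<in> {0..1}. (p t, r t) \<in> {(C, y). f C y \<in> U}}"
  proof (rule quot_times_path_open[OF E X _ p r])
    fix c r' assume "top_path X c" "top_path Y r'"
    from f[OF this] U show "openin unit_interval_top {t \<in> {0..1}. (E `` {c t}, r' t) \<in> {(C, y). f C y \<in> U}}"
      by (auto simp: continuous_map_def)
  qed
  then show "openin unit_interval_top {t \<in> topspace unit_interval_top. f (p t) (r t) \<in> U}" by simp
qed

text \<open>Both factors are replaced by their quotients, one after the other.\<close>

lemma quot_times_quot_top_path:
  assumes E: "equiv (topspace X) E" and X: "delta_generated X"
    and F: "equiv (topspace Y) F" and Y: "delta_generated Y"
    and f: "\<And>c r. top_path X c \<Longrightarrow> top_path Y r \<Longrightarrow> top_path Z (\<lambda>t. f (E `` {c t}) (F `` {r t}))"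
    and p: "top_path (quot_top X E) p" and r: "top_path (quot_top Y F) r"
  shows "top_path Z (\<lambda>t. f (p t) (r t))"
proof (rule quot_times_top_path[OF E X _ p r])
  fix c q assume c: "top_path X c" and q: "top_path (quot_top Y F) q"
  show "top_path Z (\<lambda>t. f (E `` {c t}) (q t))"
    by (rule quot_times_top_path[where f = "\<lambda>q c. f (E `` {c}) q", OF F Y _ q c]) (rule f)
qed

section \<open>Sums\<close>

text \<open>A path is connected, so it stays in one summand.\<close>

lemma top_path_sum:
  assumes "top_path (sum_topology X I) p"
  obtains i q where "i \<in> I" "top_path (X i) q" "\<And>t. t \<in> {0..1} \<Longrightarrow> p t = (i, q t)"
proof -
  have pS: "p t \<in> Sigma I (topspace \<circ> X)" if "t \<in> {0..1}" for t
    using top_path_in[OF assms that] by simp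
  define i where "i = fst (p 0)"
  have iI: "i \<in> I" using pS[of 0] by (auto simp: i_def)
  have op: "openin unit_interval_top {t \<in> {0..1}. p t \<in> Sigma J (topspace \<circ> X)}" if "J \<subseteq> I" for J
  proof -
    have "openin (sum_topology X I) (Sigma J (topspace \<circ> X))"
      unfolding openin_sum_topology
    proof (intro conjI ballI)
      fix k assume "k \<in> I"
      have "{x. (k, x) \<in> Sigma J (topspace \<circ> X)} = (if k \<in> J then topspace (X k) else {})" by auto
      then show "openin (X k) {x. (k, x) \<in> Sigma J (topspace \<circ> X)}" by simp
    qed (use that in auto)
    then show ?thesis using assms by (auto simp: continuous_map_def)
  qed
  define A where "A = {t \<in> {0..1}. p t \<in> Sigma {i} (topspace \<circ> X)}"
  have "{0..1} - A = {t \<in> {0..1}. p t \<in> Sigma (I - {i}) (topspace \<circ> X)}"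
  proof -
    have "p t \<in> Sigma (I - {i}) (topspace \<circ> X) \<longleftrightarrow> p t \<notin> Sigma {i} (topspace \<circ> X)" if "t \<in> {0..1}" for t
      using pS[OF that] by (cases "p t") simp
    then have "{t \<in> {0..1}. p t \<in> Sigma (I - {i}) (topspace \<circ> X)} = {t \<in> {0..1}. p t \<notin> Sigma {i} (topspace \<circ> X)}"
      by (rule Collect_cong[OF conj_cong[OF refl]])
    then show ?thesis by (simp add: A_def set_diff_eq cong: conj_cong)
  qed
  then have "openin unit_interval_top ({0..1} - A)" using op[of "I - {i}"] by simp
  moreover have "A \<subseteq> {0..1}" by (auto simp: A_def)
  ultimately have cl: "closedin unit_interval_top A" by (simp add: closedin_def)
  have "openin unit_interval_top A" using op[of "{i}"] iI unfolding A_def by simp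
  then have "A = {} \<or> A = {0..1}"
    using cl connected_Icc[of "0::real" 1] unfolding connected_clopen by (elim allE[of _ A]) simp
  moreover have "0 \<in> A" using pS[of 0] by (auto simp: i_def A_def)
  ultimately have "A = {0..1}" by blast
  then have "{0..1} \<subseteq> A" by simp
  from subsetD[OF this] have A: "p t \<in> Sigma {i} (topspace \<circ> X)" if "t \<in> {0..1}" for t
    using that unfolding A_def by (simp only: mem_Collect_eq)
  have eq: "p t = (i, snd (p t))" if "t \<in> {0..1}" for t using A[OF that] by auto
  have "top_path (X i) (\<lambda>t. snd (p t))"
    unfolding continuous_map_def
  proof (intro conjI allI impI)
    show "(\<lambda>t. snd (p t)) \<in> topspace unit_interval_top \<rightarrow> topspace (X i)"
    proof
      fix t :: real assume "t \<in> topspace unit_interval_top"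
      then show "snd (p t) \<in> topspace (X i)" using A[of t] by auto
    qed
    fix U assume U: "openin (X i) U"
    have "openin (sum_topology X I) (Pair i ` U)"
      using open_map_component_injection[OF iI, of X] U by (auto simp: open_map_def)
    then have "openin unit_interval_top {t \<in> {0..1}. p t \<in> Pair i ` U}"
      using assms by (auto simp: continuous_map_def)
    moreover have "{t \<in> {0..1}. p t \<in> Pair i ` U} = {t \<in> {0..1}. snd (p t) \<in> U}"
    proof (intro equalityI subsetI)
      fix t assume t: "t \<in> {t \<in> {0..1}. snd (p t) \<in> U}"
      then have "p t = (i, snd (p t))" using eq by blast
      then have "p t \<in> Pair i ` U" using t by (metis (mono_tags) imageI mem_Collect_eq)
      then show "t \<in> {t \<in> {0..1}. p t \<in> Pair i ` U}" using t by simp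
    qed auto
    ultimately show "openin unit_interval_top {t \<in> topspace unit_interval_top. snd (p t) \<in> U}" by simp
  qed
  then show ?thesis using that iI eq by blast
qed

lemma top_path_sumI:
  assumes "i \<in> I" "top_path (X i) q"
  shows "top_path (sum_topology X I) (\<lambda>t. (i, q t))"
  using continuous_map_compose[OF assms(2) continuous_map_component_injection[OF assms(1), of X]]
  by (simp add: o_def)

lemma delta_generated_sum:
  assumes "\<And>i. i \<in> I \<Longrightarrow> delta_generated (X i)"
  shows "delta_generated (sum_topology X I)"
proof (rule delta_generatedI)
  fix U assume U: "U \<subseteq> topspace (sum_topology X I)"
    "\<And>p. top_path (sum_topology X I) p \<Longrightarrow> openin unit_interval_top {t \<in> {0..1}. p t \<in> U}"
  show "openin (sum_topology X I) U"
    unfolding openin_sum_topology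
  proof (intro conjI ballI)
    show "U \<subseteq> Sigma I (topspace \<circ> X)" using U(1) by simp
    fix i assume i: "i \<in> I"
    show "openin (X i) {x. (i, x) \<in> U}"
    proof (rule delta_generatedD[OF assms[OF i]])
      show "{x. (i, x) \<in> U} \<subseteq> topspace (X i)" using U(1) by auto
      fix p assume "top_path (X i) p"
      then have "top_path (sum_topology X I) (\<lambda>t. (i, p t))" by (rule top_path_sumI[OF i])
      from U(2)[OF this]
      show "openin unit_interval_top {t \<in> {0..1}. p t \<in> {x. (i, x) \<in> U}}" by simp
    qed
  qed
qed

lemma in_Top_sum:
  assumes "\<And>i. i \<in> I \<Longrightarrow> in_Top T (X i)"
  shows "in_Top T (sum_topology X I)"
proof -
  have "delta_generated (sum_topology X I)"
    using assms in_Top_dgen by (intro delta_generated_sum) blast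
  moreover have "delta_Hausdorff (sum_topology X I)" if T: "T = Delta_Hausdorff"
    unfolding delta_Hausdorff_def
  proof (intro allI impI)
    fix p assume "top_path (sum_topology X I) p"
    then obtain i q where i: "i \<in> I" "top_path (X i) q" "\<And>t. t \<in> {0..1} \<Longrightarrow> p t = (i, q t)"
      by (elim top_path_sum) blast
    have "closedin (X i) (q ` {0..1})" using assms[OF i(1)] T i(2) by (simp add: delta_Hausdorff_def)
    then have "closedin (sum_topology X I) (Pair i ` (q ` {0..1}))"
      using closed_map_component_injection[OF i(1), of X] by (auto simp: closed_map_def)
    moreover have "Pair i ` (q ` {0..1}) = p ` {0..1}"
      using i(3) by (auto simp: image_iff)
    ultimately show "closedin (sum_topology X I) (p ` {0..1})" by simp
  qed
  ultimately show ?thesis by (cases T) auto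
qed

section \<open>Spaces of natural paths\<close>

definition natural_path :: "nat \<Rightarrow> dpath \<Rightarrow> bool" where
  "natural_path n \<gamma> \<longleftrightarrow> \<gamma> \<in> extensional {0..real n} \<and>
    (\<forall>t\<in>{0..real n}. \<gamma> t \<in> extensional {..<n}) \<and>
    (\<forall>i<n. continuous_on {0..real n} (\<lambda>t. \<gamma> t i)) \<and>
    (\<forall>i<n. \<forall>t\<in>{0..real n}. \<gamma> t i \<in> {0..1}) \<and>
    (\<forall>i<n. mono_on {0..real n} (\<lambda>t. \<gamma> t i)) \<and>
    (\<forall>t\<in>{0..real n}. (\<Sum>i<n. \<gamma> t i) = t)"

lemma natural_pathD:
  assumes "natural_path n \<gamma>"
  shows "\<gamma> \<in> extensional {0..real n}"
    "\<And>t. t \<in> {0..real n} \<Longrightarrow> \<gamma> t \<in> extensional {..<n}"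
    "\<And>i. i < n \<Longrightarrow> continuous_on {0..real n} (\<lambda>t. \<gamma> t i)"
    "\<And>i t. i < n \<Longrightarrow> t \<in> {0..real n} \<Longrightarrow> 0 \<le> \<gamma> t i \<and> \<gamma> t i \<le> 1"
    "\<And>i. i < n \<Longrightarrow> mono_on {0..real n} (\<lambda>t. \<gamma> t i)"
    "\<And>t. t \<in> {0..real n} \<Longrightarrow> (\<Sum>i<n. \<gamma> t i) = t"
  using assms unfolding natural_path_def by auto

text \<open>The coordinates are nonnegative and their sum at time \<open>0\<close> vanishes; at time \<open>n\<close> they are at most \<open>1\<close> and
  add up to \<open>n\<close>. So the end points of a natural d-path are forced, and the condition that they are
  vertices, which is not convex, follows from conditions that are.\<close>

lemma natural_path_0:
  assumes "natural_path n \<gamma>" "i < n"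
  shows "\<gamma> 0 i = 0"
proof -
  have "(\<Sum>i<n. \<gamma> 0 i) = 0" using natural_pathD(6)[OF assms(1), of 0] by simp
  moreover have "\<And>i. i \<in> {..<n} \<Longrightarrow> 0 \<le> \<gamma> 0 i" using natural_pathD(4)[OF assms(1)] by simp
  ultimately have "\<forall>i\<in>{..<n}. \<gamma> 0 i = 0" by (subst (asm) sum_nonneg_eq_0_iff) auto
  then show ?thesis using assms by simp
qed

lemma natural_path_1:
  assumes "natural_path n \<gamma>" "i < n"
  shows "\<gamma> (real n) i = 1"
proof -
  have "(\<Sum>i<n. 1 - \<gamma> (real n) i) = 0"
    using natural_pathD(6)[OF assms(1), of "real n"] by (simp add: sum_subtractf)
  moreover have "\<And>i. i \<in> {..<n} \<Longrightarrow> 0 \<le> 1 - \<gamma> (real n) i" using natural_pathD(4)[OF assms(1)] by simp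
  ultimately have "\<forall>i\<in>{..<n}. 1 - \<gamma> (real n) i = 0" by (subst (asm) sum_nonneg_eq_0_iff) auto
  then show ?thesis using assms by simp
qed

text \<open>No coordinate can increase faster than the sum of all of them. As a consequence pointwise and uniform
  convergence of natural d-paths agree, which is what makes the compact-open topology manageable.\<close>

lemma natural_path_lipschitz:
  assumes "natural_path n \<gamma>" "i < n" "s \<in> {0..real n}" "t \<in> {0..real n}"
  shows "\<bar>\<gamma> t i - \<gamma> s i\<bar> \<le> \<bar>t - s\<bar>"
proof -
  have *: "0 \<le> \<gamma> t i - \<gamma> s i \<and> \<gamma> t i - \<gamma> s i \<le> t - s" if st: "s \<le> t" "s \<in> {0..real n}" "t \<in> {0..real n}" for s t
  proof -
    have nn: "0 \<le> \<gamma> t k - \<gamma> s k" if "k < n" for k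
      using mono_onD[OF natural_pathD(5)[OF assms(1) that] st(2,3,1)] by simp
    have "\<gamma> t i - \<gamma> s i \<le> (\<Sum>k<n. \<gamma> t k - \<gamma> s k)"
      using nn assms(2) by (intro member_le_sum) auto
    also have "\<dots> = t - s" using natural_pathD(6)[OF assms(1)] st by (simp add: sum_subtractf)
    finally show ?thesis using nn assms(2) by simp
  qed
  show ?thesis using *[of s t] *[of t s] assms by (cases "s \<le> t") auto
qed

lemma topspace_compact_open:
  "topspace (compact_open_top X Y) = {f \<in> extensional (topspace X). continuous_map X Y f}"
proof -
  have "{f \<in> extensional (topspace X). continuous_map X Y f} \<in>
      {{f \<in> extensional (topspace X). continuous_map X Y f \<and> f ` C \<subseteq> U} | C U. compactin X C \<and> openin Y U}"
    by (rule CollectI, rule exI[of _ "{}"], rule exI[of _ "{}"]) auto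
  then show ?thesis
    unfolding compact_open_top_def topology_generated_by_topspace by blast
qed

lemma topspace_natural_dpaths: "\<gamma> \<in> topspace (natural_dpaths n) \<longleftrightarrow> natural_path n \<gamma>"
proof -
  have cont: "continuous_map (top_of_set {0..real n}) (product_topology (\<lambda>_. unit_interval_top) {..<n}) \<gamma> \<longleftrightarrow>
      (\<forall>t\<in>{0..real n}. \<gamma> t \<in> extensional {..<n}) \<and>
      (\<forall>i<n. continuous_on {0..real n} (\<lambda>t. \<gamma> t i)) \<and> (\<forall>i<n. \<forall>t\<in>{0..real n}. \<gamma> t i \<in> {0..1})"
    unfolding continuous_map_componentwise
    by (auto simp: continuous_map_in_subtopology image_subset_iff Pi_iff)
  have "\<gamma> \<in> topspace (natural_dpaths n) \<longleftrightarrow> natural_path n \<gamma> \<and> (\<forall>i<n. \<gamma> 0 i \<in> {0, 1} \<and> \<gamma> (real n) i \<in> {0, 1})"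
  proof -
    have eqc: "(\<forall>t\<in>{0..real n}. t = (\<Sum>i<n. \<gamma> t i)) \<longleftrightarrow> (\<forall>t\<in>{0..real n}. (\<Sum>i<n. \<gamma> t i) = t)"
      by (intro ball_cong refl eq_commute)
    show ?thesis
      unfolding natural_dpaths_def topspace_subtopology topspace_compact_open natural_path_def
        mem_Collect_eq topspace_subtopology topspace_euclidean Int_UNIV_left Int_iff cont eqc
      by (rule iffI; elim conjE; intro conjI; assumption)
  qed
  then show ?thesis using natural_path_0 natural_path_1 by blast
qed

lemma natural_dpaths_eval:
  assumes i: "i < n" and t: "t \<in> {0..real n}"
  shows "continuous_map (natural_dpaths n) euclideanreal (\<lambda>\<gamma>. \<gamma> t i)"
  unfolding continuous_map_def
proof (intro conjI allI impI)
  fix V :: "real set" assume V: "openin euclidean V"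
  let ?X = "top_of_set {0..real n}" and ?Y = "product_topology (\<lambda>_. unit_interval_top) {..<n}"
  let ?U = "{z \<in> topspace ?Y. z i \<in> V \<inter> {0..1}}"
  obtain P where P: "natural_dpaths n = subtopology (compact_open_top ?X ?Y) P"
    unfolding natural_dpaths_def by blast
  have "openin unit_interval_top (V \<inter> {0..1})" using V openin_open_Int[of V "{0..1}"] by (simp add: Int_commute)
  then have U: "openin ?Y ?U"
    using i continuous_map_product_projection[of i "{..<n}" "\<lambda>_. unit_interval_top"]
    unfolding continuous_map_def by blast
  have "openin (compact_open_top ?X ?Y) {f \<in> extensional (topspace ?X). continuous_map ?X ?Y f \<and> f ` {t} \<subseteq> ?U}"
    unfolding compact_open_top_def
  proof (rule topology_generated_by_Basis, rule CollectI, intro exI conjI)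
    show "compactin ?X {t}" using t by simp
    show "openin ?Y ?U" by (rule U)
  qed (rule refl)
  then have "openin (natural_dpaths n) ({f \<in> extensional (topspace ?X). continuous_map ?X ?Y f \<and> f ` {t} \<subseteq> ?U} \<inter> P)"
    unfolding P by (rule openin_subtopology_Int)
  then have "openin (natural_dpaths n) (topspace (natural_dpaths n) \<inter>
      ({f \<in> extensional (topspace ?X). continuous_map ?X ?Y f \<and> f ` {t} \<subseteq> ?U} \<inter> P))"
    by (rule openin_Int[OF openin_topspace])
  moreover have "topspace (natural_dpaths n) \<inter>
      ({f \<in> extensional (topspace ?X). continuous_map ?X ?Y f \<and> f ` {t} \<subseteq> ?U} \<inter> P) = {\<gamma> \<in> topspace (natural_dpaths n). \<gamma> t i \<in> V}"
  proof (intro equalityI subsetI)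
    fix \<gamma> assume g: "\<gamma> \<in> {\<gamma> \<in> topspace (natural_dpaths n). \<gamma> t i \<in> V}"
    then have c: "\<gamma> \<in> extensional (topspace ?X)" "continuous_map ?X ?Y \<gamma>" "\<gamma> \<in> P"
      unfolding P topspace_subtopology topspace_compact_open by simp_all
    have "\<gamma> t \<in> topspace ?Y" using continuous_map_funspace[OF c(2)] t by (simp add: Pi_iff)
    moreover have "\<gamma> t i \<in> {0..1}"
      using g natural_pathD(4)[of n \<gamma> i t] i t by (simp add: topspace_natural_dpaths)
    ultimately show "\<gamma> \<in> topspace (natural_dpaths n) \<inter>
        ({f \<in> extensional (topspace ?X). continuous_map ?X ?Y f \<and> f ` {t} \<subseteq> ?U} \<inter> P)"
      using g c by simp
  qed simp
  ultimately show "openin (natural_dpaths n) {\<gamma> \<in> topspace (natural_dpaths n). \<gamma> t i \<in> V}" by simp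
qed simp

lemma finite_INT_openin:
  assumes "finite P" "\<And>z. z \<in> P \<Longrightarrow> openin X (V z)"
  shows "openin X (topspace X \<inter> (\<Inter>z\<in>P. V z))"
  using assms
proof (induction P)
  case (insert z P)
  have "topspace X \<inter> (\<Inter>z\<in>insert z P. V z) = V z \<inter> (topspace X \<inter> (\<Inter>z\<in>P. V z))" by blast
  then show ?case using insert by (metis insertCI openin_Int)
qed simp

lemma continuous_on_times_nat:
  fixes f :: "'a::topological_space \<Rightarrow> nat \<Rightarrow> 'b::topological_space"
  assumes "\<And>i. continuous_on UNIV (\<lambda>t. f t i)"
  shows "continuous_on UNIV (\<lambda>z. f (fst z) (snd z))"
  unfolding continuous_on_open_vimage[OF open_UNIV]
proof (intro allI impI)
  fix B :: "'b set" assume B: "open B"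
  have "(\<lambda>z. f (fst z) (snd z)) -` B \<inter> UNIV = (\<Union>i. ((\<lambda>t. f t i) -` B) \<times> {i})" by auto
  moreover have "open (((\<lambda>t. f t i) -` B) \<times> {i})" for i
    using assms[of i] B by (intro open_Times open_vimage open_discrete) auto
  ultimately show "open ((\<lambda>z. f (fst z) (snd z)) -` B \<inter> UNIV)" by auto
qed

definition clamp_time :: "nat \<Rightarrow> real \<Rightarrow> real" where "clamp_time n t = max 0 (min (real n) t)"

text \<open>Natural d-paths are embedded into the Banach space of bounded continuous functions of a time and a
  coordinate. A path is made constant outside its interval of definition and zero in the superfluous
  coordinates, so that convex combinations of paths become convex combinations of vectors.\<close>

definition dpath_vec :: "nat \<Rightarrow> dpath \<Rightarrow> (real \<times> nat) \<Rightarrow>\<^sub>C real" where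
  "dpath_vec n \<gamma> = Bcontfun (\<lambda>z. if snd z < n then \<gamma> (clamp_time n (fst z)) (snd z) else 0)"

definition vec_dpath :: "nat \<Rightarrow> (real \<times> nat) \<Rightarrow>\<^sub>C real \<Rightarrow> dpath" where
  "vec_dpath n v = (\<lambda>t\<in>{0..real n}. \<lambda>i\<in>{..<n}. apply_bcontfun v (t, i))"

definition dpath_vecs :: "nat \<Rightarrow> ((real \<times> nat) \<Rightarrow>\<^sub>C real) set" where
  "dpath_vecs n = {v. (\<forall>t i. apply_bcontfun v (t, i) = (if i < n then apply_bcontfun v (clamp_time n t, i) else 0)) \<and>
    (\<forall>i<n. \<forall>t\<in>{0..real n}. 0 \<le> apply_bcontfun v (t, i) \<and> apply_bcontfun v (t, i) \<le> 1) \<and>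
    (\<forall>i<n. \<forall>s\<in>{0..real n}. \<forall>t\<in>{0..real n}. s \<le> t \<longrightarrow> apply_bcontfun v (s, i) \<le> apply_bcontfun v (t, i)) \<and>
    (\<forall>t\<in>{0..real n}. (\<Sum>i<n. apply_bcontfun v (t, i)) = t)}"

lemma dpath_vecsD:
  assumes "v \<in> dpath_vecs n"
  shows "apply_bcontfun v (t, i) = (if i < n then apply_bcontfun v (clamp_time n t, i) else 0)"
    "i < n \<Longrightarrow> t \<in> {0..real n} \<Longrightarrow> 0 \<le> apply_bcontfun v (t, i)"
    "i < n \<Longrightarrow> t \<in> {0..real n} \<Longrightarrow> apply_bcontfun v (t, i) \<le> 1"
    "i < n \<Longrightarrow> s \<in> {0..real n} \<Longrightarrow> t \<in> {0..real n} \<Longrightarrow> s \<le> t \<Longrightarrow> apply_bcontfun v (s, i) \<le> apply_bcontfun v (t, i)"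
    "t \<in> {0..real n} \<Longrightarrow> (\<Sum>i<n. apply_bcontfun v (t, i)) = t"
proof -
  note * = assms[unfolded dpath_vecs_def mem_Collect_eq]
  show "apply_bcontfun v (t, i) = (if i < n then apply_bcontfun v (clamp_time n t, i) else 0)"
    using *[THEN conjunct1] by (elim allE)
  show "i < n \<Longrightarrow> t \<in> {0..real n} \<Longrightarrow> 0 \<le> apply_bcontfun v (t, i)"
    "i < n \<Longrightarrow> t \<in> {0..real n} \<Longrightarrow> apply_bcontfun v (t, i) \<le> 1"
    using *[THEN conjunct2, THEN conjunct1] by simp_all
  show "i < n \<Longrightarrow> s \<in> {0..real n} \<Longrightarrow> t \<in> {0..real n} \<Longrightarrow> s \<le> t \<Longrightarrow> apply_bcontfun v (s, i) \<le> apply_bcontfun v (t, i)"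
    using *[THEN conjunct2, THEN conjunct2, THEN conjunct1] by simp
  show "t \<in> {0..real n} \<Longrightarrow> (\<Sum>i<n. apply_bcontfun v (t, i)) = t"
    using *[THEN conjunct2, THEN conjunct2, THEN conjunct2] by simp
qed

lemma clamp_time_in [simp]: "clamp_time n t \<in> {0..real n}" by (simp add: clamp_time_def)

lemma clamp_time_ge [simp]: "0 \<le> clamp_time n t" and clamp_time_le [simp]: "clamp_time n t \<le> real n"
  by (simp_all add: clamp_time_def)

lemma clamp_time_id [simp]: "t \<in> {0..real n} \<Longrightarrow> clamp_time n t = t" by (simp add: clamp_time_def)

lemma convex_dpath_vecs: "convex (dpath_vecs n)"
proof (rule convexI)
  fix x y :: "(real \<times> nat) \<Rightarrow>\<^sub>C real" and u v :: real
  assume x: "x \<in> dpath_vecs n" and y: "y \<in> dpath_vecs n" and uv: "0 \<le> u" "0 \<le> v" "u + v = 1"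
  have ap: "apply_bcontfun (u *\<^sub>R x + v *\<^sub>R y) z = u * apply_bcontfun x z + v * apply_bcontfun y z" for z
    by (simp add: plus_bcontfun.rep_eq scaleR_bcontfun.rep_eq)
  note X = dpath_vecsD[OF x] and Y = dpath_vecsD[OF y]
  show "u *\<^sub>R x + v *\<^sub>R y \<in> dpath_vecs n"
    unfolding dpath_vecs_def mem_Collect_eq ap
  proof (intro conjI allI ballI impI)
    fix t i
    show "u * apply_bcontfun x (t, i) + v * apply_bcontfun y (t, i) = (if i < n then
        u * apply_bcontfun x (clamp_time n t, i) + v * apply_bcontfun y (clamp_time n t, i) else 0)"
      unfolding X(1)[of t i] Y(1)[of t i] by simp
  next
    fix t i assume "i < n" "t \<in> {0..real n}"
    then show "0 \<le> u * apply_bcontfun x (t, i) + v * apply_bcontfun y (t, i)" using X(2) Y(2) uv by simp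
  next
    fix t i assume it: "i < n" "t \<in> {0..real n}"
    have "u * apply_bcontfun x (t, i) + v * apply_bcontfun y (t, i) \<le> u * 1 + v * 1"
      using X(3)[OF it] Y(3)[OF it] uv by (intro add_mono mult_left_mono) auto
    then show "u * apply_bcontfun x (t, i) + v * apply_bcontfun y (t, i) \<le> 1" using uv by simp
  next
    fix i s t assume "i < n" "s \<in> {0..real n}" "t \<in> {0..real n}" "s \<le> t"
    then show "u * apply_bcontfun x (s, i) + v * apply_bcontfun y (s, i) \<le> u * apply_bcontfun x (t, i) + v * apply_bcontfun y (t, i)"
      using X(4) Y(4) uv by (intro add_mono mult_left_mono) auto
  next
    fix t assume t: "t \<in> {0..real n}"
    have "(\<Sum>i<n. u * apply_bcontfun x (t, i) + v * apply_bcontfun y (t, i)) = u * t + v * t"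
      unfolding sum.distrib sum_distrib_left[symmetric] X(5)[OF t] Y(5)[OF t] ..
    also have "\<dots> = t" using uv by (metis distrib_right mult_1)
    finally show "(\<Sum>i<n. u * apply_bcontfun x (t, i) + v * apply_bcontfun y (t, i)) = t" .
  qed
qed

lemma vec_dpath_apply: "t \<in> {0..real n} \<Longrightarrow> i < n \<Longrightarrow> vec_dpath n v t i = apply_bcontfun v (t, i)"
  by (simp add: vec_dpath_def)

lemma natural_path_vec_dpath:
  assumes "v \<in> dpath_vecs n" shows "natural_path n (vec_dpath n v)"
  unfolding natural_path_def
proof (intro conjI allI ballI impI)
  fix i assume i: "i < n"
  have "continuous_on {0..real n} (\<lambda>t. apply_bcontfun v (t, i))"
    by (intro continuous_on_compose2[OF continuous_on_apply_bcontfun[of UNIV v]] continuous_intros) auto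
  then show "continuous_on {0..real n} (\<lambda>t. vec_dpath n v t i)"
    by (rule continuous_on_eq) (use i in \<open>simp add: vec_dpath_apply\<close>)
  show "mono_on {0..real n} (\<lambda>t. vec_dpath n v t i)"
    using dpath_vecsD(4)[OF assms i] i by (intro mono_onI) (simp add: vec_dpath_apply)
next
  show "vec_dpath n v \<in> extensional {0..real n}" by (simp add: vec_dpath_def)
  show "vec_dpath n v t \<in> extensional {..<n}" if "t \<in> {0..real n}" for t
    using that by (simp add: vec_dpath_def)
  fix t assume t: "t \<in> {0..real n}"
  have "(\<Sum>i<n. vec_dpath n v t i) = (\<Sum>i<n. apply_bcontfun v (t, i))"
    using t by (intro sum.cong) (simp_all add: vec_dpath_apply)
  also have "\<dots> = t" using dpath_vecsD(5)[OF assms t] .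
  finally show "(\<Sum>i<n. vec_dpath n v t i) = t" .
next
  fix i t assume it: "i < n" "t \<in> {0..real n}"
  then have "0 \<le> apply_bcontfun v (t, i) \<and> apply_bcontfun v (t, i) \<le> 1"
    using dpath_vecsD(2,3)[OF assms it] by simp
  then show "vec_dpath n v t i \<in> {0..1}" using it by (simp add: vec_dpath_apply)
qed

lemma dpath_vec_apply:
  assumes "natural_path n \<gamma>"
  shows "apply_bcontfun (dpath_vec n \<gamma>) (t, i) = (if i < n then \<gamma> (clamp_time n t) i else 0)"
proof -
  have "(\<lambda>z. if snd z < n then \<gamma> (clamp_time n (fst z)) (snd z) else 0) \<in> bcontfun"
  proof (rule bcontfun_normI)
    have "continuous_on UNIV (\<lambda>t. if i < n then \<gamma> (clamp_time n t) i else 0)" for i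
    proof (cases "i < n")
      case True
      have "continuous_on UNIV (\<lambda>t. \<gamma> (clamp_time n t) i)"
        by (rule continuous_on_compose2[OF natural_pathD(3)[OF assms True]])
          (auto simp: clamp_time_def intro!: continuous_intros)
      then show ?thesis using True by simp
    qed simp
    from continuous_on_times_nat[OF this]
    show "continuous_on UNIV (\<lambda>z. if snd z < n then \<gamma> (clamp_time n (fst z)) (snd z) else 0)" .
    show "norm (if snd z < n then \<gamma> (clamp_time n (fst z)) (snd z) else 0) \<le> 1" for z
      using natural_pathD(4)[OF assms, of "snd z" "clamp_time n (fst z)"] by simp
  qed
  then show ?thesis unfolding dpath_vec_def by (simp add: Bcontfun_inverse)
qed

lemma dpath_vec_in:
  assumes "natural_path n \<gamma>" shows "dpath_vec n \<gamma> \<in> dpath_vecs n"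
  unfolding dpath_vecs_def mem_Collect_eq dpath_vec_apply[OF assms]
  using natural_pathD(4,6)[OF assms] mono_onD[OF natural_pathD(5)[OF assms]] by auto

lemma dpath_ext:
  assumes "\<gamma> \<in> extensional {0..real n}" "\<delta> \<in> extensional {0..real n}"
    "\<And>t. t \<in> {0..real n} \<Longrightarrow> \<gamma> t \<in> extensional {..<n}" "\<And>t. t \<in> {0..real n} \<Longrightarrow> \<delta> t \<in> extensional {..<n}"
    "\<And>t i. t \<in> {0..real n} \<Longrightarrow> i < n \<Longrightarrow> \<gamma> t i = \<delta> t i"
  shows "\<gamma> = \<delta>"
proof (rule extensionalityI[OF assms(1,2)])
  fix t assume t: "t \<in> {0..real n}"
  show "\<gamma> t = \<delta> t" by (rule extensionalityI[OF assms(3,4)[OF t]]) (use assms(5)[OF t] in simp)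
qed

lemma vec_dpath_dpath_vec:
  assumes "natural_path n \<gamma>" shows "vec_dpath n (dpath_vec n \<gamma>) = \<gamma>"
proof (rule dpath_ext)
  show "vec_dpath n (dpath_vec n \<gamma>) t i = \<gamma> t i" if "t \<in> {0..real n}" "i < n" for t i
    using that by (simp add: vec_dpath_apply dpath_vec_apply[OF assms])
qed (use natural_pathD(1,2)[OF assms] in \<open>auto simp: vec_dpath_def\<close>)

lemma dpath_vec_vec_dpath:
  assumes "v \<in> dpath_vecs n" shows "dpath_vec n (vec_dpath n v) = v"
proof (rule bcontfun_eqI)
  fix z :: "real \<times> nat"
  obtain t i where z: "z = (t, i)" by fastforce
  have "apply_bcontfun v (t, i) = (if i < n then apply_bcontfun v (clamp_time n t, i) else 0)"
    by (rule dpath_vecsD(1)[OF assms])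
  then show "apply_bcontfun (dpath_vec n (vec_dpath n v)) z = apply_bcontfun v z"
    unfolding z dpath_vec_apply[OF natural_path_vec_dpath[OF assms]] by (simp add: vec_dpath_apply)
qed

text \<open>By the Lipschitz property, closeness at the multiples of \<open>e\<close> gives closeness everywhere.\<close>

lemma dpath_vec_dist:
  assumes g: "natural_path n \<gamma>" and d: "natural_path n \<delta>" and e: "e > 0"
    and grid: "\<And>i j. i < n \<Longrightarrow> real j * e \<le> real n \<Longrightarrow> \<bar>\<gamma> (real j * e) i - \<delta> (real j * e) i\<bar> \<le> e"
  shows "dist (dpath_vec n \<gamma>) (dpath_vec n \<delta>) \<le> 3 * e"
proof (rule dist_bound)
  fix z :: "real \<times> nat"
  obtain t0 i where z: "z = (t0, i)" by fastforce
  show "dist (apply_bcontfun (dpath_vec n \<gamma>) z) (apply_bcontfun (dpath_vec n \<delta>) z) \<le> 3 * e"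
  proof (cases "i < n")
    case True
    define t where "t = clamp_time n t0"
    define j where "j = nat \<lfloor>t / e\<rfloor>"
    define s where "s = real j * e"
    have t: "t \<in> {0..real n}" by (simp add: t_def)
    then have "0 \<le> t / e" using e by simp
    then have "real j \<le> t / e" "t / e \<le> real j + 1" unfolding j_def by linarith+
    then have s: "s \<le> t" "t \<le> s + e" "0 \<le> s" using e by (simp_all add: s_def field_simps)
    have s': "s \<in> {0..real n}" using s t by simp
    have "\<bar>\<gamma> s i - \<delta> s i\<bar> \<le> e" using grid[OF True, of j] s' by (simp add: s_def)
    moreover have "\<bar>\<gamma> t i - \<gamma> s i\<bar> \<le> e" "\<bar>\<delta> t i - \<delta> s i\<bar> \<le> e"
      using natural_path_lipschitz[OF g True s' t] natural_path_lipschitz[OF d True s' t] s by auto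
    ultimately have "\<bar>\<gamma> t i - \<delta> t i\<bar> \<le> 3 * e" by linarith
    then show ?thesis using True by (simp add: z dpath_vec_apply[OF g] dpath_vec_apply[OF d] dist_real_def t_def)
  next
    case False
    then show ?thesis using e by (simp add: z dpath_vec_apply[OF g] dpath_vec_apply[OF d])
  qed
qed

text \<open>A finite grid of times controls the uniform distance, and evaluation at a fixed time is continuous for
  the compact-open topology.\<close>

lemma continuous_map_dpath_vec:
  "continuous_map (natural_dpaths n) (top_of_set (dpath_vecs n)) (dpath_vec n)"
  unfolding continuous_map_in_subtopology
proof
  show "dpath_vec n \<in> topspace (natural_dpaths n) \<rightarrow> dpath_vecs n"
    by (auto simp: topspace_natural_dpaths dpath_vec_in)
  show "continuous_map (natural_dpaths n) euclidean (dpath_vec n)"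
    unfolding continuous_map_def
  proof (intro conjI allI impI)
    fix U :: "((real \<times> nat) \<Rightarrow>\<^sub>C real) set" assume "openin euclidean U"
    then have U: "open U" by simp
    show "openin (natural_dpaths n) {\<gamma> \<in> topspace (natural_dpaths n). dpath_vec n \<gamma> \<in> U}"
    proof (subst openin_subopen, intro ballI)
      fix \<gamma> assume g: "\<gamma> \<in> {\<gamma> \<in> topspace (natural_dpaths n). dpath_vec n \<gamma> \<in> U}"
      then have gp: "natural_path n \<gamma>" by (simp add: topspace_natural_dpaths)
      obtain r where r: "r > 0" "\<And>w. dist w (dpath_vec n \<gamma>) < r \<Longrightarrow> w \<in> U"
        using U g unfolding open_dist by blast
      \<comment> \<open>the distance is at most three times the mesh, so a quarter of the radius is enough\<close>
      define e where "e = r / 4"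
      have e: "e > 0" using r(1) by (simp add: e_def)
      define P where "P = {(i, j). i < n \<and> real j * e \<le> real n}"
      have "P \<subseteq> {..<n} \<times> {..nat \<lceil>real n / e\<rceil>}"
      proof safe
        fix i j assume "(i, j) \<in> P"
        then have "i < n" "real j \<le> real n / e" using e by (auto simp: P_def field_simps)
        then show "i < n" "j \<le> nat \<lceil>real n / e\<rceil>" by linarith+
      qed
      then have P: "finite P" by (rule finite_subset) auto
      define W where "W = topspace (natural_dpaths n) \<inter>
        (\<Inter>(i, j)\<in>P. {\<delta> \<in> topspace (natural_dpaths n). \<delta> (real j * e) i \<in> ball (\<gamma> (real j * e) i) e})"
      have "openin (natural_dpaths n) {\<delta> \<in> topspace (natural_dpaths n). \<delta> (real j * e) i \<in> ball (\<gamma> (real j * e) i) e}"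
        if "(i, j) \<in> P" for i j
      proof -
        have "continuous_map (natural_dpaths n) euclideanreal (\<lambda>\<delta>. \<delta> (real j * e) i)"
          using that e by (intro natural_dpaths_eval) (auto simp: P_def)
        from openin_continuous_map_preimage[OF this, of "ball (\<gamma> (real j * e) i) e"]
        show ?thesis by simp
      qed
      then have op: "\<And>z. z \<in> P \<Longrightarrow> openin (natural_dpaths n) (case z of (i, j) \<Rightarrow>
          {\<delta> \<in> topspace (natural_dpaths n). \<delta> (real j * e) i \<in> ball (\<gamma> (real j * e) i) e})" by auto
      have "openin (natural_dpaths n) W"
        unfolding W_def using P op by (rule finite_INT_openin)
      moreover have "\<gamma> \<in> W" using g e by (auto simp: W_def)
      moreover have "W \<subseteq> {\<gamma> \<in> topspace (natural_dpaths n). dpath_vec n \<gamma> \<in> U}"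
      proof
        fix \<delta> assume d: "\<delta> \<in> W"
        then have dp: "natural_path n \<delta>" by (simp add: W_def topspace_natural_dpaths)
        have "dist (dpath_vec n \<delta>) (dpath_vec n \<gamma>) \<le> 3 * e"
        proof (rule dpath_vec_dist[OF dp gp e])
          fix i j assume "i < n" "real j * e \<le> real n"
          then have "(i, j) \<in> P" by (simp add: P_def)
          then have "\<delta> (real j * e) i \<in> ball (\<gamma> (real j * e) i) e" using d unfolding W_def by blast
          then show "\<bar>\<delta> (real j * e) i - \<gamma> (real j * e) i\<bar> \<le> e" by (simp add: dist_real_def)
        qed
        then have "dpath_vec n \<delta> \<in> U" using r(1) by (intro r(2)) (simp add: e_def)
        then show "\<delta> \<in> {\<gamma> \<in> topspace (natural_dpaths n). dpath_vec n \<gamma> \<in> U}"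
          using dp by (simp add: topspace_natural_dpaths)
      qed
      ultimately show "\<exists>Ta. openin (natural_dpaths n) Ta \<and> \<gamma> \<in> Ta \<and>
          Ta \<subseteq> {\<gamma> \<in> topspace (natural_dpaths n). dpath_vec n \<gamma> \<in> U}" by blast
    qed
  qed simp
qed

lemma continuous_on_dpath_vecs_eval:
  assumes "i < n"
  shows "continuous_on (dpath_vecs n \<times> {0..real n}) (\<lambda>z. apply_bcontfun (fst z) (snd z, i))"
  unfolding continuous_on_iff
proof (intro ballI allI impI)
  fix z :: "((real \<times> nat) \<Rightarrow>\<^sub>C real) \<times> real" and e :: real
  assume z: "z \<in> dpath_vecs n \<times> {0..real n}" and e: "e > 0"
  have "dist (apply_bcontfun (fst z') (snd z', i)) (apply_bcontfun (fst z) (snd z, i)) < e"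
    if z': "z' \<in> dpath_vecs n \<times> {0..real n}" and d: "dist z' z < e / 2" for z'
  proof -
    have "dist (apply_bcontfun (fst z') (snd z', i)) (apply_bcontfun (fst z) (snd z', i)) < e / 2"
      by (rule dist_fun_lt_imp_dist_val_lt) (use d dist_fst_le[of z' z] in simp)
    moreover have "\<bar>vec_dpath n (fst z) (snd z') i - vec_dpath n (fst z) (snd z) i\<bar> \<le> \<bar>snd z' - snd z\<bar>"
      using z z' by (intro natural_path_lipschitz[OF natural_path_vec_dpath assms]) auto
    then have "dist (apply_bcontfun (fst z) (snd z', i)) (apply_bcontfun (fst z) (snd z, i)) \<le> dist (snd z') (snd z)"
      using z z' assms by (simp add: vec_dpath_apply mem_Times_iff dist_real_def)
    then have "dist (apply_bcontfun (fst z) (snd z', i)) (apply_bcontfun (fst z) (snd z, i)) < e / 2"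
      using d dist_snd_le[of z' z] by simp
    ultimately show ?thesis using dist_triangle_half_l dist_commute by (metis (no_types))
  qed
  then show "\<exists>d>0. \<forall>x'\<in>dpath_vecs n \<times> {0..real n}. dist x' z < d \<longrightarrow>
      dist (apply_bcontfun (fst x') (snd x', i)) (apply_bcontfun (fst z) (snd z, i)) < e"
    using e by (intro exI[of _ "e / 2"]) auto
qed

text \<open>Evaluation is jointly continuous in the vector and the time, so the tube lemma applied to a compact
  set of times shows that the preimage of a subbasic open set is open.\<close>

lemma continuous_map_vec_dpath:
  "continuous_map (top_of_set (dpath_vecs n)) (natural_dpaths n) (vec_dpath n)"
proof -
  let ?X = "top_of_set {0..real n}" and ?Y = "product_topology (\<lambda>_. unit_interval_top) {..<n}"
  let ?S = "dpath_vecs n"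
  have top: "vec_dpath n v \<in> topspace (natural_dpaths n)" if "v \<in> ?S" for v
    using natural_path_vec_dpath[OF that] by (simp add: topspace_natural_dpaths)
  have cv: "vec_dpath n v \<in> extensional (topspace ?X)" "continuous_map ?X ?Y (vec_dpath n v)" if "v \<in> ?S" for v
    using top[OF that] unfolding natural_dpaths_def topspace_subtopology topspace_compact_open by auto
  have joint: "continuous_map (prod_topology (top_of_set ?S) ?X) ?Y (\<lambda>z. vec_dpath n (fst z) (snd z))"
    unfolding continuous_map_componentwise
  proof (intro conjI ballI)
    show "(\<lambda>z. vec_dpath n (fst z) (snd z)) ` topspace (prod_topology (top_of_set ?S) ?X) \<subseteq> extensional {..<n}"
      by (auto simp: vec_dpath_def)
    fix i assume i: "i \<in> {..<n}"
    have "continuous_on (?S \<times> {0..real n}) (\<lambda>z. vec_dpath n (fst z) (snd z) i)"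
      by (rule continuous_on_eq[OF continuous_on_dpath_vecs_eval[of i n]])
        (use i in \<open>auto simp: vec_dpath_apply\<close>)
    moreover have "vec_dpath n (fst z) (snd z) i \<in> {0..1}" if "z \<in> ?S \<times> {0..real n}" for z
      using natural_pathD(4)[OF natural_path_vec_dpath, of "fst z" n i "snd z"] that i by auto
    ultimately show "continuous_map (prod_topology (top_of_set ?S) ?X) unit_interval_top
        (\<lambda>z. vec_dpath n (fst z) (snd z) i)"
      by (auto simp: continuous_map_in_subtopology)
  qed
  show ?thesis
    unfolding natural_dpaths_def continuous_map_in_subtopology
  proof
    show "continuous_map (top_of_set ?S) (compact_open_top ?X ?Y) (vec_dpath n)"
      unfolding compact_open_top_def
    proof (rule continuous_on_generated_topo)
      fix B assume "B \<in> {{f \<in> extensional (topspace ?X). continuous_map ?X ?Y f \<and> f ` C \<subseteq> U} | C U. compactin ?X C \<and> openin ?Y U}"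
      then obtain C U where CU: "B = {f \<in> extensional (topspace ?X). continuous_map ?X ?Y f \<and> f ` C \<subseteq> U}"
        "compactin ?X C" "openin ?Y U" by blast
      have C: "C \<subseteq> {0..real n}" using compactin_subset_topspace[OF CU(2)] by simp
      let ?W = "{z \<in> topspace (prod_topology (top_of_set ?S) ?X). vec_dpath n (fst z) (snd z) \<in> U}"
      have W: "openin (prod_topology (top_of_set ?S) ?X) ?W"
        using joint CU(3) unfolding continuous_map_def by blast
      show "openin (top_of_set ?S) (vec_dpath n -` B \<inter> topspace (top_of_set ?S))"
      proof (subst openin_subopen, intro ballI)
        fix v assume v: "v \<in> vec_dpath n -` B \<inter> topspace (top_of_set ?S)"
        then have vW: "{v} \<times> C \<subseteq> ?W" using CU(1) C by auto
        obtain N V where N: "openin (top_of_set ?S) N" "v \<in> N" "C \<subseteq> V" "N \<times> V \<subseteq> ?W"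
          using tube_lemma_right[OF W CU(2) _ vW] v by blast
        have "N \<subseteq> vec_dpath n -` B \<inter> topspace (top_of_set ?S)"
        proof
          fix w assume w: "w \<in> N"
          have wS: "w \<in> ?S" using subsetD[OF openin_subset[OF N(1)] w] by simp
          have "vec_dpath n w t \<in> U" if "t \<in> C" for t
            using subsetD[OF N(4), of "(w, t)"] w that N(3) by auto
          then show "w \<in> vec_dpath n -` B \<inter> topspace (top_of_set ?S)"
            using cv[OF wS] wS CU(1) by auto
        qed
        then show "\<exists>T. openin (top_of_set ?S) T \<and> v \<in> T \<and> T \<subseteq> vec_dpath n -` B \<inter> topspace (top_of_set ?S)"
          using N by blast
      qed
    next
      have "{f \<in> extensional (topspace ?X). continuous_map ?X ?Y f} \<subseteq>
         \<Union>{{f \<in> extensional (topspace ?X). continuous_map ?X ?Y f \<and> f ` C \<subseteq> U} | C U. compactin ?X C \<and> openin ?Y U}"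
        using topspace_compact_open[of ?X ?Y] unfolding compact_open_top_def topology_generated_by_topspace by simp
      then show "vec_dpath n ` topspace (top_of_set ?S) \<subseteq>
         \<Union>{{f \<in> extensional (topspace ?X). continuous_map ?X ?Y f \<and> f ` C \<subseteq> U} | C U. compactin ?X C \<and> openin ?Y U}"
        using cv by auto
    qed
    show "vec_dpath n \<in> topspace (top_of_set ?S) \<rightarrow> {\<gamma>. (\<forall>i<n. mono_on {0..real n} (\<lambda>t. \<gamma> t i)) \<and>
        (\<forall>i<n. \<gamma> 0 i \<in> {0, 1} \<and> \<gamma> (real n) i \<in> {0, 1}) \<and> (\<forall>t\<in>{0..real n}. t = (\<Sum>i<n. \<gamma> t i))}"
      using top unfolding natural_dpaths_def topspace_subtopology by auto
  qed
qed

lemma delta_generated_natural_dpaths: "delta_generated (natural_dpaths n)"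
proof -
  have "homeomorphic_maps (top_of_set (dpath_vecs n)) (natural_dpaths n) (vec_dpath n) (dpath_vec n)"
    unfolding homeomorphic_maps_def
    using continuous_map_vec_dpath continuous_map_dpath_vec vec_dpath_dpath_vec dpath_vec_vec_dpath
    by (auto simp: topspace_natural_dpaths)
  then have "homeomorphic_map (top_of_set (dpath_vecs n)) (natural_dpaths n) (vec_dpath n)"
    by (rule homeomorphic_maps_imp_map)
  then show ?thesis using delta_generated_convex[OF convex_dpath_vecs] by (rule delta_generated_homeomorphic)
qed


section \<open>Composition of natural paths\<close>

text \<open>When the elements of \<open>A\<close> are enumerated increasingly from \<open>0\<close>, the element \<open>k\<close> has number \<open>rank A k\<close>.\<close>

definition rank :: "nat set \<Rightarrow> nat \<Rightarrow> nat" where "rank A k = card {j \<in> A. j < k}"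

text \<open>The composite of a path \<open>x\<close> in the coordinates of \<open>A\<close> and a path \<open>y\<close> in the remaining coordinates of the
  cube of dimension \<open>n\<close>. Every composition \<open>cube_comp\<close> has this form, where \<open>A\<close> records which of the
  changing coordinates change first; this makes it visible that composition does not depend on the
  ambient cube.\<close>

definition join_paths :: "nat \<Rightarrow> nat set \<Rightarrow> dpath \<Rightarrow> dpath \<Rightarrow> dpath" where
  "join_paths n A x y = (\<lambda>t\<in>{0..real n}. \<lambda>k\<in>{..<n}.
    if t \<le> real (card A) then if k \<in> A then x t (rank A k) else 0
    else if k \<in> A then 1 else y (t - real (card A)) (rank ({..<n} - A) k))"

lemma bij_betw_rank:
  assumes "finite A"
  shows "bij_betw (rank A) A {..<card A}"
proof -
  have less: "rank A j < rank A k" if "j \<in> A" "j < k" for j k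
    unfolding rank_def by (rule psubset_card_mono) (use assms that in auto)
  have inj: "inj_on (rank A) A"
    by (rule inj_onI) (metis less nat_neq_iff less_irrefl)
  have "rank A k < card A" if "k \<in> A" for k
    unfolding rank_def by (rule psubset_card_mono) (use assms that in auto)
  then have "rank A ` A \<subseteq> {..<card A}" by auto
  moreover have "card (rank A ` A) = card {..<card A}" using inj by (simp add: card_image)
  ultimately have "rank A ` A = {..<card A}" by (simp add: card_subset_eq)
  then show ?thesis using inj by (simp add: bij_betw_def)
qed

lemma rank_less: "finite A \<Longrightarrow> k \<in> A \<Longrightarrow> rank A k < card A"
  using bij_betw_rank[of A] by (auto simp: bij_betw_def)

lemma sum_rank:
  assumes "finite A" shows "(\<Sum>k\<in>A. f (rank A k)) = (\<Sum>r<card A. f r)"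
  by (rule sum.reindex_bij_betw[OF bij_betw_rank[OF assms]])

text \<open>Until time \<open>card A\<close> the coordinates in \<open>A\<close> add up to the time and the others vanish; afterwards those in
  \<open>A\<close> contribute \<open>card A\<close> and the others the elapsed time. Both formulas agree at time \<open>card A\<close> because the
  end points of natural d-paths are known.\<close>

lemma natural_path_join_paths:
  assumes A: "A \<subseteq> {..<n}" and x: "natural_path (card A) x" and y: "natural_path (n - card A) y"
  shows "natural_path n (join_paths n A x y)"
proof -
  define B where "B = {..<n} - A"
  define l where "l = real (card A)"
  have fin: "finite A" "finite B" using A by (auto simp: B_def finite_subset)
  have cB: "card B = n - card A" using A fin by (simp add: B_def card_Diff_subset)
  have cA: "card A \<le> n" using card_mono[OF _ A] by simp
  have ln: "0 \<le> l" "l \<le> real n" using cA by (auto simp: l_def)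
  have nl: "real (n - card A) = real n - l" using cA by (simp add: l_def of_nat_diff)
  have rA: "rank A k < card A" if "k \<in> A" for k using rank_less[OF fin(1) that] .
  have rB: "rank B k < n - card A" if "k < n" "k \<notin> A" for k
    using rank_less[OF fin(2), of k] that unfolding cB by (simp add: B_def)
  have val: "join_paths n A x y t k = (if t \<le> l then if k \<in> A then x t (rank A k) else 0
      else if k \<in> A then 1 else y (t - l) (rank B k))" if "t \<in> {0..real n}" "k < n" for t k
    using that by (simp add: join_paths_def l_def B_def)
  have xr: "0 \<le> x t (rank A k)" "x t (rank A k) \<le> 1" if "k \<in> A" "t \<in> {0..l}" for k t
    using natural_pathD(4)[OF x rA[OF that(1)], of t] that(2) by (auto simp: l_def)
  have yr: "0 \<le> y (t - l) (rank B k)" "y (t - l) (rank B k) \<le> 1" if "k < n" "k \<notin> A" "t \<in> {l..real n}" for k t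
    using natural_pathD(4)[OF y rB[OF that(1,2)], of "t - l"] that(3) by (auto simp: nl)
  have x1: "x l (rank A k) = 1" if "k \<in> A" for k
    using natural_path_1[OF x rA[OF that]] by (simp add: l_def)
  have y0: "y 0 (rank B k) = 0" if "k < n" "k \<notin> A" for k
    using natural_path_0[OF y rB[OF that]] .
  show ?thesis
    unfolding natural_path_def
  proof (intro conjI ballI allI impI)
    show "join_paths n A x y \<in> extensional {0..real n}" by (simp add: join_paths_def)
    show "join_paths n A x y t \<in> extensional {..<n}" if "t \<in> {0..real n}" for t using that by (simp add: join_paths_def)
  next
    fix k assume k: "k < n"
    show "continuous_on {0..real n} (\<lambda>t. join_paths n A x y t k)"
    proof (cases "k \<in> A")
      case True
      have "continuous_on {0..real n} (\<lambda>t. if t \<le> l then x t (rank A k) else 1)"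
      proof (rule continuous_on_cases_le)
        show "continuous_on {t \<in> {0..real n}. t \<le> l} (\<lambda>t. x t (rank A k))"
          by (rule continuous_on_subset[OF natural_pathD(3)[OF x rA[OF True]]]) (auto simp: l_def)
      qed (auto intro!: continuous_intros simp: x1[OF True])
      then show ?thesis by (rule continuous_on_eq) (use True k val in simp)
    next
      case False
      have "continuous_on {0..real n} (\<lambda>t. if t \<le> l then 0 else y (t - l) (rank B k))"
      proof (rule continuous_on_cases_le)
        show "continuous_on {t \<in> {0..real n}. l \<le> t} (\<lambda>t. y (t - l) (rank B k))"
          by (rule continuous_on_compose2[OF natural_pathD(3)[OF y rB[OF k False]]])
            (auto simp: nl intro!: continuous_intros)
      qed (auto intro!: continuous_intros simp: y0[OF k False])
      then show ?thesis by (rule continuous_on_eq) (use False k val in simp)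
    qed
    show "mono_on {0..real n} (\<lambda>t. join_paths n A x y t k)"
    proof (rule mono_onI)
      fix s t assume st: "s \<in> {0..real n}" "t \<in> {0..real n}" "s \<le> t"
      show "join_paths n A x y s k \<le> join_paths n A x y t k"
      proof (cases "k \<in> A")
        case True
        have "x s (rank A k) \<le> x t (rank A k)" if "t \<le> l"
          using mono_onD[OF natural_pathD(5)[OF x rA[OF True]], of s t] st that by (simp add: l_def)
        then show ?thesis using st True xr[OF True, of s] by (auto simp: val[OF st(1) k] val[OF st(2) k])
      next
        case False
        have "y (s - l) (rank B k) \<le> y (t - l) (rank B k)" if "l \<le> s"
          using mono_onD[OF natural_pathD(5)[OF y rB[OF k False]], of "s - l" "t - l"] st that by (simp add: nl)
        then show ?thesis using st False yr[OF k False, of t] by (auto simp: val[OF st(1) k] val[OF st(2) k])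
      qed
    qed
    fix t assume t: "t \<in> {0..real n}"
    show "join_paths n A x y t k \<in> {0..1}"
      using t k xr[of k t] yr[of k t] by (auto simp: val[OF t k])
  next
    fix t assume t: "t \<in> {0..real n}"
    have split: "(\<Sum>k<n. f k) = (\<Sum>k\<in>A. f k) + (\<Sum>k\<in>B. f k)" for f :: "nat \<Rightarrow> real"
    proof -
      have "{..<n} = A \<union> B" "A \<inter> B = {}" using A by (auto simp: B_def)
      then show ?thesis using fin by (simp add: sum.union_disjoint)
    qed
    have An: "k < n" if "k \<in> A" for k using A that by auto
    have Bn: "k < n" "k \<notin> A" if "k \<in> B" for k using that by (auto simp: B_def)
    show "(\<Sum>k<n. join_paths n A x y t k) = t"
    proof (cases "t \<le> l")
      case True
      have "(\<Sum>k\<in>A. join_paths n A x y t k) = (\<Sum>k\<in>A. x t (rank A k))"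
        by (rule sum.cong) (simp_all add: val[OF t An] True)
      also have "\<dots> = t" unfolding sum_rank[OF fin(1)] using natural_pathD(6)[OF x, of t] t True by (simp add: l_def)
      finally have "(\<Sum>k\<in>A. join_paths n A x y t k) = t" .
      moreover have "(\<Sum>k\<in>B. join_paths n A x y t k) = 0"
        by (rule sum.neutral) (use Bn True val[OF t] in auto)
      ultimately show ?thesis by (simp add: split)
    next
      case False
      have "(\<Sum>k\<in>A. join_paths n A x y t k) = (\<Sum>k\<in>A. 1)"
        by (rule sum.cong) (use False in \<open>simp_all add: val[OF t An]\<close>)
      then have "(\<Sum>k\<in>A. join_paths n A x y t k) = l" by (simp add: l_def)
      moreover have "(\<Sum>k\<in>B. join_paths n A x y t k) = (\<Sum>k\<in>B. y (t - l) (rank B k))"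
        by (rule sum.cong) (use False Bn in \<open>simp_all add: val[OF t Bn(1)]\<close>)
      moreover have "(\<Sum>k\<in>B. y (t - l) (rank B k)) = t - l"
        unfolding sum_rank[OF fin(2)] cB using natural_pathD(6)[OF y, of "t - l"] t False by (simp add: nl)
      ultimately show ?thesis by (simp add: split)
    qed
  qed
qed

section \<open>Morphisms of the box category\<close>

text \<open>A face of a cube is described by a word, with \<open>None\<close> in the coordinates that are left free; \<open>fill w v\<close>
  replaces the free places of \<open>w\<close>, from left to right, by the entries of \<open>v\<close>.\<close>

fun fill :: "bool option list \<Rightarrow> bool list \<Rightarrow> bool list" where
  "fill [] v = []"
| "fill (Some e # w) v = e # fill w v"
| "fill (None # w) v = hd v # fill w (tl v)"

abbreviation free_count :: "bool option list \<Rightarrow> nat" where "free_count w \<equiv> count_list w None"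

definition cube_word :: "bool list \<Rightarrow> bool list \<Rightarrow> bool option list"
  where "cube_word \<alpha> \<beta> = map2 (\<lambda>a b. if a = b then Some a else None) \<alpha> \<beta>"

definition vertex_le :: "bool list \<Rightarrow> bool list \<Rightarrow> bool"
  where "vertex_le \<alpha> \<beta> \<longleftrightarrow> list_all2 (\<le>) \<alpha> \<beta>"

abbreviation diff_dim :: "bool list \<Rightarrow> bool list \<Rightarrow> nat" where "diff_dim \<alpha> \<beta> \<equiv> card (diff_coords \<alpha> \<beta>)"

text \<open>The inclusion of the face with lowest vertex \<open>\<alpha>\<close> and highest vertex \<open>\<beta>\<close>, for \<open>\<alpha> \<le> \<beta>\<close>.\<close>

definition subcube_map :: "bool list \<Rightarrow> bool list \<Rightarrow> bool list \<Rightarrow> bool list"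
  where "subcube_map \<alpha> \<beta> = (\<lambda>v\<in>verts (diff_dim \<alpha> \<beta>). fill (cube_word \<alpha> \<beta>) v)"

lemma length_cube_word [simp]: "length (cube_word \<alpha> \<beta>) = min (length \<alpha>) (length \<beta>)"
  by (simp add: cube_word_def)

lemma cube_word_simps [simp]:
  "cube_word [] \<beta> = []" "cube_word \<alpha> [] = []"
  "cube_word (a # \<alpha>) (b # \<beta>) = (if a = b then Some a else None) # cube_word \<alpha> \<beta>"
  by (simp_all add: cube_word_def)

lemma finite_diff_coords [simp]: "finite (diff_coords \<alpha> \<beta>)"
  by (simp add: diff_coords_def)

lemma diff_coords_Cons:
  "diff_coords (a # \<alpha>) (b # \<beta>) = (if a = b then {} else {0}) \<union> Suc ` diff_coords \<alpha> \<beta>"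
proof (intro equalityI subsetI)
  fix c assume "c \<in> diff_coords (a # \<alpha>) (b # \<beta>)"
  then show "c \<in> (if a = b then {} else {0}) \<union> Suc ` diff_coords \<alpha> \<beta>"
    by (cases c) (auto simp: diff_coords_def)
qed (auto simp: diff_coords_def split: if_splits)

lemma diff_dim_Cons [simp]: "diff_dim (a # \<alpha>) (b # \<beta>) = (if a = b then 0 else 1) + diff_dim \<alpha> \<beta>"
proof -
  have "diff_dim (a # \<alpha>) (b # \<beta>) = card (if a = b then {} else {0::nat}) + card (Suc ` diff_coords \<alpha> \<beta>)"
    unfolding diff_coords_Cons by (intro card_Un_disjoint) auto
  then show ?thesis by (simp add: card_image)
qed

lemma diff_dim_self [simp]: "diff_dim \<alpha> \<alpha> = 0" by (simp add: diff_coords_def)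

lemma vertex_le_simps [simp]:
  "vertex_le [] [] " "vertex_le (a # \<alpha>) (b # \<beta>) \<longleftrightarrow> (a \<longrightarrow> b) \<and> vertex_le \<alpha> \<beta>"
  "vertex_le [] (b # \<beta>) \<longleftrightarrow> False" "vertex_le (a # \<alpha>) [] \<longleftrightarrow> False"
  by (auto simp: vertex_le_def)

lemma vertex_le_length: "vertex_le \<alpha> \<beta> \<Longrightarrow> length \<alpha> = length \<beta>"
  by (simp add: vertex_le_def list_all2_lengthD)

lemma vertex_le_refl [simp]: "vertex_le \<alpha> \<alpha>"
  by (induction \<alpha>) auto

lemma vertex_le_trans: "vertex_le \<alpha> \<beta> \<Longrightarrow> vertex_le \<beta> \<gamma> \<Longrightarrow> vertex_le \<alpha> \<gamma>"
  unfolding vertex_le_def by (rule list_all2_trans[of "(\<le>)" "(\<le>)" "(\<le>)"]) auto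

lemma vertex_le_append:
  "length a = length a' \<Longrightarrow> vertex_le (a @ b) (a' @ b') \<longleftrightarrow> vertex_le a a' \<and> vertex_le b b'"
  by (simp add: vertex_le_def list_all2_append)

lemma vertex_le_zeros_ones: "length v = n \<Longrightarrow> vertex_le (zeros n) v" "length v = n \<Longrightarrow> vertex_le v (ones n)"
  by (auto simp: vertex_le_def list_all2_conv_all_nth)

lemma vert_less_vertex_le: "vert_less \<alpha> \<beta> \<longleftrightarrow> vertex_le \<alpha> \<beta> \<and> \<alpha> \<noteq> \<beta>"
  by (simp add: vert_less_def vertex_le_def)

lemma diff_dim_pos: "vertex_le \<alpha> \<beta> \<Longrightarrow> \<alpha> \<noteq> \<beta> \<longleftrightarrow> 0 < diff_dim \<alpha> \<beta>"
  unfolding vertex_le_def by (induction rule: list_all2_induct) auto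

lemma diff_dim_zeros_ones [simp]: "diff_dim (zeros n) (ones n) = n"
  by (induction n) auto

lemma free_count_cube_word: "vertex_le \<alpha> \<beta> \<Longrightarrow> free_count (cube_word \<alpha> \<beta>) = diff_dim \<alpha> \<beta>"
  unfolding vertex_le_def by (induction rule: list_all2_induct) auto

lemma length_fill [simp]: "length (fill w v) = length w"
  by (induction w v rule: fill.induct) auto

lemma fill_append:
  "free_count u \<le> length v \<Longrightarrow> fill (u @ w) v = fill u (take (free_count u) v) @ fill w (drop (free_count u) v)"
proof (induction u v rule: fill.induct)
  case (3 u v)
  then show ?case by (cases v) auto
qed auto

lemma fill_replicate_None: "length v = n \<Longrightarrow> fill (replicate n None) v = v"
proof (induction n arbitrary: v)
  case (Suc n) then show ?case by (cases v) auto
qed auto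

lemma cube_word_zeros_ones: "cube_word (zeros n) (ones n) = replicate n None"
  by (induction n) auto

lemma fill_cube_word_ends:
  "vertex_le \<alpha> \<beta> \<Longrightarrow> fill (cube_word \<alpha> \<beta>) (zeros (diff_dim \<alpha> \<beta>)) = \<alpha>"
  "vertex_le \<alpha> \<beta> \<Longrightarrow> fill (cube_word \<alpha> \<beta>) (ones (diff_dim \<alpha> \<beta>)) = \<beta>"
  unfolding vertex_le_def by (induction rule: list_all2_induct) auto

lemma verts_iff [simp]: "v \<in> verts n \<longleftrightarrow> length v = n"
  by (simp add: verts_def)

lemma subcube_map_zeros_ones: "subcube_map (zeros n) (ones n) = (\<lambda>v\<in>verts n. v)"
  unfolding subcube_map_def diff_dim_zeros_ones cube_word_zeros_ones
  by (rule restrict_ext) (simp add: fill_replicate_None)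

lemma subcube_map_apply: "length v = diff_dim \<alpha> \<beta> \<Longrightarrow> subcube_map \<alpha> \<beta> v = fill (cube_word \<alpha> \<beta>) v"
  by (simp add: subcube_map_def)

lemma subcube_map_ends:
  "vertex_le \<alpha> \<beta> \<Longrightarrow> subcube_map \<alpha> \<beta> (zeros (diff_dim \<alpha> \<beta>)) = \<alpha>"
  "vertex_le \<alpha> \<beta> \<Longrightarrow> subcube_map \<alpha> \<beta> (ones (diff_dim \<alpha> \<beta>)) = \<beta>"
  by (simp_all add: subcube_map_apply fill_cube_word_ends)

lemma coface_apply: "length v = n \<Longrightarrow> coface n i e v = take i v @ e # drop i v"
  by (simp add: coface_def)

lemma cube_word_append: "length a = length a' \<Longrightarrow> cube_word (a @ b) (a' @ b') = cube_word a a' @ cube_word b b'"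
  by (simp add: cube_word_def)

lemma diff_dim_append: "vertex_le (a @ b) (a' @ b') \<Longrightarrow> length a = length a' \<Longrightarrow> diff_dim (a @ b) (a' @ b') = diff_dim a a' + diff_dim b b'"
  by (metis count_list_append free_count_cube_word vertex_le_append cube_word_append)

lemma coface_subcube_map:
  assumes "vertex_le \<alpha> \<beta>" "length \<alpha> = n" "i \<le> n"
  shows "vertex_le (coface n i e \<alpha>) (coface n i e \<beta>)"
    and "diff_dim (coface n i e \<alpha>) (coface n i e \<beta>) = diff_dim \<alpha> \<beta>"
    and "compose (verts (diff_dim \<alpha> \<beta>)) (coface n i e) (subcube_map \<alpha> \<beta>) = subcube_map (coface n i e \<alpha>) (coface n i e \<beta>)"
proof -
  have len: "length \<beta> = n" using assms vertex_le_length by metis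
  define a a' b b' where ab: "a = take i \<alpha>" "a' = take i \<beta>" "b = drop i \<alpha>" "b' = drop i \<beta>"
  have eq: "\<alpha> = a @ b" "\<beta> = a' @ b'" by (simp_all add: ab)
  have la: "length a = i" "length a' = i" using assms len by (simp_all add: ab)
  have cf: "coface n i e \<alpha> = a @ e # b" "coface n i e \<beta> = a' @ e # b'"
    using assms len by (simp_all add: coface_apply ab)
  have v: "vertex_le a a'" "vertex_le b b'" using assms(1) la unfolding eq by (simp_all add: vertex_le_append)
  show 1: "vertex_le (coface n i e \<alpha>) (coface n i e \<beta>)" unfolding cf using v la by (simp add: vertex_le_append)
  show 2: "diff_dim (coface n i e \<alpha>) (coface n i e \<beta>) = diff_dim \<alpha> \<beta>"
    using 1 assms(1) la unfolding cf unfolding eq by (simp add: diff_dim_append)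
  show "compose (verts (diff_dim \<alpha> \<beta>)) (coface n i e) (subcube_map \<alpha> \<beta>) = subcube_map (coface n i e \<alpha>) (coface n i e \<beta>)"
    unfolding compose_def subcube_map_def[of "coface n i e \<alpha>"] 2
  proof (rule restrict_ext)
    fix x assume x: "x \<in> verts (diff_dim \<alpha> \<beta>)"
    have diff_dim: "diff_dim \<alpha> \<beta> = diff_dim a a' + diff_dim b b'" using assms(1) la unfolding eq by (simp add: diff_dim_append)
    have s: "free_count (cube_word a a') \<le> length x" using x v diff_dim by (simp add: free_count_cube_word)
    have "subcube_map \<alpha> \<beta> x = fill (cube_word a a') (take (free_count (cube_word a a')) x) @ fill (cube_word b b') (drop (free_count (cube_word a a')) x)"
      using x s la by (simp add: subcube_map_apply eq cube_word_append fill_append)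
    moreover have "length (fill (cube_word a a') (take (free_count (cube_word a a')) x)) = i" using la by simp
    moreover have "length (subcube_map \<alpha> \<beta> x) = n" using x assms len by (simp add: subcube_map_apply)
    ultimately show "coface n i e (subcube_map \<alpha> \<beta> x) = fill (cube_word (coface n i e \<alpha>) (coface n i e \<beta>)) x"
      using s la by (simp add: coface_apply cf cube_word_append fill_append)
  qed
qed

text \<open>A morphism of the box category preserves the order of vertices and the number of coordinates in which
  they differ, and it carries the face spanned by two vertices to the face spanned by their images. It
  is enough to check this for coface maps.\<close>

lemma box_subcube_map:
  assumes "box m n \<phi>"
  shows "\<phi> \<in> verts m \<rightarrow>\<^sub>E verts n"
    and "\<And>\<alpha> \<beta>. length \<alpha> = m \<Longrightarrow> vertex_le \<alpha> \<beta> \<Longrightarrow> vertex_le (\<phi> \<alpha>) (\<phi> \<beta>) \<and> diff_dim (\<phi> \<alpha>) (\<phi> \<beta>) = diff_dim \<alpha> \<beta> \<and>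
      compose (verts (diff_dim \<alpha> \<beta>)) \<phi> (subcube_map \<alpha> \<beta>) = subcube_map (\<phi> \<alpha>) (\<phi> \<beta>)"
proof -
  have "\<phi> \<in> verts m \<rightarrow>\<^sub>E verts n \<and> (\<forall>\<alpha> \<beta>. length \<alpha> = m \<and> vertex_le \<alpha> \<beta> \<longrightarrow> vertex_le (\<phi> \<alpha>) (\<phi> \<beta>) \<and> diff_dim (\<phi> \<alpha>) (\<phi> \<beta>) = diff_dim \<alpha> \<beta> \<and>
      compose (verts (diff_dim \<alpha> \<beta>)) \<phi> (subcube_map \<alpha> \<beta>) = subcube_map (\<phi> \<alpha>) (\<phi> \<beta>))"
    using assms
  proof (induction rule: box.induct)
    case (box_id n)
    show ?case
    proof (intro conjI allI impI)
      fix \<alpha> \<beta> :: "bool list" assume ab: "length \<alpha> = n \<and> vertex_le \<alpha> \<beta>"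
      then have lb: "length \<beta> = n" using vertex_le_length by metis
      show "vertex_le ((\<lambda>v\<in>verts n. v) \<alpha>) ((\<lambda>v\<in>verts n. v) \<beta>)"
        "diff_dim ((\<lambda>v\<in>verts n. v) \<alpha>) ((\<lambda>v\<in>verts n. v) \<beta>) = diff_dim \<alpha> \<beta>" using ab lb by simp_all
      have "compose (verts (diff_dim \<alpha> \<beta>)) (\<lambda>v\<in>verts n. v) (subcube_map \<alpha> \<beta>) = subcube_map \<alpha> \<beta>"
        unfolding compose_def subcube_map_def by (rule restrict_ext) (use ab lb in simp)
      then show "compose (verts (diff_dim \<alpha> \<beta>)) (\<lambda>v\<in>verts n. v) (subcube_map \<alpha> \<beta>) =
        subcube_map ((\<lambda>v\<in>verts n. v) \<alpha>) ((\<lambda>v\<in>verts n. v) \<beta>)" using ab lb by simp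
    qed auto
  next
    case (box_coface i n e)
    show ?case
    proof (intro conjI allI impI)
      show "coface n i e \<in> verts n \<rightarrow>\<^sub>E verts (Suc n)" using box_coface by (auto simp: coface_def)
    qed (use coface_subcube_map box_coface in blast)+
  next
    case (box_comp l m \<psi> n \<phi>)
    show ?case
    proof (intro conjI allI impI)
      show "compose (verts l) \<phi> \<psi> \<in> verts l \<rightarrow>\<^sub>E verts n"
        using box_comp.IH by (auto simp: compose_def PiE_iff)
      fix \<alpha> \<beta> assume ab: "length \<alpha> = l \<and> vertex_le \<alpha> \<beta>"
      then have lb: "length \<beta> = l" using vertex_le_length by metis
      have p: "vertex_le (\<psi> \<alpha>) (\<psi> \<beta>)" "diff_dim (\<psi> \<alpha>) (\<psi> \<beta>) = diff_dim \<alpha> \<beta>"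
        "compose (verts (diff_dim \<alpha> \<beta>)) \<psi> (subcube_map \<alpha> \<beta>) = subcube_map (\<psi> \<alpha>) (\<psi> \<beta>)" using box_comp.IH ab by blast+
      have lp: "length (\<psi> \<alpha>) = m" using box_comp.IH ab by (auto simp: PiE_iff)
      have q: "vertex_le (\<phi> (\<psi> \<alpha>)) (\<phi> (\<psi> \<beta>))" "diff_dim (\<phi> (\<psi> \<alpha>)) (\<phi> (\<psi> \<beta>)) = diff_dim (\<psi> \<alpha>) (\<psi> \<beta>)"
        "compose (verts (diff_dim (\<psi> \<alpha>) (\<psi> \<beta>))) \<phi> (subcube_map (\<psi> \<alpha>) (\<psi> \<beta>)) = subcube_map (\<phi> (\<psi> \<alpha>)) (\<phi> (\<psi> \<beta>))"
        using box_comp.IH lp p by blast+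
      have cab: "compose (verts l) \<phi> \<psi> \<alpha> = \<phi> (\<psi> \<alpha>)" "compose (verts l) \<phi> \<psi> \<beta> = \<phi> (\<psi> \<beta>)"
        using ab lb by (simp_all add: compose_def)
      show "vertex_le (compose (verts l) \<phi> \<psi> \<alpha>) (compose (verts l) \<phi> \<psi> \<beta>)"
        "diff_dim (compose (verts l) \<phi> \<psi> \<alpha>) (compose (verts l) \<phi> \<psi> \<beta>) = diff_dim \<alpha> \<beta>"
        using p q cab by simp_all
      have "compose (verts (diff_dim \<alpha> \<beta>)) (compose (verts l) \<phi> \<psi>) (subcube_map \<alpha> \<beta>) =
          compose (verts (diff_dim \<alpha> \<beta>)) \<phi> (compose (verts (diff_dim \<alpha> \<beta>)) \<psi> (subcube_map \<alpha> \<beta>))"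
        unfolding compose_def by (rule restrict_ext) (use ab lb in \<open>simp add: subcube_map_apply\<close>)
      then show "compose (verts (diff_dim \<alpha> \<beta>)) (compose (verts l) \<phi> \<psi>) (subcube_map \<alpha> \<beta>) =
          subcube_map (compose (verts l) \<phi> \<psi> \<alpha>) (compose (verts l) \<phi> \<psi> \<beta>)"
        using p q cab by simp
    qed
  qed
  then show "\<phi> \<in> verts m \<rightarrow>\<^sub>E verts n"
    and "\<And>\<alpha> \<beta>. length \<alpha> = m \<Longrightarrow> vertex_le \<alpha> \<beta> \<Longrightarrow> vertex_le (\<phi> \<alpha>) (\<phi> \<beta>) \<and> diff_dim (\<phi> \<alpha>) (\<phi> \<beta>) = diff_dim \<alpha> \<beta> \<and>
      compose (verts (diff_dim \<alpha> \<beta>)) \<phi> (subcube_map \<alpha> \<beta>) = subcube_map (\<phi> \<alpha>) (\<phi> \<beta>)" by blast+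
qed

lemma box_length: "box m n \<phi> \<Longrightarrow> length v = m \<Longrightarrow> length (\<phi> v) = n"
  using box_subcube_map(1) by (fastforce simp: PiE_iff)

lemma box_extensional: "box m n \<phi> \<Longrightarrow> \<phi> \<in> extensional (verts m)"
  using box_subcube_map(1) by (fastforce simp: PiE_iff)

lemma box_le: "box m n \<phi> \<Longrightarrow> m \<le> n"
  by (induction rule: box.induct) auto

definition id_times :: "nat \<Rightarrow> (bool list \<Rightarrow> bool list) \<Rightarrow> bool list \<Rightarrow> bool list"
  where "id_times m \<phi> = (\<lambda>v\<in>verts (Suc m). hd v # \<phi> (tl v))"

lemma box_id_times: "box m n \<phi> \<Longrightarrow> box (Suc m) (Suc n) (id_times m \<phi>)"
proof (induction rule: box.induct)
  case (box_id n)
  have "id_times n (\<lambda>v\<in>verts n. v) = (\<lambda>v\<in>verts (Suc n). v)"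
    unfolding id_times_def by (rule restrict_ext) (auto simp: length_Suc_conv)
  then show ?case using box.box_id[of "Suc n"] by (simp only:)
next
  case (box_coface i n e)
  have "id_times n (coface n i e) = coface (Suc n) (Suc i) e"
    unfolding id_times_def coface_def[of "Suc n"] by (rule restrict_ext) (auto simp: length_Suc_conv coface_apply)
  then show ?case using box.box_coface box_coface by simp
next
  case (box_comp l m \<psi> n \<phi>)
  have "id_times l (compose (verts l) \<phi> \<psi>) = compose (verts (Suc l)) (id_times m \<phi>) (id_times l \<psi>)"
    unfolding id_times_def compose_def
  proof (rule restrict_ext)
    fix v assume "v \<in> verts (Suc l)"
    then obtain a u where v: "v = a # u" "length u = l" by (auto simp: length_Suc_conv)
    then have "length (\<psi> u) = m" using box_length[OF box_comp.hyps(1)] by blast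
    then show "hd v # (\<lambda>x\<in>verts l. \<phi> (\<psi> x)) (tl v) =
        (\<lambda>v\<in>verts (Suc m). hd v # \<phi> (tl v)) ((\<lambda>v\<in>verts (Suc l). hd v # \<psi> (tl v)) v)"
      using v by simp
  qed
  then show ?case using box.box_comp[OF box_comp.IH] by (simp only:)
qed

text \<open>The word is built letter by letter: a constant letter is a coface map at position \<open>0\<close> and a free letter
  is the product of the identity of an interval with the map already obtained.\<close>

lemma box_fill: "free_count w = m \<Longrightarrow> box m (length w) (\<lambda>v\<in>verts m. fill w v)"
proof (induction w arbitrary: m)
  case Nil
  have "(\<lambda>v\<in>verts 0. fill [] v) = (\<lambda>v\<in>verts 0. v)" by (rule restrict_ext) simp
  moreover have "m = 0" using Nil by simp
  ultimately show ?case using box_id[of 0] by (simp only: list.size)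
next
  case (Cons x w)
  show ?case
  proof (cases x)
    case None
    then obtain m' where m': "m = Suc m'" "free_count w = m'" using Cons.prems by auto
    have "id_times m' (\<lambda>v\<in>verts m'. fill w v) = (\<lambda>v\<in>verts m. fill (x # w) v)"
      unfolding id_times_def m' None by (rule restrict_ext) (auto simp: length_Suc_conv)
    then show ?thesis using box_id_times[OF Cons.IH[OF m'(2)]] unfolding m'(1) by (simp only: list.size add_Suc_right add_0_right)
  next
    case (Some e)
    then have "free_count w = m" using Cons.prems by auto
    from box_comp[OF Cons.IH[OF this] box_coface[of 0 "length w" e]]
    have "box m (Suc (length w)) (compose (verts m) (coface (length w) 0 e) (\<lambda>v\<in>verts m. fill w v))"
      by (simp only: zero_le)
    moreover have "compose (verts m) (coface (length w) 0 e) (\<lambda>v\<in>verts m. fill w v) = (\<lambda>v\<in>verts m. fill (x # w) v)"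
      unfolding compose_def Some by (rule restrict_ext) (simp add: coface_apply)
    ultimately show ?thesis by (simp only: list.size add_Suc_right add_0_right)
  qed
qed

lemma box_subcube_mapI: "vertex_le \<alpha> \<beta> \<Longrightarrow> length \<alpha> = n \<Longrightarrow> box (diff_dim \<alpha> \<beta>) n (subcube_map \<alpha> \<beta>)"
  using box_fill[OF free_count_cube_word, of \<alpha> \<beta>] vertex_le_length[of \<alpha> \<beta>] by (simp add: subcube_map_def)

lemma subcube_map_self: "subcube_map v v = vertex_cell v"
proof -
  have "fill (cube_word v v) [] = v" using fill_cube_word_ends(1)[of v v] by simp
  then show ?thesis
    unfolding subcube_map_def vertex_cell_def diff_dim_self by (intro restrict_ext) auto
qed

lemma box_vertex_cell: "length v = n \<Longrightarrow> box 0 n (vertex_cell v)"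
  using box_subcube_mapI[of v v n] by (simp add: subcube_map_self)

lemma compose_vertex_cell: "compose (verts 0) \<phi> (vertex_cell v) = vertex_cell (\<phi> v)"
  unfolding compose_def vertex_cell_def by (rule restrict_ext) simp

lemma box_0: "box m 0 \<phi> \<Longrightarrow> m = 0 \<and> \<phi> = (\<lambda>v\<in>verts 0. v)"
proof -
  assume b: "box m 0 \<phi>"
  then have m: "m = 0" using box_le by blast
  have "\<phi> = (\<lambda>v\<in>verts 0. v)"
  proof (rule extensionalityI[of _ "verts 0"])
    show "\<phi> \<in> extensional (verts 0)" using box_extensional[OF b] m by simp
    show "\<phi> x = (\<lambda>v\<in>verts 0. v) x" if "x \<in> verts 0" for x
      using box_length[OF b, of x] that m by simp
  qed auto
  then show ?thesis using m by simp
qed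

section \<open>Iterated faces\<close>

definition set_word :: "nat \<Rightarrow> bool \<Rightarrow> nat set \<Rightarrow> bool option list"
  where "set_word n e B = map (\<lambda>i. if i \<in> B then Some e else None) [0..<n]"

lemma precub_id: "precubical_set K \<Longrightarrow> x \<in> cells K n \<Longrightarrow> act K n n (\<lambda>v\<in>verts n. v) x = x"
  by (simp add: precubical_set_def)

lemma precub_act: "precubical_set K \<Longrightarrow> box m n \<phi> \<Longrightarrow> x \<in> cells K n \<Longrightarrow> act K m n \<phi> x \<in> cells K m"
  by (simp add: precubical_set_def)

lemma precub_comp: "precubical_set K \<Longrightarrow> box l m \<psi> \<Longrightarrow> box m n \<phi> \<Longrightarrow> x \<in> cells K n \<Longrightarrow>
    act K l m \<psi> (act K m n \<phi> x) = act K l n (compose (verts l) \<phi> \<psi>) x"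
  unfolding precubical_set_def by metis

lemma free_count_set_word: "B \<subseteq> {..<n} \<Longrightarrow> free_count (set_word n e B) = n - card B"
proof -
  assume B: "B \<subseteq> {..<n}"
  have "free_count (map (\<lambda>i. if i \<in> B then Some e else None) xs) = length (filter (\<lambda>i. i \<notin> B) xs)" for xs :: "nat list"
    by (induction xs) auto
  moreover have "length (filter (\<lambda>i. i \<notin> B) [0..<n]) = card ({..<n} - B)"
    by (subst distinct_length_filter) (auto intro!: arg_cong[of _ _ card])
  ultimately show ?thesis using B by (simp add: set_word_def card_Diff_subset finite_subset)
qed

text \<open>The positions are listed in decreasing order. The coface map of the first of them is applied after the
  others have been inserted, and it does not shift them because its position is larger.\<close>

lemma iterated_face_set_word:
  assumes K: "precubical_set K"
  shows "sorted_wrt (>) as \<Longrightarrow> set as \<subseteq> {..<n} \<Longrightarrow> x \<in> cells K n \<Longrightarrow>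
    iterated_face K n e as x = act K (n - length as) n (\<lambda>v\<in>verts (n - length as). fill (set_word n e (set as)) v) x"
proof (induction as arbitrary: n x)
  case Nil
  have "(\<lambda>v\<in>verts n. fill (set_word n e {}) v) = (\<lambda>v\<in>verts n. v)"
    by (rule restrict_ext) (simp add: set_word_def map_replicate_const fill_replicate_None)
  then show ?case using precub_id[OF K Nil(3)] by (simp only: iterated_face.simps list.size list.set diff_zero)
next
  case (Cons a as)
  have a: "a < n" and as: "\<forall>b\<in>set as. b < a" using Cons.prems by auto
  define n' where "n' = n - 1"
  have n: "n = Suc n'" using a by (simp add: n'_def)
  have b: "box n' n (coface n' a e)" unfolding n using a n by (intro box_coface) simp
  have fx: "face K n e a x \<in> cells K n'"
    unfolding face_def using precub_act[OF K b Cons.prems(3)] by (simp add: n'_def)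
  have as': "set as \<subseteq> {..<n'}" using as a n by force
  have dist: "distinct as" using Cons.prems(1) by (induction as) auto
  define l where "l = n' - length as"
  have l: "n - length (a # as) = l" by (simp add: n l_def)
  define w' where "w' = set_word n' e (set as)"
  have sw: "free_count w' = l" unfolding w'_def l_def using free_count_set_word[OF as'] distinct_card[OF dist] by simp
  have lw: "length w' = n'" by (simp add: w'_def set_word_def)
  have box': "box l n' (\<lambda>v\<in>verts l. fill w' v)" using box_fill[OF sw] lw by simp
  have "iterated_face K n e (a # as) x = iterated_face K n' e as (face K n e a x)" by (simp add: n'_def)
  also have "\<dots> = act K l n' (\<lambda>v\<in>verts l. fill w' v) (face K n e a x)"
    unfolding l_def w'_def by (rule Cons.IH[OF _ as' fx]) (use Cons.prems(1) in simp)
  also have "\<dots> = act K l n (compose (verts l) (coface n' a e) (\<lambda>v\<in>verts l. fill w' v)) x"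
    unfolding face_def using precub_comp[OF K box' b Cons.prems(3)] by (simp add: n'_def)
  also have "compose (verts l) (coface n' a e) (\<lambda>v\<in>verts l. fill w' v) =
      (\<lambda>v\<in>verts l. fill (set_word n e (set (a # as))) v)"
    unfolding compose_def
  proof (rule restrict_ext)
    fix v assume v: "v \<in> verts l"
    have "set_word n e (set (a # as)) = take a w' @ Some e # drop a w'"
    proof (rule nth_equalityI)
      show "length (set_word n e (set (a # as))) = length (take a w' @ Some e # drop a w')"
        using lw n a by (simp add: set_word_def)
      fix i assume "i < length (set_word n e (set (a # as)))"
      then have i: "i < n" by (simp add: set_word_def)
      show "set_word n e (set (a # as)) ! i = (take a w' @ Some e # drop a w') ! i"
      proof (cases "i \<le> a")
        case True
        then show ?thesis using i a n lw by (auto simp: nth_append set_word_def w'_def)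
      next
        case False
        then obtain k where k: "i = Suc k" "a \<le> k" by (cases i) auto
        have kn: "k < n'" using k(1) i n by simp
        have "(take a w' @ Some e # drop a w') ! i = w' ! k"
          using k a n lw kn by (simp add: nth_append Suc_diff_le)
        also have "w' ! k = None" using kn as k(2) by (auto simp: w'_def set_word_def)
        finally show ?thesis using i k as by (auto simp: set_word_def)
      qed
    qed
    moreover have "fill (take a w' @ Some e # drop a w') v = take a (fill w' v) @ e # drop a (fill w' v)"
    proof -
      have "free_count (take a w' @ drop a w') = free_count (take a w') + free_count (drop a w')" by (rule count_list_append)
      then have "free_count (take a w') \<le> length v" using sw v by simp
      then have "fill (take a w' @ drop a w') v = fill (take a w') (take (free_count (take a w')) v) @ fill (drop a w') (drop (free_count (take a w')) v)"
        "fill (take a w' @ Some e # drop a w') v = fill (take a w') (take (free_count (take a w')) v) @ e # fill (drop a w') (drop (free_count (take a w')) v)"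
        by (simp_all only: fill_append fill.simps)
      moreover have "a \<le> length w'" using lw a n by simp
      ultimately show ?thesis by simp
    qed
    ultimately show "coface n' a e ((\<lambda>v\<in>verts l. fill w' v) v) = fill (set_word n e (set (a # as))) v"
      using v lw by (simp add: coface_apply)
  qed
  finally show ?case unfolding l .
qed

definition indicator :: "nat set \<Rightarrow> nat \<Rightarrow> bool list"
  where "indicator A n = map (\<lambda>c. c \<in> A) [0..<n]"

lemma length_indicator [simp]: "length (indicator A n) = n"
  by (simp add: indicator_def)

lemma diff_coords_indicator:
  assumes "A \<union> B = {..<n}" "A \<inter> B = {}"
  shows "diff_coords (zeros n) (indicator A n) = A" "diff_coords (indicator A n) (ones n) = B"
proof -
  have A: "x < n" if "x \<in> A" for x using assms(1) that by blast
  have B: "x < n" if "x \<in> B" for x using assms(1) that by blast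
  have AB: "x \<in> B \<longleftrightarrow> x \<notin> A" if "x < n" for x using assms that by blast
  show "diff_coords (zeros n) (indicator A n) = A" using A by (auto simp: diff_coords_def indicator_def)
  show "diff_coords (indicator A n) (ones n) = B" using B AB assms(2) by (auto simp: diff_coords_def indicator_def)
qed

lemma vertex_le_indicator: "vertex_le (zeros n) (indicator A n)" "vertex_le (indicator A n) (ones n)"
  by (simp_all add: vertex_le_zeros_ones)

text \<open>The two faces occurring in the elementary maps of cube chains are those between \<open>0\<close>, the indicator of
  \<open>A\<close>, and \<open>1\<close>.\<close>

lemma face_set_eq_subcube_map:
  assumes K: "precubical_set K" and x: "x \<in> cells K n" and AB: "A \<union> B = {..<n}" "A \<inter> B = {}"
  shows "face_set K n False B x = act K (card A) n (subcube_map (zeros n) (indicator A n)) x"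
    and "face_set K n True A x = act K (card B) n (subcube_map (indicator A n) (ones n)) x"
proof -
  have fin: "finite A" "finite B" using AB(1) by (metis finite_Un finite_lessThan)+
  have cn: "card A + card B = n" using AB fin by (metis card_Un_disjoint card_lessThan)
  have sA: "A \<subseteq> {..<n}" and sB: "B \<subseteq> {..<n}" and cA: "n - card A = card B" and cB: "n - card B = card A"
    using AB(1) cn by auto
  have gen: "face_set K n e C x = act K (n - card C) n (\<lambda>v\<in>verts (n - card C). fill (set_word n e C) v) x"
    if "C \<subseteq> {..<n}" "finite C" for e C
    unfolding face_set_def using iterated_face_set_word[OF K, of "rev (sorted_list_of_set C)" n x e] that x
    by (simp add: sorted_wrt_rev)
  have w: "cube_word (zeros n) (indicator A n) = set_word n False B" "cube_word (indicator A n) (ones n) = set_word n True A"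
    using AB by (auto intro!: nth_equalityI simp: cube_word_def set_word_def indicator_def)
  show "face_set K n False B x = act K (card A) n (subcube_map (zeros n) (indicator A n)) x"
    using gen[OF sB fin(2), of False] cB by (simp only: subcube_map_def diff_coords_indicator[OF AB] w)
  show "face_set K n True A x = act K (card B) n (subcube_map (indicator A n) (ones n)) x"
    using gen[OF sA fin(1), of True] cA by (simp only: subcube_map_def diff_coords_indicator[OF AB] w)
qed


section \<open>Composition in a subcube\<close>

text \<open>Among the coordinates that change between \<open>\<alpha>\<close> and \<open>\<gamma>\<close>, numbered increasingly, those that change
  already between \<open>\<alpha>\<close> and \<open>\<beta>\<close>.\<close>

definition first_coords :: "bool list \<Rightarrow> bool list \<Rightarrow> bool list \<Rightarrow> nat set" where
  "first_coords \<alpha> \<beta> \<gamma> = {k. k < diff_dim \<alpha> \<gamma> \<and> sorted_list_of_set (diff_coords \<alpha> \<gamma>) ! k \<in> diff_coords \<alpha> \<beta>}"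

lemma vertex_le_nth: "vertex_le \<alpha> \<beta> \<Longrightarrow> c < length \<alpha> \<Longrightarrow> \<alpha> ! c \<Longrightarrow> \<beta> ! c"
  unfolding vertex_le_def list_all2_conv_all_nth by auto

lemma diff_coords_split:
  assumes "vertex_le \<alpha> \<beta>" "vertex_le \<beta> \<gamma>"
  shows "diff_coords \<alpha> \<gamma> = diff_coords \<alpha> \<beta> \<union> diff_coords \<beta> \<gamma>" "diff_coords \<alpha> \<beta> \<inter> diff_coords \<beta> \<gamma> = {}"
  using assms vertex_le_nth[OF assms(1)] vertex_le_nth[OF assms(2)] vertex_le_length[OF assms(1)]
  by (auto simp: diff_coords_def)

lemma diff_dim_split: "vertex_le \<alpha> \<beta> \<Longrightarrow> vertex_le \<beta> \<gamma> \<Longrightarrow> diff_dim \<alpha> \<gamma> = diff_dim \<alpha> \<beta> + diff_dim \<beta> \<gamma>"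
  using diff_coords_split[of \<alpha> \<beta> \<gamma>] by (simp add: card_Un_disjoint)

lemma rank_reindex:
  assumes D: "finite D" and C: "C \<subseteq> D" and k: "k < card D"
  shows "rank {i. i < card D \<and> sorted_list_of_set D ! i \<in> C} k = card {j \<in> C. j < sorted_list_of_set D ! k}"
    and "card {i. i < card D \<and> sorted_list_of_set D ! i \<in> C} = card C"
proof -
  define L where "L = sorted_list_of_set D"
  have len: "length L = card D" by (simp add: L_def)
  have dist: "distinct L" by (simp add: L_def)
  have set: "set L = D" using D by (simp add: L_def)
  have sorted: "sorted_wrt (<) L" by (simp add: L_def)
  have less: "L ! i < L ! j \<longleftrightarrow> i < j" if "i < card D" "j < card D" for i j
    using sorted_wrt_nth_less[OF sorted, of i j] sorted_wrt_nth_less[OF sorted, of j i] that len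
    by (metis less_asym nat_neq_iff)
  have inj: "inj_on ((!) L) {..<card D}" using dist len by (auto simp: inj_on_def nth_eq_iff_index_eq)
  have "(!) L ` {i. i < card D \<and> L ! i \<in> C \<and> i < k} = {j \<in> C. j < L ! k}"
  proof (intro equalityI subsetI)
    fix j assume j: "j \<in> {j \<in> C. j < L ! k}"
    then obtain i where "i < card D" "L ! i = j" using C set len by (metis (mono_tags) in_set_conv_nth mem_Collect_eq subsetD)
    then show "j \<in> (!) L ` {i. i < card D \<and> L ! i \<in> C \<and> i < k}" using j less[of i k] k by auto
  qed (use less k in auto)
  moreover have "card ((!) L ` {i. i < card D \<and> L ! i \<in> C \<and> i < k}) = card {i. i < card D \<and> L ! i \<in> C \<and> i < k}"
    by (intro card_image inj_on_subset[OF inj]) auto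
  ultimately show "rank {i. i < card D \<and> sorted_list_of_set D ! i \<in> C} k = card {j \<in> C. j < sorted_list_of_set D ! k}"
    by (simp add: rank_def L_def conj_assoc)
  have "(!) L ` {i. i < card D \<and> L ! i \<in> C} = C"
  proof (intro equalityI subsetI)
    fix j assume j: "j \<in> C"
    then obtain i where "i < card D" "L ! i = j" using C set len by (metis in_set_conv_nth subsetD)
    then show "j \<in> (!) L ` {i. i < card D \<and> L ! i \<in> C}" using j by auto
  qed auto
  moreover have "card ((!) L ` {i. i < card D \<and> L ! i \<in> C}) = card {i. i < card D \<and> L ! i \<in> C}"
    by (intro card_image inj_on_subset[OF inj]) auto
  ultimately show "card {i. i < card D \<and> sorted_list_of_set D ! i \<in> C} = card C" by (simp add: L_def)
qed

lemma first_coords_props: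
  assumes "vertex_le \<alpha> \<beta>" "vertex_le \<beta> \<gamma>"
  shows "first_coords \<alpha> \<beta> \<gamma> \<subseteq> {..<diff_dim \<alpha> \<gamma>}" "card (first_coords \<alpha> \<beta> \<gamma>) = diff_dim \<alpha> \<beta>"
    "card ({..<diff_dim \<alpha> \<gamma>} - first_coords \<alpha> \<beta> \<gamma>) = diff_dim \<beta> \<gamma>"
proof -
  show 1: "first_coords \<alpha> \<beta> \<gamma> \<subseteq> {..<diff_dim \<alpha> \<gamma>}" by (auto simp: first_coords_def)
  show 2: "card (first_coords \<alpha> \<beta> \<gamma>) = diff_dim \<alpha> \<beta>"
  proof (cases "diff_dim \<alpha> \<gamma> = 0")
    case True
    then show ?thesis using diff_dim_split[OF assms] by (simp add: first_coords_def)
  next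
    case False
    then have "0 < diff_dim \<alpha> \<gamma>" by (rule neq0_conv[THEN iffD1])
    from rank_reindex(2)[OF finite_diff_coords _ this, of "diff_coords \<alpha> \<beta>"] diff_coords_split(1)[OF assms]
    show ?thesis unfolding first_coords_def by blast
  qed
  have "finite (first_coords \<alpha> \<beta> \<gamma>)" using 1 finite_subset by blast
  then show "card ({..<diff_dim \<alpha> \<gamma>} - first_coords \<alpha> \<beta> \<gamma>) = diff_dim \<beta> \<gamma>"
    using 1 2 diff_dim_split[OF assms] by (simp add: card_Diff_subset)
qed

text \<open>A coordinate that changes between \<open>\<alpha>\<close> and \<open>\<gamma>\<close> is \<open>0\<close> at \<open>\<alpha>\<close> and \<open>1\<close> at \<open>\<gamma>\<close>, so the constant value
  used by \<open>to_subcube\<close> is \<open>0\<close> during the first path and \<open>1\<close> during the second.\<close>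

lemma cube_comp_eq_join_paths:
  assumes ab: "vertex_le \<alpha> \<beta>" and bg: "vertex_le \<beta> \<gamma>"
  shows "cube_comp \<alpha> \<beta> \<gamma> x y = join_paths (diff_dim \<alpha> \<gamma>) (first_coords \<alpha> \<beta> \<gamma>) x y"
proof -
  let ?A = "first_coords \<alpha> \<beta> \<gamma>"
  define D where "D = diff_coords \<alpha> \<gamma>"
  define L where "L = sorted_list_of_set D"
  have D: "finite D" by (simp add: D_def)
  note split = diff_coords_split[OF ab bg]
  have lb: "length \<beta> = length \<alpha>" using vertex_le_length[OF ab] by simp
  note cA = first_coords_props(2)[OF ab bg]
  note dcs = diff_dim_split[OF ab bg]
  show ?thesis
    unfolding cube_comp_def from_subcube_def join_paths_def
  proof (intro restrict_ext)
    fix t k assume t: "t \<in> {0..real (diff_dim \<alpha> \<gamma>)}" and k: "k \<in> {..<diff_dim \<alpha> \<gamma>}"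
    define c where "c = L ! k"
    have cD: "c \<in> D" unfolding c_def L_def using k D nth_mem[of k "sorted_list_of_set D"] by (simp add: D_def)
    have cl: "c < length \<alpha>" using cD by (simp add: D_def diff_coords_def)
    have kA: "k \<in> ?A \<longleftrightarrow> c \<in> diff_coords \<alpha> \<beta>" using k by (simp add: first_coords_def c_def L_def D_def)
    have kB: "k \<notin> ?A \<longleftrightarrow> c \<in> diff_coords \<beta> \<gamma>" using kA cD split by (auto simp: D_def)
    have rA: "rank ?A k = card {j \<in> diff_coords \<alpha> \<beta>. j < c}"
      unfolding first_coords_def using rank_reindex(1)[OF D, of "diff_coords \<alpha> \<beta>" k] k split
      by (simp add: c_def L_def D_def)
    have "{..<diff_dim \<alpha> \<gamma>} - ?A = {i. i < card D \<and> sorted_list_of_set D ! i \<in> diff_coords \<beta> \<gamma>}"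
    proof (intro set_eqI)
      fix i
      have "sorted_list_of_set D ! i \<in> D" if "i < card D"
        using nth_mem[of i "sorted_list_of_set D"] that D by simp
      then show "i \<in> {..<diff_dim \<alpha> \<gamma>} - ?A \<longleftrightarrow> i \<in> {i. i < card D \<and> sorted_list_of_set D ! i \<in> diff_coords \<beta> \<gamma>}"
        using split by (auto simp: first_coords_def D_def)
    qed
    then have rB: "rank ({..<diff_dim \<alpha> \<gamma>} - ?A) k = card {j \<in> diff_coords \<beta> \<gamma>. j < c}"
      using rank_reindex(1)[OF D, of "diff_coords \<beta> \<gamma>" k] k split
      by (simp add: c_def L_def D_def)
    have a0: "\<not> \<alpha> ! c" using cD vertex_le_nth[OF vertex_le_trans[OF ab bg], of c] by (auto simp: D_def diff_coords_def)
    have b1: "\<beta> ! c" if "c \<in> diff_coords \<alpha> \<beta>" using that a0 by (auto simp: diff_coords_def)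
    have "moore (diff_dim \<alpha> \<beta>) (diff_dim \<beta> \<gamma>) (to_subcube \<alpha> \<beta> x) (to_subcube \<beta> \<gamma> y) t c =
      (if t \<le> real (diff_dim \<alpha> \<beta>) then to_subcube \<alpha> \<beta> x t c else to_subcube \<beta> \<gamma> y (t - real (diff_dim \<alpha> \<beta>)) c)"
      using t by (simp add: moore_def dcs)
    also have "\<dots> = (if t \<le> real (card ?A) then if k \<in> ?A then x t (rank ?A k) else 0
          else if k \<in> ?A then 1 else y (t - real (card ?A)) (rank ({..<diff_dim \<alpha> \<gamma>} - ?A) k))"
    proof (cases "t \<le> real (diff_dim \<alpha> \<beta>)")
      case True
      then show ?thesis using t cl a0 kA by (simp add: cA to_subcube_def rA)
    next
      case False
      then have "t - real (diff_dim \<alpha> \<beta>) \<in> {0..real (diff_dim \<beta> \<gamma>)}" using t by (simp add: dcs)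
      then show ?thesis using False cl b1 kA kB lb by (auto simp: cA to_subcube_def rB)
    qed
    finally show "moore (diff_dim \<alpha> \<beta>) (diff_dim \<beta> \<gamma>) (to_subcube \<alpha> \<beta> x) (to_subcube \<beta> \<gamma> y) t
        (sorted_list_of_set (diff_coords \<alpha> \<gamma>) ! k) = (if t \<le> real (card ?A) then if k \<in> ?A then x t (rank ?A k) else 0
          else if k \<in> ?A then 1 else y (t - real (card ?A)) (rank ({..<diff_dim \<alpha> \<gamma>} - ?A) k))"
      by (simp only: c_def L_def D_def)
  qed
qed

lemma natural_path_cube_comp:
  assumes "vertex_le \<alpha> \<beta>" "vertex_le \<beta> \<gamma>" "natural_path (diff_dim \<alpha> \<beta>) x" "natural_path (diff_dim \<beta> \<gamma>) y"
  shows "natural_path (diff_dim \<alpha> \<gamma>) (cube_comp \<alpha> \<beta> \<gamma> x y)"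
proof -
  have "diff_dim \<alpha> \<gamma> - diff_dim \<alpha> \<beta> = diff_dim \<beta> \<gamma>" using diff_dim_split[OF assms(1,2)] by simp
  then show ?thesis
    unfolding cube_comp_eq_join_paths[OF assms(1,2)] using assms first_coords_props[OF assms(1,2)]
    by (intro natural_path_join_paths) simp_all
qed

lemma first_coords_indicator:
  assumes "A \<subseteq> {..<n}" shows "first_coords (zeros n) (indicator A n) (ones n) = A"
proof -
  have D: "diff_coords (zeros n) (ones n) = {..<n}" by (auto simp: diff_coords_def)
  have "sorted_list_of_set {..<n} = [0..<n]" by (simp add: lessThan_atLeast0)
  moreover have "diff_coords (zeros n) (indicator A n) = A"
    using diff_coords_indicator(1)[of A "{..<n} - A" n] assms by auto
  ultimately show ?thesis unfolding first_coords_def D using assms by auto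
qed

text \<open>This brings a composition in a face of any cube into the form that occurs in the elementary maps of cube
  chains, namely a composition through an intermediate vertex of a cube of its own dimension.\<close>

lemma cube_comp_normalize:
  assumes "vertex_le \<alpha> \<beta>" "vertex_le \<beta> \<gamma>"
  shows "cube_comp \<alpha> \<beta> \<gamma> x y = cube_comp (zeros (diff_dim \<alpha> \<gamma>)) (indicator (first_coords \<alpha> \<beta> \<gamma>) (diff_dim \<alpha> \<gamma>)) (ones (diff_dim \<alpha> \<gamma>)) x y"
  by (simp add: cube_comp_eq_join_paths[OF assms] cube_comp_eq_join_paths[OF vertex_le_indicator]
      first_coords_indicator[OF first_coords_props(1)[OF assms]])

lemma sorted_diff_coords_Cons:
  "sorted_list_of_set (diff_coords (a # \<alpha>) (b # \<beta>)) =
    (if a = b then [] else [0]) @ map Suc (sorted_list_of_set (diff_coords \<alpha> \<beta>))"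
proof -
  let ?xs = "(if a = b then [] else [0]) @ map Suc (sorted_list_of_set (diff_coords \<alpha> \<beta>))"
  have "sorted_list_of_set (set ?xs) = ?xs"
    by (rule sorted_list_of_set.idem_if_sorted_distinct) (auto simp: distinct_map sorted_map)
  moreover have "set ?xs = diff_coords (a # \<alpha>) (b # \<beta>)" by (simp add: diff_coords_Cons)
  ultimately show ?thesis by simp
qed

text \<open>Where \<open>\<alpha>\<close> and \<open>\<gamma>\<close> agree, \<open>\<beta>\<close> agrees with both. At the other coordinates \<open>\<alpha>\<close> is \<open>0\<close>, so \<open>\<beta>\<close> is \<open>1\<close> exactly
  where it differs from \<open>\<alpha>\<close>.\<close>

lemma fill_middle:
  assumes "vertex_le \<alpha> \<beta>" "vertex_le \<beta> \<gamma>"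
  shows "fill (cube_word \<alpha> \<gamma>) (map (\<lambda>c. c \<in> diff_coords \<alpha> \<beta>) (sorted_list_of_set (diff_coords \<alpha> \<gamma>))) = \<beta>"
  using assms
proof (induction \<alpha> arbitrary: \<beta> \<gamma>)
  case Nil
  then show ?case by (simp add: vertex_le_def)
next
  case (Cons a \<alpha>)
  obtain b \<beta>' where b: "\<beta> = b # \<beta>'" using Cons.prems by (cases \<beta>) auto
  obtain g \<gamma>' where g: "\<gamma> = g # \<gamma>'" using Cons.prems b by (cases \<gamma>) auto
  have IH: "fill (cube_word \<alpha> \<gamma>') (map (\<lambda>c. c \<in> diff_coords \<alpha> \<beta>') (sorted_list_of_set (diff_coords \<alpha> \<gamma>'))) = \<beta>'"
    using Cons b g by simp
  have "Suc c \<in> diff_coords (a # \<alpha>) (b # \<beta>') \<longleftrightarrow> c \<in> diff_coords \<alpha> \<beta>'" for c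
    by (simp add: diff_coords_def)
  moreover have "0 \<in> diff_coords (a # \<alpha>) (b # \<beta>') \<longleftrightarrow> a \<noteq> b" by (simp add: diff_coords_def)
  ultimately show ?case
    using Cons.prems IH unfolding b g sorted_diff_coords_Cons by (auto simp: o_def)
qed

lemma subcube_map_middle:
  assumes ab: "vertex_le \<alpha> \<beta>" and bg: "vertex_le \<beta> \<gamma>"
  shows "subcube_map \<alpha> \<gamma> (indicator (first_coords \<alpha> \<beta> \<gamma>) (diff_dim \<alpha> \<gamma>)) = \<beta>"
proof -
  note fill_middle[OF assms]
  moreover have "indicator (first_coords \<alpha> \<beta> \<gamma>) (diff_dim \<alpha> \<gamma>) = map (\<lambda>c. c \<in> diff_coords \<alpha> \<beta>) (sorted_list_of_set (diff_coords \<alpha> \<gamma>))"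
    by (rule nth_equalityI) (simp_all add: indicator_def first_coords_def)
  ultimately show ?thesis by (simp add: subcube_map_apply)
qed

section \<open>Wedges of cubes\<close>

lemma equiv_equiv_gen:
  assumes "R \<subseteq> A \<times> A" shows "equiv A (equiv_gen A R)"
  unfolding equiv_gen_def
proof (rule equiv_INT)
  have "equiv A (A \<times> A)" by (auto simp: equiv_def refl_on_def sym_def trans_def)
  then show "{E. equiv A E \<and> R \<subseteq> E} \<noteq> {}" using assms by blast
qed blast

lemma equiv_gen_contains: "R \<subseteq> equiv_gen A R"
  unfolding equiv_gen_def by blast

lemma equiv_gen_least: "equiv A E \<Longrightarrow> R \<subseteq> E \<Longrightarrow> equiv_gen A R \<subseteq> E"
  unfolding equiv_gen_def by blast

lemma box_compose_id: "box m n \<phi> \<Longrightarrow> compose (verts m) \<phi> (\<lambda>v\<in>verts m. v) = \<phi>"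
  by (rule extensionalityI[of _ "verts m"]) (simp_all add: compose_def box_extensional)

lemma box_id_compose: "box m n \<phi> \<Longrightarrow> compose (verts m) (\<lambda>v\<in>verts n. v) \<phi> = \<phi>"
  by (rule extensionalityI[of _ "verts m"]) (simp_all add: compose_def box_extensional box_length)

lemma box_compose_assoc:
  "box l m \<psi> \<Longrightarrow> compose (verts l) (compose (verts m) \<phi> \<eta>) \<psi> = compose (verts l) \<phi> (compose (verts l) \<eta> \<psi>)"
  unfolding compose_def by (rule restrict_ext) (simp add: box_length)

abbreviation wedge_gen :: "nat list \<Rightarrow> nat \<Rightarrow> ((nat \<times> (bool list \<Rightarrow> bool list)) \<times> (nat \<times> (bool list \<Rightarrow> bool list))) set" where
  "wedge_gen ns d \<equiv> {((i, vertex_cell (ones (ns ! i))), (Suc i, vertex_cell (zeros (ns ! Suc i)))) | i.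
      d = 0 \<and> Suc i < length ns}"

lemma wedge_gen_subset: "wedge_gen ns d \<subseteq> wedge_cells ns d \<times> wedge_cells ns d"
  by (auto simp: wedge_cells_def box_vertex_cell)

lemma equiv_wedge_rel: "equiv (wedge_cells ns d) (wedge_rel ns d)"
  unfolding wedge_rel_def by (rule equiv_equiv_gen[OF wedge_gen_subset])

lemma wedge_rel_least:
  assumes "equiv (wedge_cells ns d) E"
    "\<And>i. d = 0 \<Longrightarrow> Suc i < length ns \<Longrightarrow>
      ((i, vertex_cell (ones (ns ! i))), (Suc i, vertex_cell (zeros (ns ! Suc i)))) \<in> E"
  shows "wedge_rel ns d \<subseteq> E"
  unfolding wedge_rel_def using assms by (intro equiv_gen_least) auto

lemma wedge_rel_link:
  assumes "Suc i < length ns"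
  shows "((i, vertex_cell (ones (ns ! i))), (Suc i, vertex_cell (zeros (ns ! Suc i)))) \<in> wedge_rel ns 0"
  unfolding wedge_rel_def by (rule subsetD[OF equiv_gen_contains]) (use assms in auto)

lemma wclass_link:
  assumes "Suc i < length ns"
  shows "wclass ns 0 i (vertex_cell (ones (ns ! i))) = wclass ns 0 (Suc i) (vertex_cell (zeros (ns ! Suc i)))"
  unfolding wclass_def by (rule equiv_class_eq[OF equiv_wedge_rel wedge_rel_link[OF assms]])

lemma cells_wedge: "cells (wedge ns) d = wedge_cells ns d // wedge_rel ns d"
  by (simp add: wedge_def)

lemma wclass_in_cells: "i < length ns \<Longrightarrow> box d (ns ! i) \<phi> \<Longrightarrow> wclass ns d i \<phi> \<in> cells (wedge ns) d"
  unfolding cells_wedge wclass_def by (rule quotientI) (simp add: wedge_cells_def)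

lemma wedge_cellE:
  assumes "C \<in> cells (wedge ns) d"
  obtains i \<phi> where "i < length ns" "box d (ns ! i) \<phi>" "C = wclass ns d i \<phi>"
proof -
  obtain p where p: "p \<in> wedge_cells ns d" "C = wedge_rel ns d `` {p}"
    using assms unfolding cells_wedge by (rule quotientE)
  obtain i \<phi> where ip: "p = (i, \<phi>)" by fastforce
  show ?thesis
    by (rule that[of i \<phi>]) (use p in \<open>simp_all add: ip wedge_cells_def wclass_def\<close>)
qed

text \<open>Only vertices are identified, and the only morphism of the box category into \<open>[0]\<close> is the identity, so
  faces respect the identifications.\<close>

lemma wedge_rel_compose:
  assumes "((i, \<phi>), (j, \<psi>)) \<in> wedge_rel ns d" and chi: "box m d \<eta>"
  shows "((i, compose (verts m) \<phi> \<eta>), (j, compose (verts m) \<psi> \<eta>)) \<in> wedge_rel ns m"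
proof -
  let ?h = "\<lambda>p. (fst p, compose (verts m) (snd p) \<eta>)"
  let ?E = "{(p, q). p \<in> wedge_cells ns d \<and> q \<in> wedge_cells ns d \<and> (?h p, ?h q) \<in> wedge_rel ns m}"
  have h: "?h p \<in> wedge_cells ns m" if "p \<in> wedge_cells ns d" for p
    using that box_comp[OF chi] by (auto simp: wedge_cells_def)
  note R = equiv_wedge_rel[of ns m]
  have "equiv (wedge_cells ns d) ?E"
  proof (rule equivI)
    show "?E \<subseteq> wedge_cells ns d \<times> wedge_cells ns d" by auto
    show "refl_on (wedge_cells ns d) ?E"
      using h R unfolding refl_on_def equiv_def by auto
    show "sym ?E" using R unfolding equiv_def sym_def by blast
    show "trans ?E" using R unfolding equiv_def trans_def by blast
  qed
  then have "wedge_rel ns d \<subseteq> ?E"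
  proof (rule wedge_rel_least)
    fix k assume d: "d = 0" and k: "Suc k < length ns"
    have m: "m = 0" "\<eta> = (\<lambda>v\<in>verts 0. v)" using box_0[of m \<eta>] chi d by auto
    have "(?h (k, vertex_cell (ones (ns ! k))), ?h (Suc k, vertex_cell (zeros (ns ! Suc k)))) \<in> wedge_rel ns m"
      using wedge_rel_link[OF k] unfolding fst_conv snd_conv m
        box_compose_id[OF box_vertex_cell[OF length_replicate]] .
    then show "((k, vertex_cell (ones (ns ! k))), (Suc k, vertex_cell (zeros (ns ! Suc k)))) \<in> ?E"
      using d k by (simp add: wedge_cells_def box_vertex_cell)
  qed
  then show ?thesis using assms(1) by auto
qed

lemma act_wedge:
  assumes i: "i < length ns" "box d (ns ! i) \<phi>" and chi: "box m d \<eta>"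
  shows "act (wedge ns) m d \<eta> (wclass ns d i \<phi>) = wclass ns m i (compose (verts m) \<phi> \<eta>)"
proof -
  have self: "(i, \<phi>) \<in> wclass ns d i \<phi>"
    unfolding wclass_def using i by (intro equiv_class_self[OF equiv_wedge_rel]) (simp add: wedge_cells_def)
  have "wclass ns m j (compose (verts m) \<psi> \<eta>) = wclass ns m i (compose (verts m) \<phi> \<eta>)"
    if "(j, \<psi>) \<in> wclass ns d i \<phi>" for j \<psi>
    using wedge_rel_compose[OF _ chi, of i \<phi> j \<psi>] that equiv_class_eq[OF equiv_wedge_rel]
    unfolding wclass_def by blast
  then have "(\<Union>(j, \<psi>)\<in>wclass ns d i \<phi>. wclass ns m j (compose (verts m) \<psi> \<eta>)) =
      (\<Union>_\<in>wclass ns d i \<phi>. wclass ns m i (compose (verts m) \<phi> \<eta>))"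
    by (intro SUP_cong refl) auto
  also have "\<dots> = wclass ns m i (compose (verts m) \<phi> \<eta>)" using self by auto
  finally show ?thesis by (simp add: wedge_def)
qed

lemma precubical_wedge: "precubical_set (wedge ns)"
  unfolding precubical_set_def
proof (intro conjI allI impI ballI)
  fix m n \<phi> x assume phi: "box m n \<phi>" and x: "x \<in> cells (wedge ns) n"
  obtain i \<psi> where i: "i < length ns" "box n (ns ! i) \<psi>" "x = wclass ns n i \<psi>" using x by (rule wedge_cellE)
  show "act (wedge ns) m n \<phi> x \<in> cells (wedge ns) m"
    unfolding i(3) act_wedge[OF i(1,2) phi] by (rule wclass_in_cells[OF i(1) box_comp[OF phi i(2)]])
next
  fix n x assume x: "x \<in> cells (wedge ns) n"
  obtain i \<psi> where i: "i < length ns" "box n (ns ! i) \<psi>" "x = wclass ns n i \<psi>" using x by (rule wedge_cellE)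
  show "act (wedge ns) n n (\<lambda>v\<in>verts n. v) x = x"
    unfolding i(3) act_wedge[OF i(1,2) box_id] box_compose_id[OF i(2)] ..
next
  fix l m n \<psi> \<phi> x assume b: "box l m \<psi> \<and> box m n \<phi>" and x: "x \<in> cells (wedge ns) n"
  obtain i \<eta> where i: "i < length ns" "box n (ns ! i) \<eta>" "x = wclass ns n i \<eta>" using x by (rule wedge_cellE)
  have b1: "box l m \<psi>" and b2: "box m n \<phi>" using b by auto
  show "act (wedge ns) l n (compose (verts l) \<phi> \<psi>) x = act (wedge ns) l m \<psi> (act (wedge ns) m n \<phi> x)"
    unfolding i(3) act_wedge[OF i(1,2) b2] act_wedge[OF i(1,2) box_comp[OF b1 b2]]
      act_wedge[OF i(1) box_comp[OF b2 i(2)] b1] box_compose_assoc[OF b1] ..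
qed

lemma pmapsD:
  assumes "f \<in> pmaps K L"
  shows "f n \<in> extensional (cells K n)" "x \<in> cells K n \<Longrightarrow> f n x \<in> cells L n"
    "box m n \<phi> \<Longrightarrow> x \<in> cells K n \<Longrightarrow> f m (act K m n \<phi> x) = act L m n \<phi> (f n x)"
  using assms unfolding pmaps_def by (auto simp: PiE_iff)

lemma pmap_comp_in: "f \<in> pmaps K L \<Longrightarrow> g \<in> pmaps L M \<Longrightarrow> precubical_set K \<Longrightarrow> pmap_comp K g f \<in> pmaps K M"
  unfolding pmaps_def pmap_comp_def
  by (auto simp: PiE_iff compose_def precub_act Pi_iff)

lemma pmap_id_in: "precubical_set K \<Longrightarrow> pmap_id K \<in> pmaps K K"
  unfolding pmaps_def pmap_id_def by (auto simp: precub_act)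

lemma pmap_comp_apply: "x \<in> cells K n \<Longrightarrow> pmap_comp K g f n x = g n (f n x)"
  by (simp add: pmap_comp_def compose_def)

lemma block_id_in: "i < length ns \<Longrightarrow> block_id ns i \<in> cells (wedge ns) (ns ! i)"
  unfolding block_id_def by (rule wclass_in_cells[OF _ box_id])

lemma wclass_act_block: "i < length ns \<Longrightarrow> box d (ns ! i) \<phi> \<Longrightarrow>
    wclass ns d i \<phi> = act (wedge ns) d (ns ! i) \<phi> (block_id ns i)"
  unfolding block_id_def by (simp only: act_wedge[OF _ box_id] box_id_compose)

text \<open>A cell of a wedge is a face of the top cell of one of the blocks, so a map out of a wedge is determined
  by its values on the top cells.\<close>

lemma pmap_wclass:
  assumes "a \<in> pmaps (wedge ns) K" "i < length ns" "box d (ns ! i) \<phi>"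
  shows "a d (wclass ns d i \<phi>) = act K d (ns ! i) \<phi> (a (ns ! i) (block_id ns i))"
  unfolding wclass_act_block[OF assms(2,3)]
  by (rule pmapsD(3)[OF assms(1,3) block_id_in[OF assms(2)]])

lemma wedge_pmap_ext:
  assumes a: "a \<in> pmaps (wedge ns) K" and b: "b \<in> pmaps (wedge ns) K"
    and eq: "\<And>i. i < length ns \<Longrightarrow> a (ns ! i) (block_id ns i) = b (ns ! i) (block_id ns i)"
  shows "a = b"
proof
  fix d show "a d = b d"
  proof (rule extensionalityI[OF pmapsD(1)[OF a] pmapsD(1)[OF b]])
    fix C assume "C \<in> cells (wedge ns) d"
    then obtain i \<phi> where i: "i < length ns" "box d (ns ! i) \<phi>" "C = wclass ns d i \<phi>" by (rule wedge_cellE)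
    show "a d C = b d C"
      unfolding i(3) pmap_wclass[OF a i(1,2)] pmap_wclass[OF b i(1,2)] eq[OF i(1)] ..
  qed
qed

definition vertex_of :: "'k precub \<Rightarrow> nat \<Rightarrow> 'k \<Rightarrow> bool list \<Rightarrow> 'k"
  where "vertex_of K n c v = act K 0 n (vertex_cell v) c"

lemma vertex_of_act:
  assumes "precubical_set K" "box m n \<phi>" "c \<in> cells K n" "length v = m"
  shows "vertex_of K m (act K m n \<phi> c) v = vertex_of K n c (\<phi> v)"
  unfolding vertex_of_def precub_comp[OF assms(1) box_vertex_cell[OF assms(4)] assms(2,3)] compose_vertex_cell ..

lemma vertex_of_in: "precubical_set K \<Longrightarrow> c \<in> cells K n \<Longrightarrow> length v = n \<Longrightarrow> vertex_of K n c v \<in> cells K 0"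
  unfolding vertex_of_def by (rule precub_act[OF _ box_vertex_cell])

text \<open>The map out of a wedge with prescribed values \<open>cs\<close> on the top cells of the blocks; it exists if the last
  vertex of each value is the first vertex of the next one.\<close>

definition wedge_map :: "'k precub \<Rightarrow> nat list \<Rightarrow> 'k list \<Rightarrow> (wcell, 'k) pmap" where
  "wedge_map K ns cs = (\<lambda>d. \<lambda>C\<in>cells (wedge ns) d. the_elem ((\<lambda>(i, \<phi>). act K d (ns ! i) \<phi> (cs ! i)) ` C))"

text \<open>Pairs with the same prescribed value form an equivalence relation, which contains the generating
  identifications by the matching condition.\<close>

lemma wedge_map_wclass:
  assumes K: "precubical_set K" and cs: "\<And>i. i < length ns \<Longrightarrow> cs ! i \<in> cells K (ns ! i)"
    and link: "\<And>i. Suc i < length ns \<Longrightarrow>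
      vertex_of K (ns ! i) (cs ! i) (ones (ns ! i)) = vertex_of K (ns ! Suc i) (cs ! Suc i) (zeros (ns ! Suc i))"
    and i: "i < length ns" "box d (ns ! i) \<phi>"
  shows "wedge_map K ns cs d (wclass ns d i \<phi>) = act K d (ns ! i) \<phi> (cs ! i)"
proof -
  let ?h = "\<lambda>p. act K d (ns ! fst p) (snd p) (cs ! fst p)"
  let ?E = "{(p, q). p \<in> wedge_cells ns d \<and> q \<in> wedge_cells ns d \<and> ?h p = ?h q}"
  have "equiv (wedge_cells ns d) ?E"
    by (auto simp: equiv_def refl_on_def sym_def trans_def)
  then have "wedge_rel ns d \<subseteq> ?E"
  proof (rule wedge_rel_least)
    fix k assume k: "d = 0" "Suc k < length ns"
    then show "((k, vertex_cell (ones (ns ! k))), (Suc k, vertex_cell (zeros (ns ! Suc k)))) \<in> ?E"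
      using link[OF k(2)] by (simp add: wedge_cells_def box_vertex_cell vertex_of_def)
  qed
  then have "?h p = ?h (i, \<phi>)" if "p \<in> wclass ns d i \<phi>" for p
    using that unfolding wclass_def by fastforce
  moreover have "(i, \<phi>) \<in> wclass ns d i \<phi>"
    unfolding wclass_def using i by (intro equiv_class_self[OF equiv_wedge_rel]) (simp add: wedge_cells_def)
  ultimately have "(\<lambda>(i, \<phi>). act K d (ns ! i) \<phi> (cs ! i)) ` wclass ns d i \<phi> = {?h (i, \<phi>)}"
    by (auto simp: case_prod_beta image_iff Bex_def)
  then show ?thesis unfolding wedge_map_def using wclass_in_cells[OF i] by simp
qed

lemma wedge_map_in_pmaps:
  assumes K: "precubical_set K" and cs: "\<And>i. i < length ns \<Longrightarrow> cs ! i \<in> cells K (ns ! i)"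
    and link: "\<And>i. Suc i < length ns \<Longrightarrow>
      vertex_of K (ns ! i) (cs ! i) (ones (ns ! i)) = vertex_of K (ns ! Suc i) (cs ! Suc i) (zeros (ns ! Suc i))"
  shows "wedge_map K ns cs \<in> pmaps (wedge ns) K"
    and "i < length ns \<Longrightarrow> wedge_map K ns cs (ns ! i) (block_id ns i) = cs ! i"
proof -
  have W: "wedge_map K ns cs d (wclass ns d i \<phi>) = act K d (ns ! i) \<phi> (cs ! i)"
    if "i < length ns" "box d (ns ! i) \<phi>" for d i \<phi>
    by (rule wedge_map_wclass[OF K _ _ that]) (fact cs link)+
  show "wedge_map K ns cs \<in> pmaps (wedge ns) K"
    unfolding pmaps_def
  proof (rule CollectI, intro conjI allI impI ballI)
    fix n show "wedge_map K ns cs n \<in> cells (wedge ns) n \<rightarrow>\<^sub>E cells K n"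
    proof (rule PiE_I)
      fix C assume "C \<in> cells (wedge ns) n"
      then obtain i \<phi> where i: "i < length ns" "box n (ns ! i) \<phi>" "C = wclass ns n i \<phi>" by (rule wedge_cellE)
      show "wedge_map K ns cs n C \<in> cells K n" unfolding i(3) W[OF i(1,2)] by (rule precub_act[OF K i(2) cs[OF i(1)]])
    qed (simp add: wedge_map_def)
  next
    fix m n \<phi> C assume phi: "box m n \<phi>" and C: "C \<in> cells (wedge ns) n"
    obtain i \<psi> where i: "i < length ns" "box n (ns ! i) \<psi>" "C = wclass ns n i \<psi>" using C by (rule wedge_cellE)
    show "wedge_map K ns cs m (act (wedge ns) m n \<phi> C) = act K m n \<phi> (wedge_map K ns cs n C)"
      unfolding i(3) act_wedge[OF i(1,2) phi] W[OF i(1,2)] W[OF i(1) box_comp[OF phi i(2)]]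
      by (rule precub_comp[OF K phi i(2) cs[OF i(1)], symmetric])
  qed
  show "wedge_map K ns cs (ns ! i) (block_id ns i) = cs ! i" if "i < length ns"
    unfolding block_id_def W[OF that box_id] by (rule precub_id[OF K cs[OF that]])
qed

section \<open>Chains as lists of blocks\<close>

type_synonym 'k block = "nat \<times> 'k \<times> dpath"

abbreviation block_dim :: "'k block \<Rightarrow> nat" where "block_dim b \<equiv> fst b"
abbreviation block_cell :: "'k block \<Rightarrow> 'k" where "block_cell b \<equiv> fst (snd b)"
abbreviation block_path :: "'k block \<Rightarrow> dpath" where "block_path b \<equiv> snd (snd b)"
abbreviation dims :: "'k block list \<Rightarrow> nat list" where "dims bs \<equiv> map fst bs"

definition block_source :: "'k precub \<Rightarrow> 'k block \<Rightarrow> 'k" where "block_source K b = vertex_of K (block_dim b) (block_cell b) (zeros (block_dim b))"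
definition block_target :: "'k precub \<Rightarrow> 'k block \<Rightarrow> 'k" where "block_target K b = vertex_of K (block_dim b) (block_cell b) (ones (block_dim b))"
definition block_ok :: "'k precub \<Rightarrow> 'k block \<Rightarrow> bool" where
  "block_ok K b \<longleftrightarrow> 0 < block_dim b \<and> block_cell b \<in> cells K (block_dim b) \<and> natural_path (block_dim b) (block_path b)"

text \<open>The list is the data of a cube chain from \<open>\<alpha>\<close> to \<open>\<beta>\<close> with a path in each cube.\<close>

fun linked :: "'k precub \<Rightarrow> 'k \<Rightarrow> 'k \<Rightarrow> 'k block list \<Rightarrow> bool" where
  "linked K \<alpha> \<beta> [] \<longleftrightarrow> \<alpha> = \<beta>"
| "linked K \<alpha> \<beta> (b # bs) \<longleftrightarrow> block_ok K b \<and> block_source K b = \<alpha> \<and> linked K (block_target K b) \<beta> bs"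

lemma linked_append: "linked K \<alpha> \<beta> (bs @ cs) \<longleftrightarrow> (\<exists>\<gamma>. linked K \<alpha> \<gamma> bs \<and> linked K \<gamma> \<beta> cs)"
  by (induction bs arbitrary: \<alpha>) auto

lemma linked_nth:
  "bs \<noteq> [] \<Longrightarrow> linked K \<alpha> \<beta> bs \<longleftrightarrow> (\<forall>i<length bs. block_ok K (bs ! i)) \<and> block_source K (bs ! 0) = \<alpha> \<and>
    block_target K (bs ! (length bs - 1)) = \<beta> \<and> (\<forall>i. Suc i < length bs \<longrightarrow> block_target K (bs ! i) = block_source K (bs ! Suc i))"
proof (induction bs arbitrary: \<alpha>)
  case (Cons b bs)
  show ?case
  proof (cases "bs = []")
    case False
    have all: "(\<forall>i<length (b # bs). P ((b # bs) ! i)) \<longleftrightarrow> P b \<and> (\<forall>i<length bs. P (bs ! i))" for P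
      by (simp only: all_set_conv_all_nth[symmetric]) auto
    have "(\<forall>i. Suc i < length (b # bs) \<longrightarrow> block_target K ((b # bs) ! i) = block_source K ((b # bs) ! Suc i)) \<longleftrightarrow>
      block_target K b = block_source K (bs ! 0) \<and> (\<forall>i. Suc i < length bs \<longrightarrow> block_target K (bs ! i) = block_source K (bs ! Suc i))"
    proof -
      have allS: "(\<forall>i. Q i) \<longleftrightarrow> Q 0 \<and> (\<forall>i. Q (Suc i))" for Q :: "nat \<Rightarrow> bool"
        by (metis not0_implies_Suc)
      show ?thesis by (subst allS) (use False in simp)
    qed
    then show ?thesis using False Cons.IH[OF False, of "block_target K b"] all[of "block_ok K"]
      by (auto simp: nth_Cons')
  qed auto
qed simp

definition tuple_of :: "'k precub \<Rightarrow> 'k block list \<Rightarrow> 'k tagged_tuple" where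
  "tuple_of K bs = ((dims bs, wedge_map K (dims bs) (map block_cell bs)), map block_path bs)"

definition blocks :: "'k tagged_tuple \<Rightarrow> 'k block list" where
  "blocks p = (case p of ((ns, a), xs) \<Rightarrow> map (\<lambda>i. (ns ! i, a (ns ! i) (block_id ns i), xs ! i)) [0..<length ns])"

lemma length_blocks [simp]: "length (blocks ((ns, a), xs)) = length ns"
  by (simp add: blocks_def)

lemma nth_blocks [simp]: "i < length ns \<Longrightarrow> blocks ((ns, a), xs) ! i = (ns ! i, a (ns ! i) (block_id ns i), xs ! i)"
  by (simp add: blocks_def)

lemma dims_blocks [simp]: "dims (blocks ((ns, a), xs)) = ns"
  by (rule nth_equalityI) simp_all

lemma topspace_path_tuples:
  "xs \<in> topspace (path_tuples ns) \<longleftrightarrow> length xs = length ns \<and> (\<forall>i<length ns. natural_path (ns ! i) (xs ! i))"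
  unfolding path_tuples_def topspace_delta_gen topspace_pullback_topology topspace_product_topology
  by (auto simp: PiE_iff topspace_natural_dpaths)

lemma blocks_linked:
  assumes K: "precubical_set K" and a: "a \<in> pmaps (wedge ns) K" and ns: "ns \<noteq> []" "0 \<notin> set ns"
    and xs: "xs \<in> topspace (path_tuples ns)"
  shows "linked K (a 0 (wedge_initial ns)) (a 0 (wedge_final ns)) (blocks ((ns, a), xs))"
proof -
  have ne: "blocks ((ns, a), xs) \<noteq> []" using ns by (metis dims_blocks list.simps(8))
  have l0: "0 < length ns" using ns by simp
  have V: "a 0 (wclass ns 0 i (vertex_cell v)) = vertex_of K (ns ! i) (a (ns ! i) (block_id ns i)) v"
    if "i < length ns" "length v = ns ! i" for i v
    unfolding vertex_of_def by (rule pmap_wclass[OF a that(1) box_vertex_cell[OF that(2)]])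
  show ?thesis
    unfolding linked_nth[OF ne]
  proof (intro conjI allI impI)
    show "block_ok K (blocks ((ns, a), xs) ! i)" if "i < length (blocks ((ns, a), xs))" for i
    proof -
      have i: "i < length ns" using that by simp
      have "ns ! i \<noteq> 0" using ns(2) nth_mem[OF i] by metis
      then show ?thesis using i xs pmapsD(2)[OF a block_id_in[OF i]]
        by (simp add: block_ok_def topspace_path_tuples)
    qed
    show "block_source K (blocks ((ns, a), xs) ! 0) = a 0 (wedge_initial ns)"
      using l0 by (simp add: block_source_def wedge_initial_def V)
    show "block_target K (blocks ((ns, a), xs) ! (length (blocks ((ns, a), xs)) - 1)) = a 0 (wedge_final ns)"
      using l0 ns(1) by (simp add: block_target_def wedge_final_def V last_conv_nth)
    show "block_target K (blocks ((ns, a), xs) ! i) = block_source K (blocks ((ns, a), xs) ! Suc i)"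
      if "Suc i < length (blocks ((ns, a), xs))" for i
    proof -
      have i: "i < length ns" "Suc i < length ns" using that by auto
      have "block_target K (blocks ((ns, a), xs) ! i) = a 0 (wclass ns 0 i (vertex_cell (ones (ns ! i))))"
        using i V[OF i(1), of "ones (ns ! i)"] by (simp add: block_target_def)
      also have "\<dots> = block_source K (blocks ((ns, a), xs) ! Suc i)"
        using i V[OF i(2), of "zeros (ns ! Suc i)"] by (simp add: block_source_def wclass_link)
      finally show ?thesis .
    qed
  qed
qed

lemma chains_blocks:
  assumes K: "precubical_set K" and a: "(ns, a) \<in> chains K \<alpha> \<beta> n" and xs: "xs \<in> topspace (path_tuples ns)"
  shows "linked K \<alpha> \<beta> (blocks ((ns, a), xs))" "blocks ((ns, a), xs) \<noteq> []" "sum_list ns = n"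
proof -
  have *: "ns \<noteq> []" "0 \<notin> set ns" "sum_list ns = n" "a \<in> pmaps (wedge ns) K"
    "a 0 (wedge_initial ns) = \<alpha>" "a 0 (wedge_final ns) = \<beta>" using a by (auto simp: chains_def)
  show "linked K \<alpha> \<beta> (blocks ((ns, a), xs))" using blocks_linked[OF K *(4,1,2) xs] *(5,6) by simp
  show "blocks ((ns, a), xs) \<noteq> []" using *(1) by (metis dims_blocks list.simps(8))
  show "sum_list ns = n" by fact
qed

text \<open>Together with \<open>tuple_of_blocks\<close> this says that linked lists of blocks and points of the coproduct over
  all cube chains are the same thing.\<close>

lemma tuple_of_props:
  assumes K: "precubical_set K" and l: "linked K \<alpha> \<beta> bs" and ne: "bs \<noteq> []"
  shows "wedge_map K (dims bs) (map block_cell bs) \<in> pmaps (wedge (dims bs)) K"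
    and "blocks (tuple_of K bs) = bs"
    and "map block_path bs \<in> topspace (path_tuples (dims bs))"
    and "0 \<notin> set (dims bs)"
    and "fst (tuple_of K bs) \<in> chains K \<alpha> \<beta> (sum_list (dims bs))"
proof -
  note L = l[unfolded linked_nth[OF ne]]
  have cs: "map block_cell bs ! i \<in> cells K (dims bs ! i)" if "i < length (dims bs)" for i
    using L that by (simp add: block_ok_def)
  have link: "vertex_of K (dims bs ! i) (map block_cell bs ! i) (ones (dims bs ! i)) =
      vertex_of K (dims bs ! Suc i) (map block_cell bs ! Suc i) (zeros (dims bs ! Suc i))" if "Suc i < length (dims bs)" for i
    using L that by (simp add: block_target_def block_source_def)
  show w: "wedge_map K (dims bs) (map block_cell bs) \<in> pmaps (wedge (dims bs)) K"
    by (rule wedge_map_in_pmaps(1)[OF K cs link])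
  show bl: "blocks (tuple_of K bs) = bs"
  proof (rule nth_equalityI)
    show "length (blocks (tuple_of K bs)) = length bs" by (simp add: tuple_of_def)
    fix i assume "i < length (blocks (tuple_of K bs))"
    then have i: "i < length bs" by (simp add: tuple_of_def)
    then show "blocks (tuple_of K bs) ! i = bs ! i"
      using wedge_map_in_pmaps(2)[OF K cs link, of i] by (simp add: tuple_of_def prod_eq_iff)
  qed
  show xs: "map block_path bs \<in> topspace (path_tuples (dims bs))"
    using L by (simp add: topspace_path_tuples block_ok_def)
  show z: "0 \<notin> set (dims bs)"
  proof
    assume "0 \<in> set (dims bs)"
    then obtain i where "i < length (dims bs)" "dims bs ! i = 0" unfolding in_set_conv_nth by blast
    then show False using L[THEN conjunct1, rule_format, of i] by (simp add: block_ok_def)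
  qed
  have "linked K (wedge_map K (dims bs) (map block_cell bs) 0 (wedge_initial (dims bs)))
      (wedge_map K (dims bs) (map block_cell bs) 0 (wedge_final (dims bs))) bs"
    using blocks_linked[OF K w _ z xs] ne bl by (simp add: tuple_of_def)
  then have "wedge_map K (dims bs) (map block_cell bs) 0 (wedge_initial (dims bs)) = \<alpha>"
    "wedge_map K (dims bs) (map block_cell bs) 0 (wedge_final (dims bs)) = \<beta>"
    using L unfolding linked_nth[OF ne] by auto
  then show "fst (tuple_of K bs) \<in> chains K \<alpha> \<beta> (sum_list (dims bs))"
    using w z ne by (simp add: tuple_of_def chains_def)
qed

lemma tuple_of_blocks:
  assumes K: "precubical_set K" and a: "(ns, a) \<in> chains K \<alpha> \<beta> n" and xs: "xs \<in> topspace (path_tuples ns)"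
  shows "tuple_of K (blocks ((ns, a), xs)) = ((ns, a), xs)"
proof -
  let ?bs = "blocks ((ns, a), xs)"
  note B = chains_blocks[OF K a xs]
  note T = tuple_of_props[OF K B(1,2)]
  have "map block_path ?bs = xs"
    using xs by (intro nth_equalityI) (simp_all add: topspace_path_tuples)
  moreover have "wedge_map K ns (map block_cell ?bs) = a"
  proof (rule wedge_pmap_ext)
    show "wedge_map K ns (map block_cell ?bs) \<in> pmaps (wedge ns) K" using T(1) by simp
    show "a \<in> pmaps (wedge ns) K" using a by (simp add: chains_def)
    fix i assume i: "i < length ns"
    have "blocks (tuple_of K ?bs) ! i = ?bs ! i" unfolding T(2) ..
    then show "wedge_map K ns (map block_cell ?bs) (ns ! i) (block_id ns i) = a (ns ! i) (block_id ns i)"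
      using i by (simp add: tuple_of_def)
  qed
  ultimately show ?thesis by (simp add: tuple_of_def)
qed


lemma wedge_map_block:
  assumes K: "precubical_set K" and l: "linked K \<alpha> \<beta> bs" and i: "i < length bs"
  shows "wedge_map K (dims bs) (map block_cell bs) (block_dim (bs ! i)) (block_id (dims bs) i) = block_cell (bs ! i)"
proof -
  have ne: "bs \<noteq> []" using i by auto
  have "blocks (tuple_of K bs) ! i = bs ! i" unfolding tuple_of_props(2)[OF K l ne] ..
  then show ?thesis using i by (simp add: tuple_of_def prod_eq_iff)
qed

text \<open>Used to read off the blocks of a composite with \<open>b\<close> from the blocks of a map into the wedge.\<close>

lemma map_blocks:
  assumes "length xs = length ms"
  shows "map (\<lambda>q. (block_dim q, b (block_dim q) (block_cell q), block_path q)) (blocks ((ms, pmap_id (wedge ms)), xs)) = blocks ((ms, b), xs)"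
  using assms by (intro nth_equalityI) (simp_all add: pmap_id_def block_id_in)

section \<open>Gluing as merging of blocks\<close>

text \<open>The elementary gluing step: the two faces of the cube \<open>c\<close> determined by a partition of its coordinates
  are replaced by \<open>c\<close> itself, and the two paths by their composite.\<close>

inductive block_merge :: "'k precub \<Rightarrow> 'k block list \<Rightarrow> 'k block list \<Rightarrow> bool" for K where
  block_mergeI: "A \<union> B = {..<n} \<Longrightarrow> A \<inter> B = {} \<Longrightarrow> A \<noteq> {} \<Longrightarrow> B \<noteq> {} \<Longrightarrow> c \<in> cells K n \<Longrightarrow>
    block_merge K
      (L @ [(card A, act K (card A) n (subcube_map (zeros n) (indicator A n)) c, x),
            (card B, act K (card B) n (subcube_map (indicator A n) (ones n)) c, y)] @ R)
      (L @ [(n, c, cube_comp (zeros n) (indicator A n) (ones n) x y)] @ R)"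

context
  fixes n :: nat and A B :: "nat set"
  assumes AB: "A \<union> B = {..<n}" "A \<inter> B = {}"
begin

lemma partition_finite: "finite A" "finite B"
  using AB(1) by (metis finite_Un finite_lessThan)+

lemma partition_card: "card A + card B = n"
  using AB partition_finite by (metis card_Un_disjoint card_lessThan)

lemma partition_diff_dim: "diff_dim (zeros n) (indicator A n) = card A" "diff_dim (indicator A n) (ones n) = card B"
  using diff_coords_indicator[OF AB] by simp_all

lemma partition_box: "box (card A) n (subcube_map (zeros n) (indicator A n))" "box (card B) n (subcube_map (indicator A n) (ones n))"
  using box_subcube_mapI[OF vertex_le_indicator(1)[of n A], of n] box_subcube_mapI[OF vertex_le_indicator(2)[of A n], of n] partition_diff_dim by simp_all

lemma partition_vertex_of:
  assumes K: "precubical_set K" and c: "c \<in> cells K n"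
  shows "vertex_of K (card A) (act K (card A) n (subcube_map (zeros n) (indicator A n)) c) (zeros (card A)) = vertex_of K n c (zeros n)"
    "vertex_of K (card A) (act K (card A) n (subcube_map (zeros n) (indicator A n)) c) (ones (card A)) = vertex_of K n c (indicator A n)"
    "vertex_of K (card B) (act K (card B) n (subcube_map (indicator A n) (ones n)) c) (zeros (card B)) = vertex_of K n c (indicator A n)"
    "vertex_of K (card B) (act K (card B) n (subcube_map (indicator A n) (ones n)) c) (ones (card B)) = vertex_of K n c (ones n)"
  using subcube_map_ends[OF vertex_le_indicator(1)[of n A]] subcube_map_ends[OF vertex_le_indicator(2)[of A n]] partition_diff_dim
  by (simp_all add: vertex_of_act[OF K partition_box(1) c] vertex_of_act[OF K partition_box(2) c])

lemma partition_cells: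
  assumes K: "precubical_set K" and c: "c \<in> cells K n"
  shows "act K (card A) n (subcube_map (zeros n) (indicator A n)) c \<in> cells K (card A)"
    "act K (card B) n (subcube_map (indicator A n) (ones n)) c \<in> cells K (card B)"
  using precub_act[OF K partition_box(1) c] precub_act[OF K partition_box(2) c] by auto

lemma linked_unmerge:
  assumes K: "precubical_set K" and AB': "A \<noteq> {}" "B \<noteq> {}" and c: "c \<in> cells K n"
    and xy: "natural_path (card A) x" "natural_path (card B) y"
    and l: "linked K \<alpha> \<beta> (L @ [(n, c, z)] @ R)"
  shows "linked K \<alpha> \<beta> (L @ [(card A, act K (card A) n (subcube_map (zeros n) (indicator A n)) c, x),
            (card B, act K (card B) n (subcube_map (indicator A n) (ones n)) c, y)] @ R)"
  using l AB' partition_finite xy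
  by (auto simp: linked_append block_ok_def block_source_def block_target_def partition_vertex_of[OF K c] partition_cells[OF K c] card_gt_0_iff)

lemma linked_merge:
  assumes K: "precubical_set K" and c: "c \<in> cells K n"
    and l: "linked K \<alpha> \<beta> (L @ [(card A, act K (card A) n (subcube_map (zeros n) (indicator A n)) c, x),
            (card B, act K (card B) n (subcube_map (indicator A n) (ones n)) c, y)] @ R)"
  shows "linked K \<alpha> \<beta> (L @ [(n, c, cube_comp (zeros n) (indicator A n) (ones n) x y)] @ R)"
    "natural_path (card A) x" "natural_path (card B) y"
proof -
  show xy: "natural_path (card A) x" "natural_path (card B) y"
    using l by (auto simp: linked_append block_ok_def)
  have "natural_path n (cube_comp (zeros n) (indicator A n) (ones n) x y)"
    using natural_path_cube_comp[OF vertex_le_indicator(1)[of n A] vertex_le_indicator(2)[of A n], of x y] xy by (simp add: partition_diff_dim)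
  moreover have "0 < n" using l partition_card by (auto simp: linked_append block_ok_def)
  ultimately show "linked K \<alpha> \<beta> (L @ [(n, c, cube_comp (zeros n) (indicator A n) (ones n) x y)] @ R)"
    using l c by (auto simp: linked_append block_ok_def block_source_def block_target_def partition_vertex_of[OF K c])
qed

end

lemma merge_linked:
  assumes K: "precubical_set K" and m: "block_merge K bs bs'" and l: "linked K \<alpha> \<beta> bs"
  shows "linked K \<alpha> \<beta> bs'"
  using m l
proof (cases rule: block_merge.cases)
  case (block_mergeI A B n c L x y R)
  show ?thesis using linked_merge(1)[OF block_mergeI(3,4) K block_mergeI(7)] l unfolding block_mergeI(1,2) by blast
qed

lemma merge_dims: "block_merge K bs bs' \<Longrightarrow> sum_list (dims bs) = sum_list (dims bs') \<and> bs \<noteq> [] \<and> bs' \<noteq> []"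
proof (induction rule: block_merge.induct)
  case (block_mergeI A B n c L x y R)
  have "card A + card B = n" by (rule partition_card[OF block_mergeI(1,2)])
  then show ?case by auto
qed

lemma merge_append: "block_merge K bs bs' \<Longrightarrow> block_merge K (Q @ bs @ S) (Q @ bs' @ S)"
proof (induction rule: block_merge.induct)
  case (block_mergeI A B n c L x y R)
  from block_merge.block_mergeI[OF this, of "Q @ L" x y "R @ S"] show ?case by simp
qed

text \<open>Each merging step comes from an elementary map of cube chains. Such a map is a map of wedges, and maps
  out of a wedge are obtained from linked lists of cells; applying this to the wedge of the merged chain,
  in which the list of top cells is linked, and splitting one top cell into its two faces gives the
  required map.\<close>

lemma merge_glue:
  assumes K: "precubical_set K" and m: "block_merge K bs bs'" and l: "linked K \<alpha> \<beta> bs"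
  shows "(tuple_of K bs, tuple_of K bs') \<in> chain_glue K \<alpha> \<beta> (sum_list (dims bs))"
  using m
proof (cases rule: block_merge.cases)
  case (block_mergeI A B n c L x y R)
  note AB = block_mergeI(3,4)
  have ne: "bs \<noteq> []" "bs' \<noteq> []" and sum: "sum_list (dims bs) = sum_list (dims bs')"
    using merge_dims[OF m] by auto
  have l': "linked K \<alpha> \<beta> bs'" by (rule merge_linked[OF K m l])
  note T = tuple_of_props[OF K l ne(1)] and T' = tuple_of_props[OF K l' ne(2)]
  define z where "z = cube_comp (zeros n) (indicator A n) (ones n) x y"
  define ns ms i where "ns = dims bs" and "ms = dims bs'" and "i = length L"
  define a b where "a = wedge_map K ns (map block_cell bs)" and "b = wedge_map K ms (map block_cell bs')"
  have bs: "bs = L @ [(card A, act K (card A) n (subcube_map (zeros n) (indicator A n)) c, x),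
            (card B, act K (card B) n (subcube_map (indicator A n) (ones n)) c, y)] @ R" by (rule block_mergeI(1))
  have bs': "bs' = L @ [(n, c, z)] @ R" unfolding z_def by (rule block_mergeI(2))
  have im: "i < length ms" and mi: "ms ! i = n" by (simp_all add: i_def ms_def bs' nth_append)
  have ns: "ns = split_at ms i A B" by (simp add: ns_def ms_def split_at_def i_def bs bs')
  have a: "a \<in> pmaps (wedge ns) K" and b: "b \<in> pmaps (wedge ms) K"
    using T(1) T'(1) by (simp_all add: a_def b_def ns_def ms_def)
  have xy: "natural_path (card A) x" "natural_path (card B) y"
    using linked_merge(2,3)[OF AB K block_mergeI(7)] l unfolding bs by blast+
  \<comment> \<open>the wedge of the merged chain plays the role of \<open>K\<close>; \<open>D'\<close> is its own list of top cells\<close>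
  let ?W = "wedge ms"
  define D' where "D' = blocks ((ms, pmap_id ?W), map block_path bs')"
  have lenms: "length ms = length bs'" by (simp add: ms_def)
  have ms0: "ms \<noteq> []" "0 \<notin> set ms" using im T'(4) by (auto simp: ms_def)
  have lD': "linked ?W (pmap_id ?W 0 (wedge_initial ms)) (pmap_id ?W 0 (wedge_final ms)) D'"
    unfolding D'_def
    by (rule blocks_linked[OF precubical_wedge pmap_id_in[OF precubical_wedge] ms0]) (use T'(3) in \<open>simp add: ms_def\<close>)
  have D'nth: "D' ! j = (ms ! j, block_id ms j, block_path (bs' ! j))" if "j < length ms" for j
    using that lenms by (simp add: D'_def pmap_id_def block_id_in)
  have lenD': "length D' = length ms" by (simp add: D'_def)
  have D': "D' = take i D' @ [(n, block_id ms i, z)] @ drop (Suc i) D'"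
    using id_take_nth_drop[of i D'] im lenD' D'nth[OF im] mi by (simp add: bs' i_def)
  define D where "D = take i D' @ [(card A, act ?W (card A) n (subcube_map (zeros n) (indicator A n)) (block_id ms i), x),
            (card B, act ?W (card B) n (subcube_map (indicator A n) (ones n)) (block_id ms i), y)] @ drop (Suc i) D'"
  have bi: "block_id ms i \<in> cells ?W n" using block_id_in[OF im] mi by simp
  have lD: "linked ?W (pmap_id ?W 0 (wedge_initial ms)) (pmap_id ?W 0 (wedge_final ms)) D"
    unfolding D_def
  proof (rule linked_unmerge[OF AB precubical_wedge block_mergeI(5,6) bi xy])
    show "linked ?W (pmap_id ?W 0 (wedge_initial ms)) (pmap_id ?W 0 (wedge_final ms))
        (take i D' @ [(n, block_id ms i, z)] @ drop (Suc i) D')"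
      using lD' unfolding D'[symmetric] .
  qed
  have neD: "D \<noteq> []" by (simp add: D_def)
  have dimsD': "dims D' = ms" by (simp add: D'_def)
  have dimsD: "dims D = ns"
    by (simp add: D_def ns split_at_def take_map[symmetric] drop_map[symmetric] dimsD')
  define f where "f = wedge_map ?W ns (map block_cell D)"
  have f: "f \<in> pmaps (wedge ns) ?W"
    using tuple_of_props(1)[OF precubical_wedge lD neD] by (simp add: dimsD f_def)
  have fD: "f (block_dim (D ! j)) (block_id ns j) = block_cell (D ! j)" if "j < length D" for j
    using wedge_map_block[OF precubical_wedge lD that] by (simp add: f_def dimsD)
  have lenD: "length D = Suc (length ms)" using im by (simp add: D_def lenD')
  have lt: "length (take i D') = i" using im lenD' by simp
  have delta: "is_delta ms i A B f"
    unfolding is_delta_def mi ns[symmetric]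
  proof (intro conjI allI impI)
    show "i < length ms" by (rule im)
    show "A \<union> B = {..<n}" "A \<inter> B = {}" "A \<noteq> {}" "B \<noteq> {}" by fact+
    show "f \<in> pmaps (wedge ns) (wedge ms)" by (rule f)
    show "f (ms ! j) (block_id ns j) = block_id ms j" if "j < i" for j
    proof -
      have "D ! j = (ms ! j, block_id ms j, block_path (bs' ! j))"
        using that lt im D'nth[of j] by (simp add: D_def nth_append)
      then show ?thesis using fD[of j] that im lenD by simp
    qed
    have "D ! i = (card A, act ?W (card A) n (subcube_map (zeros n) (indicator A n)) (block_id ms i), x)"
      using lt by (simp add: D_def nth_append)
    then show "f (card A) (block_id ns i) = face_set (wedge ms) n False B (block_id ms i)"
      using fD[of i] im lenD by (simp add: face_set_eq_subcube_map(1)[OF precubical_wedge bi AB])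
    have "D ! Suc i = (card B, act ?W (card B) n (subcube_map (indicator A n) (ones n)) (block_id ms i), y)"
      using lt by (simp add: D_def nth_append)
    then show "f (card B) (block_id ns (Suc i)) = face_set (wedge ms) n True A (block_id ms i)"
      using fD[of "Suc i"] im lenD by (simp add: face_set_eq_subcube_map(2)[OF precubical_wedge bi AB])
    show "f (ms ! j) (block_id ns (Suc j)) = block_id ms j" if "i < j \<and> j < length ms" for j
    proof -
      have ij: "i < j" "j < length ms" using that by auto
      obtain k where k: "j = Suc (i + k)" using less_imp_Suc_add[OF ij(1)] by (elim exE)
      have "D ! Suc j = drop (Suc i) D' ! k" using lt by (simp add: D_def nth_append k)
      also have "\<dots> = D' ! j" using that lenD' by (simp add: k)
      finally have "D ! Suc j = (ms ! j, block_id ms j, block_path (bs' ! j))" using D'nth[of j] ij by simp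
      then show ?thesis using fD[of "Suc j"] that lenD by simp
    qed
  qed
  \<comment> \<open>applying \<open>b\<close> to the cells of \<open>D\<close> gives back \<open>bs\<close>, hence \<open>b\<close> composed with \<open>f\<close> is the chain \<open>a\<close>\<close>
  let ?g = "\<lambda>q. (block_dim q, b (block_dim q) (block_cell q), block_path q)"
  have "map ?g D' = blocks ((ms, b), map block_path bs')"
    unfolding D'_def by (rule map_blocks) (simp add: lenms)
  also have "\<dots> = bs'" using T'(2) by (simp add: tuple_of_def b_def ms_def)
  finally have gD': "map ?g D' = bs'" .
  have bc: "b n (block_id ms i) = c"
    using wedge_map_block[OF K l', of i] im by (simp add: b_def ms_def bs' i_def nth_append)
  have gD: "map ?g D = bs"
  proof -
    have "map ?g (take i D') = L" "map ?g (drop (Suc i) D') = R"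
      by (simp_all add: take_map[symmetric] drop_map[symmetric] gD') (simp_all add: bs' i_def)
    moreover have "b (card A) (act ?W (card A) n (subcube_map (zeros n) (indicator A n)) (block_id ms i)) = act K (card A) n (subcube_map (zeros n) (indicator A n)) c"
      "b (card B) (act ?W (card B) n (subcube_map (indicator A n) (ones n)) (block_id ms i)) = act K (card B) n (subcube_map (indicator A n) (ones n)) c"
      using pmapsD(3)[OF b partition_box(1)[OF AB] bi] pmapsD(3)[OF b partition_box(2)[OF AB] bi] bc by simp_all
    ultimately show ?thesis by (simp add: D_def bs)
  qed
  have comp: "pmap_comp (wedge ns) b f = a"
  proof (rule wedge_pmap_ext[OF _ a])
    show "pmap_comp (wedge ns) b f \<in> pmaps (wedge ns) K" by (rule pmap_comp_in[OF f b precubical_wedge])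
    fix j assume j: "j < length ns"
    then have jD: "j < length D" using dimsD by auto
    have dj: "block_dim (D ! j) = ns ! j" using jD by (simp add: dimsD[symmetric])
    have bj: "block_dim (bs ! j) = ns ! j" using j by (simp add: ns_def)
    have "pmap_comp (wedge ns) b f (ns ! j) (block_id ns j) = b (ns ! j) (f (ns ! j) (block_id ns j))"
      by (rule pmap_comp_apply[OF block_id_in[OF j]])
    also have "\<dots> = block_cell (map ?g D ! j)" using fD[OF jD] jD dj by simp
    also have "\<dots> = block_cell (bs ! j)" unfolding gD ..
    also have "\<dots> = a (ns ! j) (block_id ns j)"
    proof -
      have "wedge_map K (dims bs) (map block_cell bs) (block_dim (bs ! j)) (block_id (dims bs) j) = block_cell (bs ! j)"
        by (rule wedge_map_block[OF K l]) (use j in \<open>simp add: ns_def\<close>)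
      then show ?thesis unfolding bj a_def ns_def by (rule sym)
    qed
    finally show "pmap_comp (wedge ns) b f (ns ! j) (block_id ns j) = a (ns ! j) (block_id ns j)" .
  qed
  have dp: "delta_paths n i A (map block_path bs) = map block_path bs'"
    by (simp add: delta_paths_def bs bs' i_def nth_append z_def indicator_def)
  have mor: "chain_mor ns ms f (delta_paths n i A)"
    using chain_mor_delta[OF ms0(2) delta] by (simp add: ns mi)
  have tb: "tuple_of K bs = ((ns, a), map block_path bs)" "tuple_of K bs' = ((ms, b), map block_path bs')"
    by (simp_all add: tuple_of_def a_def b_def ns_def ms_def)
  have ca: "(ns, a) \<in> chains K \<alpha> \<beta> (sum_list (dims bs))" using T(5) by (simp add: tb)
  have cb: "(ms, b) \<in> chains K \<alpha> \<beta> (sum_list (dims bs))" using T'(5) by (simp add: tb sum)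
  have xs: "map block_path bs \<in> topspace (path_tuples ns)" using T(3) by (simp add: ns_def)
  show ?thesis
    unfolding tb chain_glue_def dp[symmetric]
    by (rule CollectI, rule exI[of _ "(ns, a)"], rule exI[of _ "(ms, b)"], rule exI[of _ f],
        rule exI[of _ "delta_paths n i A"], rule exI[of _ "map block_path bs"])
      (use ca cb mor comp xs in simp)
qed

text \<open>Conversely every morphism of cube chains amounts to a sequence of merging steps. The statement
  quantifies over all \<open>K\<close>, \<open>b\<close> and \<open>xs\<close> to make the induction over composites go through.\<close>

lemma chain_mor_blocks:
  assumes "chain_mor ns ms f F"
  shows "f \<in> pmaps (wedge ns) (wedge ms) \<and>
    (\<forall>(K :: 'k precub) b xs. precubical_set K \<longrightarrow> b \<in> pmaps (wedge ms) K \<longrightarrow> length xs = length ns \<longrightarrow>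
      length (F xs) = length ms \<and>
      (block_merge K)\<^sup>*\<^sup>* (blocks ((ns, pmap_comp (wedge ns) b f), xs)) (blocks ((ms, b), F xs)))"
  using assms
proof (induction rule: chain_mor.induct)
  case (chain_mor_id ns)
  have "pmap_comp (wedge ns) b (pmap_id (wedge ns)) = b" if "b \<in> pmaps (wedge ns) K" for b and K :: "'k precub"
    using that by (intro wedge_pmap_ext[OF pmap_comp_in[OF pmap_id_in[OF precubical_wedge] that precubical_wedge] that])
      (simp add: pmap_comp_apply block_id_in pmap_id_def)
  then show ?case using pmap_id_in[OF precubical_wedge] by auto
next
  case (chain_mor_delta ms i A B f)
  define n where "n = ms ! i"
  define ns where "ns = split_at ms i A B"
  have d: "i < length ms" "A \<union> B = {..<n}" "A \<inter> B = {}" "A \<noteq> {}" "B \<noteq> {}"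
    "f \<in> pmaps (wedge ns) (wedge ms)"
    "\<And>j. j < i \<Longrightarrow> f (ms ! j) (block_id ns j) = block_id ms j"
    "f (card A) (block_id ns i) = face_set (wedge ms) n False B (block_id ms i)"
    "f (card B) (block_id ns (Suc i)) = face_set (wedge ms) n True A (block_id ms i)"
    "\<And>j. i < j \<Longrightarrow> j < length ms \<Longrightarrow> f (ms ! j) (block_id ns (Suc j)) = block_id ms j"
    using chain_mor_delta.hyps(2) unfolding is_delta_def n_def ns_def by auto
  note AB = d(2,3)
  have bi: "block_id ms i \<in> cells (wedge ms) n" using block_id_in[OF d(1)] by (simp add: n_def)
  have lens: "length ns = Suc (length ms)" using d(1) by (simp add: ns_def split_at_def)
  have nsn: "j < i \<Longrightarrow> ns ! j = ms ! j" "ns ! i = card A" "ns ! Suc i = card B"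
    "i < j \<Longrightarrow> j < length ms \<Longrightarrow> ns ! Suc j = ms ! j" for j
  proof -
    show "j < i \<Longrightarrow> ns ! j = ms ! j" "ns ! i = card A" "ns ! Suc i = card B"
      using d(1) by (simp_all add: ns_def split_at_def nth_append)
    assume j: "i < j" "j < length ms"
    obtain k where "j = Suc (i + k)" using less_imp_Suc_add[OF j(1)] by (elim exE)
    then show "ns ! Suc j = ms ! j" using j d(1) by (simp add: ns_def split_at_def nth_append)
  qed
  show ?case
    unfolding ns_def[symmetric] n_def[symmetric]
  proof (intro conjI allI impI)
    show "f \<in> pmaps (wedge ns) (wedge ms)" by (rule d)
    fix K :: "'k precub" and b and xs :: "dpath list"
    assume K: "precubical_set K" and b: "b \<in> pmaps (wedge ms) K" and xs: "length xs = length ns"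
    let ?F = "delta_paths n i A"
    have lF: "length (?F xs) = length ms" using d(1) xs lens by (simp add: delta_paths_def)
    show "length (?F xs) = length ms" by (rule lF)
    have Fn: "j < i \<Longrightarrow> ?F xs ! j = xs ! j" "?F xs ! i = cube_comp (zeros n) (indicator A n) (ones n) (xs ! i) (xs ! Suc i)"
      "i < j \<Longrightarrow> j < length ms \<Longrightarrow> ?F xs ! j = xs ! Suc j" for j
    proof -
      show "j < i \<Longrightarrow> ?F xs ! j = xs ! j" "?F xs ! i = cube_comp (zeros n) (indicator A n) (ones n) (xs ! i) (xs ! Suc i)"
        using d(1) xs lens by (simp_all add: delta_paths_def nth_append indicator_def)
      assume j: "i < j" "j < length ms"
      obtain k where "j = Suc (i + k)" using less_imp_Suc_add[OF j(1)] by (elim exE)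
      then show "?F xs ! j = xs ! Suc j" using j d(1) xs lens by (simp add: delta_paths_def nth_append)
    qed
    define c where "c = b n (block_id ms i)"
    have c: "c \<in> cells K n" unfolding c_def by (rule pmapsD(2)[OF b bi])
    define W where "W = blocks ((ms, b), ?F xs)"
    have lW: "length W = length ms" by (simp add: W_def)
    have lt: "length (take i W) = i" using d(1) lW by simp
    have W: "W = take i W @ [(n, c, cube_comp (zeros n) (indicator A n) (ones n) (xs ! i) (xs ! Suc i))] @ drop (Suc i) W"
      using id_take_nth_drop[of i W] d(1) lW Fn(2) by (simp add: W_def c_def n_def)
    let ?V = "take i W @ [(card A, act K (card A) n (subcube_map (zeros n) (indicator A n)) c, xs ! i),
            (card B, act K (card B) n (subcube_map (indicator A n) (ones n)) c, xs ! Suc i)] @ drop (Suc i) W"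
    let ?U = "blocks ((ns, pmap_comp (wedge ns) b f), xs)"
    have Un: "?U ! j = (ns ! j, b (ns ! j) (f (ns ! j) (block_id ns j)), xs ! j)" if "j < length ns" for j
      using that by (simp add: pmap_comp_apply block_id_in)
    have bA: "b (card A) (f (card A) (block_id ns i)) = act K (card A) n (subcube_map (zeros n) (indicator A n)) c"
      unfolding d(8) face_set_eq_subcube_map(1)[OF precubical_wedge bi AB] c_def by (rule pmapsD(3)[OF b partition_box(1)[OF AB] bi])
    have bB: "b (card B) (f (card B) (block_id ns (Suc i))) = act K (card B) n (subcube_map (indicator A n) (ones n)) c"
      unfolding d(9) face_set_eq_subcube_map(2)[OF precubical_wedge bi AB] c_def by (rule pmapsD(3)[OF b partition_box(2)[OF AB] bi])
    have "?U = ?V"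
    proof (rule nth_equalityI)
      show "length ?U = length ?V" using lens d(1) lW by simp
      fix j assume "j < length ?U"
      then have jl: "j < length ns" and j: "j < Suc (length ms)" using lens by simp_all
      consider "j < i" | "j = i" | "j = Suc i" | k where "j = Suc (Suc (i + k))"
        by (metis add_Suc less_antisym less_imp_Suc_add not_less_eq)
      then show "?U ! j = ?V ! j"
      proof cases
        case 1
        have "?V ! j = W ! j" using 1 lt by (simp add: nth_append)
        then show ?thesis unfolding Un[OF jl] using 1 d(1) lens by (simp add: nsn(1) d(7) W_def Fn(1))
      next
        case 2
        then show ?thesis unfolding Un[OF jl] using lt lens d(1) bA by (simp add: nsn(2) nth_append)
      next
        case 3
        then show ?thesis unfolding Un[OF jl] using lt lens d(1) bB by (simp add: nsn(3) nth_append)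
      next
        case 4
        define m where "m = Suc (i + k)"
        have m: "i < m" "m < length ms" "j = Suc m" using 4 j by (simp_all add: m_def)
        have "?V ! j = drop (Suc i) W ! k" using lt 4 by (simp add: nth_append)
        also have "\<dots> = W ! m" using m lW by (simp add: m_def)
        finally show ?thesis unfolding Un[OF jl] using m lens by (simp add: nsn(4) d(10) W_def Fn(3))
      qed
    qed
    then have "block_merge K ?U W" using block_mergeI[OF AB d(4,5) c, of "take i W" "xs ! i" "xs ! Suc i" "drop (Suc i) W"]
      by (simp only: W[symmetric])
    then show "(block_merge K)\<^sup>*\<^sup>* ?U (blocks ((ms, b), ?F xs))" unfolding W_def by (rule r_into_rtranclp)
  qed
next
  case (chain_mor_comp ls ms f F ns g G)
  have f: "f \<in> pmaps (wedge ls) (wedge ms)" and g: "g \<in> pmaps (wedge ms) (wedge ns)"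
    using chain_mor_comp.IH by blast+
  show ?case
  proof (intro conjI allI impI)
    show "pmap_comp (wedge ls) g f \<in> pmaps (wedge ls) (wedge ns)" by (rule pmap_comp_in[OF f g precubical_wedge])
    fix K :: "'k precub" and b and xs :: "dpath list"
    assume K: "precubical_set K" and b: "b \<in> pmaps (wedge ns) K" and xs: "length xs = length ls"
    have bg: "pmap_comp (wedge ms) b g \<in> pmaps (wedge ms) K" by (rule pmap_comp_in[OF g b precubical_wedge])
    have 1: "length (F xs) = length ms"
      "(block_merge K)\<^sup>*\<^sup>* (blocks ((ls, pmap_comp (wedge ls) (pmap_comp (wedge ms) b g) f), xs)) (blocks ((ms, pmap_comp (wedge ms) b g), F xs))"
      using chain_mor_comp.IH(1) K bg xs by blast+
    have 2: "length (G (F xs)) = length ns"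
      "(block_merge K)\<^sup>*\<^sup>* (blocks ((ms, pmap_comp (wedge ms) b g), F xs)) (blocks ((ns, b), G (F xs)))"
      using chain_mor_comp.IH(2) K b 1(1) by blast+
    have "pmap_comp (wedge ls) b (pmap_comp (wedge ls) g f) = pmap_comp (wedge ls) (pmap_comp (wedge ms) b g) f"
      unfolding pmap_comp_def compose_def
      by (rule ext, rule restrict_ext) (simp add: pmapsD(2)[OF f])
    then show "length ((G \<circ> F) xs) = length ns"
      "(block_merge K)\<^sup>*\<^sup>* (blocks ((ls, pmap_comp (wedge ls) b (pmap_comp (wedge ls) g f)), xs)) (blocks ((ns, b), (G \<circ> F) xs))"
      using 1(2) 2 by simp_all
  qed
qed

lemma chain_glue_merge:
  assumes K: "precubical_set K" and g: "(p, q) \<in> chain_glue K \<alpha> \<beta> n"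
  shows "(block_merge K)\<^sup>*\<^sup>* (blocks p) (blocks q)"
    "p \<in> topspace (chain_sum K \<alpha> \<beta> n)" "q \<in> topspace (chain_sum K \<alpha> \<beta> n)"
proof -
  obtain a b f F xs where *: "p = (a, xs)" "q = (b, F xs)" "a \<in> chains K \<alpha> \<beta> n" "b \<in> chains K \<alpha> \<beta> n"
    "chain_mor (fst a) (fst b) f F" "pmap_comp (wedge (fst a)) (snd b) f = snd a" "xs \<in> topspace (path_tuples (fst a))"
    using g unfolding chain_glue_def by blast
  obtain ns a' where a: "a = (ns, a')" by fastforce
  obtain ms b' where b: "b = (ms, b')" by fastforce
  have b': "b' \<in> pmaps (wedge ms) K" using *(4) b by (simp add: chains_def)
  have xs: "length xs = length ns" using *(7) a by (simp add: topspace_path_tuples)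
  have len: "length (F xs) = length ms" and m: "(block_merge K)\<^sup>*\<^sup>* (blocks p) (blocks q)"
    using chain_mor_blocks[OF *(5), THEN conjunct2, rule_format, of K b' xs] K b' xs *(1,2,6) a b by simp_all
  show "(block_merge K)\<^sup>*\<^sup>* (blocks p) (blocks q)" by (rule m)
  show "p \<in> topspace (chain_sum K \<alpha> \<beta> n)" using *(1,3,7) by (simp add: chain_sum_def)
  have "linked K \<alpha> \<beta> (blocks p)" using chains_blocks[OF K, of ns a' \<alpha> \<beta> n xs] * a by simp_all
  with m have l: "linked K \<alpha> \<beta> (blocks q)"
    by (induction rule: rtranclp_induct) (auto intro: merge_linked[OF K])
  have ms: "ms \<noteq> []" using *(4) b by (simp add: chains_def)
  have "blocks q \<noteq> []" using ms *(2) b by (metis dims_blocks list.simps(8))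
  then have "F xs \<in> topspace (path_tuples ms)"
    using l *(2) b len unfolding linked_nth[OF \<open>blocks q \<noteq> []\<close>] by (simp add: topspace_path_tuples block_ok_def)
  then show "q \<in> topspace (chain_sum K \<alpha> \<beta> n)" using *(2,4) b by (simp add: chain_sum_def)
qed

text \<open>All members of a class of the wedge give the same value in the definition of the concatenated map,
  namely the value of the map out of the long wedge determined by the joint list of cells.\<close>

lemma chain_concat_blocks:
  assumes K: "precubical_set K"
    and a: "(ns, a) \<in> chains K \<alpha> \<beta> m" and xs: "xs \<in> topspace (path_tuples ns)"
    and b: "(ms, b) \<in> chains K \<beta> \<gamma> n" and ys: "ys \<in> topspace (path_tuples ms)"
  shows "(chain_concat (ns, a) (ms, b), xs @ ys) = tuple_of K (blocks ((ns, a), xs) @ blocks ((ms, b), ys))"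
proof -
  let ?bs = "blocks ((ns, a), xs) @ blocks ((ms, b), ys)"
  note A = chains_blocks[OF K a xs] and B = chains_blocks[OF K b ys]
  have l: "linked K \<alpha> \<gamma> ?bs" using A(1) B(1) by (auto simp: linked_append)
  have ne: "?bs \<noteq> []" using A(2) by simp
  define w where "w = wedge_map K (ns @ ms) (map block_cell ?bs)"
  have w: "w \<in> pmaps (wedge (ns @ ms)) K"
    using tuple_of_props(1)[OF K l ne] by (simp add: w_def)
  have ap: "a \<in> pmaps (wedge ns) K" and bp: "b \<in> pmaps (wedge ms) K" using a b by (simp_all add: chains_def)
  have wb: "w ((ns @ ms) ! i) (block_id (ns @ ms) i) = block_cell (?bs ! i)" if "i < length (ns @ ms)" for i
    using wedge_map_block[OF K l, of i] that by (auto simp: w_def nth_append)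
  have eq: "(if i < length ns then a d (wclass ns d i \<phi>) else b d (wclass ms d (i - length ns) \<phi>)) = w d (wclass (ns @ ms) d i \<phi>)"
    if i: "i < length (ns @ ms)" "box d ((ns @ ms) ! i) \<phi>" for d i \<phi>
  proof (cases "i < length ns")
    case True
    then show ?thesis using i wb[OF i(1)] pmap_wclass[OF ap True, of d \<phi>] pmap_wclass[OF w i]
      by (simp add: nth_append)
  next
    case False
    then have "i - length ns < length ms" using i by simp
    then show ?thesis using False i wb[OF i(1)] pmap_wclass[OF bp, of "i - length ns" d \<phi>] pmap_wclass[OF w i]
      by (simp add: nth_append)
  qed
  have "snd (chain_concat (ns, a) (ms, b)) = w"
  proof
    fix d
    show "snd (chain_concat (ns, a) (ms, b)) d = w d"
    proof (rule extensionalityI[of _ "cells (wedge (ns @ ms)) d"])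
      show "snd (chain_concat (ns, a) (ms, b)) d \<in> extensional (cells (wedge (ns @ ms)) d)"
        by (simp add: chain_concat_def)
      show "w d \<in> extensional (cells (wedge (ns @ ms)) d)" by (rule pmapsD(1)[OF w])
      fix C assume C: "C \<in> cells (wedge (ns @ ms)) d"
      then obtain i0 \<phi>0 where i0: "i0 < length (ns @ ms)" "box d ((ns @ ms) ! i0) \<phi>0" "C = wclass (ns @ ms) d i0 \<phi>0"
        by (rule wedge_cellE)
      let ?h = "\<lambda>(i, \<phi>). if i < length ns then a d (wclass ns d i \<phi>) else b d (wclass ms d (i - length ns) \<phi>)"
      have "?h p = w d C" if p: "p \<in> C" for p
      proof -
        obtain i \<phi> where ip: "p = (i, \<phi>)" by fastforce
        have r: "((i0, \<phi>0), (i, \<phi>)) \<in> wedge_rel (ns @ ms) d" using p unfolding i0(3) ip wclass_def by simp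
        then have "(i, \<phi>) \<in> wedge_cells (ns @ ms) d" using equiv_type[OF equiv_wedge_rel] by blast
        then have i: "i < length (ns @ ms)" "box d ((ns @ ms) ! i) \<phi>" by (simp_all add: wedge_cells_def)
        have "wclass (ns @ ms) d i \<phi> = C" unfolding i0(3) wclass_def using equiv_class_eq[OF equiv_wedge_rel r] by simp
        then show ?thesis using eq[OF i] by (simp add: ip)
      qed
      moreover have "(i0, \<phi>0) \<in> C" unfolding i0(3) wclass_def
        by (rule equiv_class_self[OF equiv_wedge_rel]) (use i0 in \<open>simp add: wedge_cells_def\<close>)
      ultimately have "?h ` C = {w d C}" by (metis (no_types, lifting) image_cong image_constant)
      then show "snd (chain_concat (ns, a) (ms, b)) d C = w d C"
        using C unfolding chain_concat_def fst_conv snd_conv by simp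
    qed
  qed
  moreover have "fst (chain_concat (ns, a) (ms, b)) = ns @ ms" by (simp add: chain_concat_def)
  moreover have "map block_path ?bs = xs @ ys"
    using xs ys by (intro nth_equalityI) (auto simp: topspace_path_tuples nth_append)
  ultimately show ?thesis by (simp add: tuple_of_def w_def prod_eq_iff)
qed

section \<open>The flow of cube chains\<close>

lemma delta_generated_path_tuples: "delta_generated (path_tuples ns)"
  by (simp add: path_tuples_def)

lemma top_path_tuples:
  "top_path (path_tuples ns) q \<longleftrightarrow> (\<forall>t\<in>{0..1}. length (q t) = length ns) \<and>
    (\<forall>i<length ns. top_path (natural_dpaths (ns ! i)) (\<lambda>t. q t ! i))"
proof -
  let ?P = "product_topology (\<lambda>i. natural_dpaths (ns ! i)) {..<length ns}"
  let ?f = "\<lambda>xs. \<lambda>i\<in>{..<length ns}. xs ! i"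
  let ?A = "{xs :: dpath list. length xs = length ns}"
  have "top_path (pullback_topology ?A ?f ?P) q \<longleftrightarrow> (\<forall>t\<in>{0..1}. q t \<in> ?A) \<and> top_path ?P (?f \<circ> q)"
  proof
    assume q: "top_path (pullback_topology ?A ?f ?P) q"
    have "q t \<in> ?A" if "t \<in> {0..1}" for t
      using top_path_in[OF q that] unfolding topspace_pullback_topology by blast
    moreover have "continuous_map (pullback_topology ?A ?f ?P) ?P (id \<circ> ?f)"
      by (rule continuous_map_pullback) simp
    from continuous_map_compose[OF q this] have "top_path ?P (?f \<circ> q)" by (simp only: id_comp)
    ultimately show "(\<forall>t\<in>{0..1}. q t \<in> ?A) \<and> top_path ?P (?f \<circ> q)" by simp
  next
    assume q: "(\<forall>t\<in>{0..1}. q t \<in> ?A) \<and> top_path ?P (?f \<circ> q)"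
    show "top_path (pullback_topology ?A ?f ?P) q"
      by (rule continuous_map_pullback'[OF q[THEN conjunct2]]) (use q in auto)
  qed
  moreover have "top_path ?P (?f \<circ> q) \<longleftrightarrow> (\<forall>i<length ns. top_path (natural_dpaths (ns ! i)) (\<lambda>t. q t ! i))"
    unfolding continuous_map_componentwise by (auto simp: image_subset_iff)
  ultimately show ?thesis by (simp add: path_tuples_def)
qed

lemma delta_generated_chain_sum: "delta_generated (chain_sum K \<alpha> \<beta> n)"
  unfolding chain_sum_def by (rule delta_generated_sum) (rule delta_generated_path_tuples)

lemma topspace_chain_sum:
  "topspace (chain_sum K \<alpha> \<beta> n) = {(a, xs). a \<in> chains K \<alpha> \<beta> n \<and> xs \<in> topspace (path_tuples (fst a))}"
  by (auto simp: chain_sum_def)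

lemma top_path_chain_sum:
  assumes "top_path (chain_sum K \<alpha> \<beta> n) p"
  obtains ns a q where "(ns, a) \<in> chains K \<alpha> \<beta> n" "top_path (path_tuples ns) q"
    "\<And>t. t \<in> {0..1} \<Longrightarrow> p t = ((ns, a), q t)"
proof -
  obtain i q where i: "i \<in> chains K \<alpha> \<beta> n" "top_path (path_tuples (fst i)) q"
    "\<And>t. t \<in> {0..1} \<Longrightarrow> p t = (i, q t)"
    using assms unfolding chain_sum_def by (rule top_path_sum) blast
  show ?thesis by (rule that[of "fst i" "snd i" q]) (use i in auto)
qed

lemma linked_sum_pos: "linked K \<alpha> \<beta> bs \<Longrightarrow> bs \<noteq> [] \<Longrightarrow> 1 \<le> sum_list (dims bs)"
  by (cases bs) (auto simp: block_ok_def)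

lemma linked_last: "linked K \<alpha> \<beta> bs \<Longrightarrow> bs \<noteq> [] \<Longrightarrow> block_target K (last bs) = \<beta>"
  by (simp add: linked_nth last_conv_nth)

lemma linked_ends:
  assumes "precubical_set K" "linked K \<alpha> \<beta> bs" "bs \<noteq> []"
  shows "\<alpha> \<in> cells K 0" "\<beta> \<in> cells K 0"
proof -
  have "block_ok K (bs ! 0)" "block_ok K (bs ! (length bs - 1))" "block_source K (bs ! 0) = \<alpha>" "block_target K (bs ! (length bs - 1)) = \<beta>"
    using assms(2,3) by (auto simp: linked_nth)
  then show "\<alpha> \<in> cells K 0" "\<beta> \<in> cells K 0"
    using vertex_of_in[OF assms(1)] by (auto simp: block_ok_def block_source_def block_target_def)
qed

definition block_class :: "top_choice \<Rightarrow> 'k precub \<Rightarrow> 'k \<Rightarrow> 'k \<Rightarrow> 'k block list \<Rightarrow> 'k cpath" where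
  "block_class T K \<alpha> \<beta> bs = (sum_list (dims bs), chain_rel T K \<alpha> \<beta> (sum_list (dims bs)) `` {tuple_of K bs})"

lemma states_chain_flow [simp]: "states (chain_flow T K) = cells K 0"
  by (simp add: chain_flow_def)

lemma paths_chain_flow: "paths (chain_flow T K) \<alpha> \<beta> = sum_topology (\<lambda>n. chain_colim T K \<alpha> \<beta> n) {1..}"
  by (simp add: chain_flow_def)

definition concat_classes :: "top_choice \<Rightarrow> 'k precub \<Rightarrow> 'k \<Rightarrow> 'k \<Rightarrow> nat
    \<Rightarrow> 'k tagged_tuple set \<Rightarrow> 'k tagged_tuple set \<Rightarrow> 'k tagged_tuple set" where
  "concat_classes T K \<alpha> \<gamma> k C D =
    (\<Union>(a, xs)\<in>C. \<Union>(b, ys)\<in>D. chain_rel T K \<alpha> \<gamma> k `` {(chain_concat a b, xs @ ys)})"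

context
  fixes K :: "'k precub" and T :: top_choice
  assumes K: "precubical_set K"
begin

lemma chain_glue_subset: "chain_glue K \<alpha> \<beta> n \<subseteq> topspace (chain_sum K \<alpha> \<beta> n) \<times> topspace (chain_sum K \<alpha> \<beta> n)"
  using chain_glue_merge(2,3)[OF K] by (intro subrelI) blast

lemma equiv_chain_rel: "equiv (topspace (chain_sum K \<alpha> \<beta> n)) (chain_rel T K \<alpha> \<beta> n)"
  unfolding chain_rel_def by (rule equiv_coeq_rel[OF chain_glue_subset])

lemma chain_colim_quot: "chain_colim T K \<alpha> \<beta> n = quot_top (chain_sum K \<alpha> \<beta> n) (chain_rel T K \<alpha> \<beta> n)"
  by (simp add: chain_colim_def coeq_top_def chain_rel_def)

lemma in_Top_chain_colim: "in_Top T (chain_colim T K \<alpha> \<beta> n)"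
  unfolding chain_colim_def by (rule in_Top_coeq_top[OF chain_glue_subset delta_generated_chain_sum])

lemma tuple_of_in_chain_sum:
  assumes "linked K \<alpha> \<beta> bs" "bs \<noteq> []"
  shows "tuple_of K bs \<in> topspace (chain_sum K \<alpha> \<beta> (sum_list (dims bs)))"
  using tuple_of_props(3,5)[OF K assms] by (simp add: topspace_chain_sum tuple_of_def)

lemma chain_sum_blocks:
  assumes "p \<in> topspace (chain_sum K \<alpha> \<beta> n)"
  shows "linked K \<alpha> \<beta> (blocks p)" "blocks p \<noteq> []" "sum_list (dims (blocks p)) = n" "tuple_of K (blocks p) = p"
proof -
  obtain ns a xs where p: "p = ((ns, a), xs)" by (metis prod.collapse)
  have *: "(ns, a) \<in> chains K \<alpha> \<beta> n" "xs \<in> topspace (path_tuples ns)"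
    using assms by (simp_all add: p topspace_chain_sum)
  show "linked K \<alpha> \<beta> (blocks p)" "blocks p \<noteq> []" "sum_list (dims (blocks p)) = n" "tuple_of K (blocks p) = p"
    using chains_blocks[OF K *] tuple_of_blocks[OF K *] by (simp_all add: p)
qed

lemma block_class_in:
  assumes "linked K \<alpha> \<beta> bs" "bs \<noteq> []"
  shows "block_class T K \<alpha> \<beta> bs \<in> topspace (paths (chain_flow T K) \<alpha> \<beta>)"
  using linked_sum_pos[OF assms] tuple_of_in_chain_sum[OF assms]
  by (simp add: paths_chain_flow block_class_def chain_colim_quot topspace_quot_top[OF equiv_chain_rel] quotientI)

lemma block_class_cases:
  assumes "p \<in> topspace (paths (chain_flow T K) \<alpha> \<beta>)"
  obtains bs where "linked K \<alpha> \<beta> bs" "bs \<noteq> []" "p = block_class T K \<alpha> \<beta> bs"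
proof -
  obtain n C where p: "p = (n, C)" by fastforce
  have "C \<in> topspace (chain_sum K \<alpha> \<beta> n) // chain_rel T K \<alpha> \<beta> n"
    using assms by (simp add: p paths_chain_flow chain_colim_quot topspace_quot_top[OF equiv_chain_rel])
  then obtain q where q: "q \<in> topspace (chain_sum K \<alpha> \<beta> n)" "C = chain_rel T K \<alpha> \<beta> n `` {q}" by (rule quotientE)
  show ?thesis
    by (rule that[of "blocks q"]) (simp_all add: chain_sum_blocks[OF q(1)] p q(2) block_class_def)
qed

text \<open>The gluing relation is contained in the equivalence relation generated by the merging steps, so
  \<open>coeq_rel_kernel\<close> applies as soon as \<open>g\<close> respects these steps.\<close>

lemma chain_rel_kernel:
  assumes g: "continuous_map (chain_sum K \<alpha> \<beta> n) Y g" and Y: "in_Top T Y"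
    and m: "\<And>bs bs'. linked K \<alpha> \<beta> bs \<Longrightarrow> sum_list (dims bs) = n \<Longrightarrow> block_merge K bs bs' \<Longrightarrow> g (tuple_of K bs) = g (tuple_of K bs')"
    and pq: "(p, q) \<in> chain_rel T K \<alpha> \<beta> n"
  shows "g p = g q"
proof (rule coeq_rel_kernel[OF g Y delta_generated_chain_sum chain_glue_subset _ pq[unfolded chain_rel_def]])
  fix x y assume xy: "(x, y) \<in> chain_glue K \<alpha> \<beta> n"
  note X = chain_glue_merge[OF K xy]
  have "linked K \<alpha> \<beta> ys \<and> sum_list (dims ys) = n \<and> g (tuple_of K (blocks x)) = g (tuple_of K ys)"
    if "(block_merge K)\<^sup>*\<^sup>* (blocks x) ys" for ys
    using that
  proof (induction rule: rtranclp_induct)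
    case base
    show ?case using chain_sum_blocks[OF X(2)] by simp
  next
    case (step ys zs)
    then show ?case using merge_linked[OF K step(2)] merge_dims[OF step(2)] m[OF _ _ step(2)] by auto
  qed
  from this[OF X(1)] show "g x = g y"
    using chain_sum_blocks(4)[OF X(2)] chain_sum_blocks(4)[OF X(3)] by simp
qed

lemma merge_same_class:
  assumes "block_merge K bs bs'" "linked K \<alpha> \<beta> bs"
  shows "block_class T K \<alpha> \<beta> bs = block_class T K \<alpha> \<beta> bs'"
proof -
  have "(tuple_of K bs, tuple_of K bs') \<in> chain_rel T K \<alpha> \<beta> (sum_list (dims bs))"
    unfolding chain_rel_def using coeq_rel_contains merge_glue[OF K assms] by blast
  from equiv_class_eq[OF equiv_chain_rel this] show ?thesis
    using merge_dims[OF assms(1)] by (simp add: block_class_def)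
qed

lemma top_path_chain_class:
  assumes "top_path (chain_sum K \<alpha> \<beta> n) p"
  shows "top_path (chain_colim T K \<alpha> \<beta> n) (\<lambda>t. chain_rel T K \<alpha> \<beta> n `` {p t})"
  using continuous_map_compose[OF assms continuous_map_quot_proj[OF equiv_chain_rel]]
  by (simp add: o_def chain_colim_quot)

text \<open>A path in a coproduct stays on one chain, so only the tuples of paths move, and they move
  coordinatewise.\<close>

lemma top_path_concat:
  assumes a: "(ns, a) \<in> chains K \<alpha> \<beta> m" and q: "top_path (path_tuples ns) q"
    and b: "(ms, b) \<in> chains K \<beta> \<gamma> n" and r: "top_path (path_tuples ms) r"
  shows "top_path (chain_sum K \<alpha> \<gamma> (m + n)) (\<lambda>t. tuple_of K (blocks ((ns, a), q t) @ blocks ((ms, b), r t)))"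
proof -
  let ?c = "chain_concat (ns, a) (ms, b)"
  have eq: "tuple_of K (blocks ((ns, a), q t) @ blocks ((ms, b), r t)) = (?c, q t @ r t)" if "t \<in> {0..1}" for t
    using chain_concat_blocks[OF K a top_path_in[OF q that] b top_path_in[OF r that]] by simp
  have 0: "(0::real) \<in> {0..1}" by simp
  note A = chains_blocks[OF K a top_path_in[OF q 0]] and B = chains_blocks[OF K b top_path_in[OF r 0]]
  have l: "linked K \<alpha> \<gamma> (blocks ((ns, a), q 0) @ blocks ((ms, b), r 0))" using A(1) B(1) by (auto simp: linked_append)
  have c: "?c \<in> chains K \<alpha> \<gamma> (m + n)"
    using tuple_of_props(5)[OF K l] A B unfolding eq[OF 0] by simp
  have fc: "fst ?c = ns @ ms" by (simp add: chain_concat_def)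
  have "top_path (path_tuples (fst ?c)) (\<lambda>t. q t @ r t)"
    unfolding top_path_tuples fc
  proof (intro conjI ballI allI impI)
    show "length (q t @ r t) = length (ns @ ms)" if "t \<in> {0..1}" for t
      using q r that by (simp add: top_path_tuples)
    fix i assume i: "i < length (ns @ ms)"
    have "top_path (natural_dpaths ((ns @ ms) ! i)) (\<lambda>t. if i < length ns then q t ! i else r t ! (i - length ns))"
      using q r i by (cases "i < length ns") (simp_all add: top_path_tuples nth_append)
    then show "top_path (natural_dpaths ((ns @ ms) ! i)) (\<lambda>t. (q t @ r t) ! i)"
      by (rule continuous_map_eq) (use q in \<open>simp add: top_path_tuples nth_append\<close>)
  qed
  then have "top_path (chain_sum K \<alpha> \<gamma> (m + n)) (\<lambda>t. (?c, q t @ r t))"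
    unfolding chain_sum_def by (rule top_path_sumI[OF c])
  then show ?thesis by (rule continuous_map_eq) (use eq in simp)
qed

text \<open>Concatenation with a fixed chain is a continuous map that respects merging steps, because a merging
  step remains one inside a longer list.\<close>

lemma concat_class_left:
  assumes pq: "(p, q) \<in> chain_rel T K \<alpha> \<beta> m" and l: "linked K \<beta> \<gamma> cs" "cs \<noteq> []" and n: "sum_list (dims cs) = n"
  shows "chain_rel T K \<alpha> \<gamma> (m + n) `` {tuple_of K (blocks p @ cs)} = chain_rel T K \<alpha> \<gamma> (m + n) `` {tuple_of K (blocks q @ cs)}"
proof (rule chain_rel_kernel[OF _ in_Top_chain_colim _ pq])
  show "continuous_map (chain_sum K \<alpha> \<beta> m) (chain_colim T K \<alpha> \<gamma> (m + n))
     (\<lambda>p. chain_rel T K \<alpha> \<gamma> (m + n) `` {tuple_of K (blocks p @ cs)})"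
  proof (rule continuous_map_from_delta_generated[OF delta_generated_chain_sum])
    fix c assume "top_path (chain_sum K \<alpha> \<beta> m) c"
    then obtain ns a r where c: "(ns, a) \<in> chains K \<alpha> \<beta> m" "top_path (path_tuples ns) r"
      "\<And>t. t \<in> {0..1} \<Longrightarrow> c t = ((ns, a), r t)" by (rule top_path_chain_sum) blast
    note C = tuple_of_props[OF K l]
    have "top_path (chain_sum K \<alpha> \<gamma> (m + n)) (\<lambda>t. tuple_of K (blocks ((ns, a), r t) @
        blocks ((dims cs, wedge_map K (dims cs) (map block_cell cs)), map block_path cs)))"
      by (rule top_path_concat[OF c(1,2)])
        (use C(3,5) in \<open>simp_all add: n[symmetric] top_path_const tuple_of_def\<close>)
    then have "top_path (chain_sum K \<alpha> \<gamma> (m + n)) (\<lambda>t. tuple_of K (blocks ((ns, a), r t) @ cs))"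
      using C(2) by (simp add: tuple_of_def)
    from top_path_chain_class[OF this]
    show "top_path (chain_colim T K \<alpha> \<gamma> (m + n)) ((\<lambda>p. chain_rel T K \<alpha> \<gamma> (m + n) `` {tuple_of K (blocks p @ cs)}) \<circ> c)"
      by (rule continuous_map_eq) (use c(3) in simp)
  qed
next
  fix bs bs' assume b: "linked K \<alpha> \<beta> bs" "sum_list (dims bs) = m" "block_merge K bs bs'"
  have l': "linked K \<alpha> \<beta> bs'" by (rule merge_linked[OF K b(3,1)])
  note ne = merge_dims[OF b(3)]
  have "block_merge K (bs @ cs) (bs' @ cs)" using merge_append[OF b(3), of "[]" cs] by simp
  moreover have "linked K \<alpha> \<gamma> (bs @ cs)" using b(1) l by (auto simp: linked_append)
  ultimately have "block_class T K \<alpha> \<gamma> (bs @ cs) = block_class T K \<alpha> \<gamma> (bs' @ cs)" by (rule merge_same_class)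
  then show "chain_rel T K \<alpha> \<gamma> (m + n) `` {tuple_of K (blocks (tuple_of K bs) @ cs)} =
      chain_rel T K \<alpha> \<gamma> (m + n) `` {tuple_of K (blocks (tuple_of K bs') @ cs)}"
    using b(2) n ne tuple_of_props(2)[OF K b(1)] tuple_of_props(2)[OF K l'] by (simp add: block_class_def)
qed

lemma concat_class_right:
  assumes pq: "(p, q) \<in> chain_rel T K \<beta> \<gamma> n" and l: "linked K \<alpha> \<beta> bs" "bs \<noteq> []" and m: "sum_list (dims bs) = m"
  shows "chain_rel T K \<alpha> \<gamma> (m + n) `` {tuple_of K (bs @ blocks p)} = chain_rel T K \<alpha> \<gamma> (m + n) `` {tuple_of K (bs @ blocks q)}"
proof (rule chain_rel_kernel[OF _ in_Top_chain_colim _ pq])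
  show "continuous_map (chain_sum K \<beta> \<gamma> n) (chain_colim T K \<alpha> \<gamma> (m + n))
     (\<lambda>p. chain_rel T K \<alpha> \<gamma> (m + n) `` {tuple_of K (bs @ blocks p)})"
  proof (rule continuous_map_from_delta_generated[OF delta_generated_chain_sum])
    fix c assume "top_path (chain_sum K \<beta> \<gamma> n) c"
    then obtain ns a r where c: "(ns, a) \<in> chains K \<beta> \<gamma> n" "top_path (path_tuples ns) r"
      "\<And>t. t \<in> {0..1} \<Longrightarrow> c t = ((ns, a), r t)" by (rule top_path_chain_sum) blast
    note C = tuple_of_props[OF K l]
    have "top_path (chain_sum K \<alpha> \<gamma> (m + n)) (\<lambda>t. tuple_of K (
        blocks ((dims bs, wedge_map K (dims bs) (map block_cell bs)), map block_path bs) @ blocks ((ns, a), r t)))"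
      by (rule top_path_concat[OF _ _ c(1,2)])
        (use C(3,5) in \<open>simp_all add: m[symmetric] top_path_const tuple_of_def\<close>)
    then have "top_path (chain_sum K \<alpha> \<gamma> (m + n)) (\<lambda>t. tuple_of K (bs @ blocks ((ns, a), r t)))"
      using C(2) by (simp add: tuple_of_def)
    from top_path_chain_class[OF this]
    show "top_path (chain_colim T K \<alpha> \<gamma> (m + n)) ((\<lambda>p. chain_rel T K \<alpha> \<gamma> (m + n) `` {tuple_of K (bs @ blocks p)}) \<circ> c)"
      by (rule continuous_map_eq) (use c(3) in simp)
  qed
next
  fix cs cs' assume b: "linked K \<beta> \<gamma> cs" "sum_list (dims cs) = n" "block_merge K cs cs'"
  have l': "linked K \<beta> \<gamma> cs'" by (rule merge_linked[OF K b(3,1)])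
  note ne = merge_dims[OF b(3)]
  have "block_merge K (bs @ cs) (bs @ cs')" using merge_append[OF b(3), of bs "[]"] by simp
  moreover have "linked K \<alpha> \<gamma> (bs @ cs)" using b(1) l by (auto simp: linked_append)
  ultimately have "block_class T K \<alpha> \<gamma> (bs @ cs) = block_class T K \<alpha> \<gamma> (bs @ cs')" by (rule merge_same_class)
  then show "chain_rel T K \<alpha> \<gamma> (m + n) `` {tuple_of K (bs @ blocks (tuple_of K cs))} =
      chain_rel T K \<alpha> \<gamma> (m + n) `` {tuple_of K (bs @ blocks (tuple_of K cs'))}"
    using b(2) m ne tuple_of_props(2)[OF K b(1)] tuple_of_props(2)[OF K l'] by (simp add: block_class_def)
qed

lemma pcomp_chain_flow: "pcomp (chain_flow T K) \<alpha> \<beta> \<gamma> (m, C) (n, D) = (m + n, concat_classes T K \<alpha> \<gamma> (m + n) C D)"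
  by (simp add: chain_flow_def concat_classes_def)

text \<open>The union in the definition of the composition runs over equal sets, so it may be computed with one
  pair of representatives.\<close>

lemma concat_classes_eq:
  assumes p: "p \<in> topspace (chain_sum K \<alpha> \<beta> m)" and q: "q \<in> topspace (chain_sum K \<beta> \<gamma> n)"
  shows "concat_classes T K \<alpha> \<gamma> (m + n) (chain_rel T K \<alpha> \<beta> m `` {p}) (chain_rel T K \<beta> \<gamma> n `` {q}) =
    chain_rel T K \<alpha> \<gamma> (m + n) `` {tuple_of K (blocks p @ blocks q)}"
proof -
  let ?R = "chain_rel T K \<alpha> \<gamma> (m + n) `` {tuple_of K (blocks p @ blocks q)}"
  let ?C = "chain_rel T K \<alpha> \<beta> m `` {p}" and ?D = "chain_rel T K \<beta> \<gamma> n `` {q}"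
  have R: "chain_rel T K \<alpha> \<gamma> (m + n) `` {(chain_concat a b, xs @ ys)} = ?R"
    if "(a, xs) \<in> ?C" "(b, ys) \<in> ?D" for a b xs ys
  proof -
    have r: "(p, (a, xs)) \<in> chain_rel T K \<alpha> \<beta> m" "(q, (b, ys)) \<in> chain_rel T K \<beta> \<gamma> n" using that by simp_all
    then have t: "(a, xs) \<in> topspace (chain_sum K \<alpha> \<beta> m)" "(b, ys) \<in> topspace (chain_sum K \<beta> \<gamma> n)"
      using equiv_type[OF equiv_chain_rel] by blast+
    obtain ns a' where a: "a = (ns, a')" by fastforce
    obtain ms b' where b: "b = (ms, b')" by fastforce
    have "(chain_concat a b, xs @ ys) = tuple_of K (blocks (a, xs) @ blocks (b, ys))"
    proof -
      have "(ns, a') \<in> chains K \<alpha> \<beta> m" "xs \<in> topspace (path_tuples ns)"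
        "(ms, b') \<in> chains K \<beta> \<gamma> n" "ys \<in> topspace (path_tuples ms)"
        using t unfolding a b by (simp_all add: topspace_chain_sum)
      then show ?thesis unfolding a b by (rule chain_concat_blocks[OF K])
    qed
    then show ?thesis
      using concat_class_left[OF r(1) chain_sum_blocks(1,2,3)[OF t(2)]]
        concat_class_right[OF r(2) chain_sum_blocks(1,2,3)[OF p]] by simp
  qed
  have ne: "p \<in> ?C" "q \<in> ?D" using equiv_class_self[OF equiv_chain_rel] p q by auto
  have "concat_classes T K \<alpha> \<gamma> (m + n) ?C ?D = (\<Union>_\<in>?C. \<Union>_\<in>?D. ?R)"
    unfolding concat_classes_def
  proof (rule SUP_cong[OF refl])
    fix z assume z: "z \<in> ?C"
    obtain a xs where z': "z = (a, xs)" by fastforce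
    have "(\<Union>(b, ys)\<in>?D. chain_rel T K \<alpha> \<gamma> (m + n) `` {(chain_concat a b, xs @ ys)}) = (\<Union>_\<in>?D. ?R)"
    proof (rule SUP_cong[OF refl])
      fix w assume w: "w \<in> ?D"
      obtain b ys where w': "w = (b, ys)" by fastforce
      show "(case w of (b, ys) \<Rightarrow> chain_rel T K \<alpha> \<gamma> (m + n) `` {(chain_concat a b, xs @ ys)}) = ?R"
        using R[of a xs b ys] z w unfolding z' w' by simp
    qed
    then show "(case z of (a, xs) \<Rightarrow> \<Union>(b, ys)\<in>?D. chain_rel T K \<alpha> \<gamma> (m + n) `` {(chain_concat a b, xs @ ys)}) = (\<Union>_\<in>?D. ?R)"
      by (simp add: z')
  qed
  also have "\<dots> = ?R" using ne by blast
  finally show ?thesis .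
qed

text \<open>This makes the associativity of composition a property of lists.\<close>

lemma pcomp_block_class:
  assumes l: "linked K \<alpha> \<beta> bs" "bs \<noteq> []" and m: "linked K \<beta> \<gamma> cs" "cs \<noteq> []"
  shows "pcomp (chain_flow T K) \<alpha> \<beta> \<gamma> (block_class T K \<alpha> \<beta> bs) (block_class T K \<beta> \<gamma> cs) = block_class T K \<alpha> \<gamma> (bs @ cs)"
  unfolding block_class_def pcomp_chain_flow
  using concat_classes_eq[OF tuple_of_in_chain_sum[OF l] tuple_of_in_chain_sum[OF m]]
    tuple_of_props(2)[OF K l] tuple_of_props(2)[OF K m] by simp

text \<open>On representatives, composition is continuous by \<open>top_path_concat\<close>; since a product of two quotient maps
  is again one for $\Delta$-generated spaces, this suffices.\<close>

lemma continuous_map_pcomp_chain_flow: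
  "continuous_map (dprod (paths (chain_flow T K) \<alpha> \<beta>) (paths (chain_flow T K) \<beta> \<gamma>)) (paths (chain_flow T K) \<alpha> \<gamma>)
    (\<lambda>(x, y). pcomp (chain_flow T K) \<alpha> \<beta> \<gamma> x y)"
proof (rule continuous_map_from_delta_generated)
  show "delta_generated (dprod (paths (chain_flow T K) \<alpha> \<beta>) (paths (chain_flow T K) \<beta> \<gamma>))"
    by (simp add: dprod_def)
  fix p assume "top_path (dprod (paths (chain_flow T K) \<alpha> \<beta>) (paths (chain_flow T K) \<beta> \<gamma>)) p"
  then have p: "top_path (sum_topology (\<lambda>n. chain_colim T K \<alpha> \<beta> n) {1..}) (\<lambda>t. fst (p t))"
    "top_path (sum_topology (\<lambda>n. chain_colim T K \<beta> \<gamma> n) {1..}) (\<lambda>t. snd (p t))"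
    by (simp_all add: top_path_dprod paths_chain_flow)
  obtain m q where q: "m \<in> {1..}" "top_path (chain_colim T K \<alpha> \<beta> m) q" "\<And>t. t \<in> {0..1} \<Longrightarrow> fst (p t) = (m, q t)"
    using p(1) by (rule top_path_sum) blast
  obtain n r where r: "n \<in> {1..}" "top_path (chain_colim T K \<beta> \<gamma> n) r" "\<And>t. t \<in> {0..1} \<Longrightarrow> snd (p t) = (n, r t)"
    using p(2) by (rule top_path_sum) blast
  have "top_path (chain_colim T K \<alpha> \<gamma> (m + n)) (\<lambda>t. concat_classes T K \<alpha> \<gamma> (m + n) (q t) (r t))"
  proof (rule quot_times_quot_top_path[where f = "concat_classes T K \<alpha> \<gamma> (m + n)" and p = q and r = r, OF equiv_chain_rel delta_generated_chain_sum equiv_chain_rel delta_generated_chain_sum])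
    show "top_path (quot_top (chain_sum K \<alpha> \<beta> m) (chain_rel T K \<alpha> \<beta> m)) q"
      "top_path (quot_top (chain_sum K \<beta> \<gamma> n) (chain_rel T K \<beta> \<gamma> n)) r"
      using q(2) r(2) by (simp_all add: chain_colim_quot)
    fix c d assume c: "top_path (chain_sum K \<alpha> \<beta> m) c" and d: "top_path (chain_sum K \<beta> \<gamma> n) d"
    obtain ns a u where u: "(ns, a) \<in> chains K \<alpha> \<beta> m" "top_path (path_tuples ns) u"
      "\<And>t. t \<in> {0..1} \<Longrightarrow> c t = ((ns, a), u t)" using c by (rule top_path_chain_sum) blast
    obtain ms b v where v: "(ms, b) \<in> chains K \<beta> \<gamma> n" "top_path (path_tuples ms) v"
      "\<And>t. t \<in> {0..1} \<Longrightarrow> d t = ((ms, b), v t)" using d by (rule top_path_chain_sum) blast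
    from top_path_chain_class[OF top_path_concat[OF u(1,2) v(1,2)]]
    show "top_path (chain_colim T K \<alpha> \<gamma> (m + n))
        (\<lambda>t. concat_classes T K \<alpha> \<gamma> (m + n) (chain_rel T K \<alpha> \<beta> m `` {c t}) (chain_rel T K \<beta> \<gamma> n `` {d t}))"
    proof (rule continuous_map_eq)
      fix t :: real assume "t \<in> topspace unit_interval_top"
      then have t: "t \<in> {0..1}" by simp
      show "chain_rel T K \<alpha> \<gamma> (m + n) `` {tuple_of K (blocks ((ns, a), u t) @ blocks ((ms, b), v t))} =
        concat_classes T K \<alpha> \<gamma> (m + n) (chain_rel T K \<alpha> \<beta> m `` {c t}) (chain_rel T K \<beta> \<gamma> n `` {d t})"
        using concat_classes_eq[OF top_path_in[OF c t] top_path_in[OF d t]]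
        unfolding u(3)[OF t] v(3)[OF t] by (rule sym)
    qed
  qed
  from top_path_sumI[where i = "m + n" and I = "{1..}" and X = "\<lambda>n. chain_colim T K \<alpha> \<gamma> n", OF _ this] q(1)
  have "top_path (sum_topology (\<lambda>n. chain_colim T K \<alpha> \<gamma> n) {1..}) (\<lambda>t. (m + n, concat_classes T K \<alpha> \<gamma> (m + n) (q t) (r t)))"
    by simp
  then show "top_path (paths (chain_flow T K) \<alpha> \<gamma>) ((\<lambda>(x, y). pcomp (chain_flow T K) \<alpha> \<beta> \<gamma> x y) \<circ> p)"
    unfolding paths_chain_flow
  proof (rule continuous_map_eq)
    fix t :: real assume "t \<in> topspace unit_interval_top"
    then have t: "t \<in> {0..1}" by simp
    show "(m + n, concat_classes T K \<alpha> \<gamma> (m + n) (q t) (r t)) = ((\<lambda>(x, y). pcomp (chain_flow T K) \<alpha> \<beta> \<gamma> x y) \<circ> p) t"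
      using q(3)[OF t] r(3)[OF t] by (simp add: case_prod_beta pcomp_chain_flow)
  qed
qed

lemma is_flow_chain_flow: "is_flow T (chain_flow T K)"
  unfolding is_flow_def
proof (intro conjI ballI)
  show "in_Top T (paths (chain_flow T K) \<alpha> \<beta>)" for \<alpha> \<beta>
    unfolding paths_chain_flow by (rule in_Top_sum) (rule in_Top_chain_colim)
  fix \<alpha> \<beta> \<gamma> \<delta> x y z
  assume "x \<in> topspace (paths (chain_flow T K) \<alpha> \<beta>)" "y \<in> topspace (paths (chain_flow T K) \<beta> \<gamma>)"
    "z \<in> topspace (paths (chain_flow T K) \<gamma> \<delta>)"
  then obtain bs cs ds where b: "linked K \<alpha> \<beta> bs" "bs \<noteq> []" "x = block_class T K \<alpha> \<beta> bs"
    and c: "linked K \<beta> \<gamma> cs" "cs \<noteq> []" "y = block_class T K \<beta> \<gamma> cs"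
    and d: "linked K \<gamma> \<delta> ds" "ds \<noteq> []" "z = block_class T K \<gamma> \<delta> ds"
    by (meson block_class_cases)
  have bc: "linked K \<alpha> \<gamma> (bs @ cs)" "linked K \<beta> \<delta> (cs @ ds)" using b c d by (auto simp: linked_append)
  show "pcomp (chain_flow T K) \<alpha> \<gamma> \<delta> (pcomp (chain_flow T K) \<alpha> \<beta> \<gamma> x y) z =
    pcomp (chain_flow T K) \<alpha> \<beta> \<delta> x (pcomp (chain_flow T K) \<beta> \<gamma> \<delta> y z)"
    unfolding b(3) c(3) d(3) pcomp_block_class[OF b(1,2) c(1,2)] pcomp_block_class[OF c(1,2) d(1,2)]
    using pcomp_block_class[OF bc(1) _ d(1,2)] pcomp_block_class[OF b(1,2) bc(2)] b c d by simp
qed (rule continuous_map_pcomp_chain_flow)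

end

section \<open>The legs of the colimit\<close>

definition top_cell :: "'k cube_over \<Rightarrow> 'k" where
  "top_cell a = snd a (fst a) (\<lambda>v\<in>verts (fst a). v)"

text \<open>The map from the standard cube to \<open>K\<close> with value \<open>c\<close> on the top cell.\<close>

definition yoneda_map :: "'k precub \<Rightarrow> nat \<Rightarrow> 'k \<Rightarrow> (bool list \<Rightarrow> bool list, 'k) pmap" where
  "yoneda_map K n c = (\<lambda>d. \<lambda>\<phi>\<in>cells (std_cube n) d. act K d n \<phi> c)"

text \<open>A path from \<open>\<alpha>\<close> to \<open>\<beta>\<close> in a cube is regarded as a cube chain with a single cube, the face spanned by
  these vertices.\<close>

definition chain_leg :: "top_choice \<Rightarrow> 'k precub \<Rightarrow> 'k cube_over \<Rightarrow> (bool list, dpath, 'k, 'k cpath) fmap" where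
  "chain_leg T K a = (vertex_of K (fst a) (top_cell a), \<lambda>\<alpha> \<beta> x.
    block_class T K (vertex_of K (fst a) (top_cell a) \<alpha>) (vertex_of K (fst a) (top_cell a) \<beta>)
      [(diff_dim \<alpha> \<beta>, act K (diff_dim \<alpha> \<beta>) (fst a) (subcube_map \<alpha> \<beta>) (top_cell a), x)])"

lemma cells_std_cube: "cells (std_cube n) d = {\<phi>. box d n \<phi>}"
  by (simp add: std_cube_def)

lemma act_std_cube: "act (std_cube n) m d \<psi> \<phi> = compose (verts m) \<phi> \<psi>"
  by (simp add: std_cube_def)

lemma precubical_std_cube: "precubical_set (std_cube n)"
  unfolding precubical_set_def cells_std_cube act_std_cube
  by (auto simp: box_compose_id box_compose_assoc intro: box_comp)

context
  fixes K :: "'k precub"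
  assumes K: "precubical_set K"
begin

lemma yoneda_map_apply: "box d n \<phi> \<Longrightarrow> yoneda_map K n c d \<phi> = act K d n \<phi> c"
  by (simp add: yoneda_map_def cells_std_cube)

lemma yoneda_map_pmaps:
  assumes c: "c \<in> cells K n" shows "yoneda_map K n c \<in> pmaps (std_cube n) K"
  unfolding pmaps_def
proof (rule CollectI, intro conjI allI impI ballI)
  show "yoneda_map K n c d \<in> cells (std_cube n) d \<rightarrow>\<^sub>E cells K d" for d
    using precub_act[OF K _ c] by (auto simp: yoneda_map_def cells_std_cube)
  fix m d \<psi> \<phi> assume b: "box m d \<psi>" and "\<phi> \<in> cells (std_cube n) d"
  then have phi: "box d n \<phi>" by (simp add: cells_std_cube)
  show "yoneda_map K n c m (act (std_cube n) m d \<psi> \<phi>) = act K m d \<psi> (yoneda_map K n c d \<phi>)"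
    unfolding act_std_cube yoneda_map_apply[OF phi] yoneda_map_apply[OF box_comp[OF b phi]] by (rule precub_comp[OF K b phi c, symmetric])
qed

lemma yoneda_map_over: "c \<in> cells K n \<Longrightarrow> (n, yoneda_map K n c) \<in> cubes_over K"
  by (simp add: cubes_over_def yoneda_map_pmaps)

lemma top_cell_yoneda_map: "c \<in> cells K n \<Longrightarrow> top_cell (n, yoneda_map K n c) = c"
  unfolding top_cell_def fst_conv snd_conv yoneda_map_apply[OF box_id] by (rule precub_id[OF K])

lemma top_cell_in:
  assumes "a \<in> cubes_over K" shows "top_cell a \<in> cells K (fst a)"
proof -
  have "snd a \<in> pmaps (std_cube (fst a)) K" using assms by (auto simp: cubes_over_def)
  then show ?thesis unfolding top_cell_def by (rule pmapsD(2)) (simp add: cells_std_cube box_id)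
qed

lemma cube_over_apply:
  assumes a: "a \<in> cubes_over K" and b: "box d (fst a) \<phi>"
  shows "snd a d \<phi> = act K d (fst a) \<phi> (top_cell a)"
proof -
  have p: "snd a \<in> pmaps (std_cube (fst a)) K" using a by (auto simp: cubes_over_def)
  have "(\<lambda>v\<in>verts (fst a). v) \<in> cells (std_cube (fst a)) (fst a)" by (simp add: cells_std_cube box_id)
  from pmapsD(3)[OF p b this] show ?thesis unfolding act_std_cube box_id_compose[OF b] top_cell_def .
qed

lemma cube_over_yoneda_map:
  assumes a: "a \<in> cubes_over K" shows "a = (fst a, yoneda_map K (fst a) (top_cell a))"
proof -
  have p: "snd a \<in> pmaps (std_cube (fst a)) K" using a by (auto simp: cubes_over_def)
  have "snd a = yoneda_map K (fst a) (top_cell a)"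
  proof
    fix d show "snd a d = yoneda_map K (fst a) (top_cell a) d"
      by (rule extensionalityI[OF pmapsD(1)[OF p]])
        (use cube_over_apply[OF a] in \<open>simp_all add: yoneda_map_def cells_std_cube\<close>)
  qed
  then show ?thesis by (simp add: prod_eq_iff)
qed

lemma yoneda_map_hom:
  assumes b: "box m n \<phi>" and c: "c \<in> cells K n"
  shows "(\<phi>, \<lambda>_ _. id) \<in> cube_over_homs (m, yoneda_map K m (act K m n \<phi> c)) (n, yoneda_map K n c)"
proof -
  have "pmap_comp (std_cube m) (yoneda_map K n c) (std_cube_map m \<phi>) = yoneda_map K m (act K m n \<phi> c)"
    unfolding pmap_comp_def yoneda_map_def[of K m] compose_def
  proof (rule ext, rule restrict_ext)
    fix d \<psi> assume "\<psi> \<in> cells (std_cube m) d"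
    then have psi: "box d m \<psi>" by (simp add: cells_std_cube)
    have "std_cube_map m \<phi> d \<psi> = compose (verts d) \<phi> \<psi>" using psi by (simp add: std_cube_map_def cells_std_cube)
    then show "yoneda_map K n c d (std_cube_map m \<phi> d \<psi>) = act K d m \<psi> (act K m n \<phi> c)"
      using yoneda_map_apply[OF box_comp[OF psi b]] precub_comp[OF K psi b c] by simp
  qed
  then show ?thesis using b unfolding cube_over_homs_def by simp
qed

lemma cube_over_homs_top:
  assumes m: "m \<in> cube_over_homs a b" and b: "b \<in> cubes_over K"
  obtains \<phi> where "m = (\<phi>, \<lambda>_ _. id)" "box (fst a) (fst b) \<phi>" "top_cell a = act K (fst a) (fst b) \<phi> (top_cell b)"
proof -
  obtain \<phi> where phi: "m = (\<phi>, \<lambda>_ _. id)" "box (fst a) (fst b) \<phi>"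
    "pmap_comp (std_cube (fst a)) (snd b) (std_cube_map (fst a) \<phi>) = snd a"
    using m unfolding cube_over_homs_def by blast
  let ?id = "\<lambda>v\<in>verts (fst a). v"
  have i: "?id \<in> cells (std_cube (fst a)) (fst a)" by (simp add: cells_std_cube box_id)
  have "top_cell a = snd b (fst a) (std_cube_map (fst a) \<phi> (fst a) ?id)"
    unfolding top_cell_def phi(3)[symmetric] by (rule pmap_comp_apply[OF i])
  also have "std_cube_map (fst a) \<phi> (fst a) ?id = \<phi>"
    using box_compose_id[OF phi(2)] i by (simp only: std_cube_map_def restrict_apply' )
  also have "snd b (fst a) \<phi> = act K (fst a) (fst b) \<phi> (top_cell b)" by (rule cube_over_apply[OF b phi(2)])
  finally show ?thesis using that phi by blast
qed

lemma subcube_block_linked: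
  assumes c: "c \<in> cells K n" and ab: "vertex_le \<alpha> \<beta>" "\<alpha> \<noteq> \<beta>" "length \<alpha> = n" and x: "natural_path (diff_dim \<alpha> \<beta>) x"
  shows "linked K (vertex_of K n c \<alpha>) (vertex_of K n c \<beta>) [(diff_dim \<alpha> \<beta>, act K (diff_dim \<alpha> \<beta>) n (subcube_map \<alpha> \<beta>) c, x)]"
proof -
  note b = box_subcube_mapI[OF ab(1,3)]
  have "0 < diff_dim \<alpha> \<beta>" using diff_dim_pos[OF ab(1)] ab(2) by simp
  then show ?thesis
    using precub_act[OF K b c] x subcube_map_ends[OF ab(1)]
    by (simp add: block_ok_def block_source_def block_target_def vertex_of_act[OF K b c])
qed

text \<open>The composite in the cube is computed in the face spanned by \<open>\<alpha>\<close> and \<open>\<gamma>\<close>, where \<open>\<beta>\<close> becomes the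
  indicator of the set of coordinates that change first. This is exactly the shape of a merging step.\<close>

lemma subcube_maps_merge:
  assumes c: "c \<in> cells K n" and ab: "vertex_le \<alpha> \<beta>" "\<alpha> \<noteq> \<beta>" "length \<alpha> = n" and bg: "vertex_le \<beta> \<gamma>" "\<beta> \<noteq> \<gamma>"
  shows "block_merge K [(diff_dim \<alpha> \<beta>, act K (diff_dim \<alpha> \<beta>) n (subcube_map \<alpha> \<beta>) c, x), (diff_dim \<beta> \<gamma>, act K (diff_dim \<beta> \<gamma>) n (subcube_map \<beta> \<gamma>) c, y)]
    [(diff_dim \<alpha> \<gamma>, act K (diff_dim \<alpha> \<gamma>) n (subcube_map \<alpha> \<gamma>) c, cube_comp \<alpha> \<beta> \<gamma> x y)]"
proof -
  have ag: "vertex_le \<alpha> \<gamma>" by (rule vertex_le_trans[OF ab(1) bg(1)])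
  define m where "m = diff_dim \<alpha> \<gamma>"
  define A B where "A = first_coords \<alpha> \<beta> \<gamma>" and "B = {..<m} - A"
  note fc = first_coords_props[OF ab(1) bg(1), folded m_def A_def]
  have AB: "A \<union> B = {..<m}" "A \<inter> B = {}" using fc(1) by (auto simp: B_def)
  have cAB: "card A = diff_dim \<alpha> \<beta>" "card B = diff_dim \<beta> \<gamma>" using fc(2,3) by (simp_all add: B_def)
  have "0 < diff_dim \<alpha> \<beta>" "0 < diff_dim \<beta> \<gamma>" using diff_dim_pos[OF ab(1)] diff_dim_pos[OF bg(1)] ab bg by simp_all
  then have ne: "A \<noteq> {}" "B \<noteq> {}" using cAB by auto
  note s = box_subcube_mapI[OF ag ab(3), folded m_def]
  let ?c = "act K m n (subcube_map \<alpha> \<gamma>) c"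
  have c': "?c \<in> cells K m" by (rule precub_act[OF K s c])
  have ends: "subcube_map \<alpha> \<gamma> (zeros m) = \<alpha>" "subcube_map \<alpha> \<gamma> (indicator A m) = \<beta>" "subcube_map \<alpha> \<gamma> (ones m) = \<gamma>"
    using subcube_map_ends[OF ag] subcube_map_middle[OF ab(1) bg(1)] by (simp_all add: m_def A_def)
  have "compose (verts (card A)) (subcube_map \<alpha> \<gamma>) (subcube_map (zeros m) (indicator A m)) = subcube_map \<alpha> \<beta>"
    "compose (verts (card B)) (subcube_map \<alpha> \<gamma>) (subcube_map (indicator A m) (ones m)) = subcube_map \<beta> \<gamma>"
    using box_subcube_map(2)[OF s, of "zeros m" "indicator A m"] box_subcube_map(2)[OF s, of "indicator A m" "ones m"]
      vertex_le_indicator(1)[of m A] vertex_le_indicator(2)[of A m]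
    by (simp_all add: ends partition_diff_dim[OF AB])
  then have "act K (card A) m (subcube_map (zeros m) (indicator A m)) ?c = act K (diff_dim \<alpha> \<beta>) n (subcube_map \<alpha> \<beta>) c"
    "act K (card B) m (subcube_map (indicator A m) (ones m)) ?c = act K (diff_dim \<beta> \<gamma>) n (subcube_map \<beta> \<gamma>) c"
    using precub_comp[OF K partition_box(1)[OF AB] s c] precub_comp[OF K partition_box(2)[OF AB] s c] cAB by simp_all
  moreover have "cube_comp \<alpha> \<beta> \<gamma> x y = cube_comp (zeros m) (indicator A m) (ones m) x y"
    unfolding m_def A_def by (rule cube_comp_normalize[OF ab(1) bg(1)])
  ultimately show ?thesis
    using block_mergeI[OF AB ne c', of "[]" x y "[]"] cAB by (simp add: m_def[symmetric])
qed

end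

section \<open>Maps of flows\<close>

lemma fmap_eq_sym: "fmap_eq X f g \<Longrightarrow> fmap_eq X g f"
  by (simp add: fmap_eq_def)

lemma fmap_eq_trans: "fmap_eq X f g \<Longrightarrow> fmap_eq X g h \<Longrightarrow> fmap_eq X f h"
  by (simp add: fmap_eq_def)

lemma flow_mapD:
  assumes "flow_map X Y f" "\<alpha> \<in> states X" "\<beta> \<in> states X"
  shows "fst f \<alpha> \<in> states Y"
    "continuous_map (paths X \<alpha> \<beta>) (paths Y (fst f \<alpha>) (fst f \<beta>)) (snd f \<alpha> \<beta>)"
    "x \<in> topspace (paths X \<alpha> \<beta>) \<Longrightarrow> snd f \<alpha> \<beta> x \<in> topspace (paths Y (fst f \<alpha>) (fst f \<beta>))"
    "\<gamma> \<in> states X \<Longrightarrow> x \<in> topspace (paths X \<alpha> \<beta>) \<Longrightarrow> y \<in> topspace (paths X \<beta> \<gamma>) \<Longrightarrow>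
      snd f \<alpha> \<gamma> (pcomp X \<alpha> \<beta> \<gamma> x y) = pcomp Y (fst f \<alpha>) (fst f \<beta>) (fst f \<gamma>) (snd f \<alpha> \<beta> x) (snd f \<beta> \<gamma> y)"
proof -
  show "fst f \<alpha> \<in> states Y" using assms unfolding flow_map_def by blast
  show c: "continuous_map (paths X \<alpha> \<beta>) (paths Y (fst f \<alpha>) (fst f \<beta>)) (snd f \<alpha> \<beta>)"
    using assms unfolding flow_map_def by blast
  show "x \<in> topspace (paths X \<alpha> \<beta>) \<Longrightarrow> snd f \<alpha> \<beta> x \<in> topspace (paths Y (fst f \<alpha>) (fst f \<beta>))"
    using continuous_map_funspace[OF c] by blast
  show "\<gamma> \<in> states X \<Longrightarrow> x \<in> topspace (paths X \<alpha> \<beta>) \<Longrightarrow> y \<in> topspace (paths X \<beta> \<gamma>) \<Longrightarrow>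
      snd f \<alpha> \<gamma> (pcomp X \<alpha> \<beta> \<gamma> x y) = pcomp Y (fst f \<alpha>) (fst f \<beta>) (fst f \<gamma>) (snd f \<alpha> \<beta> x) (snd f \<beta> \<gamma> y)"
    using assms unfolding flow_map_def by blast
qed

lemma flow_map_id: "flow_map X X fmap_id"
  by (simp add: flow_map_def fmap_id_def)

lemma flow_map_comp:
  assumes f: "flow_map X Y f" and g: "flow_map Y Z g"
  shows "flow_map X Z (fmap_comp g f)"
proof -
  have s1: "fst (fmap_comp g f) v = fst g (fst f v)"
    and s2: "snd (fmap_comp g f) v w = snd g (fst f v) (fst f w) \<circ> snd f v w" for v w
    by (simp_all add: fmap_comp_def)
  show ?thesis
    unfolding flow_map_def
  proof (intro conjI ballI)
    fix \<alpha> assume a: "\<alpha> \<in> states X"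
    show "fst (fmap_comp g f) \<alpha> \<in> states Z" unfolding s1 using flow_mapD(1)[OF g] flow_mapD(1)[OF f] a by blast
    fix \<beta> assume b: "\<beta> \<in> states X"
    note ab = flow_mapD(1)[OF f a a] flow_mapD(1)[OF f b b]
    show "continuous_map (paths X \<alpha> \<beta>) (paths Z (fst (fmap_comp g f) \<alpha>) (fst (fmap_comp g f) \<beta>)) (snd (fmap_comp g f) \<alpha> \<beta>)"
      unfolding s1 s2 by (rule continuous_map_compose[OF flow_mapD(2)[OF f a b] flow_mapD(2)[OF g ab]])
    fix \<gamma> x y assume c: "\<gamma> \<in> states X" and x: "x \<in> topspace (paths X \<alpha> \<beta>)" and y: "y \<in> topspace (paths X \<beta> \<gamma>)"
    note fc = flow_mapD(1)[OF f c c]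
    show "snd (fmap_comp g f) \<alpha> \<gamma> (pcomp X \<alpha> \<beta> \<gamma> x y) =
      pcomp Z (fst (fmap_comp g f) \<alpha>) (fst (fmap_comp g f) \<beta>) (fst (fmap_comp g f) \<gamma>)
        (snd (fmap_comp g f) \<alpha> \<beta> x) (snd (fmap_comp g f) \<beta> \<gamma> y)"
      unfolding s1 s2 comp_apply flow_mapD(4)[OF f a b c x y]
      by (rule flow_mapD(4)[OF g ab fc flow_mapD(3)[OF f a b x] flow_mapD(3)[OF f b c y]])
  qed
qed

lemma fmap_comp_assoc: "fmap_comp h (fmap_comp g f) = fmap_comp (fmap_comp h g) f"
  by (simp add: fmap_comp_def comp_assoc)

lemma fmap_comp_cong_left: "fmap_eq X f g \<Longrightarrow> fmap_eq X (fmap_comp h f) (fmap_comp h g)"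
  by (simp add: fmap_eq_def fmap_comp_def)

lemma fmap_comp_cong_right: "flow_map X Y f \<Longrightarrow> fmap_eq Y g h \<Longrightarrow> fmap_eq X (fmap_comp g f) (fmap_comp h f)"
  using flow_mapD(1,3)[of X Y f] by (simp add: fmap_eq_def fmap_comp_def)

lemma fmap_comp_id_left [simp]: "fmap_comp fmap_id f = f"
  by (simp add: fmap_comp_def fmap_id_def prod_eq_iff)

lemma flow_map_cong:
  assumes "flow_map X Y f" "fmap_eq X f g" "is_flow T X"
  shows "flow_map X Y g"
proof -
  have s: "fst g \<alpha> = fst f \<alpha>" if "\<alpha> \<in> states X" for \<alpha> using assms(2) that by (simp add: fmap_eq_def)
  have p: "snd g \<alpha> \<beta> x = snd f \<alpha> \<beta> x" if "\<alpha> \<in> states X" "\<beta> \<in> states X" "x \<in> topspace (paths X \<alpha> \<beta>)" for \<alpha> \<beta> x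
    using assms(2) that by (simp add: fmap_eq_def)
  show ?thesis
    unfolding flow_map_def
  proof (intro conjI ballI)
    fix \<alpha> assume a: "\<alpha> \<in> states X"
    show "fst g \<alpha> \<in> states Y" using flow_mapD(1)[OF assms(1) a a] s[OF a] by simp
    fix \<beta> assume b: "\<beta> \<in> states X"
    show "continuous_map (paths X \<alpha> \<beta>) (paths Y (fst g \<alpha>) (fst g \<beta>)) (snd g \<alpha> \<beta>)"
      unfolding s[OF a] s[OF b] by (rule continuous_map_eq[OF flow_mapD(2)[OF assms(1) a b]]) (simp add: p a b)
    fix \<gamma> x y assume c: "\<gamma> \<in> states X" and x: "x \<in> topspace (paths X \<alpha> \<beta>)" and y: "y \<in> topspace (paths X \<beta> \<gamma>)"
    have "pcomp X \<alpha> \<beta> \<gamma> x y \<in> topspace (paths X \<alpha> \<gamma>)"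
    proof -
      have "continuous_map (dprod (paths X \<alpha> \<beta>) (paths X \<beta> \<gamma>)) (paths X \<alpha> \<gamma>) (\<lambda>(x, y). pcomp X \<alpha> \<beta> \<gamma> x y)"
        using assms(3) a b c unfolding is_flow_def by blast
      from funcset_mem[OF continuous_map_funspace[OF this], of "(x, y)"] x y show ?thesis
        by (simp add: dprod_def)
    qed
    then show "snd g \<alpha> \<gamma> (pcomp X \<alpha> \<beta> \<gamma> x y) = pcomp Y (fst g \<alpha>) (fst g \<beta>) (fst g \<gamma>) (snd g \<alpha> \<beta> x) (snd g \<beta> \<gamma> y)"
      using flow_mapD(4)[OF assms(1) a b c x y] by (simp add: s p a b c x y)
  qed
qed

lemma is_flow_pcomp:
  assumes "is_flow T X" "\<alpha> \<in> states X" "\<beta> \<in> states X" "\<gamma> \<in> states X"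
  shows "continuous_map (dprod (paths X \<alpha> \<beta>) (paths X \<beta> \<gamma>)) (paths X \<alpha> \<gamma>) (\<lambda>(x, y). pcomp X \<alpha> \<beta> \<gamma> x y)"
    "x \<in> topspace (paths X \<alpha> \<beta>) \<Longrightarrow> y \<in> topspace (paths X \<beta> \<gamma>) \<Longrightarrow> pcomp X \<alpha> \<beta> \<gamma> x y \<in> topspace (paths X \<alpha> \<gamma>)"
proof -
  show c: "continuous_map (dprod (paths X \<alpha> \<beta>) (paths X \<beta> \<gamma>)) (paths X \<alpha> \<gamma>) (\<lambda>(x, y). pcomp X \<alpha> \<beta> \<gamma> x y)"
    using assms unfolding is_flow_def by blast
  show "x \<in> topspace (paths X \<alpha> \<beta>) \<Longrightarrow> y \<in> topspace (paths X \<beta> \<gamma>) \<Longrightarrow> pcomp X \<alpha> \<beta> \<gamma> x y \<in> topspace (paths X \<alpha> \<gamma>)"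
    using funcset_mem[OF continuous_map_funspace[OF c], of "(x, y)"] by (simp add: dprod_def)
qed

lemma is_flow_assoc:
  assumes "is_flow T X" "\<alpha> \<in> states X" "\<beta> \<in> states X" "\<gamma> \<in> states X" "\<delta> \<in> states X"
    "x \<in> topspace (paths X \<alpha> \<beta>)" "y \<in> topspace (paths X \<beta> \<gamma>)" "z \<in> topspace (paths X \<gamma> \<delta>)"
  shows "pcomp X \<alpha> \<gamma> \<delta> (pcomp X \<alpha> \<beta> \<gamma> x y) z = pcomp X \<alpha> \<beta> \<delta> x (pcomp X \<beta> \<gamma> \<delta> y z)"
  using assms unfolding is_flow_def by blast

section \<open>The cocone\<close>

lemma states_cube_flow [simp]: "states (cube_flow n) = verts n"
  by (simp add: cube_flow_def)

lemma topspace_cube_flow: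
  "x \<in> topspace (paths (cube_flow n) \<alpha> \<beta>) \<longleftrightarrow> vertex_le \<alpha> \<beta> \<and> \<alpha> \<noteq> \<beta> \<and> natural_path (diff_dim \<alpha> \<beta>) x"
  by (simp add: cube_flow_def vert_less_vertex_le topspace_natural_dpaths)

lemma pcomp_cube_flow [simp]: "pcomp (cube_flow n) = cube_comp"
  by (simp add: cube_flow_def)

text \<open>Continuity uses that the space of natural d-paths is $\Delta$-generated, so that it may be tested along
  paths; compatibility with composition is \<open>subcube_maps_merge\<close>.\<close>

lemma flow_map_chain_leg:
  assumes K: "precubical_set K" and a: "a \<in> cubes_over K"
  shows "flow_map (cube_flow (fst a)) (chain_flow T K) (chain_leg T K a)"
  unfolding flow_map_def states_cube_flow states_chain_flow
proof (intro conjI ballI)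
  define n c where "n = fst a" and "c = top_cell a"
  have c: "c \<in> cells K n" using top_cell_in[OF K a] by (simp add: n_def c_def)
  have leg: "fst (chain_leg T K a) v = vertex_of K n c v"
    "snd (chain_leg T K a) \<alpha> \<beta> x = block_class T K (vertex_of K n c \<alpha>) (vertex_of K n c \<beta>) [(diff_dim \<alpha> \<beta>, act K (diff_dim \<alpha> \<beta>) n (subcube_map \<alpha> \<beta>) c, x)]"
    for v \<alpha> \<beta> x by (simp_all add: chain_leg_def n_def c_def)
  fix \<alpha> assume a1: "\<alpha> \<in> verts (fst a)"
  then have la: "length \<alpha> = n" by (simp add: n_def)
  show "fst (chain_leg T K a) \<alpha> \<in> cells K 0" unfolding leg by (rule vertex_of_in[OF K c la])
  fix \<beta> assume b1: "\<beta> \<in> verts (fst a)"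
  then have lb: "length \<beta> = n" by (simp add: n_def)
  show "continuous_map (paths (cube_flow (fst a)) \<alpha> \<beta>)
     (paths (chain_flow T K) (fst (chain_leg T K a) \<alpha>) (fst (chain_leg T K a) \<beta>)) (snd (chain_leg T K a) \<alpha> \<beta>)"
  proof (cases "vert_less \<alpha> \<beta>")
    case False
    then show ?thesis by (simp add: cube_flow_def)
  next
    case True
    then have ab: "vertex_le \<alpha> \<beta>" "\<alpha> \<noteq> \<beta>" by (simp_all add: vert_less_vertex_le)
    define m e where "m = diff_dim \<alpha> \<beta>" and "e = act K m n (subcube_map \<alpha> \<beta>) c"
    have l: "linked K (vertex_of K n c \<alpha>) (vertex_of K n c \<beta>) [(m, e, x)]" if "natural_path m x" for x
      unfolding m_def e_def by (rule subcube_block_linked[OF K c ab la]) (use that m_def in simp)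
    have "continuous_map (natural_dpaths m) (paths (chain_flow T K) (vertex_of K n c \<alpha>) (vertex_of K n c \<beta>))
        (\<lambda>x. block_class T K (vertex_of K n c \<alpha>) (vertex_of K n c \<beta>) [(m, e, x)])"
    proof (rule continuous_map_from_delta_generated[OF delta_generated_natural_dpaths])
      fix q assume q: "top_path (natural_dpaths m) q"
      have 0: "natural_path m (q 0)" using top_path_in[OF q, of 0] by (simp add: topspace_natural_dpaths)
      note T0 = tuple_of_props[OF K l[OF 0]]
      have ch: "([m], wedge_map K [m] [e]) \<in> chains K (vertex_of K n c \<alpha>) (vertex_of K n c \<beta>) m"
        using T0(5) by (simp add: tuple_of_def)
      have "top_path (path_tuples (fst ([m], wedge_map K [m] [e]))) (\<lambda>t. [q t])"
        using q by (simp add: top_path_tuples)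
      then have "top_path (chain_sum K (vertex_of K n c \<alpha>) (vertex_of K n c \<beta>) m) (\<lambda>t. (([m], wedge_map K [m] [e]), [q t]))"
        unfolding chain_sum_def by (rule top_path_sumI[OF ch])
      from top_path_chain_class[OF K this]
      have "top_path (sum_topology (\<lambda>k. chain_colim T K (vertex_of K n c \<alpha>) (vertex_of K n c \<beta>) k) {1..})
          (\<lambda>t. (m, chain_rel T K (vertex_of K n c \<alpha>) (vertex_of K n c \<beta>) m `` {(([m], wedge_map K [m] [e]), [q t])}))"
        by (rule top_path_sumI[where X = "\<lambda>k. chain_colim T K (vertex_of K n c \<alpha>) (vertex_of K n c \<beta>) k", rotated]) (use linked_sum_pos[OF l[OF 0]] in simp)
      then show "top_path (paths (chain_flow T K) (vertex_of K n c \<alpha>) (vertex_of K n c \<beta>))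
          ((\<lambda>x. block_class T K (vertex_of K n c \<alpha>) (vertex_of K n c \<beta>) [(m, e, x)]) \<circ> q)"
        by (simp add: paths_chain_flow block_class_def tuple_of_def o_def)
    qed
    moreover have "snd (chain_leg T K a) \<alpha> \<beta> = (\<lambda>x. block_class T K (vertex_of K n c \<alpha>) (vertex_of K n c \<beta>) [(m, e, x)])"
      by (rule ext) (simp add: leg m_def e_def)
    ultimately show ?thesis using True by (simp add: cube_flow_def leg(1) m_def)
  qed
  fix \<gamma> x y assume g1: "\<gamma> \<in> verts (fst a)"
    and x: "x \<in> topspace (paths (cube_flow (fst a)) \<alpha> \<beta>)" and y: "y \<in> topspace (paths (cube_flow (fst a)) \<beta> \<gamma>)"
  have ab: "vertex_le \<alpha> \<beta>" "\<alpha> \<noteq> \<beta>" "natural_path (diff_dim \<alpha> \<beta>) x" and bg: "vertex_le \<beta> \<gamma>" "\<beta> \<noteq> \<gamma>" "natural_path (diff_dim \<beta> \<gamma>) y"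
    using x y by (simp_all add: topspace_cube_flow)
  note l1 = subcube_block_linked[OF K c ab(1,2) la ab(3)] and l2 = subcube_block_linked[OF K c bg(1,2) lb bg(3)]
  have l12: "linked K (vertex_of K n c \<alpha>) (vertex_of K n c \<gamma>) ([(diff_dim \<alpha> \<beta>, act K (diff_dim \<alpha> \<beta>) n (subcube_map \<alpha> \<beta>) c, x)] @
      [(diff_dim \<beta> \<gamma>, act K (diff_dim \<beta> \<gamma>) n (subcube_map \<beta> \<gamma>) c, y)])"
    unfolding linked_append using l1 l2 by blast
  show "snd (chain_leg T K a) \<alpha> \<gamma> (pcomp (cube_flow (fst a)) \<alpha> \<beta> \<gamma> x y) =
    pcomp (chain_flow T K) (fst (chain_leg T K a) \<alpha>) (fst (chain_leg T K a) \<beta>) (fst (chain_leg T K a) \<gamma>)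
      (snd (chain_leg T K a) \<alpha> \<beta> x) (snd (chain_leg T K a) \<beta> \<gamma> y)"
    unfolding leg pcomp_cube_flow pcomp_block_class[OF K l1 _ l2, simplified]
    using merge_same_class[OF K subcube_maps_merge[OF K c ab(1,2) la bg(1,2), of x y], of _ _ T] l12 by simp
qed

text \<open>A morphism of the box category carries the face spanned by two vertices to the face spanned by their
  images.\<close>

lemma chain_leg_hom:
  assumes K: "precubical_set K" and b: "b \<in> cubes_over K" and m: "m \<in> cube_over_homs a b"
  shows "fmap_eq (cube_flow (fst a)) (fmap_comp (chain_leg T K b) m) (chain_leg T K a)"
proof -
  obtain \<phi> where phi: "m = (\<phi>, \<lambda>_ _. id)" "box (fst a) (fst b) \<phi>"
    "top_cell a = act K (fst a) (fst b) \<phi> (top_cell b)" by (rule cube_over_homs_top[OF K m b])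
  note c = top_cell_in[OF K b]
  have v: "vertex_of K (fst a) (top_cell a) v = vertex_of K (fst b) (top_cell b) (\<phi> v)" if "length v = fst a" for v
    unfolding phi(3) by (rule vertex_of_act[OF K phi(2) c that])
  show ?thesis
    unfolding fmap_eq_def states_cube_flow
  proof (intro conjI ballI)
    fix \<alpha> assume "\<alpha> \<in> verts (fst a)"
    then have la: "length \<alpha> = fst a" by simp
    show "fst (fmap_comp (chain_leg T K b) m) \<alpha> = fst (chain_leg T K a) \<alpha>"
      using v[OF la] by (simp add: fmap_comp_def chain_leg_def phi(1))
    fix \<beta> x assume "\<beta> \<in> verts (fst a)" and x: "x \<in> topspace (paths (cube_flow (fst a)) \<alpha> \<beta>)"
    then have lb: "length \<beta> = fst a" by simp
    have ab: "vertex_le \<alpha> \<beta>" using x by (simp add: topspace_cube_flow)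
    note s = box_subcube_map(2)[OF phi(2) la ab]
    have "act K (diff_dim \<alpha> \<beta>) (fst a) (subcube_map \<alpha> \<beta>) (top_cell a) = act K (diff_dim \<alpha> \<beta>) (fst b) (subcube_map (\<phi> \<alpha>) (\<phi> \<beta>)) (top_cell b)"
      using precub_comp[OF K box_subcube_mapI[OF ab la] phi(2) c] s by (simp add: phi(3))
    then show "snd (fmap_comp (chain_leg T K b) m) \<alpha> \<beta> x = snd (chain_leg T K a) \<alpha> \<beta> x"
      using v[OF la] v[OF lb] s by (simp add: fmap_comp_def chain_leg_def phi(1))
  qed
qed

abbreviation cube_cocone where
  "cube_cocone T K \<equiv> flow_cocone T (cubes_over K) (\<lambda>a. cube_flow (fst a)) cube_over_homs"

lemma chain_cocone:
  assumes K: "precubical_set K"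
  shows "cube_cocone T K (chain_flow T K) (chain_leg T K)"
  unfolding flow_cocone_def
  using is_flow_chain_flow[OF K] flow_map_chain_leg[OF K] chain_leg_hom[OF K] by blast

lemma cube_cocone_pullback:
  assumes K: "precubical_set K" and L: "precubical_set L" and f: "f \<in> pmaps K L"
    and Y: "cube_cocone T L Y k"
  shows "cube_cocone T K Y (\<lambda>(n, c). k (n, pmap_comp (std_cube n) f c))"
proof -
  have over: "(n, pmap_comp (std_cube n) f c) \<in> cubes_over L" if "(n, c) \<in> cubes_over K" for n c
    using that pmap_comp_in[OF _ f precubical_std_cube] by (simp add: cubes_over_def)
  have hom: "m \<in> cube_over_homs (fst a, pmap_comp (std_cube (fst a)) f (snd a)) (fst b, pmap_comp (std_cube (fst b)) f (snd b))"
    if m: "m \<in> cube_over_homs a b" for m and a b :: "'a cube_over"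
  proof -
    obtain \<phi> where phi: "m = (\<phi>, \<lambda>_ _. id)" "box (fst a) (fst b) \<phi>"
      "pmap_comp (std_cube (fst a)) (snd b) (std_cube_map (fst a) \<phi>) = snd a"
      using m unfolding cube_over_homs_def by blast
    have "pmap_comp (std_cube (fst a)) (pmap_comp (std_cube (fst b)) f (snd b)) (std_cube_map (fst a) \<phi>) =
        pmap_comp (std_cube (fst a)) f (pmap_comp (std_cube (fst a)) (snd b) (std_cube_map (fst a) \<phi>))"
      unfolding pmap_comp_def compose_def
    proof (rule ext, rule restrict_ext)
      fix d \<psi> assume psi: "\<psi> \<in> cells (std_cube (fst a)) d"
      then have "std_cube_map (fst a) \<phi> d \<psi> \<in> cells (std_cube (fst b)) d"
        using box_comp[OF _ phi(2)] by (simp add: std_cube_map_def cells_std_cube)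
      then show "(\<lambda>x\<in>cells (std_cube (fst b)) d. f d (snd b d x)) (std_cube_map (fst a) \<phi> d \<psi>) =
          f d ((\<lambda>x\<in>cells (std_cube (fst a)) d. snd b d (std_cube_map (fst a) \<phi> d x)) \<psi>)"
        using psi by simp
    qed
    then show ?thesis unfolding cube_over_homs_def using phi by auto
  qed
  show ?thesis
    unfolding flow_cocone_def
  proof (intro conjI ballI)
    show "is_flow T Y" using Y unfolding flow_cocone_def by blast
    show "flow_map (cube_flow (fst a)) Y (case a of (n, c) \<Rightarrow> k (n, pmap_comp (std_cube n) f c))" if "a \<in> cubes_over K" for a
    proof -
      obtain n c where a: "a = (n, c)" by fastforce
      show ?thesis using Y over[of n c] that unfolding a flow_cocone_def by fastforce
    qed
    fix a b m assume a: "a \<in> cubes_over K" and b: "b \<in> cubes_over K" and m: "m \<in> cube_over_homs a b"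
    obtain n c where ac: "a = (n, c)" by fastforce
    obtain n' c' where bc: "b = (n', c')" by fastforce
    have "fmap_eq (cube_flow (fst (n, pmap_comp (std_cube n) f c)))
        (fmap_comp (k (n', pmap_comp (std_cube n') f c')) m) (k (n, pmap_comp (std_cube n) f c))"
    proof (rule Y[unfolded flow_cocone_def, THEN conjunct2, THEN conjunct2, rule_format])
      show "(n, pmap_comp (std_cube n) f c) \<in> cubes_over L" "(n', pmap_comp (std_cube n') f c') \<in> cubes_over L"
        using over a b by (simp_all add: ac bc)
      show "m \<in> cube_over_homs (n, pmap_comp (std_cube n) f c) (n', pmap_comp (std_cube n') f c')"
        using hom[OF m] by (simp add: ac bc)
    qed
    then show "fmap_eq (cube_flow (fst a)) (fmap_comp (case b of (n, c) \<Rightarrow> k (n, pmap_comp (std_cube n) f c)) m)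
        (case a of (n, c) \<Rightarrow> k (n, pmap_comp (std_cube n) f c))" by (simp add: ac bc)
  qed
qed

section \<open>The universal property\<close>

definition eval_vertex :: "'k precub \<Rightarrow> ('k cube_over \<Rightarrow> (bool list, dpath, 't, 'q) fmap) \<Rightarrow> 'k \<Rightarrow> 't" where
  "eval_vertex K k v = fst (k (0, yoneda_map K 0 v)) []"

text \<open>The path of the block runs from the first to the last vertex of its cube, so the component of the cocone
  at this cube applies to it.\<close>

definition eval_block :: "'k precub \<Rightarrow> ('k cube_over \<Rightarrow> (bool list, dpath, 't, 'q) fmap) \<Rightarrow> 'k block \<Rightarrow> 'q" where
  "eval_block K k b = snd (k (block_dim b, yoneda_map K (block_dim b) (block_cell b))) (zeros (block_dim b)) (ones (block_dim b)) (block_path b)"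

text \<open>The composite in \<open>Y\<close> of the values of the cocone on the blocks. The empty list is excluded because flows
  have no identities.\<close>

primrec eval_blocks :: "'k precub \<Rightarrow> ('t, 'q) flow \<Rightarrow> ('k cube_over \<Rightarrow> (bool list, dpath, 't, 'q) fmap) \<Rightarrow> 'k block list \<Rightarrow> 'q" where
  "eval_blocks K Y k [] = undefined"
| "eval_blocks K Y k (b # bs) = (if bs = [] then eval_block K k b else
    pcomp Y (eval_vertex K k (block_source K b)) (eval_vertex K k (block_target K b)) (eval_vertex K k (block_target K (last bs)))
      (eval_block K k b) (eval_blocks K Y k bs))"

context
  fixes K :: "'k precub" and T :: top_choice and Y :: "('t, 'q) flow"
    and k :: "'k cube_over \<Rightarrow> (bool list, dpath, 't, 'q) fmap"
  assumes K: "precubical_set K" and cocone: "cube_cocone T K Y k"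
begin

abbreviation "on_states \<equiv> eval_vertex K k"

lemma flow_Y: "is_flow T Y"
  using cocone unfolding flow_cocone_def by blast

lemma leg_flow_map: "c \<in> cells K n \<Longrightarrow> flow_map (cube_flow n) Y (k (n, yoneda_map K n c))"
  using cocone[unfolded flow_cocone_def, THEN conjunct2, THEN conjunct1, rule_format, OF yoneda_map_over[OF K]] by simp

lemma leg_compat:
  assumes b: "box m n \<phi>" and c: "c \<in> cells K n"
  shows "length v = m \<Longrightarrow> fst (k (n, yoneda_map K n c)) (\<phi> v) = fst (k (m, yoneda_map K m (act K m n \<phi> c))) v"
    "vertex_le \<alpha> \<beta> \<Longrightarrow> \<alpha> \<noteq> \<beta> \<Longrightarrow> length \<alpha> = m \<Longrightarrow> natural_path (diff_dim \<alpha> \<beta>) x \<Longrightarrow>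
      snd (k (n, yoneda_map K n c)) (\<phi> \<alpha>) (\<phi> \<beta>) x = snd (k (m, yoneda_map K m (act K m n \<phi> c))) \<alpha> \<beta> x"
proof -
  have "fmap_eq (cube_flow (fst (m, yoneda_map K m (act K m n \<phi> c))))
      (fmap_comp (k (n, yoneda_map K n c)) (\<phi>, \<lambda>_ _. id)) (k (m, yoneda_map K m (act K m n \<phi> c)))"
    by (rule cocone[unfolded flow_cocone_def, THEN conjunct2, THEN conjunct2, rule_format,
          OF yoneda_map_over[OF K precub_act[OF K b c]] yoneda_map_over[OF K c] yoneda_map_hom[OF K b c]])
  then have eq: "fmap_eq (cube_flow m) (fmap_comp (k (n, yoneda_map K n c)) (\<phi>, \<lambda>_ _. id)) (k (m, yoneda_map K m (act K m n \<phi> c)))"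
    by simp
  show "length v = m \<Longrightarrow> fst (k (n, yoneda_map K n c)) (\<phi> v) = fst (k (m, yoneda_map K m (act K m n \<phi> c))) v"
    using eq by (simp add: fmap_eq_def fmap_comp_def)
  show "vertex_le \<alpha> \<beta> \<Longrightarrow> \<alpha> \<noteq> \<beta> \<Longrightarrow> length \<alpha> = m \<Longrightarrow> natural_path (diff_dim \<alpha> \<beta>) x \<Longrightarrow>
      snd (k (n, yoneda_map K n c)) (\<phi> \<alpha>) (\<phi> \<beta>) x = snd (k (m, yoneda_map K m (act K m n \<phi> c))) \<alpha> \<beta> x"
    using eq vertex_le_length[of \<alpha> \<beta>] by (simp add: fmap_eq_def fmap_comp_def topspace_cube_flow)
qed

lemma leg_vertex:
  assumes c: "c \<in> cells K n" and v: "length v = n"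
  shows "fst (k (n, yoneda_map K n c)) v = on_states (vertex_of K n c v)"
  using leg_compat(1)[OF box_vertex_cell[OF v] c, of "[]"]
  by (simp add: eval_vertex_def vertex_of_def vertex_cell_def)

text \<open>This is the compatibility of the cocone with the inclusion of the face spanned by the end points.\<close>

lemma leg_path_eval:
  assumes c: "c \<in> cells K n" and ab: "vertex_le \<alpha> \<beta>" "\<alpha> \<noteq> \<beta>" "length \<alpha> = n" and x: "natural_path (diff_dim \<alpha> \<beta>) x"
  shows "snd (k (n, yoneda_map K n c)) \<alpha> \<beta> x = eval_block K k (diff_dim \<alpha> \<beta>, act K (diff_dim \<alpha> \<beta>) n (subcube_map \<alpha> \<beta>) c, x)"
proof -
  have "0 < diff_dim \<alpha> \<beta>" using diff_dim_pos[OF ab(1)] ab(2) by simp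
  then have "zeros (diff_dim \<alpha> \<beta>) \<noteq> ones (diff_dim \<alpha> \<beta>)" by (metis diff_dim_self diff_dim_zeros_ones less_irrefl)
  from leg_compat(2)[OF box_subcube_mapI[OF ab(1,3)] c vertex_le_zeros_ones(1)[of "ones (diff_dim \<alpha> \<beta>)"] this, of x] x
  show ?thesis by (simp add: eval_block_def subcube_map_ends[OF ab(1)])
qed

lemma on_states_in: "v \<in> cells K 0 \<Longrightarrow> on_states v \<in> states Y"
  unfolding eval_vertex_def by (rule flow_mapD(1)[OF leg_flow_map, of v 0 "[]" "[]"]) simp_all

lemma block_ends_in:
  assumes "block_ok K b" shows "block_source K b \<in> cells K 0" "block_target K b \<in> cells K 0"
  using assms vertex_of_in[OF K] by (simp_all add: block_ok_def block_source_def block_target_def)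

lemma eval_block_continuous:
  assumes "c \<in> cells K n" "0 < n"
  shows "continuous_map (natural_dpaths n) (paths Y (on_states (block_source K (n, c, z))) (on_states (block_target K (n, c, z)))) (\<lambda>x. eval_block K k (n, c, x))"
proof -
  have "vert_less (zeros n) (ones n)" using assms(2) vertex_le_zeros_ones(1)[of "ones n" n] by (simp add: vert_less_vertex_le)
  then show ?thesis
    using flow_mapD(2)[OF leg_flow_map[OF assms(1)], of "zeros n" "ones n"]
    by (simp add: cube_flow_def eval_block_def leg_vertex[OF assms(1)] block_source_def block_target_def)
qed

lemma eval_block_in:
  assumes "block_ok K b" shows "eval_block K k b \<in> topspace (paths Y (on_states (block_source K b)) (on_states (block_target K b)))"
proof -
  obtain n c x where b: "b = (n, c, x)" by (cases b) auto
  have "c \<in> cells K n" "0 < n" "x \<in> topspace (natural_dpaths n)"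
    using assms by (simp_all add: b block_ok_def topspace_natural_dpaths)
  from funcset_mem[OF continuous_map_funspace[OF eval_block_continuous[OF this(1,2), of x]] this(3)]
  show ?thesis by (simp add: b)
qed

lemma eval_Cons:
  assumes "linked K \<gamma> \<beta> bs" "bs \<noteq> []"
  shows "eval_blocks K Y k (b # bs) = pcomp Y (on_states (block_source K b)) (on_states (block_target K b)) (on_states \<beta>) (eval_block K k b) (eval_blocks K Y k bs)"
  using assms linked_last[OF assms] by simp

lemma eval_in_paths:
  assumes "linked K \<alpha> \<beta> bs" "bs \<noteq> []"
  shows "eval_blocks K Y k bs \<in> topspace (paths Y (on_states \<alpha>) (on_states \<beta>))"
  using assms
proof (induction bs arbitrary: \<alpha>)
  case (Cons b bs)
  have b: "block_ok K b" "block_source K b = \<alpha>" and l: "linked K (block_target K b) \<beta> bs" using Cons.prems by auto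
  show ?case
  proof (cases "bs = []")
    case True
    then show ?thesis using eval_block_in[OF b(1)] b l by simp
  next
    case False
    have "on_states \<alpha> \<in> states Y" "on_states (block_target K b) \<in> states Y" "on_states \<beta> \<in> states Y"
      using on_states_in block_ends_in[OF b(1)] b(2) linked_ends[OF K l False] by auto
    from is_flow_pcomp(2)[OF flow_Y this _ Cons.IH[OF l False], of "eval_block K k b"] eval_block_in[OF b(1)]
    show ?thesis unfolding eval_Cons[OF l False] by (simp add: b(2))
  qed
qed simp

lemma eval_append:
  assumes "linked K \<alpha> \<beta> bs" "bs \<noteq> []" "linked K \<beta> \<gamma> cs" "cs \<noteq> []"
  shows "eval_blocks K Y k (bs @ cs) = pcomp Y (on_states \<alpha>) (on_states \<beta>) (on_states \<gamma>) (eval_blocks K Y k bs) (eval_blocks K Y k cs)"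
  using assms(1,2)
proof (induction bs arbitrary: \<alpha>)
  case (Cons b bs)
  have b: "block_ok K b" "block_source K b = \<alpha>" and l: "linked K (block_target K b) \<beta> bs" using Cons.prems by auto
  show ?case
  proof (cases "bs = []")
    case True
    then show ?thesis using eval_Cons[OF assms(3,4), of b] b l by simp
  next
    case False
    have st: "on_states \<alpha> \<in> states Y" "on_states (block_target K b) \<in> states Y" "on_states \<beta> \<in> states Y" "on_states \<gamma> \<in> states Y"
      using on_states_in block_ends_in[OF b(1)] b(2) linked_ends[OF K l False] linked_ends[OF K assms(3,4)] by auto
    have l': "linked K (block_target K b) \<gamma> (bs @ cs)" unfolding linked_append using l assms(3) by blast
    have "eval_blocks K Y k ((b # bs) @ cs) = pcomp Y (on_states \<alpha>) (on_states (block_target K b)) (on_states \<gamma>) (eval_block K k b)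
        (pcomp Y (on_states (block_target K b)) (on_states \<beta>) (on_states \<gamma>) (eval_blocks K Y k bs) (eval_blocks K Y k cs))"
      using eval_Cons[OF l', of b] False Cons.IH[OF l False] b(2) by simp
    also have "\<dots> = pcomp Y (on_states \<alpha>) (on_states \<beta>) (on_states \<gamma>)
        (pcomp Y (on_states \<alpha>) (on_states (block_target K b)) (on_states \<beta>) (eval_block K k b) (eval_blocks K Y k bs)) (eval_blocks K Y k cs)"
      by (rule is_flow_assoc[OF flow_Y st _ eval_in_paths[OF l False] eval_in_paths[OF assms(3,4)], symmetric])
        (use eval_block_in[OF b(1)] b(2) in simp)
    also have "\<dots> = pcomp Y (on_states \<alpha>) (on_states \<beta>) (on_states \<gamma>) (eval_blocks K Y k (b # bs)) (eval_blocks K Y k cs)"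
      unfolding eval_Cons[OF l False] b(2) ..
    finally show ?thesis .
  qed
qed simp

text \<open>Since \<open>L\<close> or \<open>R\<close> may be empty and flows have no identities, the four cases are treated separately.\<close>

lemma eval_context:
  assumes l: "linked K \<alpha> \<beta> (L @ M @ R)" and l': "linked K \<alpha> \<beta> (L @ M' @ R)"
    and ne: "M \<noteq> []" "M' \<noteq> []" and eq: "eval_blocks K Y k M = eval_blocks K Y k M'"
  shows "eval_blocks K Y k (L @ M @ R) = eval_blocks K Y k (L @ M' @ R)"
proof -
  obtain \<gamma> \<delta> where 1: "linked K \<alpha> \<gamma> L" "linked K \<gamma> \<delta> M" "linked K \<delta> \<beta> R" using l by (auto simp: linked_append)
  obtain \<gamma>' \<delta>' where 2: "linked K \<alpha> \<gamma>' L" "linked K \<gamma>' \<delta>' M'" "linked K \<delta>' \<beta> R" using l' by (auto simp: linked_append)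
  have uniq1: "\<gamma> = \<gamma>'"
    using 1(1) 2(1) linked_last[of K \<alpha> _ L] by (cases "L = []") auto
  have uniq2: "\<delta> = \<delta>'"
    using 1(3) 2(3) by (cases R) auto
  have MR: "eval_blocks K Y k (M @ R) = eval_blocks K Y k (M' @ R)"
  proof (cases "R = []")
    case False
    then show ?thesis using eval_append[OF 1(2) ne(1) 1(3) False] eval_append[OF 2(2) ne(2) 2(3) False] eq uniq1 uniq2 by simp
  qed (use eq in simp)
  have lM: "linked K \<gamma> \<beta> (M @ R)" "linked K \<gamma>' \<beta> (M' @ R)" unfolding linked_append using 1 2 by blast+
  show ?thesis
  proof (cases "L = []")
    case False
    then show ?thesis using eval_append[OF 1(1) False lM(1)] eval_append[OF 2(1) False lM(2)] MR uniq1 ne by simp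
  qed (use MR in simp)
qed

text \<open>The component of the cocone at the cube \<open>c\<close> is a map of flows, so it carries the composite of the two
  paths to the composite of their values; these values depend only on the two faces of \<open>c\<close>.\<close>

lemma eval_merge:
  assumes m: "block_merge K bs bs'" and l: "linked K \<alpha> \<beta> bs"
  shows "eval_blocks K Y k bs = eval_blocks K Y k bs'"
  using m
proof (cases rule: block_merge.cases)
  case (block_mergeI A B n c L x y R)
  note AB = block_mergeI(3,4) and c = block_mergeI(7)
  have xy: "natural_path (card A) x" "natural_path (card B) y"
    using linked_merge(2,3)[OF AB K c] l unfolding block_mergeI(1) by blast+
  have l': "linked K \<alpha> \<beta> bs'" by (rule merge_linked[OF K m l])
  let ?b1 = "(card A, act K (card A) n (subcube_map (zeros n) (indicator A n)) c, x)"
  let ?b2 = "(card B, act K (card B) n (subcube_map (indicator A n) (ones n)) c, y)"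
  let ?z = "cube_comp (zeros n) (indicator A n) (ones n) x y"
  have pos: "0 < card A" "0 < card B" using block_mergeI(5,6) partition_finite[OF AB] by (simp_all add: card_gt_0_iff)
  then have n: "0 < n" using partition_card[OF AB] by simp
  have ne: "zeros n \<noteq> indicator A n" "indicator A n \<noteq> ones n" "zeros n \<noteq> ones n"
    using pos n diff_dim_pos[OF vertex_le_indicator(1)[of n A]] diff_dim_pos[OF vertex_le_indicator(2)[of A n]] partition_diff_dim[OF AB] by auto
  have z: "natural_path n ?z"
    using natural_path_cube_comp[OF vertex_le_indicator(1)[of n A] vertex_le_indicator(2)[of A n], of x y] xy by (simp add: partition_diff_dim[OF AB])
  have xt: "x \<in> topspace (paths (cube_flow n) (zeros n) (indicator A n))" "y \<in> topspace (paths (cube_flow n) (indicator A n) (ones n))"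
    using ne vertex_le_indicator xy by (simp_all add: topspace_cube_flow partition_diff_dim[OF AB])
  have v01: "vertex_le (zeros n) (ones n)" by (rule vertex_le_zeros_ones(1)) simp
  have "eval_block K k (n, c, ?z) = snd (k (n, yoneda_map K n c)) (zeros n) (ones n) (pcomp (cube_flow n) (zeros n) (indicator A n) (ones n) x y)"
    by (simp add: eval_block_def)
  also have "\<dots> = pcomp Y (on_states (vertex_of K n c (zeros n))) (on_states (vertex_of K n c (indicator A n))) (on_states (vertex_of K n c (ones n)))
      (snd (k (n, yoneda_map K n c)) (zeros n) (indicator A n) x) (snd (k (n, yoneda_map K n c)) (indicator A n) (ones n) y)"
    using flow_mapD(4)[OF leg_flow_map[OF c], of "zeros n" "indicator A n" "ones n" x y] xt
    by (simp add: leg_vertex[OF c])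
  also have "\<dots> = eval_blocks K Y k [?b1, ?b2]"
    using leg_path_eval[OF c vertex_le_indicator(1) ne(1), of x] leg_path_eval[OF c vertex_le_indicator(2) ne(2), of y] xy
    by (simp add: partition_diff_dim[OF AB] block_source_def block_target_def partition_vertex_of[OF AB K c])
  finally have "eval_blocks K Y k [?b1, ?b2] = eval_blocks K Y k [(n, c, ?z)]" by simp
  then show ?thesis
    using l l' unfolding block_mergeI(1,2) by (intro eval_context) auto
qed

text \<open>Here the blocks carry paths of paths, and \<open>at_time t\<close> freezes them at time \<open>t\<close>.\<close>

lemma eval_continuous:
  fixes bs :: "(nat \<times> 'k \<times> (real \<Rightarrow> dpath)) list"
  defines "at_time \<equiv> \<lambda>t (q :: nat \<times> 'k \<times> (real \<Rightarrow> dpath)). (fst q, fst (snd q), snd (snd q) t)"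
  assumes "\<And>t. t \<in> {0..1} \<Longrightarrow> linked K \<alpha> \<beta> (map (at_time t) bs)" "bs \<noteq> []"
    "\<And>q. q \<in> set bs \<Longrightarrow> top_path (natural_dpaths (fst q)) (snd (snd q))"
  shows "top_path (paths Y (on_states \<alpha>) (on_states \<beta>)) (\<lambda>t. eval_blocks K Y k (map (at_time t) bs))"
  using assms(2-)
proof (induction bs arbitrary: \<alpha>)
  case (Cons q bs)
  obtain n c r where q: "q = (n, c, r)" by (cases q) auto
  have l: "linked K \<alpha> \<beta> (at_time t q # map (at_time t) bs)" if "t \<in> {0..1}" for t using Cons.prems(1)[OF that] by simp
  have at_time: "at_time t q = (n, c, r t)" for t by (simp add: at_time_def q)
  have src: "block_source K (at_time t q) = block_source K (at_time 0 q)" "block_target K (at_time t q) = block_target K (at_time 0 q)" for t by (simp_all add: at_time block_source_def block_target_def)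
  have b0: "block_ok K (at_time 0 q)" "block_source K (at_time 0 q) = \<alpha>" using l[of 0] by simp_all
  have cn: "c \<in> cells K n" "0 < n" using b0(1) by (simp_all add: block_ok_def at_time)
  have r: "top_path (natural_dpaths n) r" using Cons.prems(3)[of q] by (simp add: q)
  from continuous_map_compose[OF r eval_block_continuous[OF cn, of "r 0"]]
  have p1: "top_path (paths Y (on_states \<alpha>) (on_states (block_target K (at_time 0 q)))) (\<lambda>t. eval_block K k (at_time t q))"
    using b0(2) by (simp add: at_time o_def)
  show ?case
  proof (cases "bs = []")
    case True
    have "block_target K (at_time 0 q) = \<beta>" using l[of 0] True by simp
    then show ?thesis using p1 True by simp
  next
    case False
    have lt: "linked K (block_target K (at_time 0 q)) \<beta> (map (at_time t) bs)" if "t \<in> {0..1}" for t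
      using l[OF that] src(2)[of t] by simp
    have p2: "top_path (paths Y (on_states (block_target K (at_time 0 q))) (on_states \<beta>)) (\<lambda>t. eval_blocks K Y k (map (at_time t) bs))"
      by (rule Cons.IH[OF lt False]) (use Cons.prems(3) in simp_all)
    have ne: "map (at_time t) bs \<noteq> []" for t using False by simp
    have l0: "linked K (block_target K (at_time 0 q)) \<beta> (map (at_time 0) bs)" by (rule lt) simp
    have st: "on_states \<alpha> \<in> states Y" "on_states (block_target K (at_time 0 q)) \<in> states Y" "on_states \<beta> \<in> states Y"
      using on_states_in block_ends_in[OF b0(1)] b0(2) linked_ends[OF K l0 ne] by auto
    have "top_path (dprod (paths Y (on_states \<alpha>) (on_states (block_target K (at_time 0 q)))) (paths Y (on_states (block_target K (at_time 0 q))) (on_states \<beta>)))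
        (\<lambda>t. (eval_block K k (at_time t q), eval_blocks K Y k (map (at_time t) bs)))"
      using p1 p2 by (simp add: top_path_dprod)
    from continuous_map_compose[OF this is_flow_pcomp(1)[OF flow_Y st]]
    have "top_path (paths Y (on_states \<alpha>) (on_states \<beta>)) (\<lambda>t. pcomp Y (on_states \<alpha>) (on_states (block_target K (at_time 0 q))) (on_states \<beta>)
        (eval_block K k (at_time t q)) (eval_blocks K Y k (map (at_time t) bs)))"
      by (simp add: o_def)
    then show ?thesis
    proof (rule continuous_map_eq)
      fix t :: real assume "t \<in> topspace unit_interval_top"
      then have t: "t \<in> {0..1}" by simp
      show "pcomp Y (on_states \<alpha>) (on_states (block_target K (at_time 0 q))) (on_states \<beta>) (eval_block K k (at_time t q)) (eval_blocks K Y k (map (at_time t) bs)) =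
          eval_blocks K Y k (map (at_time t) (q # bs))"
        unfolding list.map eval_Cons[OF lt[OF t] ne] using src[of t] b0(2) by simp
    qed
  qed
qed simp

lemma eval_of_tuple_continuous:
  "continuous_map (chain_sum K \<alpha> \<beta> n) (paths Y (on_states \<alpha>) (on_states \<beta>)) (\<lambda>p. eval_blocks K Y k (blocks p))"
proof (rule continuous_map_from_delta_generated[OF delta_generated_chain_sum])
  fix p assume p: "top_path (chain_sum K \<alpha> \<beta> n) p"
  obtain ns a q where q: "(ns, a) \<in> chains K \<alpha> \<beta> n" "top_path (path_tuples ns) q"
    "\<And>t. t \<in> {0..1} \<Longrightarrow> p t = ((ns, a), q t)" using p by (rule top_path_chain_sum) blast
  let ?bs = "map (\<lambda>i. (ns ! i, a (ns ! i) (block_id ns i), \<lambda>t. q t ! i)) [0..<length ns]"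
  have eq: "map (\<lambda>s. (fst s, fst (snd s), snd (snd s) t)) ?bs = blocks ((ns, a), q t)" for t
    by (simp add: blocks_def o_def)
  have "top_path (paths Y (on_states \<alpha>) (on_states \<beta>)) (\<lambda>t. eval_blocks K Y k (map (\<lambda>s. (fst s, fst (snd s), snd (snd s) t)) ?bs))"
  proof (rule eval_continuous)
    show "linked K \<alpha> \<beta> (map (\<lambda>s. (fst s, fst (snd s), snd (snd s) t)) ?bs)" if "t \<in> {0..1}" for t
      unfolding eq by (rule chains_blocks(1)[OF K q(1) top_path_in[OF q(2) that]])
    show "?bs \<noteq> []" using q(1) by (simp add: chains_def)
    show "top_path (natural_dpaths (fst s)) (snd (snd s))" if "s \<in> set ?bs" for s
      using that q(2) by (auto simp: top_path_tuples)
  qed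
  then show "top_path (paths Y (on_states \<alpha>) (on_states \<beta>)) ((\<lambda>p. eval_blocks K Y k (blocks p)) \<circ> p)"
    by (rule continuous_map_eq) (simp add: eq q(3) del: map_map)
qed

definition induced :: "('k, 'k cpath, 't, 'q) fmap" where
  "induced = (on_states, \<lambda>\<alpha> \<beta> p. eval_blocks K Y k (blocks (SOME q. q \<in> snd p)))"

lemma in_Top_paths: "\<alpha> \<in> cells K 0 \<Longrightarrow> \<beta> \<in> cells K 0 \<Longrightarrow> in_Top T (paths Y (on_states \<alpha>) (on_states \<beta>))"
  using flow_Y on_states_in unfolding is_flow_def by blast

lemma eval_chain_rel:
  assumes ab: "\<alpha> \<in> cells K 0" "\<beta> \<in> cells K 0" and pq: "(p, q) \<in> chain_rel T K \<alpha> \<beta> n"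
  shows "eval_blocks K Y k (blocks p) = eval_blocks K Y k (blocks q)"
proof (rule chain_rel_kernel[OF K eval_of_tuple_continuous in_Top_paths[OF ab] _ pq])
  fix bs bs' assume l: "linked K \<alpha> \<beta> bs" and m: "block_merge K bs bs'"
  show "eval_blocks K Y k (blocks (tuple_of K bs)) = eval_blocks K Y k (blocks (tuple_of K bs'))"
    using eval_merge[OF m l] tuple_of_props(2)[OF K l] tuple_of_props(2)[OF K merge_linked[OF K m l]] merge_dims[OF m]
    by simp
qed

lemma eval_class:
  assumes ab: "\<alpha> \<in> cells K 0" "\<beta> \<in> cells K 0" and p: "p \<in> topspace (chain_sum K \<alpha> \<beta> n)"
  shows "eval_blocks K Y k (blocks (SOME q. q \<in> chain_rel T K \<alpha> \<beta> n `` {p})) = eval_blocks K Y k (blocks p)"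
proof -
  have "p \<in> chain_rel T K \<alpha> \<beta> n `` {p}" by (rule equiv_class_self[OF equiv_chain_rel[OF K] p])
  then have "(SOME q. q \<in> chain_rel T K \<alpha> \<beta> n `` {p}) \<in> chain_rel T K \<alpha> \<beta> n `` {p}" by (rule someI)
  then have "(p, SOME q. q \<in> chain_rel T K \<alpha> \<beta> n `` {p}) \<in> chain_rel T K \<alpha> \<beta> n" by simp
  from eval_chain_rel[OF ab this] show ?thesis by simp
qed

lemma induced_block_class:
  assumes l: "linked K \<alpha> \<beta> bs" "bs \<noteq> []"
  shows "snd induced \<alpha> \<beta> (block_class T K \<alpha> \<beta> bs) = eval_blocks K Y k bs"
  using eval_class[OF linked_ends[OF K l] tuple_of_in_chain_sum[OF K l]] tuple_of_props(2)[OF K l]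
  by (simp add: induced_def block_class_def)

lemma flow_map_induced: "flow_map (chain_flow T K) Y induced"
  unfolding flow_map_def states_chain_flow
proof (intro conjI ballI)
  have fst: "fst induced = on_states" by (simp add: induced_def)
  fix \<alpha> assume a: "\<alpha> \<in> cells K 0"
  show "fst induced \<alpha> \<in> states Y" unfolding fst by (rule on_states_in[OF a])
  fix \<beta> assume b: "\<beta> \<in> cells K 0"
  show "continuous_map (paths (chain_flow T K) \<alpha> \<beta>) (paths Y (fst induced \<alpha>) (fst induced \<beta>)) (snd induced \<alpha> \<beta>)"
  proof (rule continuous_map_from_delta_generated)
    show "delta_generated (paths (chain_flow T K) \<alpha> \<beta>)"
      using is_flow_chain_flow[OF K, of T] a b unfolding is_flow_def states_chain_flow by (intro in_Top_dgen) blast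
    fix p assume "top_path (paths (chain_flow T K) \<alpha> \<beta>) p"
    then obtain n q where q: "top_path (chain_colim T K \<alpha> \<beta> n) q" "\<And>t. t \<in> {0..1} \<Longrightarrow> p t = (n, q t)"
      unfolding paths_chain_flow by (rule top_path_sum) blast
    have "continuous_map (chain_colim T K \<alpha> \<beta> n) (paths Y (on_states \<alpha>) (on_states \<beta>)) (\<lambda>C. eval_blocks K Y k (blocks (SOME q. q \<in> C)))"
      unfolding chain_colim_quot[OF K]
      by (rule continuous_map_from_quot[OF equiv_chain_rel[OF K]], rule continuous_map_eq[OF eval_of_tuple_continuous])
        (rule eval_class[OF a b, symmetric])
    from continuous_map_compose[OF q(1) this]
    show "top_path (paths Y (fst induced \<alpha>) (fst induced \<beta>)) (snd induced \<alpha> \<beta> \<circ> p)"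
      unfolding fst by (rule continuous_map_eq) (simp add: q(2) induced_def)
  qed
  fix \<gamma> x y assume "x \<in> topspace (paths (chain_flow T K) \<alpha> \<beta>)" "y \<in> topspace (paths (chain_flow T K) \<beta> \<gamma>)"
  then obtain bs cs where bs: "linked K \<alpha> \<beta> bs" "bs \<noteq> []" "x = block_class T K \<alpha> \<beta> bs"
    and cs: "linked K \<beta> \<gamma> cs" "cs \<noteq> []" "y = block_class T K \<beta> \<gamma> cs"
    by (meson block_class_cases[OF K])
  have bc: "linked K \<alpha> \<gamma> (bs @ cs)" "bs @ cs \<noteq> []" using bs cs by (auto simp: linked_append)
  show "snd induced \<alpha> \<gamma> (pcomp (chain_flow T K) \<alpha> \<beta> \<gamma> x y) =
      pcomp Y (fst induced \<alpha>) (fst induced \<beta>) (fst induced \<gamma>) (snd induced \<alpha> \<beta> x) (snd induced \<beta> \<gamma> y)"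
    unfolding bs(3) cs(3) pcomp_block_class[OF K bs(1,2) cs(1,2)] induced_block_class[OF bc] induced_block_class[OF bs(1,2)]
      induced_block_class[OF cs(1,2)] fst by (rule eval_append[OF bs(1,2) cs(1,2)])
qed

lemma induced_leg:
  assumes a: "a \<in> cubes_over K"
  shows "fmap_eq (cube_flow (fst a)) (fmap_comp induced (chain_leg T K a)) (k a)"
proof -
  define n c where "n = fst a" and "c = top_cell a"
  have c: "c \<in> cells K n" using top_cell_in[OF K a] by (simp add: n_def c_def)
  have ay: "a = (n, yoneda_map K n c)" unfolding n_def c_def by (rule cube_over_yoneda_map[OF K a])
  have ka: "k a = k (n, yoneda_map K n c)" by (rule arg_cong[OF ay])
  have leg: "chain_leg T K a = (vertex_of K n c, \<lambda>\<alpha> \<beta> x. block_class T K (vertex_of K n c \<alpha>) (vertex_of K n c \<beta>) [(diff_dim \<alpha> \<beta>, act K (diff_dim \<alpha> \<beta>) n (subcube_map \<alpha> \<beta>) c, x)])"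
    by (simp add: chain_leg_def n_def c_def)
  show ?thesis
    unfolding fmap_eq_def states_cube_flow
  proof (intro conjI ballI)
    fix \<alpha> assume "\<alpha> \<in> verts (fst a)"
    then have la: "length \<alpha> = n" by (simp add: n_def)
    show "fst (fmap_comp induced (chain_leg T K a)) \<alpha> = fst (k a) \<alpha>"
      using leg_vertex[OF c la] by (simp add: fmap_comp_def leg induced_def ka)
    fix \<beta> x assume x: "x \<in> topspace (paths (cube_flow (fst a)) \<alpha> \<beta>)"
    then have ab: "vertex_le \<alpha> \<beta>" "\<alpha> \<noteq> \<beta>" "natural_path (diff_dim \<alpha> \<beta>) x" by (simp_all add: topspace_cube_flow)
    have "snd (fmap_comp induced (chain_leg T K a)) \<alpha> \<beta> x = eval_block K k (diff_dim \<alpha> \<beta>, act K (diff_dim \<alpha> \<beta>) n (subcube_map \<alpha> \<beta>) c, x)"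
      using induced_block_class[OF subcube_block_linked[OF K c ab(1,2) la ab(3)]] by (simp add: fmap_comp_def leg)
    also have "\<dots> = snd (k a) \<alpha> \<beta> x" using leg_path_eval[OF c ab(1,2) la ab(3)] by (simp add: ka)
    finally show "snd (fmap_comp induced (chain_leg T K a)) \<alpha> \<beta> x = snd (k a) \<alpha> \<beta> x" .
  qed
qed

text \<open>Every path of the flow of cube chains is a composite of paths in the image of the legs.\<close>

lemma legs_determine:
  assumes h: "flow_map (chain_flow T K) Y h"
    and legs: "\<And>a. a \<in> cubes_over K \<Longrightarrow> fmap_eq (cube_flow (fst a)) (fmap_comp h (chain_leg T K a)) (k a)"
  shows "v \<in> cells K 0 \<Longrightarrow> fst h v = on_states v"
    and "linked K \<alpha> \<beta> bs \<Longrightarrow> bs \<noteq> [] \<Longrightarrow> snd h \<alpha> \<beta> (block_class T K \<alpha> \<beta> bs) = eval_blocks K Y k bs"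
proof -
  have leg: "chain_leg T K (n, yoneda_map K n c) = (vertex_of K n c, \<lambda>\<alpha> \<beta> x. block_class T K (vertex_of K n c \<alpha>) (vertex_of K n c \<beta>)
      [(diff_dim \<alpha> \<beta>, act K (diff_dim \<alpha> \<beta>) n (subcube_map \<alpha> \<beta>) c, x)])" if "c \<in> cells K n" for n c
    by (simp add: chain_leg_def top_cell_yoneda_map[OF K that])
  have st: "fst h v = on_states v" if v: "v \<in> cells K 0" for v
  proof -
    have "vertex_cell [] = (\<lambda>v\<in>verts 0. v)" unfolding vertex_cell_def by (rule restrict_ext) simp
    then have "vertex_of K 0 v [] = v" unfolding vertex_of_def using precub_id[OF K v] by simp
    then show ?thesis
      using legs[OF yoneda_map_over[OF K v]] by (simp add: fmap_eq_def fmap_comp_def leg[OF v] eval_vertex_def)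
  qed
  show "v \<in> cells K 0 \<Longrightarrow> fst h v = on_states v" by (rule st)
  have single: "snd h (block_source K b) (block_target K b) (block_class T K (block_source K b) (block_target K b) [b]) = eval_block K k b" if b: "block_ok K b" for b
  proof -
    obtain n c x where bb: "b = (n, c, x)" by (cases b) auto
    have ok: "c \<in> cells K n" "0 < n" "natural_path n x" using b by (simp_all add: bb block_ok_def)
    have s: "act K n n (subcube_map (zeros n) (ones n)) c = c" unfolding subcube_map_zeros_ones by (rule precub_id[OF K ok(1)])
    have "x \<in> topspace (paths (cube_flow n) (zeros n) (ones n))"
      using ok vertex_le_zeros_ones(1)[of "ones n" n] by (simp add: topspace_cube_flow)
    then have "snd (fmap_comp h (chain_leg T K (n, yoneda_map K n c))) (zeros n) (ones n) x = snd (k (n, yoneda_map K n c)) (zeros n) (ones n) x"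
      using legs[OF yoneda_map_over[OF K ok(1)]] unfolding fmap_eq_def fst_conv by simp
    then show ?thesis
      using s by (simp add: fmap_comp_def leg[OF ok(1)] bb block_source_def block_target_def eval_block_def)
  qed
  show "linked K \<alpha> \<beta> bs \<Longrightarrow> bs \<noteq> [] \<Longrightarrow> snd h \<alpha> \<beta> (block_class T K \<alpha> \<beta> bs) = eval_blocks K Y k bs"
  proof (induction bs arbitrary: \<alpha>)
    case (Cons b bs)
    have b: "block_ok K b" "block_source K b = \<alpha>" and l: "linked K (block_target K b) \<beta> bs" using Cons.prems by auto
    show ?case
    proof (cases "bs = []")
      case True
      then show ?thesis using single[OF b(1)] b l by simp
    next
      case False
      have lb: "linked K \<alpha> (block_target K b) [b]" using b by simp
      have s0: "\<alpha> \<in> states (chain_flow T K)" "block_target K b \<in> states (chain_flow T K)" "\<beta> \<in> states (chain_flow T K)"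
        using block_ends_in[OF b(1)] b(2) linked_ends[OF K l False] by simp_all
      have "snd h \<alpha> \<beta> (block_class T K \<alpha> \<beta> (b # bs)) = snd h \<alpha> \<beta> (pcomp (chain_flow T K) \<alpha> (block_target K b) \<beta>
          (block_class T K \<alpha> (block_target K b) [b]) (block_class T K (block_target K b) \<beta> bs))"
        using pcomp_block_class[OF K lb _ l False] by simp
      also have "\<dots> = pcomp Y (fst h \<alpha>) (fst h (block_target K b)) (fst h \<beta>)
          (snd h \<alpha> (block_target K b) (block_class T K \<alpha> (block_target K b) [b])) (snd h (block_target K b) \<beta> (block_class T K (block_target K b) \<beta> bs))"
        by (rule flow_mapD(4)[OF h s0 block_class_in[OF K lb] block_class_in[OF K l False]]) simp
      also have "\<dots> = eval_blocks K Y k (b # bs)"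
        unfolding eval_Cons[OF l False] Cons.IH[OF l False] using s0 single[OF b(1)] b(2) st by simp
      finally show ?thesis .
    qed
  qed simp
qed

end

lemma chain_flow_colimit:
  fixes K :: "'k precub"
  assumes K: "precubical_set K"
  shows "is_flow_colimit TYPE(('u, 'r) flow) T (cubes_over K) (\<lambda>a. cube_flow (fst a)) cube_over_homs
    (chain_flow T K) (chain_leg T K)"
  unfolding is_flow_colimit_def
proof (intro conjI allI impI)
  show "cube_cocone T K (chain_flow T K) (chain_leg T K)" by (rule chain_cocone[OF K])
  fix Y :: "('u, 'r) flow" and k assume Y: "cube_cocone T K Y k"
  let ?h = "induced K Y k"
  show "\<exists>h. flow_map (chain_flow T K) Y h \<and>
      (\<forall>a\<in>cubes_over K. fmap_eq (cube_flow (fst a)) (fmap_comp h (chain_leg T K a)) (k a)) \<and>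
      (\<forall>h'. flow_map (chain_flow T K) Y h' \<and>
        (\<forall>a\<in>cubes_over K. fmap_eq (cube_flow (fst a)) (fmap_comp h' (chain_leg T K a)) (k a)) \<longrightarrow>
        fmap_eq (chain_flow T K) h' h)"
  proof (intro exI[of _ ?h] conjI ballI allI impI)
    show "flow_map (chain_flow T K) Y ?h" by (rule flow_map_induced[OF K Y])
    show "fmap_eq (cube_flow (fst a)) (fmap_comp ?h (chain_leg T K a)) (k a)" if "a \<in> cubes_over K" for a
      by (rule induced_leg[OF K Y that])
    fix h' assume h': "flow_map (chain_flow T K) Y h' \<and>
        (\<forall>a\<in>cubes_over K. fmap_eq (cube_flow (fst a)) (fmap_comp h' (chain_leg T K a)) (k a))"
    note D = legs_determine[OF K Y h'[THEN conjunct1] h'[THEN conjunct2, rule_format]]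
    show "fmap_eq (chain_flow T K) h' ?h"
      unfolding fmap_eq_def states_chain_flow
    proof (intro conjI ballI)
      show "fst h' \<alpha> = fst ?h \<alpha>" if "\<alpha> \<in> cells K 0" for \<alpha>
        using D(1) that by (simp add: induced_def[OF K Y])
      show "snd h' \<alpha> \<beta> x = snd ?h \<alpha> \<beta> x" if x: "x \<in> topspace (paths (chain_flow T K) \<alpha> \<beta>)" for \<alpha> \<beta> x
        using x by (rule block_class_cases[OF K]) (simp add: D(2) induced_block_class[OF K Y])
    qed
  qed
qed

section \<open>Uniqueness of colimits and naturality\<close>

lemma flow_colimit_map:
  fixes Y :: "('u, 'r) flow"
  assumes "is_flow_colimit TYPE(('u, 'r) flow) T I D M X j" "flow_cocone T I D M Y k"
  obtains h where "flow_map X Y h" "\<And>a. a \<in> I \<Longrightarrow> fmap_eq (D a) (fmap_comp h (j a)) (k a)"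
  using assms unfolding is_flow_colimit_def by metis

lemma flow_colimit_unique:
  fixes Y :: "('u, 'r) flow"
  assumes X: "is_flow_colimit TYPE(('u, 'r) flow) T I D M X j" and Y: "flow_cocone T I D M Y k"
    and g: "flow_map X Y g" "\<And>a. a \<in> I \<Longrightarrow> fmap_eq (D a) (fmap_comp g (j a)) (k a)"
    and h: "flow_map X Y h" "\<And>a. a \<in> I \<Longrightarrow> fmap_eq (D a) (fmap_comp h (j a)) (k a)"
  shows "fmap_eq X g h"
proof -
  obtain u where u: "\<And>h'. flow_map X Y h' \<and> (\<forall>a\<in>I. fmap_eq (D a) (fmap_comp h' (j a)) (k a)) \<Longrightarrow> fmap_eq X h' u"
    using X Y unfolding is_flow_colimit_def by metis
  have "fmap_eq X g u" "fmap_eq X h u" using u g h by blast+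
  then show ?thesis by (simp add: fmap_eq_def)
qed

lemma flow_colimit_cocone: "is_flow_colimit U T I D M X j \<Longrightarrow> flow_cocone T I D M X j"
  by (simp add: is_flow_colimit_def)

text \<open>The map back is the one that the universal property of \<open>Y\<close> gives for the cocone of \<open>X\<close>; each of
  the two flows is then tested against itself to see that the composites are identities.\<close>

lemma flow_colimit_iso:
  fixes X :: "('t, 'q) flow" and Y :: "('s, 'p) flow"
  assumes XX: "is_flow_colimit TYPE(('t, 'q) flow) T I D M X i"
    and YX: "is_flow_colimit TYPE(('t, 'q) flow) T I D M Y j" and YY: "is_flow_colimit TYPE(('s, 'p) flow) T I D M Y j"
    and h: "flow_map X Y h" "\<And>a. a \<in> I \<Longrightarrow> fmap_eq (D a) (fmap_comp h (i a)) (j a)"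
  shows "flow_iso T X Y h"
proof -
  note cX = flow_colimit_cocone[OF XX] and cY = flow_colimit_cocone[OF YY]
  obtain g where g: "flow_map Y X g" "\<And>a. a \<in> I \<Longrightarrow> fmap_eq (D a) (fmap_comp g (j a)) (i a)"
    using YX cX by (rule flow_colimit_map) blast
  have gh: "fmap_eq X (fmap_comp g h) fmap_id"
  proof (rule flow_colimit_unique[OF XX cX flow_map_comp[OF h(1) g(1)] _ flow_map_id])
    fix a assume a: "a \<in> I"
    have "fmap_eq (D a) (fmap_comp g (fmap_comp h (i a))) (fmap_comp g (j a))" by (rule fmap_comp_cong_left[OF h(2)[OF a]])
    from fmap_eq_trans[OF this g(2)[OF a]] show "fmap_eq (D a) (fmap_comp (fmap_comp g h) (i a)) (i a)"
      by (simp add: fmap_comp_assoc)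
  qed (simp add: fmap_eq_def)
  have hg: "fmap_eq Y (fmap_comp h g) fmap_id"
  proof (rule flow_colimit_unique[OF YY cY flow_map_comp[OF g(1) h(1)] _ flow_map_id])
    fix a assume a: "a \<in> I"
    have "fmap_eq (D a) (fmap_comp h (fmap_comp g (j a))) (fmap_comp h (i a))" by (rule fmap_comp_cong_left[OF g(2)[OF a]])
    from fmap_eq_trans[OF this h(2)[OF a]] show "fmap_eq (D a) (fmap_comp (fmap_comp h g) (j a)) (j a)"
      by (simp add: fmap_comp_assoc)
  qed (simp add: fmap_eq_def)
  show ?thesis using cX cY h(1) g(1) gh hg unfolding flow_iso_def flow_cocone_def by blast
qed

definition map_block :: "('k, 'l) pmap \<Rightarrow> 'k block \<Rightarrow> 'l block" where
  "map_block f b = (block_dim b, f (block_dim b) (block_cell b), block_path b)"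

lemma blocks_pmap_comp: "blocks ((ns, pmap_comp (wedge ns) f a), xs) = map (map_block f) (blocks ((ns, a), xs))"
  by (rule nth_equalityI) (simp_all add: pmap_comp_apply block_id_in map_block_def)

context
  fixes K :: "'k precub" and L :: "'l precub" and f :: "('k, 'l) pmap" and T :: top_choice
  assumes K: "precubical_set K" and L: "precubical_set L" and f: "f \<in> pmaps K L"
begin

lemma vertex_of_pmap: "c \<in> cells K n \<Longrightarrow> length v = n \<Longrightarrow> vertex_of L n (f n c) v = f 0 (vertex_of K n c v)"
  unfolding vertex_of_def using pmapsD(3)[OF f box_vertex_cell] by simp

lemma linked_map_block: "linked K \<alpha> \<beta> bs \<Longrightarrow> linked L (f 0 \<alpha>) (f 0 \<beta>) (map (map_block f) bs)"
proof (induction bs arbitrary: \<alpha>)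
  case (Cons b bs)
  have b: "block_ok K b" "block_source K b = \<alpha>" "linked K (block_target K b) \<beta> bs" using Cons.prems by auto
  have c: "block_cell b \<in> cells K (block_dim b)" using b(1) by (simp add: block_ok_def)
  have "block_ok L (map_block f b)" using b(1) pmapsD(2)[OF f c] by (simp add: block_ok_def map_block_def)
  moreover have "block_source L (map_block f b) = f 0 \<alpha>" "block_target L (map_block f b) = f 0 (block_target K b)"
    using vertex_of_pmap[OF c] b(2) by (auto simp: block_source_def block_target_def map_block_def)
  ultimately show ?case using Cons.IH[OF b(3)] by simp
qed simp

lemma chains_pmap:
  assumes a: "(ns, a) \<in> chains K \<alpha> \<beta> n"
  shows "(ns, pmap_comp (wedge ns) f a) \<in> chains L (f 0 \<alpha>) (f 0 \<beta>) n"
proof -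
  have p: "a \<in> pmaps (wedge ns) K" "ns \<noteq> []" "a 0 (wedge_initial ns) = \<alpha>" "a 0 (wedge_final ns) = \<beta>"
    using a by (auto simp: chains_def)
  have "wedge_initial ns \<in> cells (wedge ns) 0" "wedge_final ns \<in> cells (wedge ns) 0"
    unfolding wedge_initial_def wedge_final_def using p(2)
    by (auto intro!: wclass_in_cells box_vertex_cell simp: last_conv_nth)
  then show ?thesis
    using a p pmap_comp_in[OF p(1) f precubical_wedge] by (simp add: chains_def pmap_comp_apply)
qed

abbreviation "leg_along \<equiv> (\<lambda>(n, c). chain_leg T L (n, pmap_comp (std_cube n) f c))"

lemma cocone_along: "cube_cocone T K (chain_flow T L) leg_along"
  by (rule cube_cocone_pullback[OF K L f chain_cocone[OF L]])

lemma top_cell_along: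
  assumes c: "c \<in> cells K n"
  shows "top_cell (n, pmap_comp (std_cube n) f (yoneda_map K n c)) = f n c"
proof -
  have i: "(\<lambda>v\<in>verts n. v) \<in> cells (std_cube n) n" by (simp add: cells_std_cube box_id)
  have "yoneda_map K n c n (\<lambda>v\<in>verts n. v) = c" using top_cell_yoneda_map[OF K c] by (simp only: top_cell_def fst_conv snd_conv)
  then show ?thesis unfolding top_cell_def fst_conv snd_conv pmap_comp_apply[OF i] by (rule arg_cong)
qed

lemma eval_vertex_along:
  assumes v: "v \<in> cells K 0" shows "eval_vertex K leg_along v = f 0 v"
proof -
  have "vertex_cell [] = (\<lambda>v\<in>verts 0. v)" unfolding vertex_cell_def by (rule restrict_ext) simp
  then have "vertex_of L 0 (f 0 v) [] = f 0 v" unfolding vertex_of_def using precub_id[OF L pmapsD(2)[OF f v]] by simp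
  then show ?thesis by (simp add: eval_vertex_def chain_leg_def top_cell_along[OF v])
qed

text \<open>A leg of \<open>L\<close> along \<open>f\<close> sends the path of a block to the class of the same path in the image of its cell,
  and composition in the flow of cube chains is concatenation.\<close>

lemma eval_along:
  assumes "linked K \<alpha> \<beta> bs" "bs \<noteq> []"
  shows "eval_blocks K (chain_flow T L) leg_along bs = block_class T L (f 0 \<alpha>) (f 0 \<beta>) (map (map_block f) bs)"
  using assms
proof (induction bs arbitrary: \<alpha>)
  case (Cons b bs)
  have b: "block_ok K b" "block_source K b = \<alpha>" and l: "linked K (block_target K b) \<beta> bs" using Cons.prems by auto
  obtain n c x where bb: "b = (n, c, x)" by (cases b) auto
  have c: "c \<in> cells K n" using b(1) by (simp add: bb block_ok_def)
  have s: "act L n n (subcube_map (zeros n) (ones n)) (f n c) = f n c"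
    unfolding subcube_map_zeros_ones by (rule precub_id[OF L pmapsD(2)[OF f c]])
  have ends: "vertex_of L n (f n c) (zeros n) = f 0 \<alpha>" "vertex_of L n (f n c) (ones n) = f 0 (block_target K b)"
    using vertex_of_pmap[OF c] b(2) by (auto simp: bb block_source_def block_target_def)
  have eb: "eval_block K leg_along b = block_class T L (f 0 \<alpha>) (f 0 (block_target K b)) [map_block f b]"
    using s ends by (simp add: eval_block_def chain_leg_def bb top_cell_along[OF c] map_block_def)
  show ?case
  proof (cases "bs = []")
    case True
    then show ?thesis using eb l by simp
  next
    case False
    have lb: "linked K \<alpha> (block_target K b) [b]" using b by simp
    have v: "\<alpha> \<in> cells K 0" "block_target K b \<in> cells K 0" "\<beta> \<in> cells K 0"
      using linked_ends[OF K lb] linked_ends[OF K l False] by auto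
    have lL: "linked L (f 0 \<alpha>) (f 0 (block_target K b)) [map_block f b]" using linked_map_block[OF lb] by simp
    have "eval_blocks K (chain_flow T L) leg_along (b # bs) = pcomp (chain_flow T L) (f 0 \<alpha>) (f 0 (block_target K b)) (f 0 \<beta>)
        (block_class T L (f 0 \<alpha>) (f 0 (block_target K b)) [map_block f b]) (block_class T L (f 0 (block_target K b)) (f 0 \<beta>) (map (map_block f) bs))"
      unfolding eval_Cons[OF K cocone_along l False] Cons.IH[OF l False] eb b(2) eval_vertex_along[OF v(1)]
        eval_vertex_along[OF v(2)] eval_vertex_along[OF v(3)] ..
    also have "\<dots> = block_class T L (f 0 \<alpha>) (f 0 \<beta>) ([map_block f b] @ map (map_block f) bs)"
      by (rule pcomp_block_class[OF L lL _ linked_map_block[OF l]]) (use False in simp_all)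
    finally show ?thesis by simp
  qed
qed simp

text \<open>The explicit functoriality of the flow of cube chains is the map given by the universal property. That
  \<open>chain_flow_map\<close> is continuous and respects composition is a consequence.\<close>

lemma chain_flow_map_eq_induced:
  "fmap_eq (chain_flow T K) (chain_flow_map T K L f) (induced K (chain_flow T L) leg_along)"
  unfolding fmap_eq_def states_chain_flow
proof (intro conjI ballI)
  fix \<alpha> assume a: "\<alpha> \<in> cells K 0"
  show "fst (chain_flow_map T K L f) \<alpha> = fst (induced K (chain_flow T L) leg_along) \<alpha>"
    using eval_vertex_along[OF a] by (simp add: chain_flow_map_def induced_def[OF K cocone_along])
  fix \<beta> x assume b: "\<beta> \<in> cells K 0" and x: "x \<in> topspace (paths (chain_flow T K) \<alpha> \<beta>)"
  obtain bs where bs: "linked K \<alpha> \<beta> bs" "bs \<noteq> []" "x = block_class T K \<alpha> \<beta> bs" using x by (rule block_class_cases[OF K])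
  define n p where "n = sum_list (dims bs)" and "p = tuple_of K bs"
  let ?C = "chain_rel T K \<alpha> \<beta> n `` {p}"
  let ?R = "chain_rel T L (f 0 \<alpha>) (f 0 \<beta>) n `` {tuple_of L (map (map_block f) bs)}"
  have p: "p \<in> topspace (chain_sum K \<alpha> \<beta> n)" unfolding p_def n_def by (rule tuple_of_in_chain_sum[OF K bs(1,2)])
  have pC: "p \<in> ?C" by (rule equiv_class_self[OF equiv_chain_rel[OF K] p])
  have dims: "dims (map (map_block f) cs) = dims cs" for cs by (simp add: map_block_def)
  have R: "chain_rel T L (f 0 \<alpha>) (f 0 \<beta>) n `` {((ns, pmap_comp (wedge ns) f a), xs)} = ?R"
    if q: "((ns, a), xs) \<in> ?C" for ns a xs
  proof -
    have r: "(p, ((ns, a), xs)) \<in> chain_rel T K \<alpha> \<beta> n" using q by simp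
    then have t: "((ns, a), xs) \<in> topspace (chain_sum K \<alpha> \<beta> n)" using equiv_type[OF equiv_chain_rel[OF K]] by blast
    then have ch: "(ns, a) \<in> chains K \<alpha> \<beta> n" "xs \<in> topspace (path_tuples ns)" by (simp_all add: topspace_chain_sum)
    note B = chain_sum_blocks[OF K t]
    have "eval_blocks K (chain_flow T L) leg_along (blocks p) = eval_blocks K (chain_flow T L) leg_along (blocks ((ns, a), xs))"
      by (rule eval_chain_rel[OF K cocone_along a b r])
    then have "block_class T L (f 0 \<alpha>) (f 0 \<beta>) (map (map_block f) bs) = block_class T L (f 0 \<alpha>) (f 0 \<beta>) (map (map_block f) (blocks ((ns, a), xs)))"
      using eval_along[OF bs(1,2)] eval_along[OF B(1,2)] tuple_of_props(2)[OF K bs(1,2)] by (simp add: p_def)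
    moreover have "block_class T L (f 0 \<alpha>) (f 0 \<beta>) (map (map_block f) bs) = (n, ?R)"
      by (simp only: block_class_def dims n_def)
    moreover have "block_class T L (f 0 \<alpha>) (f 0 \<beta>) (map (map_block f) (blocks ((ns, a), xs))) =
        (n, chain_rel T L (f 0 \<alpha>) (f 0 \<beta>) n `` {((ns, pmap_comp (wedge ns) f a), xs)})"
      unfolding block_class_def dims B(3)
      unfolding blocks_pmap_comp[symmetric] tuple_of_blocks[OF L chains_pmap[OF ch(1)] ch(2)] ..
    ultimately show ?thesis by simp
  qed
  have "(\<Union>((ns, a), xs)\<in>?C. chain_rel T L (f 0 \<alpha>) (f 0 \<beta>) n `` {((ns, pmap_comp (wedge ns) f a), xs)}) = (\<Union>_\<in>?C. ?R)"
  proof (rule SUP_cong[OF refl])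
    fix q assume q: "q \<in> ?C"
    obtain ns a xs where q': "q = ((ns, a), xs)" by (metis prod.collapse)
    show "(case q of (x, xs) \<Rightarrow> (case x of (ns, a) \<Rightarrow> \<lambda>xs. chain_rel T L (f 0 \<alpha>) (f 0 \<beta>) n `` {((ns, pmap_comp (wedge ns) f a), xs)}) xs) = ?R"
      using R[of ns a xs] q unfolding q' by simp
  qed
  also have "\<dots> = ?R" using pC by blast
  finally have "snd (chain_flow_map T K L f) \<alpha> \<beta> x = (n, ?R)"
    by (simp add: chain_flow_map_def bs(3) block_class_def n_def p_def)
  also have "\<dots> = eval_blocks K (chain_flow T L) leg_along bs"
    unfolding eval_along[OF bs(1,2)] block_class_def dims n_def ..
  also have "\<dots> = snd (induced K (chain_flow T L) leg_along) \<alpha> \<beta> x"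
    unfolding bs(3) by (rule induced_block_class[OF K cocone_along bs(1,2), symmetric])
  finally show "snd (chain_flow_map T K L f) \<alpha> \<beta> x = snd (induced K (chain_flow T L) leg_along) \<alpha> \<beta> x" .
qed

lemma flow_map_chain_flow_map: "flow_map (chain_flow T K) (chain_flow T L) (chain_flow_map T K L f)"
  by (rule flow_map_cong[OF flow_map_induced[OF K cocone_along] fmap_eq_sym[OF chain_flow_map_eq_induced] is_flow_chain_flow[OF K]])

lemma chain_flow_map_leg:
  assumes a: "(n, c) \<in> cubes_over K"
  shows "fmap_eq (cube_flow n) (fmap_comp (chain_flow_map T K L f) (chain_leg T K (n, c)))
    (chain_leg T L (n, pmap_comp (std_cube n) f c))"
proof -
  have "fmap_eq (cube_flow n) (fmap_comp (chain_flow_map T K L f) (chain_leg T K (n, c)))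
      (fmap_comp (induced K (chain_flow T L) leg_along) (chain_leg T K (n, c)))"
    using flow_map_chain_leg[OF K a, of T] by (intro fmap_comp_cong_right[OF _ chain_flow_map_eq_induced]) simp
  moreover have "fmap_eq (cube_flow n) (fmap_comp (induced K (chain_flow T L) leg_along) (chain_leg T K (n, c)))
      (chain_leg T L (n, pmap_comp (std_cube n) f c))"
    using induced_leg[OF K cocone_along a] by simp
  ultimately show ?thesis by (rule fmap_eq_trans)
qed

end

lemma chain_flow_natural_realization:
  "natural_realization TYPE(('u, 'r) flow) T (chain_flow T) (chain_leg T) (chain_flow_map T)"
  unfolding natural_realization_def
  by (auto intro: chain_flow_colimit flow_map_chain_flow_map chain_flow_map_leg)

theorem theorem6p3:
  fixes T :: top_choice
  shows
    "(\<exists>(R :: 'k precub \<Rightarrow> ('k, 'k cpath) flow) j Rmap.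
        natural_realization TYPE(('k, 'k cpath) flow) T R j Rmap \<and>
        natural_realization TYPE(('u, 'r) flow) T R j Rmap)
     \<and> (\<forall>(R :: 'k precub \<Rightarrow> ('s, 'p) flow) j Rmap.
        natural_realization TYPE(('s, 'p) flow) T R j Rmap \<and>
        natural_realization TYPE(('k, 'k cpath) flow) T R j Rmap \<longrightarrow>
        (\<exists>\<eta>. natural_flow_iso T (chain_flow T) (chain_flow_map T) R Rmap \<eta>))"
proof (intro conjI allI impI)
  show "\<exists>(R :: 'k precub \<Rightarrow> ('k, 'k cpath) flow) j Rmap.
        natural_realization TYPE(('k, 'k cpath) flow) T R j Rmap \<and>
        natural_realization TYPE(('u, 'r) flow) T R j Rmap"
    by (intro exI conjI) (rule chain_flow_natural_realization)+
next
  fix R :: "'k precub \<Rightarrow> ('s, 'p) flow" and j Rmap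
  assume "natural_realization TYPE(('s, 'p) flow) T R j Rmap \<and>
        natural_realization TYPE(('k, 'k cpath) flow) T R j Rmap"
  then have R1: "natural_realization TYPE(('s, 'p) flow) T R j Rmap"
    and R2: "natural_realization TYPE(('k, 'k cpath) flow) T R j Rmap" by auto
  let ?D = "\<lambda>a :: 'k cube_over. cube_flow (fst a)"
  have colim1: "is_flow_colimit TYPE(('s, 'p) flow) T (cubes_over K) ?D cube_over_homs (R K) (j K)"
    and colim2: "is_flow_colimit TYPE(('k, 'k cpath) flow) T (cubes_over K) ?D cube_over_homs (R K) (j K)"
    if "precubical_set K" for K
    using R1 R2 that unfolding natural_realization_def by auto
  define \<eta> where "\<eta> = (\<lambda>K. SOME h. flow_map (chain_flow T K) (R K) h \<and>
    (\<forall>a\<in>cubes_over K. fmap_eq (?D a) (fmap_comp h (chain_leg T K a)) (j K a)))"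
  have \<eta>: "flow_map (chain_flow T K) (R K) (\<eta> K) \<and>
    (\<forall>a\<in>cubes_over K. fmap_eq (?D a) (fmap_comp (\<eta> K) (chain_leg T K a)) (j K a))" if K: "precubical_set K" for K
  proof -
    obtain h where "flow_map (chain_flow T K) (R K) h"
      "\<And>a. a \<in> cubes_over K \<Longrightarrow> fmap_eq (?D a) (fmap_comp h (chain_leg T K a)) (j K a)"
      using chain_flow_colimit[OF K] flow_colimit_cocone[OF colim1[OF K]] by (rule flow_colimit_map) blast
    then show ?thesis unfolding \<eta>_def by (intro someI_ex[of "\<lambda>h. flow_map (chain_flow T K) (R K) h \<and> _ h"]) blast
  qed
  have "natural_flow_iso T (chain_flow T) (chain_flow_map T) R Rmap \<eta>"
    unfolding natural_flow_iso_def
  proof (intro conjI allI impI)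
    fix K :: "'k precub" assume K: "precubical_set K"
    show "flow_iso T (chain_flow T K) (R K) (\<eta> K)"
      by (rule flow_colimit_iso[OF chain_flow_colimit[OF K] colim2[OF K] colim1[OF K]])
        (use \<eta>[OF K] in auto)
  next
    fix K L :: "'k precub" and f assume KLf: "precubical_set K \<and> precubical_set L \<and> f \<in> pmaps K L"
    then have K: "precubical_set K" and L: "precubical_set L" and f: "f \<in> pmaps K L" by auto
    note chain_map = flow_map_chain_flow_map[OF K L f, of T]
    show "flow_map (chain_flow T K) (chain_flow T L) (chain_flow_map T K L f)" by (rule chain_map)
    have Rf: "flow_map (R K) (R L) (Rmap K L f)"
      "\<And>n c. (n, c) \<in> cubes_over K \<Longrightarrow> fmap_eq (cube_flow n) (fmap_comp (Rmap K L f) (j K (n, c)))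
        (j L (n, pmap_comp (std_cube n) f c))"
      using R1 KLf unfolding natural_realization_def by blast+
    show "flow_map (R K) (R L) (Rmap K L f)" by (rule Rf)
    let ?k = "\<lambda>(n, c). j L (n, pmap_comp (std_cube n) f c)"
    show "fmap_eq (chain_flow T K) (fmap_comp (\<eta> L) (chain_flow_map T K L f)) (fmap_comp (Rmap K L f) (\<eta> K))"
    proof (rule flow_colimit_unique[OF chain_flow_colimit[OF K]
          cube_cocone_pullback[OF K L f flow_colimit_cocone[OF colim1[OF L]]]])
      show "flow_map (chain_flow T K) (R L) (fmap_comp (\<eta> L) (chain_flow_map T K L f))"
        using flow_map_comp[OF chain_map] \<eta>[OF L] by blast
      show "flow_map (chain_flow T K) (R L) (fmap_comp (Rmap K L f) (\<eta> K))"
        using flow_map_comp[OF _ Rf(1)] \<eta>[OF K] by blast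
    next
      fix a assume a: "a \<in> cubes_over K"
      obtain n c where nc: "a = (n, c)" by fastforce
      have over: "(n, pmap_comp (std_cube n) f c) \<in> cubes_over L"
        using a pmap_comp_in[OF _ f precubical_std_cube] by (simp add: nc cubes_over_def)
      have "fmap_eq (cube_flow n) (fmap_comp (\<eta> L) (fmap_comp (chain_flow_map T K L f) (chain_leg T K (n, c))))
          (fmap_comp (\<eta> L) (chain_leg T L (n, pmap_comp (std_cube n) f c)))"
        using a by (intro fmap_comp_cong_left chain_flow_map_leg[OF K L f]) (simp add: nc)
      moreover have "fmap_eq (cube_flow n) (fmap_comp (\<eta> L) (chain_leg T L (n, pmap_comp (std_cube n) f c)))
          (j L (n, pmap_comp (std_cube n) f c))"
        using \<eta>[OF L] over by fastforce
      ultimately show "fmap_eq (?D a) (fmap_comp (fmap_comp (\<eta> L) (chain_flow_map T K L f)) (chain_leg T K a)) (?k a)"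
        unfolding fmap_comp_assoc[symmetric] nc by (simp add: fmap_eq_def)
      have "fmap_eq (cube_flow n) (fmap_comp (Rmap K L f) (fmap_comp (\<eta> K) (chain_leg T K (n, c))))
          (fmap_comp (Rmap K L f) (j K (n, c)))"
        using \<eta>[OF K] a unfolding nc by (intro fmap_comp_cong_left) fastforce
      moreover note Rf(2)[of n c]
      ultimately show "fmap_eq (?D a) (fmap_comp (fmap_comp (Rmap K L f) (\<eta> K)) (chain_leg T K a)) (?k a)"
        unfolding fmap_comp_assoc[symmetric] using a unfolding nc by (simp add: fmap_eq_def)
    qed
  qed
  then show "\<exists>\<eta>. natural_flow_iso T (chain_flow T) (chain_flow_map T) R Rmap \<eta>" by blast
qed

end
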